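(* Let $\mathbf n\in S^{d-1}$ and $\beta\ge0$ be such that $\beta'\mapsto\tau^q_{\beta'}(\mathbf n)$ is left continuous at $\beta$. Then the lower large deviations of surface tension are of surface order, that is, $I_{\beta,\mathbf n}(\tau^q_\beta(\mathbf n)-r)>0$ for all $r>0$. Hence the set $$\mathcal N_I=\{\beta\ge0:\ \exists\,\mathbf n\in S^{d-1}\text{ and }r>0\text{ such that }I_{\beta,\mathbf n}(\tau^q_\beta(\mathbf n)-r)=0\}$$ is at most countable.
   Context: Fix $d\ge 2$, $q\ge 1$; $\beta\ge 0$. For $x,y\in\mathbb Z^d$ write $x\sim y$ if $\|x-y\|_2=1$; for $\Lambda\subset\mathbb Z^d$ let $E(\Lambda)=\{\{x,y\}:x,y\in\Lambda,\ x\sim y\}$. The couplings $J=(J_e)_{e\in E(\mathbb Z^d)}$ are i.i.d. with values in $[0,1]$ under the product measure $\mathbb P$. $J^{\min}=\inf\{\lambda\ge0:\mathbb P(J_e<\lambda)>0\}$. Random cluster model: for finite $E\subset E(\mathbb Z^d)$, boundary condition $\pi\in\{0,1\}^{E^c}$ and $\omega\in\{0,1\}^E$, $\Phi^{J,\pi,q}_{E,\beta}(\{\omega\})=\frac1Z\prod_{e\in E}p_e^{\omega_e}(1-p_e)^{1-\omega_e}\,q^{C^\pi_E(\omega)}$ with $p_e=1-e^{-\beta J_e}$, where $C^\pi_E(\omega)$ is the number of clusters of the set of vertices touched by $E$ when connections use the open edges of $\omega$ in $E$ and of $\pi$ outside $E$, and $Z$ is the normalizing constant. The boundary condition $w$ (wired)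 is $\pi\equiv1$. Geometry: $S^{d-1}$ is the Euclidean unit sphere. For $\mathbf n\in S^{d-1}$, $\mathbb S_{\mathbf n}$ is the set of the $(d-1)$-dimensional unit cubes $\{\sum_{k=1}^{d-1}t_k\mathbf u_k: t_k\in[-\frac12,\frac12]\}$ with $(\mathbf u_1,\dots,\mathbf u_{d-1},\mathbf n)$ an orthonormal basis of $\mathbb R^d$. $\mathcal R_{x,L,H}(\mathcal S,\mathbf n)=x+L\mathcal S+[-H,H]\mathbf n$. For such $\mathcal R$, $\hat{\mathcal R}$ is the set of points of $\mathbb Z^d$ in the interior of $\mathcal R$; $\partial\hat{\mathcal R}=\{y\in\hat{\mathcal R}:\exists z\in\mathbb Z^d\setminus\hat{\mathcal R},\ z\sim y\}$; $\partial^+\hat{\mathcal R}=\{y\in\partial\hat{\mathcal R}:(y-x)\cdot\mathbf n\ge0\}$, $\partial^-\hat{\mathcal R}=\{y\in\partial\hat{\mathcal R}:(y-x)\cdot\mathbf n<0\}$. $\Phi^{J,w}_{\mathcal R}$ is $\Phi^{J,w,q}_{E(\hat{\mathcal R}),\beta}$. Surface tension: $\mathcal D_{\mathcal R}$ is the event that no $\omega$-open path in $E(\hat{\mathcal R})$ joins $\partial^+\hat{\mathcal R}$ to $\partial^-\hat{\mathcal R}$, and $\tau^J_{\mathcal R}=-\frac1{L^{d-1}}\log\Phi^{J,w}_{\mathcal R}(\mathcal D_{\mathcal R})$. The quenched surface tension $\tau^q_\beta(\mathbf n)$ is the limit in $\mathbb P$-probability of $\tau^J_{\mathcal R_{0,N,\delta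 N}(\mathcal S,\mathbf n)}$ as $N\to\infty$ (it exists and does not depend on $\delta>0$, $\mathcal S\in\mathbb S_{\mathbf n}$); $\tau^{\min}(\mathbf n)$ is the same limit for the constant couplings $J\equiv J^{\min}$. Rate function: for $\tau>\tau^{\min}(\mathbf n)$, $I_{\beta,\mathbf n}(\tau)=\lim_{N}-\frac1{N^{d-1}}\log\mathbb P(\tau^J_{\mathcal R_{0,N,\delta N}(\mathcal S,\mathbf n)}\le\tau)\in[0,\infty)$ (it exists and does not depend on $\delta>0$, $\mathcal S\in\mathbb S_{\mathbf n}$); $I_{\beta,\mathbf n}(\tau)=+\infty$ for $\tau<\tau^{\min}(\mathbf n)$ and $I_{\beta,\mathbf n}(\tau^{\min}(\mathbf n))=\lim_{\varepsilon\to0^+}I_{\beta,\mathbf n}(\tau^{\min}(\mathbf n)+\varepsilon)$. *)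

theory Defs
  imports "HOL-Probability.Probability"
begin

section \<open>The lattice\<close>

definition emb :: "int ^ 'd::finite \<Rightarrow> real ^ 'd" where
  "emb x = (\<chi> i. real_of_int (x $ i))"

definition adjacent :: "int ^ 'd::finite \<Rightarrow> int ^ 'd \<Rightarrow> bool" (infix \<open>\<sim>\<^sub>Z\<close> 50) where
  "x \<sim>\<^sub>Z y \<longleftrightarrow> norm (emb x - emb y) = 1"

type_synonym 'd edge = "(int ^ 'd) set"

definition lattice_edges :: "(int ^ 'd) set \<Rightarrow> ('d::finite) edge set" where
  "lattice_edges \<Lambda> = {{x, y} | x y. x \<in> \<Lambda> \<and> y \<in> \<Lambda> \<and> x \<sim>\<^sub>Z y}"

definition joined :: "('d::finite) edge set \<Rightarrow> int ^ 'd \<Rightarrow> int ^ 'd \<Rightarrow> bool" where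
  "joined F x y \<longleftrightarrow> (x, y) \<in> {(u, v). {u, v} \<in> F}\<^sup>*"


section \<open>Random couplings\<close>

text \<open>Throughout, \<open>\<mu>\<close> is the common law on the real line of the couplings \<open>J\<^sub>e\<close>.\<close>

definition coupling_space :: "real measure \<Rightarrow> (('d::finite) edge \<Rightarrow> real) measure" where
  "coupling_space \<mu> = PiM (lattice_edges UNIV) (\<lambda>_. \<mu>)"

definition J_min :: "real measure \<Rightarrow> real" where
  "J_min \<mu> = Inf {l. 0 \<le> l \<and> measure \<mu> {..<l} > 0}"


section \<open>The random cluster model\<close>

text \<open>
  A configuration is identified with its set of open edges: \<open>\<omega> \<in> {0,1}\<^sup>E\<close> is a subset of \<open>E\<close>,
  and a boundary condition \<open>\<pi>\<close> is a set of edges of which only the part outside \<open>E\<close> matters.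
\<close>

definition num_clusters :: "('d::finite) edge set \<Rightarrow> 'd edge set \<Rightarrow> 'd edge set \<Rightarrow> nat" where
  "num_clusters E \<pi> \<omega> = card ((\<lambda>x. {y. joined ((\<omega> \<inter> E) \<union> (\<pi> - E)) x y}) ` \<Union>E)"

definition edge_prob :: "real \<Rightarrow> (('d::finite) edge \<Rightarrow> real) \<Rightarrow> 'd edge \<Rightarrow> real" where
  "edge_prob \<beta> J e = 1 - exp (- \<beta> * J e)"

definition rc_weight ::
  "real \<Rightarrow> real \<Rightarrow> ('d::finite) edge set \<Rightarrow> 'd edge set \<Rightarrow> ('d edge \<Rightarrow> real) \<Rightarrow> 'd edge set \<Rightarrow> real" where
  "rc_weight q \<beta> E \<pi> J \<omega> =
     (\<Prod>e\<in>E. if e \<in> \<omega> then edge_prob \<beta> J e else 1 - edge_prob \<beta> J e) * q ^ num_clusters E \<pi> \<omega>"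

definition rc_partition ::
  "real \<Rightarrow> real \<Rightarrow> ('d::finite) edge set \<Rightarrow> 'd edge set \<Rightarrow> ('d edge \<Rightarrow> real) \<Rightarrow> real" where
  "rc_partition q \<beta> E \<pi> J = (\<Sum>\<omega>\<in>Pow E. rc_weight q \<beta> E \<pi> J \<omega>)"

definition rc_measure ::
  "real \<Rightarrow> real \<Rightarrow> ('d::finite) edge set \<Rightarrow> 'd edge set \<Rightarrow> ('d edge \<Rightarrow> real) \<Rightarrow> 'd edge set measure" where
  "rc_measure q \<beta> E \<pi> J =
     point_measure (Pow E) (\<lambda>\<omega>. ennreal (rc_weight q \<beta> E \<pi> J \<omega> / rc_partition q \<beta> E \<pi> J))"

definition wired :: "('d::finite) edge set" where
  "wired = lattice_edges UNIV"


section \<open>Rectangular parallelepipeds\<close>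

text \<open>The frame is \<open>u\<^sub>1, \<dots>, u\<^sub>d\<close> with \<open>u\<^sub>d = n\<close>, where \<open>d = CARD('d)\<close>.\<close>

definition unit_cubes :: "real ^ 'd::finite \<Rightarrow> (real ^ 'd) set set" where
  "unit_cubes n =
     {{(\<Sum>k\<in>{1..<CARD('d)}. t k *\<^sub>R u k) | t. \<forall>k\<in>{1..<CARD('d)}. t k \<in> {-1/2..1/2}} | u.
        u CARD('d) = n
        \<and> (\<forall>i\<in>{1..CARD('d)}. \<forall>j\<in>{1..CARD('d)}. u i \<bullet> u j = (if i = j then 1 else 0))
        \<and> span (u ` {1..CARD('d)}) = UNIV}"

definition rect :: "real ^ 'd::finite \<Rightarrow> real \<Rightarrow> real \<Rightarrow> (real ^ 'd) set \<Rightarrow> real ^ 'd \<Rightarrow> (real ^ 'd) set" where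
  "rect x L H S n = {x + L *\<^sub>R s + t *\<^sub>R n | s t. s \<in> S \<and> t \<in> {-H..H}}"

definition hat :: "(real ^ 'd::finite) set \<Rightarrow> (int ^ 'd) set" where
  "hat R = {y. emb y \<in> interior R}"

definition bdry :: "(int ^ 'd::finite) set \<Rightarrow> (int ^ 'd) set" where
  "bdry \<Lambda> = {y\<in>\<Lambda>. \<exists>z. z \<notin> \<Lambda> \<and> z \<sim>\<^sub>Z y}"

definition bdry_plus :: "real ^ 'd::finite \<Rightarrow> real ^ 'd \<Rightarrow> (int ^ 'd) set \<Rightarrow> (int ^ 'd) set" where
  "bdry_plus x n \<Lambda> = {y\<in>bdry \<Lambda>. (emb y - x) \<bullet> n \<ge> 0}"

definition bdry_minus :: "real ^ 'd::finite \<Rightarrow> real ^ 'd \<Rightarrow> (int ^ 'd) set \<Rightarrow> (int ^ 'd) set" where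
  "bdry_minus x n \<Lambda> = {y\<in>bdry \<Lambda>. (emb y - x) \<bullet> n < 0}"


section \<open>Surface tension\<close>

definition disconnection ::
  "real ^ 'd::finite \<Rightarrow> real \<Rightarrow> real \<Rightarrow> (real ^ 'd) set \<Rightarrow> real ^ 'd \<Rightarrow> 'd edge set set" where
  "disconnection x L H S n =
     (let \<Lambda> = hat (rect x L H S n) in
      {\<omega>. \<omega> \<subseteq> lattice_edges \<Lambda> \<and>
          \<not> (\<exists>y\<in>bdry_plus x n \<Lambda>. \<exists>z\<in>bdry_minus x n \<Lambda>. joined \<omega> y z)})"

definition surf_tension ::
  "real \<Rightarrow> real \<Rightarrow> (('d::finite) edge \<Rightarrow> real) \<Rightarrow> real ^ 'd \<Rightarrow> real \<Rightarrow> real \<Rightarrow> (real ^ 'd) set \<Rightarrow> real ^ 'd \<Rightarrow> real"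
  where
  "surf_tension q \<beta> J x L H S n =
     - (1 / L ^ (CARD('d) - 1)) *
       ln (measure (rc_measure q \<beta> (lattice_edges (hat (rect x L H S n))) wired J)
                   (disconnection x L H S n))"

definition tends_in_prob :: "'a measure \<Rightarrow> (nat \<Rightarrow> 'a \<Rightarrow> real) \<Rightarrow> real \<Rightarrow> bool" where
  "tends_in_prob M X l \<longleftrightarrow>
     (\<forall>\<epsilon>>0. (\<lambda>N. measure M {\<xi>\<in>space M. \<bar>X N \<xi> - l\<bar> \<ge> \<epsilon>}) \<longlonglongrightarrow> 0)"

definition tau_quenched :: "real measure \<Rightarrow> real \<Rightarrow> real \<Rightarrow> real ^ 'd::finite \<Rightarrow> real" where
  "tau_quenched \<mu> q \<beta> n =
     (THE l. \<forall>\<delta>>0. \<forall>S\<in>unit_cubes n.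
        tends_in_prob (coupling_space \<mu>)
          (\<lambda>N J. surf_tension q \<beta> J 0 (real N) (\<delta> * real N) S n) l)"

definition tau_min :: "real measure \<Rightarrow> real \<Rightarrow> real \<Rightarrow> real ^ 'd::finite \<Rightarrow> real" where
  "tau_min \<mu> q \<beta> n =
     (THE l. \<forall>\<delta>>0. \<forall>S\<in>unit_cubes n.
        (\<lambda>N. surf_tension q \<beta> (\<lambda>_. J_min \<mu>) 0 (real N) (\<delta> * real N) S n) \<longlonglongrightarrow> l)"


section \<open>Rate function\<close>

text \<open>Minus the logarithm, with \<open>- log 0 = \<infinity>\<close> (whereas \<open>ln 0 = 0\<close> in the library).\<close>

definition neg_log :: "real \<Rightarrow> ereal" where
  "neg_log p = (if p = 0 then \<infinity> else ereal (- ln p))"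

definition rate_above :: "real measure \<Rightarrow> real \<Rightarrow> real \<Rightarrow> real ^ 'd::finite \<Rightarrow> real \<Rightarrow> ereal" where
  "rate_above \<mu> q \<beta> n \<tau> =
     (THE l. \<forall>\<delta>>0. \<forall>S\<in>unit_cubes n.
        (\<lambda>N. neg_log (measure (coupling_space \<mu>)
                        {J\<in>space (coupling_space \<mu>).
                           surf_tension q \<beta> J 0 (real N) (\<delta> * real N) S n \<le> \<tau>})
             / ereal (real N ^ (CARD('d) - 1))) \<longlonglongrightarrow> l)"

definition rate :: "real measure \<Rightarrow> real \<Rightarrow> real \<Rightarrow> real ^ 'd::finite \<Rightarrow> real \<Rightarrow> ereal" where
  "rate \<mu> q \<beta> n \<tau> =
     (if \<tau> > tau_min \<mu> q \<beta> n then rate_above \<mu> q \<beta> n \<tau>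
      else if \<tau> < tau_min \<mu> q \<beta> n then \<infinity>
      else Lim (at_right 0) (\<lambda>\<epsilon>. rate_above \<mu> q \<beta> n (tau_min \<mu> q \<beta> n + \<epsilon>)))"

end

theory Submission
  imports Defs "HOL-Real_Asymp.Real_Asymp"
begin

text \<open>
  Write \<open>c(\<beta>, J) = - log \<Phi>(\<D>)\<close> for the cost of disconnecting the two halves of a rectangle of side
  \<open>N\<close>. It is compared with \<open>N^(d-1)\<close> throughout.

  \<^bold>\<open>Subadditivity.\<close> Tile the middle hyperplane of a large rectangle by small rectangles. If every
  tile is disconnected and the few edges between the tiles that cross the hyperplane are closed, the
  large rectangle is disconnected. Disconnection is a decreasing event, so by the FKG inequality and
  by monotonicity of the wired measure in the domain, the cost of the large rectangle is at most
  the sum of the costs of the tiles plus a small surface term (\<open>cost_tiles\<close>, \<open>good_tiling_exists\<close>).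
  The costs of disjoint tiles are independent and identically distributed. Hence the mean tension
  converges; Hoeffding's inequality over the tiles excludes large values, and bounded variables
  that do not exceed the limit of their means cannot be far below it either, so the tension
  converges in probability (\<open>tau_quenched_limit\<close>). For constant couplings and for the
  probabilities of small tension the same tiling gives \<open>\<tau>_min\<close> and the rate function
  (\<open>tau_min_limit\<close>, \<open>rate_above_limit\<close>), which identifies the quantities defined by a description.

  \<^bold>\<open>Lower deviations.\<close> Closing one edge \<open>e\<close> lowers the cost by at most a constant times the
  influence of \<open>e\<close>, and the \<open>\<beta>\<close>-derivative of the cost is a weighted sum of the influences.
  Therefore the cost \<open>Z\<close> averaged over \<open>\<beta>' \<le> s \<le> \<beta>\<close> changes by at most a constant per edge, and
  the sum of these changes is bounded by a constant times \<open>c(\<beta>, J) / (\<beta> - \<beta>')\<close>, which is of surface order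
  (\<open>mean_cost_drop\<close>). The entropy method turns such a bound on the sum of squared drops into
  \<open>P(Z \<le> E Z - t) \<le> exp (- l t + C l\<^sup>2 N^(d-1))\<close> for small \<open>l\<close> (\<open>concentration_below\<close>). As the cost
  increases with \<open>\<beta>\<close>, \<open>c(\<beta>', J) \<le> Z \<le> c(\<beta>, J)\<close>, so the tension at \<open>\<beta>\<close> falls below
  \<open>\<tau>\<^sup>q(\<beta>') - r\<close> with probability at most \<open>exp (- c N^(d-1))\<close> for every \<open>\<beta>' < \<beta>\<close>
  (\<open>rate_above_pos\<close>). Left continuity at \<open>\<beta>\<close> allows \<open>\<tau>\<^sup>q(\<beta>')\<close> to be replaced by \<open>\<tau>\<^sup>q(\<beta>)\<close>
  (\<open>rate_pos_of_left_continuous\<close>).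

  \<^bold>\<open>Countability.\<close> For a fixed direction, \<open>\<beta> \<mapsto> \<tau>\<^sup>q(\<beta>)\<close> is increasing and has countably many
  discontinuities. Since \<open>\<tau>\<^sup>q\<close> is Lipschitz in the direction, locally and uniformly for bounded
  \<open>\<beta>\<close> (\<open>tau_quenched_lipschitz\<close>, from placing one tilted tile in a rectangle of nearly the same
  size), a left jump in some direction is still visible in all nearby directions. So a countable
  dense set of directions detects all exceptional \<open>\<beta>\<close> (\<open>countable_rate_zero\<close>).
\<close>

section \<open>Correlation inequalities for sums over subsets\<close>

text \<open>
  The one-edge case of the four functions theorem. The product on the right also contains the term \<open>c1 * d0\<close>, about
  which nothing is assumed; it is recovered from \<open>(P - u) * (P - v) \<ge> 0\<close> with \<open>P = c0 * d1\<close>.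
\<close>

lemma two_point_four_functions:
  fixes a0 a1 b0 b1 c0 c1 d0 d1 :: real
  assumes nn: "0 \<le> a0" "0 \<le> a1" "0 \<le> b0" "0 \<le> b1" "0 \<le> c0" "0 \<le> c1" "0 \<le> d0" "0 \<le> d1"
    and h00: "a0 * b0 \<le> c0 * d0" and h01: "a0 * b1 \<le> c0 * d1"
    and h10: "a1 * b0 \<le> c0 * d1" and h11: "a1 * b1 \<le> c1 * d1"
  shows "(a0 + a1) * (b0 + b1) \<le> (c0 + c1) * (d0 + d1)"
proof -
  define P u v where "P = c0 * d1" and "u = a0 * b1" and "v = a1 * b0"
  have P0: "P \<ge> 0" "u \<ge> 0" "v \<ge> 0" "u \<le> P" "v \<le> P"
    using nn h01 h10 by (auto simp: P_def u_def v_def)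
  have "u + v \<le> P + c1 * d0"
  proof (cases "P = 0")
    case True
    then show ?thesis using P0 nn by (simp add: mult_nonneg_nonneg)
  next
    case False
    then have Ppos: "P > 0" using P0 by simp
    have "0 \<le> (P - u) * (P - v)" using P0 by simp
    then have "(u + v) * P \<le> P * P + u * v" by (simp add: algebra_simps)
    also have "u * v = (a0 * b0) * (a1 * b1)" by (simp add: u_def v_def)
    also have "\<dots> \<le> (c0 * d0) * (c1 * d1)" using nn by (intro mult_mono[OF h00 h11]) auto
    also have "\<dots> = (c1 * d0) * P" by (simp add: P_def)
    finally have "(u + v) * P \<le> (P + c1 * d0) * P" by (simp add: algebra_simps)
    then show ?thesis using Ppos by simp
  qed
  then show ?thesis using h00 h11 by (simp add: algebra_simps P_def u_def v_def)
qed

lemma sum_Pow_insert: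
  assumes "finite E" "x \<notin> E"
  shows "(\<Sum>\<omega>\<in>Pow (insert x E). f \<omega>) = (\<Sum>\<omega>\<in>Pow E. f \<omega> + (f (insert x \<omega>) :: real))"
proof -
  have "inj_on (insert x) (Pow E)" using assms by (auto simp: inj_on_def)
  moreover have "Pow E \<inter> insert x ` Pow E = {}" using assms by auto
  ultimately show ?thesis using assms
    by (simp add: Pow_insert sum.union_disjoint sum.reindex sum.distrib)
qed

text \<open>
  The Ahlswede--Daykin inequality: sum out the elements of \<open>E\<close> one by one, each time by the two-point case.
\<close>

lemma four_functions:
  fixes f g h k :: "'a set \<Rightarrow> real"
  assumes "finite E"
    and "\<And>\<omega>. \<omega> \<subseteq> E \<Longrightarrow> 0 \<le> f \<omega> \<and> 0 \<le> g \<omega> \<and> 0 \<le> h \<omega> \<and> 0 \<le> k \<omega>"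
    and "\<And>\<omega> \<omega>'. \<omega> \<subseteq> E \<Longrightarrow> \<omega>' \<subseteq> E \<Longrightarrow> f \<omega> * g \<omega>' \<le> h (\<omega> \<inter> \<omega>') * k (\<omega> \<union> \<omega>')"
  shows "(\<Sum>\<omega>\<in>Pow E. f \<omega>) * (\<Sum>\<omega>\<in>Pow E. g \<omega>) \<le> (\<Sum>\<omega>\<in>Pow E. h \<omega>) * (\<Sum>\<omega>\<in>Pow E. k \<omega>)"
  using assms
proof (induction E arbitrary: f g h k rule: finite_induct)
  case empty
  then show ?case by force
next
  case (insert x E)
  have *: "\<omega> \<subseteq> insert x E" "insert x \<omega> \<subseteq> insert x E" if "\<omega> \<subseteq> E" for \<omega> using that by auto
  have "(\<Sum>\<omega>\<in>Pow E. f \<omega> + f (insert x \<omega>)) * (\<Sum>\<omega>\<in>Pow E. g \<omega> + g (insert x \<omega>))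
      \<le> (\<Sum>\<omega>\<in>Pow E. h \<omega> + h (insert x \<omega>)) * (\<Sum>\<omega>\<in>Pow E. k \<omega> + k (insert x \<omega>))"
  proof (rule insert.IH)
    show "0 \<le> f \<omega> + f (insert x \<omega>) \<and> 0 \<le> g \<omega> + g (insert x \<omega>) \<and>
          0 \<le> h \<omega> + h (insert x \<omega>) \<and> 0 \<le> k \<omega> + k (insert x \<omega>)" if "\<omega> \<subseteq> E" for \<omega>
      using insert.prems(1)[OF *(1)[OF that]] insert.prems(1)[OF *(2)[OF that]] by simp
  next
    fix \<omega> \<omega>' assume w: "\<omega> \<subseteq> E" "\<omega>' \<subseteq> E"
    then have x: "x \<notin> \<omega>" "x \<notin> \<omega>'" using insert.hyps by auto
    have i: "\<omega> \<inter> \<omega>' \<subseteq> E" "\<omega> \<union> \<omega>' \<subseteq> E" using w by auto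
    show "(f \<omega> + f (insert x \<omega>)) * (g \<omega>' + g (insert x \<omega>'))
       \<le> (h (\<omega> \<inter> \<omega>') + h (insert x (\<omega> \<inter> \<omega>'))) * (k (\<omega> \<union> \<omega>') + k (insert x (\<omega> \<union> \<omega>')))"
    proof (rule two_point_four_functions)
      show "f \<omega> * g \<omega>' \<le> h (\<omega> \<inter> \<omega>') * k (\<omega> \<union> \<omega>')"
        using insert.prems(2)[of \<omega> \<omega>'] w by auto
      show "f \<omega> * g (insert x \<omega>') \<le> h (\<omega> \<inter> \<omega>') * k (insert x (\<omega> \<union> \<omega>'))"
        using insert.prems(2)[of \<omega> "insert x \<omega>'"] w x by auto
      show "f (insert x \<omega>) * g \<omega>' \<le> h (\<omega> \<inter> \<omega>') * k (insert x (\<omega> \<union> \<omega>'))"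
        using insert.prems(2)[of "insert x \<omega>" \<omega>'] w x by auto
      show "f (insert x \<omega>) * g (insert x \<omega>') \<le> h (insert x (\<omega> \<inter> \<omega>')) * k (insert x (\<omega> \<union> \<omega>'))"
        using insert.prems(2)[of "insert x \<omega>" "insert x \<omega>'"] w x by auto
    qed (use insert.prems(1) w i * in auto)
  qed
  then show ?case by (simp add: sum_Pow_insert[OF insert.hyps])
qed

definition decreasing :: "'a set \<Rightarrow> 'a set set \<Rightarrow> bool" where
  "decreasing E A \<longleftrightarrow> (\<forall>\<omega>\<in>A. \<forall>\<eta>. \<eta> \<subseteq> \<omega> \<longrightarrow> \<eta> \<subseteq> E \<longrightarrow> \<eta> \<in> A)"

lemma decreasingD: "decreasing E A \<Longrightarrow> \<omega> \<in> A \<Longrightarrow> \<eta> \<subseteq> \<omega> \<Longrightarrow> \<eta> \<subseteq> E \<Longrightarrow> \<eta> \<in> A"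
  by (simp add: decreasing_def)

lemma decreasing_INT: "(\<And>i. i \<in> I \<Longrightarrow> decreasing E (A i)) \<Longrightarrow> decreasing E (\<Inter>i\<in>I. A i)"
  unfolding decreasing_def by blast

text \<open>
  Holley's comparison of two weights: \<open>g\<close> favours large configurations, so a decreasing event is more likely
  under \<open>f\<close>. Restricting \<open>f\<close> and \<open>g\<close> to \<open>A\<close> keeps the hypothesis of the four functions theorem, because
  \<open>A\<close> is decreasing. The inequality is stated without denominators, so that the weights need no normalisation.
\<close>

lemma holley:
  fixes f g :: "'a set \<Rightarrow> real"
  assumes fin: "finite E"
    and nn: "\<And>\<omega>. \<omega> \<subseteq> E \<Longrightarrow> 0 \<le> f \<omega>" "\<And>\<omega>. \<omega> \<subseteq> E \<Longrightarrow> 0 \<le> g \<omega>"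
    and lat: "\<And>\<omega> \<omega>'. \<omega> \<subseteq> E \<Longrightarrow> \<omega>' \<subseteq> E \<Longrightarrow> f \<omega> * g \<omega>' \<le> f (\<omega> \<inter> \<omega>') * g (\<omega> \<union> \<omega>')"
    and dec: "decreasing E A"
  shows "(\<Sum>\<omega>\<in>Pow E \<inter> A. g \<omega>) * (\<Sum>\<omega>\<in>Pow E. f \<omega>) \<le> (\<Sum>\<omega>\<in>Pow E \<inter> A. f \<omega>) * (\<Sum>\<omega>\<in>Pow E. g \<omega>)"
proof -
  define h where "h = (\<lambda>u \<omega>. if \<omega> \<in> A then u \<omega> else (0::real))"
  have s: "(\<Sum>\<omega>\<in>Pow E \<inter> A. u \<omega>) = (\<Sum>\<omega>\<in>Pow E. h u \<omega>)" for u
    using fin by (simp add: h_def sum.inter_restrict)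
  have "(\<Sum>\<omega>\<in>Pow E. f \<omega>) * (\<Sum>\<omega>\<in>Pow E. h g \<omega>) \<le> (\<Sum>\<omega>\<in>Pow E. h f \<omega>) * (\<Sum>\<omega>\<in>Pow E. g \<omega>)"
  proof (rule four_functions[OF fin])
    fix \<omega> \<omega>' assume w: "\<omega> \<subseteq> E" "\<omega>' \<subseteq> E"
    have "\<omega> \<inter> \<omega>' \<in> A" if "\<omega>' \<in> A"
      using decreasingD[OF dec that, of "\<omega> \<inter> \<omega>'"] w by auto
    moreover have "0 \<le> f (\<omega> \<inter> \<omega>')" "0 \<le> g (\<omega> \<union> \<omega>')"
      using w by (auto intro: nn)
    ultimately show "f \<omega> * h g \<omega>' \<le> h f (\<omega> \<inter> \<omega>') * g (\<omega> \<union> \<omega>')"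
      using lat[OF w] by (simp add: h_def)
  qed (simp add: h_def nn)
  then show ?thesis unfolding s by (simp add: mult.commute)
qed

section \<open>Clusters\<close>

lemma joined_refl [simp]: "joined F x x"
  by (simp add: joined_def)

lemma joined_trans: "joined F x y \<Longrightarrow> joined F y z \<Longrightarrow> joined F x z"
  unfolding joined_def by (rule rtrancl_trans)

lemma joined_sym: "joined F x y \<Longrightarrow> joined F y x"
proof -
  have "sym ({(u, v). {u, v} \<in> F}\<^sup>*)"
    by (rule sym_rtrancl) (auto simp: sym_def insert_commute)
  then show "joined F x y \<Longrightarrow> joined F y x" unfolding joined_def by (auto dest: symD)
qed

lemma joined_mono: "F \<subseteq> G \<Longrightarrow> joined F x y \<Longrightarrow> joined G x y"
  unfolding joined_def using rtrancl_mono[of "{(u, v). {u, v} \<in> F}" "{(u, v). {u, v} \<in> G}"] by blast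

lemma joined_edge: "{x, y} \<in> F \<Longrightarrow> joined F x y"
  unfolding joined_def by (simp add: r_into_rtrancl)

lemma joined_invariant:
  assumes "joined F x y" "P x" "\<And>u v. {u, v} \<in> F \<Longrightarrow> P u \<Longrightarrow> P v"
  shows "P y"
  using assms(1) unfolding joined_def by (induction rule: rtrancl_induct) (use assms in auto)

definition cluster :: "('d::finite) edge set \<Rightarrow> int ^ 'd \<Rightarrow> (int ^ 'd) set" where
  "cluster F x = {y. joined F x y}"

lemma cluster_eq_iff: "cluster F x = cluster F y \<longleftrightarrow> joined F x y"
  unfolding cluster_def using joined_sym joined_trans joined_refl by blast

text \<open>
  A path through the new edge needs it only once.
\<close>

lemma joined_insert_iff:
  "joined (insert {x, y} F) u v \<longleftrightarrow>
     joined F u v \<or> (joined F u x \<and> joined F y v) \<or> (joined F u y \<and> joined F x v)"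
  (is "?l \<longleftrightarrow> ?r v")
proof
  assume ?l
  then show "?r v"
  proof (rule joined_invariant)
    fix a b assume ab: "{a, b} \<in> insert {x, y} F" and r: "?r a"
    consider "{a, b} \<in> F" | "a = x" "b = y" | "a = y" "b = x"
      using ab by (auto simp: doubleton_eq_iff)
    then show "?r b"
    proof cases
      case 1
      then show ?thesis using r joined_trans joined_edge by meson
    qed (use r joined_trans joined_refl in blast)+
  qed simp
next
  have xy: "joined (insert {x, y} F) x y" by (simp add: joined_edge)
  have "joined F a b \<Longrightarrow> joined (insert {x, y} F) a b" for a b by (rule joined_mono) auto
  then show "?r v \<Longrightarrow> ?l" using xy joined_trans joined_sym by meson
qed

lemma card_clusters_insert:
  assumes V: "finite V" and xy: "x \<in> V" "y \<in> V"
  shows "card (cluster F ` V) = card (cluster (insert {x, y} F) ` V) + (if joined F x y then 0 else 1)"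
proof (cases "joined F x y")
  case True
  have "cluster (insert {x, y} F) = cluster F"
    unfolding cluster_def joined_insert_iff using True joined_sym joined_trans by blast
  then show ?thesis using True by simp
next
  case False
  let ?G = "insert {x, y} F"
  let ?U = "cluster F x \<union> cluster F y"
  let ?R = "cluster F ` V - {cluster F x, cluster F y}"
  have c1: "cluster ?G u = ?U" if "joined F u x \<or> joined F u y" for u
    using that unfolding cluster_def joined_insert_iff using joined_sym joined_trans joined_refl by blast
  have c2: "cluster ?G u = cluster F u" if "\<not> (joined F u x \<or> joined F u y)" for u
    using that unfolding cluster_def joined_insert_iff by blast
  have "cluster ?G ` V = insert ?U ?R"
  proof (intro equalityI subsetI)
    fix c assume "c \<in> cluster ?G ` V"
    then obtain u where u: "u \<in> V" "c = cluster ?G u" by blast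
    show "c \<in> insert ?U ?R"
    proof (cases "joined F u x \<or> joined F u y")
      case False
      then have "cluster F u \<noteq> cluster F x" "cluster F u \<noteq> cluster F y"
        unfolding cluster_eq_iff by blast+
      then show ?thesis using u(1) unfolding u(2) c2[OF False] by blast
    next
      case True
      then show ?thesis unfolding u(2) c1[OF True] by blast
    qed
  next
    fix c assume "c \<in> insert ?U ?R"
    then consider "c = ?U" | u where "u \<in> V" "c = cluster F u" "\<not> (joined F u x \<or> joined F u y)"
      using cluster_eq_iff[of F] by blast
    then show "c \<in> cluster ?G ` V"
    proof cases
      case 1
      then show ?thesis using c1[of x] xy by (metis imageI joined_refl)
    next
      case 2
      then show ?thesis using c2 by (metis imageI)
    qed
  qed
  moreover have "?U \<notin> ?R"
  proof
    assume "?U \<in> ?R"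
    then obtain u where u: "?U = cluster F u" "cluster F u \<noteq> cluster F x" by auto
    then have "\<not> joined F u x" by (simp add: cluster_eq_iff)
    moreover have "x \<in> cluster F u" unfolding u(1)[symmetric] by (simp add: cluster_def)
    ultimately show False by (simp add: cluster_def)
  qed
  ultimately have "card (cluster ?G ` V) = Suc (card ?R)" using V by simp
  moreover have "card ?R = card (cluster F ` V) - 2"
    using False xy V by (subst card_Diff_subset) (auto simp: cluster_eq_iff)
  moreover have "card (cluster F ` V) \<ge> 2"
  proof -
    have "card {cluster F x, cluster F y} \<le> card (cluster F ` V)"
      using xy V by (intro card_mono) auto
    then show ?thesis using False by (simp add: cluster_eq_iff)
  qed
  ultimately show ?thesis using False by simp
qed

text \<open>
  Adding an edge merges two clusters or none. If it merges two in the larger configuration, it does so in the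
  smaller one. This is the source of all correlation inequalities below.
\<close>

lemma card_clusters_supermodular_insert:
  assumes "finite V" "x \<in> V" "y \<in> V" "F \<subseteq> G"
  shows "card (cluster (insert {x, y} F) ` V) + card (cluster G ` V)
       \<le> card (cluster F ` V) + card (cluster (insert {x, y} G) ` V)"
  using card_clusters_insert[OF assms(1-3), of F] card_clusters_insert[OF assms(1-3), of G]
    joined_mono[OF assms(4), of x y] by auto

lemma card_clusters_supermodular:
  assumes V: "finite V" and H: "finite H" "\<And>e. e \<in> H \<Longrightarrow> \<exists>x\<in>V. \<exists>y\<in>V. e = {x, y}" and FG: "F \<subseteq> G"
  shows "card (cluster (F \<union> H) ` V) + card (cluster G ` V)
       \<le> card (cluster F ` V) + card (cluster (G \<union> H) ` V)"
  using H
proof (induction H rule: finite_induct)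
  case (insert e H)
  then obtain x y where e: "x \<in> V" "y \<in> V" "e = {x, y}" by blast
  have "F \<union> H \<subseteq> G \<union> H" using FG by auto
  from card_clusters_supermodular_insert[OF V e(1,2) this]
  show ?case using insert e(3) by fastforce
qed simp

section \<open>The wired random cluster measure\<close>

text \<open>
  The weights are divided by the constant factor \<open>\<Prod>(1 - p\<^sub>e)\<close>: with \<open>x\<^sub>e = p\<^sub>e / (1 - p\<^sub>e)\<close> only the open edges
  contribute, and the total weight is a polynomial in the \<open>x\<^sub>e\<close>, affine in each of them.
\<close>

definition rc_wt :: "real \<Rightarrow> ('d::finite) edge set \<Rightarrow> ('d edge \<Rightarrow> real) \<Rightarrow> 'd edge set \<Rightarrow> real" where
  "rc_wt q E x \<omega> = (\<Prod>e\<in>\<omega>. x e) * q ^ num_clusters E wired \<omega>"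

definition rc_tot :: "real \<Rightarrow> ('d::finite) edge set \<Rightarrow> ('d edge \<Rightarrow> real) \<Rightarrow> 'd edge set set \<Rightarrow> real" where
  "rc_tot q E x A = (\<Sum>\<omega>\<in>Pow E \<inter> A. rc_wt q E x \<omega>)"

definition rc_pr :: "real \<Rightarrow> ('d::finite) edge set \<Rightarrow> ('d edge \<Rightarrow> real) \<Rightarrow> 'd edge set set \<Rightarrow> real" where
  "rc_pr q E x A = rc_tot q E x A / rc_tot q E x UNIV"

definition odds :: "real \<Rightarrow> (('d::finite) edge \<Rightarrow> real) \<Rightarrow> 'd edge \<Rightarrow> real" where
  "odds \<beta> J e = exp (\<beta> * J e) - 1"

lemma wired_edgeE:
  assumes "e \<in> wired" obtains x y where "e = {x, y}"
  using assms by (auto simp: wired_def lattice_edges_def)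

locale rc_region =
  fixes q :: real and E :: "('d::finite) edge set"
  assumes q1: "1 \<le> q" and finE: "finite E" and Ewired: "E \<subseteq> wired"
begin

lemma finite_vertices: "finite (\<Union>E)"
proof (rule finite_Union[OF finE])
  fix e assume "e \<in> E"
  then obtain x y where "e = {x, y}" using Ewired wired_edgeE by blast
  then show "finite e" by simp
qed

lemma num_clusters_cluster:
  "num_clusters E \<pi> \<omega> = card (cluster ((\<omega> \<inter> E) \<union> (\<pi> - E)) ` \<Union>E)"
  by (simp add: num_clusters_def cluster_def)

lemma edge_endpoints:
  assumes "e \<in> E" shows "\<exists>x\<in>\<Union>E. \<exists>y\<in>\<Union>E. e = {x, y}"
proof -
  obtain x y where "e = {x, y}" using assms Ewired wired_edgeE by blast
  then show ?thesis using assms by blast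
qed

lemma num_clusters_supermodular:
  assumes "\<omega> \<subseteq> E" "\<omega>' \<subseteq> E"
  shows "num_clusters E \<pi> \<omega> + num_clusters E \<pi> \<omega>'
       \<le> num_clusters E \<pi> (\<omega> \<inter> \<omega>') + num_clusters E \<pi> (\<omega> \<union> \<omega>')"
proof -
  let ?B = "\<pi> - E"
  have "card (cluster (((\<omega> \<inter> \<omega>') \<union> ?B) \<union> (\<omega> - \<omega>')) ` \<Union>E) + card (cluster (\<omega>' \<union> ?B) ` \<Union>E)
      \<le> card (cluster ((\<omega> \<inter> \<omega>') \<union> ?B) ` \<Union>E) + card (cluster ((\<omega>' \<union> ?B) \<union> (\<omega> - \<omega>')) ` \<Union>E)"
  proof (rule card_clusters_supermodular[OF finite_vertices])
    show "finite (\<omega> - \<omega>')" using assms finE by (auto intro: finite_subset)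
    show "\<exists>x\<in>\<Union>E. \<exists>y\<in>\<Union>E. e = {x, y}" if "e \<in> \<omega> - \<omega>'" for e
      using that assms edge_endpoints by blast
  qed auto
  moreover have "((\<omega> \<inter> \<omega>') \<union> ?B) \<union> (\<omega> - \<omega>') = \<omega> \<union> ?B" "(\<omega>' \<union> ?B) \<union> (\<omega> - \<omega>') = (\<omega> \<union> \<omega>') \<union> ?B" by auto
  moreover have "\<omega> \<inter> E = \<omega>" "\<omega>' \<inter> E = \<omega>'" "(\<omega> \<inter> \<omega>') \<inter> E = \<omega> \<inter> \<omega>'" "(\<omega> \<union> \<omega>') \<inter> E = \<omega> \<union> \<omega>'"
    using assms by auto
  ultimately show ?thesis by (simp add: num_clusters_cluster)
qed

lemma num_clusters_insert_le:
  assumes "e \<in> E" "\<omega> \<subseteq> E"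
  shows "num_clusters E \<pi> (insert e \<omega>) \<le> num_clusters E \<pi> \<omega>"
proof -
  obtain x y where xy: "x \<in> \<Union>E" "y \<in> \<Union>E" "e = {x, y}" using edge_endpoints[OF assms(1)] by blast
  have *: "(insert e \<omega> \<inter> E) \<union> (\<pi> - E) = insert {x, y} ((\<omega> \<inter> E) \<union> (\<pi> - E))" using assms xy(3) by auto
  show ?thesis using card_clusters_insert[OF finite_vertices xy(1,2), of "(\<omega> \<inter> E) \<union> (\<pi> - E)"]
    unfolding num_clusters_cluster * by simp
qed

lemma rc_wt_nonneg: "(\<And>e. e \<in> E \<Longrightarrow> 0 \<le> x e) \<Longrightarrow> \<omega> \<subseteq> E \<Longrightarrow> 0 \<le> rc_wt q E x \<omega>"
  unfolding rc_wt_def using q1 by (intro mult_nonneg_nonneg prod_nonneg) auto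

lemma rc_tot_nonneg: "(\<And>e. e \<in> E \<Longrightarrow> 0 \<le> x e) \<Longrightarrow> 0 \<le> rc_tot q E x A"
  unfolding rc_tot_def by (intro sum_nonneg rc_wt_nonneg) auto

lemma rc_tot_pos:
  assumes "\<And>e. e \<in> E \<Longrightarrow> 0 \<le> x e" "{} \<in> A"
  shows "0 < rc_tot q E x A"
proof -
  have "0 < rc_wt q E x {}" using q1 by (simp add: rc_wt_def)
  also have "\<dots> \<le> rc_tot q E x A"
    unfolding rc_tot_def using finE assms by (intro member_le_sum rc_wt_nonneg) auto
  finally show ?thesis .
qed

lemma rc_tot_mono: "(\<And>e. e \<in> E \<Longrightarrow> 0 \<le> x e) \<Longrightarrow> A \<inter> Pow E \<subseteq> B \<Longrightarrow> rc_tot q E x A \<le> rc_tot q E x B"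
  unfolding rc_tot_def using finE by (intro sum_mono2 rc_wt_nonneg) auto

lemma rc_pr_nonneg: "(\<And>e. e \<in> E \<Longrightarrow> 0 \<le> x e) \<Longrightarrow> 0 \<le> rc_pr q E x A"
  unfolding rc_pr_def by (intro divide_nonneg_nonneg rc_tot_nonneg)

lemma rc_pr_pos: "(\<And>e. e \<in> E \<Longrightarrow> 0 \<le> x e) \<Longrightarrow> {} \<in> A \<Longrightarrow> 0 < rc_pr q E x A"
  unfolding rc_pr_def by (intro divide_pos_pos rc_tot_pos) auto

lemma rc_pr_mono: "(\<And>e. e \<in> E \<Longrightarrow> 0 \<le> x e) \<Longrightarrow> A \<inter> Pow E \<subseteq> B \<Longrightarrow> rc_pr q E x A \<le> rc_pr q E x B"
  unfolding rc_pr_def by (intro divide_right_mono rc_tot_mono rc_tot_nonneg) auto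

lemma rc_pr_le_1: "(\<And>e. e \<in> E \<Longrightarrow> 0 \<le> x e) \<Longrightarrow> rc_pr q E x A \<le> 1"
  using rc_pr_mono[of x A UNIV] rc_tot_pos[of x UNIV] by (simp add: rc_pr_def)

text \<open>
  The FKG lattice condition, for two parameters at once: the number of clusters is supermodular, and moving an
  edge from the configuration with the smaller parameter to the one with the larger parameter does not decrease the weight.
\<close>

lemma rc_wt_lattice:
  assumes x: "\<And>e. e \<in> E \<Longrightarrow> 0 \<le> x e" "\<And>e. e \<in> E \<Longrightarrow> x e \<le> x' e"
    and w: "\<omega> \<subseteq> E" "\<omega>' \<subseteq> E"
  shows "rc_wt q E x \<omega> * rc_wt q E x' \<omega>' \<le> rc_wt q E x (\<omega> \<inter> \<omega>') * rc_wt q E x' (\<omega> \<union> \<omega>')"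
proof -
  have fin: "finite \<omega>" "finite \<omega>'" using w finE finite_subset by auto
  have "(\<Prod>e\<in>\<omega>. x e) = (\<Prod>e\<in>\<omega> \<inter> \<omega>'. x e) * (\<Prod>e\<in>\<omega> - \<omega>'. x e)"
    using fin by (subst prod.Int_Diff[of \<omega> _ \<omega>']) auto
  also have "\<dots> \<le> (\<Prod>e\<in>\<omega> \<inter> \<omega>'. x e) * (\<Prod>e\<in>\<omega> - \<omega>'. x' e)"
    using w x by (intro mult_left_mono prod_mono prod_nonneg) auto
  finally have "(\<Prod>e\<in>\<omega>. x e) * (\<Prod>e\<in>\<omega>'. x' e) \<le> (\<Prod>e\<in>\<omega> \<inter> \<omega>'. x e) * (\<Prod>e\<in>\<omega> - \<omega>'. x' e) * (\<Prod>e\<in>\<omega>'. x' e)"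
    using w x by (intro mult_right_mono prod_nonneg) force+
  also have "\<dots> = (\<Prod>e\<in>\<omega> \<inter> \<omega>'. x e) * (\<Prod>e\<in>\<omega> \<union> \<omega>'. x' e)"
  proof -
    have "(\<omega> - \<omega>') \<union> \<omega>' = \<omega> \<union> \<omega>'" by auto
    then have "(\<Prod>e\<in>\<omega> \<union> \<omega>'. x' e) = (\<Prod>e\<in>\<omega> - \<omega>'. x' e) * (\<Prod>e\<in>\<omega>'. x' e)"
      using fin prod.union_disjoint[of "\<omega> - \<omega>'" \<omega>' x'] by auto
    then show ?thesis by simp
  qed
  finally have p: "(\<Prod>e\<in>\<omega>. x e) * (\<Prod>e\<in>\<omega>'. x' e) \<le> (\<Prod>e\<in>\<omega> \<inter> \<omega>'. x e) * (\<Prod>e\<in>\<omega> \<union> \<omega>'. x' e)" .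
  have "q ^ num_clusters E wired \<omega> * q ^ num_clusters E wired \<omega>'
      \<le> q ^ num_clusters E wired (\<omega> \<inter> \<omega>') * q ^ num_clusters E wired (\<omega> \<union> \<omega>')"
    unfolding power_add[symmetric] using num_clusters_supermodular[OF w] q1 by (intro power_increasing)
  moreover have "0 \<le> (\<Prod>e\<in>\<omega>. x e) * (\<Prod>e\<in>\<omega>'. x' e)"
    using w x by (intro mult_nonneg_nonneg prod_nonneg) force+
  ultimately have "((\<Prod>e\<in>\<omega>. x e) * (\<Prod>e\<in>\<omega>'. x' e)) * (q ^ num_clusters E wired \<omega> * q ^ num_clusters E wired \<omega>')
     \<le> ((\<Prod>e\<in>\<omega> \<inter> \<omega>'. x e) * (\<Prod>e\<in>\<omega> \<union> \<omega>'. x' e)) * (q ^ num_clusters E wired (\<omega> \<inter> \<omega>') * q ^ num_clusters E wired (\<omega> \<union> \<omega>'))"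
    using q1 order_trans[OF _ p] by (intro mult_mono[OF p]) auto
  then show ?thesis unfolding rc_wt_def by (simp add: mult_ac)
qed

lemma rc_tot_filter: "rc_tot q E x (A \<inter> B) = (\<Sum>\<omega>\<in>Pow E \<inter> A. if \<omega> \<in> B then rc_wt q E x \<omega> else 0)"
  unfolding rc_tot_def using finE by (simp add: sum.inter_restrict[symmetric] Int_assoc)

lemma rc_pr_antimono_odds:
  assumes "\<And>e. e \<in> E \<Longrightarrow> 0 \<le> x e" "\<And>e. e \<in> E \<Longrightarrow> x e \<le> x' e" and dec: "decreasing E A"
  shows "rc_pr q E x' A \<le> rc_pr q E x A"
proof -
  have x': "0 \<le> x' e" if "e \<in> E" for e using assms(1,2)[OF that] by simp
  have "rc_tot q E x' A * rc_tot q E x UNIV \<le> rc_tot q E x A * rc_tot q E x' UNIV"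
    unfolding rc_tot_def Int_UNIV_right
    by (rule holley[OF finE _ _ _ dec]) (use assms x' in \<open>auto intro!: rc_wt_nonneg rc_wt_lattice\<close>)
  then show ?thesis
    unfolding rc_pr_def using rc_tot_pos[of x UNIV] rc_tot_pos[of x' UNIV] assms x'
    by (simp add: divide_simps)
qed

lemma rc_pr_fkg:
  assumes x: "\<And>e. e \<in> E \<Longrightarrow> 0 \<le> x e" and dA: "decreasing E A" and dB: "decreasing E B"
  shows "rc_pr q E x A * rc_pr q E x B \<le> rc_pr q E x (A \<inter> B)"
proof -
  let ?f = "\<lambda>\<omega>. if \<omega> \<in> B then rc_wt q E x \<omega> else 0"
  have "(\<Sum>\<omega>\<in>Pow E \<inter> A. rc_wt q E x \<omega>) * (\<Sum>\<omega>\<in>Pow E. ?f \<omega>) \<le> (\<Sum>\<omega>\<in>Pow E \<inter> A. ?f \<omega>) * (\<Sum>\<omega>\<in>Pow E. rc_wt q E x \<omega>)"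
  proof (rule holley[OF finE _ _ _ dA])
    fix \<omega> \<omega>' assume w: "\<omega> \<subseteq> E" "\<omega>' \<subseteq> E"
    have "0 \<le> rc_wt q E x (\<omega> \<inter> \<omega>')" "0 \<le> rc_wt q E x (\<omega> \<union> \<omega>')"
      using w x by (auto intro!: rc_wt_nonneg)
    moreover have "\<omega> \<inter> \<omega>' \<in> B" if "\<omega> \<in> B" using decreasingD[OF dB that, of "\<omega> \<inter> \<omega>'"] w by auto
    ultimately show "?f \<omega> * rc_wt q E x \<omega>' \<le> ?f (\<omega> \<inter> \<omega>') * rc_wt q E x (\<omega> \<union> \<omega>')"
      using rc_wt_lattice[of x x \<omega> \<omega>'] x w by simp
  qed (use x in \<open>auto intro!: rc_wt_nonneg\<close>)
  then have "rc_tot q E x A * rc_tot q E x (UNIV \<inter> B) \<le> rc_tot q E x (A \<inter> B) * rc_tot q E x UNIV"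
    unfolding rc_tot_filter by (simp add: rc_tot_def)
  then show ?thesis
    unfolding rc_pr_def using rc_tot_pos[of x UNIV] x
    by (simp add: divide_simps mult_ac)
qed

lemma rc_pr_fkg_INT:
  assumes x: "\<And>e. e \<in> E \<Longrightarrow> 0 \<le> x e" and "finite I" "\<And>i. i \<in> I \<Longrightarrow> decreasing E (A i)"
  shows "(\<Prod>i\<in>I. rc_pr q E x (A i)) \<le> rc_pr q E x (\<Inter>i\<in>I. A i)"
  using assms(2,3)
proof (induction I rule: finite_induct)
  case empty
  have "rc_tot q E x UNIV \<noteq> 0" using rc_tot_pos[of x UNIV] x by simp
  then show ?case by (simp add: rc_pr_def)
next
  case (insert i I)
  have "(\<Prod>i\<in>insert i I. rc_pr q E x (A i)) \<le> rc_pr q E x (A i) * rc_pr q E x (\<Inter>i\<in>I. A i)"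
    using insert by (simp add: mult_left_mono rc_pr_nonneg x)
  also have "\<dots> \<le> rc_pr q E x (A i \<inter> (\<Inter>i\<in>I. A i))"
    using insert.prems by (intro rc_pr_fkg x decreasing_INT) auto
  finally show ?case by simp
qed

text \<open>
  The slope of the total weight as a function of the parameter of \<open>e\<close>.
\<close>

definition rc_open :: "('d edge \<Rightarrow> real) \<Rightarrow> 'd edge set set \<Rightarrow> 'd edge \<Rightarrow> real" where
  "rc_open x A e = (\<Sum>\<omega>\<in>{\<omega>\<in>Pow E \<inter> A. e \<in> \<omega>}. (\<Prod>e'\<in>\<omega> - {e}. x e') * q ^ num_clusters E wired \<omega>)"

lemma rc_wt_cong: "\<omega> \<subseteq> E \<Longrightarrow> (\<And>e. e \<in> \<omega> \<Longrightarrow> x e = y e) \<Longrightarrow> rc_wt q E x \<omega> = rc_wt q E y \<omega>"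
  unfolding rc_wt_def by (intro arg_cong2[where f="(*)"] prod.cong) auto

lemma rc_tot_split:
  "rc_tot q E x A = rc_tot q E x (A \<inter> {\<omega>. e \<notin> \<omega>}) + x e * rc_open x A e"
proof -
  have "rc_wt q E x \<omega> = x e * ((\<Prod>e'\<in>\<omega> - {e}. x e') * q ^ num_clusters E wired \<omega>)" if "e \<in> \<omega>" "\<omega> \<subseteq> E" for \<omega>
    using that finE finite_subset[of \<omega> E] by (simp add: rc_wt_def prod.remove[of \<omega> e])
  then have "x e * rc_open x A e = (\<Sum>\<omega>\<in>{\<omega>\<in>Pow E \<inter> A. e \<in> \<omega>}. rc_wt q E x \<omega>)"
    unfolding rc_open_def sum_distrib_left by (intro sum.cong) auto
  moreover have *: "Pow E \<inter> A = (Pow E \<inter> (A \<inter> {\<omega>. e \<notin> \<omega>})) \<union> {\<omega>\<in>Pow E \<inter> A. e \<in> \<omega>}" by auto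
  have "rc_tot q E x A = rc_tot q E x (A \<inter> {\<omega>. e \<notin> \<omega>}) + (\<Sum>\<omega>\<in>{\<omega>\<in>Pow E \<inter> A. e \<in> \<omega>}. rc_wt q E x \<omega>)"
    unfolding rc_tot_def using finE by (subst *, subst sum.union_disjoint) auto
  ultimately show ?thesis by simp
qed

lemma rc_tot_closed_eq: "rc_tot q E x (A \<inter> {\<omega>. e \<notin> \<omega>}) = rc_tot q E (x(e := 0)) A"
proof -
  have "rc_tot q E (x(e := 0)) A = rc_tot q E (x(e := 0)) (A \<inter> {\<omega>. e \<notin> \<omega>})"
    using rc_tot_split[of "x(e := 0)" A e] by simp
  also have "\<dots> = rc_tot q E x (A \<inter> {\<omega>. e \<notin> \<omega>})"
    unfolding rc_tot_def by (intro sum.cong refl rc_wt_cong) auto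
  finally show ?thesis by simp
qed

lemma rc_open_nonneg: "(\<And>e. e \<in> E \<Longrightarrow> 0 \<le> x e) \<Longrightarrow> 0 \<le> rc_open x A e"
  unfolding rc_open_def using q1 by (intro sum_nonneg mult_nonneg_nonneg prod_nonneg) auto

text \<open>
  Removing \<open>e\<close> does not decrease the number of clusters, and \<open>q \<ge> 1\<close>.
\<close>

lemma rc_open_le:
  assumes x: "\<And>e. e \<in> E \<Longrightarrow> 0 \<le> x e" and "e \<in> E"
  shows "rc_open x UNIV e \<le> rc_tot q E x {\<omega>. e \<notin> \<omega>}"
proof -
  have "rc_open x UNIV e = (\<Sum>\<eta>\<in>Pow E \<inter> {\<omega>. e \<notin> \<omega>}. (\<Prod>e'\<in>\<eta>. x e') * q ^ num_clusters E wired (insert e \<eta>))"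
    unfolding rc_open_def
    by (rule sum.reindex_bij_witness[of _ "insert e" "\<lambda>\<omega>. \<omega> - {e}"]) (use assms in \<open>auto simp: insert_absorb\<close>)
  also have "\<dots> \<le> rc_tot q E x {\<omega>. e \<notin> \<omega>}"
    unfolding rc_tot_def rc_wt_def using assms q1 num_clusters_insert_le
    by (intro sum_mono mult_left_mono power_increasing prod_nonneg) auto
  finally show ?thesis .
qed

lemma rc_pr_closed:
  assumes x: "\<And>e. e \<in> E \<Longrightarrow> 0 \<le> x e" and "e \<in> E"
  shows "1 / (1 + x e) \<le> rc_pr q E x {\<omega>. e \<notin> \<omega>}"
proof -
  let ?c = "rc_tot q E x {\<omega>. e \<notin> \<omega>}"
  have c: "0 < ?c" using x by (intro rc_tot_pos) auto
  have xe: "0 \<le> x e" using assms by simp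
  have "rc_tot q E x UNIV = ?c + x e * rc_open x UNIV e" using rc_tot_split[of x UNIV e] by simp
  also have "\<dots> \<le> ?c + x e * ?c" using rc_open_le[OF assms] xe by (intro add_left_mono mult_left_mono)
  finally have "rc_tot q E x UNIV \<le> (1 + x e) * ?c" by (simp add: algebra_simps)
  then show ?thesis unfolding rc_pr_def using c xe rc_tot_pos[of x UNIV] x by (simp add: divide_simps mult_ac)
qed

lemma decreasing_closed: "decreasing E {\<omega>. e \<notin> \<omega>}"
  by (auto simp: decreasing_def)

end

lemma rc_measure_eq:
  fixes J :: "('d::finite) edge \<Rightarrow> real"
  assumes "rc_region q E" "0 \<le> \<beta>" "\<And>e. e \<in> E \<Longrightarrow> 0 \<le> J e" "A \<subseteq> Pow E"
  shows "measure (rc_measure q \<beta> E wired J) A = rc_pr q E (odds \<beta> J) A"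
proof -
  interpret rc_region q E by fact
  define K where "K = (\<Prod>e\<in>E. exp (- \<beta> * J e))"
  have K: "K > 0" unfolding K_def by (intro prod_pos) auto
  have x: "0 \<le> odds \<beta> J e" if "e \<in> E" for e using assms that by (simp add: odds_def)
  have w: "rc_weight q \<beta> E wired J \<omega> = K * rc_wt q E (odds \<beta> J) \<omega>" if "\<omega> \<subseteq> E" for \<omega>
  proof -
    have "(\<Prod>e\<in>E. if e \<in> \<omega> then edge_prob \<beta> J e else 1 - edge_prob \<beta> J e)
        = (\<Prod>e\<in>E. exp (- \<beta> * J e) * (if e \<in> \<omega> then odds \<beta> J e else 1))"
      by (intro prod.cong) (auto simp: edge_prob_def odds_def algebra_simps exp_minus_inverse simp flip: exp_add)
    also have "\<dots> = K * (\<Prod>e\<in>E. if e \<in> \<omega> then odds \<beta> J e else 1)"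
      by (simp add: K_def prod.distrib)
    also have "(\<Prod>e\<in>E. if e \<in> \<omega> then odds \<beta> J e else 1) = (\<Prod>e\<in>\<omega>. odds \<beta> J e)"
      using finE that by (simp add: prod.inter_restrict[symmetric] Int_absorb1)
    finally show ?thesis by (simp add: rc_weight_def rc_wt_def)
  qed
  have Z: "rc_partition q \<beta> E wired J = K * rc_tot q E (odds \<beta> J) UNIV"
    unfolding rc_partition_def rc_tot_def sum_distrib_left by (intro sum.cong) (auto simp: w)
  have tot: "0 < rc_tot q E (odds \<beta> J) UNIV" using rc_tot_pos x by blast
  have nn: "0 \<le> rc_weight q \<beta> E wired J \<omega> / rc_partition q \<beta> E wired J" if "\<omega> \<in> Pow E" for \<omega>
    using that K tot rc_wt_nonneg[OF x] by (simp add: w Z)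
  have "emeasure (rc_measure q \<beta> E wired J) A
      = (\<Sum>\<omega>\<in>A. ennreal (rc_weight q \<beta> E wired J \<omega> / rc_partition q \<beta> E wired J))"
    unfolding rc_measure_def using finE assms(4) by (intro emeasure_point_measure_finite) auto
  also have "\<dots> = ennreal (\<Sum>\<omega>\<in>A. rc_weight q \<beta> E wired J \<omega> / rc_partition q \<beta> E wired J)"
    using nn assms(4) by (intro sum_ennreal) auto
  finally have "measure (rc_measure q \<beta> E wired J) A
     = (\<Sum>\<omega>\<in>A. rc_weight q \<beta> E wired J \<omega> / rc_partition q \<beta> E wired J)"
    unfolding measure_def using nn assms(4) by (simp add: sum_nonneg subset_eq)
  also have "\<dots> = (\<Sum>\<omega>\<in>A. rc_wt q E (odds \<beta> J) \<omega>) / rc_tot q E (odds \<beta> J) UNIV"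
    unfolding sum_divide_distrib Z using assms(4) K by (intro sum.cong) (auto simp: w)
  finally show ?thesis
    using assms(4) by (simp add: rc_pr_def rc_tot_def Int_absorb1)
qed

text \<open>
  With all edges of \<open>E - E'\<close> open, the part of \<open>E\<close> outside \<open>E'\<close> acts as the wired boundary condition of \<open>E'\<close>.
  Clusters that avoid the vertices of \<open>E'\<close> do not depend on the configuration in \<open>E'\<close>; they are the constant \<open>k\<close>.
\<close>

lemma num_clusters_wired_subregion:
  fixes E E' :: "('d::finite) edge set"
  assumes "rc_region q E" "E' \<subseteq> E"
  obtains k where "\<And>\<omega>. \<omega> \<subseteq> E' \<Longrightarrow> num_clusters E wired (\<omega> \<union> (E - E')) = num_clusters E' wired \<omega> + k"
proof
  interpret rc_region q E by fact
  interpret sub: rc_region q E' using assms q1 finE Ewired by unfold_locales (auto intro: finite_subset)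
  let ?N = "\<lambda>F. cluster F ` \<Union>E - cluster F ` \<Union>E'"
  fix \<omega> assume w: "\<omega> \<subseteq> E'"
  let ?F = "\<omega> \<union> (wired - E')" and ?W = "wired - E'"
  have e: "((\<omega> \<union> (E - E')) \<inter> E) \<union> (wired - E) = ?F" "(\<omega> \<inter> E') \<union> (wired - E') = ?F"
    using w assms(2) Ewired by auto
  have far: "cluster F u = cluster ?W u"
    if F: "F = ?F \<or> F = ?W" and G: "G = ?F \<or> G = ?W" and u: "cluster G u \<notin> cluster G ` \<Union>E'" for u F G
  proof -
    have nj: "\<not> joined G u v" if "v \<in> \<Union>E'" for v
      using u that cluster_eq_iff[of G u v] by blast
    have edge: "{a, b} \<in> ?W" if "{a, b} \<in> ?F" "joined G u a" for a b
      using that nj w by blast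
    have *: "joined ?W u v" if "joined ?F u v" for v
    proof -
      have "joined ?W u v \<and> joined G u v"
        using that
      proof (rule joined_invariant)
        fix a b assume ab: "{a, b} \<in> ?F" and j: "joined ?W u a \<and> joined G u a"
        have "{a, b} \<in> ?W" using edge ab j by blast
        then have W: "joined ?W a b" by (rule joined_edge)
        then have "joined ?F a b" by (rule joined_mono[rotated]) simp
        with W have "joined ?W a b" "joined G a b" using G by auto
        then show "joined ?W u b \<and> joined G u b" using j joined_trans by blast
      qed simp
      then show ?thesis by simp
    qed
    have "joined ?F u v \<longleftrightarrow> joined ?W u v" for v using * joined_mono[of ?W ?F u v, OF Un_upper2] by blast
    then show ?thesis using F unfolding cluster_def by auto
  qed
  have "?N ?F = ?N ?W"
  proof (intro equalityI subsetI)
    fix c assume c: "c \<in> ?N ?F"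
    then obtain u where u: "u \<in> \<Union>E" "c = cluster ?F u" "cluster ?F u \<notin> cluster ?F ` \<Union>E'" by blast
    have c0: "c = cluster ?W u" using far[of ?F ?F u] u by simp
    have "cluster ?W u \<notin> cluster ?W ` \<Union>E'"
    proof
      assume "cluster ?W u \<in> cluster ?W ` \<Union>E'"
      then obtain v where "v \<in> \<Union>E'" "cluster ?W u = cluster ?W v" by blast
      then have "joined ?W u v" by (simp add: cluster_eq_iff)
      then have "joined ?F u v" using joined_mono[of ?W ?F u v] by auto
      then show False using u(3) \<open>v \<in> \<Union>E'\<close> cluster_eq_iff[of ?F u v] by blast
    qed
    then show "c \<in> ?N ?W" using c0 u(1) by auto
  next
    fix c assume c: "c \<in> ?N ?W"
    then obtain u where u: "u \<in> \<Union>E" "c = cluster ?W u" "cluster ?W u \<notin> cluster ?W ` \<Union>E'" by blast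
    have c1: "cluster ?F u = cluster ?W u" using far[of ?F ?W u] u by simp
    have "cluster ?F u \<notin> cluster ?F ` \<Union>E'"
    proof
      assume "cluster ?F u \<in> cluster ?F ` \<Union>E'"
      then obtain v where v: "v \<in> \<Union>E'" "cluster ?F u = cluster ?F v" by blast
      then have "v \<in> cluster ?W u" using c1 by (auto simp: cluster_def)
      then have "joined ?W u v" by (simp add: cluster_def)
      then show False using u(3) v(1) cluster_eq_iff[of ?W u v] by blast
    qed
    then show "c \<in> ?N ?F" using c u(1,2) c1 by auto
  qed
  moreover have "card (cluster ?F ` \<Union>E) = card (cluster ?F ` \<Union>E') + card (?N ?F)"
  proof -
    have "cluster ?F ` \<Union>E = cluster ?F ` \<Union>E' \<union> ?N ?F" using assms(2) by auto
    then have "card (cluster ?F ` \<Union>E) = card (cluster ?F ` \<Union>E' \<union> ?N ?F)" by (rule arg_cong)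
    also have "\<dots> = card (cluster ?F ` \<Union>E') + card (?N ?F)"
      using finite_vertices sub.finite_vertices by (intro card_Un_disjoint) auto
    finally show ?thesis .
  qed
  ultimately have "card (cluster ?F ` \<Union>E) = card (cluster ?F ` \<Union>E') + card (?N ?W)" by (simp only:)
  then show "num_clusters E wired (\<omega> \<union> (E - E')) = num_clusters E' wired \<omega> + card (?N ?W)"
    unfolding num_clusters_cluster sub.num_clusters_cluster e .
qed

text \<open>
  The wired measure of \<open>E'\<close> is the wired measure of \<open>E\<close> conditioned on all edges of \<open>E - E'\<close> being open, and this
  conditioning makes decreasing events less likely. The weight \<open>g\<close> of the proof is that of the conditioned measure.
\<close>

lemma rc_pr_subregion:
  assumes "rc_region q E" "E' \<subseteq> E" and x: "\<And>e. e \<in> E \<Longrightarrow> 0 \<le> x e" and dec: "decreasing E' A"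
  shows "rc_pr q E' x A \<le> rc_pr q E x {\<omega>. \<omega> \<inter> E' \<in> A}"
proof -
  interpret rc_region q E by fact
  interpret sub: rc_region q E' using assms q1 finE Ewired by unfold_locales (auto intro: finite_subset)
  obtain k where k: "\<And>\<omega>. \<omega> \<subseteq> E' \<Longrightarrow> num_clusters E wired (\<omega> \<union> (E - E')) = num_clusters E' wired \<omega> + k"
    using num_clusters_wired_subregion[OF assms(1,2)] by blast
  define g where "g \<omega> = (if E - E' \<subseteq> \<omega> then (\<Prod>e\<in>\<omega> \<inter> E'. x e) * q ^ num_clusters E wired \<omega> else 0)" for \<omega>
  have g_sum: "(\<Sum>\<omega>\<in>Pow E \<inter> {\<omega>. \<omega> \<inter> E' \<in> B}. g \<omega>) = q ^ k * rc_tot q E' x B" for B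
  proof -
    have "q ^ k * rc_tot q E' x B = (\<Sum>\<omega>\<in>Pow E' \<inter> B. g (\<omega> \<union> (E - E')))"
      unfolding rc_tot_def sum_distrib_left
    proof (intro sum.cong refl)
      fix \<omega> assume "\<omega> \<in> Pow E' \<inter> B"
      then have w: "\<omega> \<subseteq> E'" by simp
      then have "(\<omega> \<union> (E - E')) \<inter> E' = \<omega>" by auto
      then show "q ^ k * rc_wt q E' x \<omega> = g (\<omega> \<union> (E - E'))"
        by (simp add: g_def rc_wt_def k[OF w] power_add mult_ac)
    qed
    also have "\<dots> = (\<Sum>\<omega>\<in>{\<omega>\<in>Pow E \<inter> {\<omega>. \<omega> \<inter> E' \<in> B}. E - E' \<subseteq> \<omega>}. g \<omega>)"
    proof (rule sum.reindex_bij_witness[of _ "\<lambda>\<omega>. \<omega> \<inter> E'" "\<lambda>\<omega>. \<omega> \<union> (E - E')"])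
      fix \<omega> assume "\<omega> \<in> Pow E' \<inter> B"
      then have "\<omega> \<subseteq> E'" "\<omega> \<in> B" by auto
      moreover from this have *: "(\<omega> \<union> (E - E')) \<inter> E' = \<omega>" by auto
      ultimately show "(\<omega> \<union> (E - E')) \<inter> E' = \<omega>"
        "\<omega> \<union> (E - E') \<in> {\<omega> \<in> Pow E \<inter> {\<omega>. \<omega> \<inter> E' \<in> B}. E - E' \<subseteq> \<omega>}"
        using assms(2) by auto
    qed (use assms(2) in auto)
    also have "\<dots> = (\<Sum>\<omega>\<in>Pow E \<inter> {\<omega>. \<omega> \<inter> E' \<in> B}. g \<omega>)"
      using finE by (intro sum.mono_neutral_left) (auto simp: g_def)
    finally show ?thesis by simp
  qed
  have x': "0 \<le> x e" if "e \<in> E'" for e using x that assms(2) by blast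
  have "(\<Sum>\<omega>\<in>Pow E \<inter> {\<omega>. \<omega> \<inter> E' \<in> A}. g \<omega>) * (\<Sum>\<omega>\<in>Pow E. rc_wt q E x \<omega>)
     \<le> (\<Sum>\<omega>\<in>Pow E \<inter> {\<omega>. \<omega> \<inter> E' \<in> A}. rc_wt q E x \<omega>) * (\<Sum>\<omega>\<in>Pow E. g \<omega>)"
  proof (rule holley[OF finE])
    fix \<omega> \<omega>' assume w: "\<omega> \<subseteq> E" "\<omega>' \<subseteq> E"
    show "rc_wt q E x \<omega> * g \<omega>' \<le> rc_wt q E x (\<omega> \<inter> \<omega>') * g (\<omega> \<union> \<omega>')"
    proof (cases "E - E' \<subseteq> \<omega>'")
      case True
      then have T: "E - E' \<subseteq> \<omega> \<union> \<omega>'" by auto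
      have fin: "finite \<omega>" "finite \<omega>'" using w finE finite_subset by auto
      have "(\<Prod>e\<in>\<omega>. x e) = (\<Prod>e\<in>\<omega> \<inter> \<omega>'. x e) * (\<Prod>e\<in>\<omega> - \<omega>'. x e)"
        using fin by (subst prod.Int_Diff[of \<omega> _ \<omega>']) auto
      moreover have "(\<omega> \<union> \<omega>') \<inter> E' = (\<omega> - \<omega>') \<union> (\<omega>' \<inter> E')" using w True by auto
      then have "(\<Prod>e\<in>(\<omega> \<union> \<omega>') \<inter> E'. x e) = (\<Prod>e\<in>\<omega> - \<omega>'. x e) * (\<Prod>e\<in>\<omega>' \<inter> E'. x e)"
        using fin by (simp only:) (intro prod.union_disjoint, auto)
      ultimately have p: "(\<Prod>e\<in>\<omega>. x e) * (\<Prod>e\<in>\<omega>' \<inter> E'. x e)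
          = (\<Prod>e\<in>\<omega> \<inter> \<omega>'. x e) * (\<Prod>e\<in>(\<omega> \<union> \<omega>') \<inter> E'. x e)" by simp
      have "q ^ num_clusters E wired \<omega> * q ^ num_clusters E wired \<omega>'
        \<le> q ^ num_clusters E wired (\<omega> \<inter> \<omega>') * q ^ num_clusters E wired (\<omega> \<union> \<omega>')"
        unfolding power_add[symmetric] using num_clusters_supermodular[OF w] q1 by (intro power_increasing)
      moreover have "0 \<le> (\<Prod>e\<in>\<omega>. x e) * (\<Prod>e\<in>\<omega>' \<inter> E'. x e)"
        using w x by (intro mult_nonneg_nonneg prod_nonneg) force+
      ultimately have "((\<Prod>e\<in>\<omega>. x e) * (\<Prod>e\<in>\<omega>' \<inter> E'. x e)) * (q ^ num_clusters E wired \<omega> * q ^ num_clusters E wired \<omega>')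
        \<le> ((\<Prod>e\<in>\<omega>. x e) * (\<Prod>e\<in>\<omega>' \<inter> E'. x e)) * (q ^ num_clusters E wired (\<omega> \<inter> \<omega>') * q ^ num_clusters E wired (\<omega> \<union> \<omega>'))"
        by (intro mult_left_mono)
      also have "\<dots> = ((\<Prod>e\<in>\<omega> \<inter> \<omega>'. x e) * (\<Prod>e\<in>(\<omega> \<union> \<omega>') \<inter> E'. x e)) * (q ^ num_clusters E wired (\<omega> \<inter> \<omega>') * q ^ num_clusters E wired (\<omega> \<union> \<omega>'))"
        by (simp only: p)
      finally show ?thesis unfolding rc_wt_def g_def using True T by (simp add: mult_ac)
    next
      case False
      have "0 \<le> (\<Prod>e\<in>(\<omega> \<union> \<omega>') \<inter> E'. x e) * q ^ num_clusters E wired (\<omega> \<union> \<omega>')"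
        using x' q1 by (intro mult_nonneg_nonneg prod_nonneg) auto
      then have "0 \<le> g (\<omega> \<union> \<omega>')" by (simp add: g_def)
      moreover have "0 \<le> rc_wt q E x (\<omega> \<inter> \<omega>')" using w x by (intro rc_wt_nonneg) auto
      ultimately show ?thesis using False by (simp add: g_def)
    qed
  next
    show "decreasing E {\<omega>. \<omega> \<inter> E' \<in> A}"
      unfolding decreasing_def
    proof safe
      fix \<omega> \<eta> assume "\<omega> \<inter> E' \<in> A" "\<eta> \<subseteq> \<omega>"
      then show "\<eta> \<inter> E' \<in> A" using decreasingD[OF dec, of "\<omega> \<inter> E'" "\<eta> \<inter> E'"] by auto
    qed
    show "0 \<le> g \<omega>" for \<omega> unfolding g_def using x' q1 by (auto intro!: mult_nonneg_nonneg prod_nonneg)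
  qed (use x in \<open>auto intro!: rc_wt_nonneg\<close>)
  then have "q ^ k * (rc_tot q E' x A * rc_tot q E x UNIV)
      \<le> q ^ k * (rc_tot q E x {\<omega>. \<omega> \<inter> E' \<in> A} * rc_tot q E' x UNIV)"
    using g_sum[of A] g_sum[of UNIV] by (simp add: rc_tot_def mult_ac)
  then have "rc_tot q E' x A * rc_tot q E x UNIV \<le> rc_tot q E x {\<omega>. \<omega> \<inter> E' \<in> A} * rc_tot q E' x UNIV"
    using q1 by simp
  then show ?thesis unfolding rc_pr_def
    using rc_tot_pos[of x UNIV] sub.rc_tot_pos[of x UNIV] x x' by (simp add: divide_simps)
qed

section \<open>The disconnection cost and its dependence on the couplings\<close>

definition cost :: "real \<Rightarrow> ('d::finite) edge set \<Rightarrow> 'd edge set set \<Rightarrow> real \<Rightarrow> ('d edge \<Rightarrow> real) \<Rightarrow> real" where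
  "cost q E A \<beta> J = - ln (rc_pr q E (odds \<beta> J) A)"

lemma odds_nonneg: "0 \<le> \<beta> \<Longrightarrow> 0 \<le> J e \<Longrightarrow> 0 \<le> odds \<beta> J e"
  by (simp add: odds_def)

lemma odds_mono: "0 \<le> \<beta> \<Longrightarrow> 0 \<le> J e \<Longrightarrow> \<beta> \<le> \<beta>' \<Longrightarrow> J e \<le> J' e \<Longrightarrow> odds \<beta> J e \<le> odds \<beta>' J' e"
  by (auto simp: odds_def intro!: mult_mono)

lemma odds_upd_0: "odds \<beta> (J(e := 0)) = (odds \<beta> J)(e := 0)"
  by (auto simp: odds_def)

context rc_region
begin

text \<open>
  The logarithmic derivative of \<open>1 / \<Phi>(A)\<close> in the parameter of \<open>e\<close>.
\<close>

definition influence :: "('d edge \<Rightarrow> real) \<Rightarrow> 'd edge set set \<Rightarrow> 'd edge \<Rightarrow> real" where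
  "influence x A e = rc_open x UNIV e / rc_tot q E x UNIV - rc_open x A e / rc_tot q E x A"

text \<open>
  FKG for \<open>A\<close> and the event that \<open>e\<close> is closed. The factor \<open>x e\<close> avoids a division by zero.
\<close>

lemma influence_nonneg:
  assumes x: "\<And>e. e \<in> E \<Longrightarrow> 0 \<le> x e" and A: "decreasing E A" "{} \<in> A" and e: "e \<in> E"
  shows "0 \<le> x e * influence x A e"
proof -
  let ?T = "rc_tot q E x UNIV" and ?TA = "rc_tot q E x A"
  have T: "0 < ?T" "0 < ?TA" using rc_tot_pos[of x UNIV] rc_tot_pos[of x A] x A(2) by auto
  have "rc_pr q E x A * rc_pr q E x {\<omega>. e \<notin> \<omega>} \<le> rc_pr q E x (A \<inter> {\<omega>. e \<notin> \<omega>})"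
    by (rule rc_pr_fkg[OF x A(1) decreasing_closed])
  then have "?TA * rc_tot q E x {\<omega>. e \<notin> \<omega>} \<le> rc_tot q E x (A \<inter> {\<omega>. e \<notin> \<omega>}) * ?T"
    using T by (simp add: rc_pr_def divide_simps mult_ac)
  moreover have "rc_tot q E x {\<omega>. e \<notin> \<omega>} = ?T - x e * rc_open x UNIV e"
    using rc_tot_split[of x UNIV e] by simp
  moreover have "rc_tot q E x (A \<inter> {\<omega>. e \<notin> \<omega>}) = ?TA - x e * rc_open x A e"
    using rc_tot_split[of x A e] by simp
  ultimately have "?TA * (?T - x e * rc_open x UNIV e) \<le> (?TA - x e * rc_open x A e) * ?T" by simp
  then have "x e * rc_open x A e * ?T \<le> x e * rc_open x UNIV e * ?TA" by (simp add: algebra_simps)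
  then show ?thesis using T unfolding influence_def by (simp add: right_diff_distrib divide_simps)
qed

text \<open>
  With \<open>a\<close> and \<open>b\<close> the probabilities that \<open>e\<close> is open, given \<open>A\<close> and unconditionally, closing \<open>e\<close> multiplies the
  probability of \<open>A\<close> by \<open>(1 - a) / (1 - b)\<close>. The second bound uses \<open>1 - b \<ge> 1 / (1 + x\<^sub>e)\<close> and \<open>1 - a \<le> 1\<close>; the third one
  uses \<open>log z \<le> z - 1\<close> instead of the latter, and it is the one that can be summed over the edges, since \<open>b - a\<close> is \<open>x\<^sub>e\<close> times the influence.
\<close>

lemma close_edge_cost:
  assumes x: "\<And>e. e \<in> E \<Longrightarrow> 0 \<le> x e" and A: "decreasing E A" "{} \<in> A" and e: "e \<in> E"
  shows "rc_pr q E x A \<le> rc_pr q E (x(e := 0)) A"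
    and "ln (rc_pr q E (x(e := 0)) A) - ln (rc_pr q E x A) \<le> ln (1 + x e)"
    and "ln (rc_pr q E (x(e := 0)) A) - ln (rc_pr q E x A) \<le> x e * (1 + x e) * influence x A e"
proof -
  let ?y = "x(e := 0)"
  have y: "0 \<le> ?y e'" if "e' \<in> E" for e' using x that by simp
  have xe: "0 \<le> x e" using x e by simp
  show 1: "rc_pr q E x A \<le> rc_pr q E ?y A"
    by (rule rc_pr_antimono_odds) (use y x e A in auto)
  let ?T = "rc_tot q E x UNIV" and ?TA = "rc_tot q E x A"
  let ?S = "rc_tot q E ?y UNIV" and ?SA = "rc_tot q E ?y A"
  have T: "0 < ?T" "0 < ?TA" "0 < ?S" "0 < ?SA"
    using rc_tot_pos[of x UNIV] rc_tot_pos[of x A] rc_tot_pos[of ?y UNIV] rc_tot_pos[of ?y A] x y A(2) by auto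
  define a b where "a = x e * (rc_open x A e / ?TA)" and "b = x e * (rc_open x UNIV e / ?T)"
  have SA: "?SA / ?TA = 1 - a"
    using rc_tot_split[of x A e] T by (simp add: a_def rc_tot_closed_eq field_simps)
  have S: "?S / ?T = 1 - b"
    using rc_tot_split[of x UNIV e] T rc_tot_closed_eq[of x UNIV e] by (simp add: b_def field_simps)
  have b1: "1 / (1 + x e) \<le> 1 - b"
    using rc_pr_closed[of x, OF x e] rc_tot_closed_eq[of x UNIV e] S by (simp add: rc_pr_def)
  have ab: "b - a = x e * influence x A e" by (simp add: a_def b_def influence_def algebra_simps)
  have b0: "0 < 1 - b" using S T by (metis divide_pos_pos)
  have a1: "0 < 1 - a" using SA T by (metis divide_pos_pos)
  have a0: "0 \<le> a" using xe T rc_open_nonneg[of x A e, OF x] by (simp add: a_def)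
  have eq: "ln (rc_pr q E ?y A) - ln (rc_pr q E x A) = ln (1 - a) - ln (1 - b)"
    unfolding rc_pr_def SA[symmetric] S[symmetric] using T by (simp add: ln_div)
  have "ln (1 - a) \<le> 0" using a0 a1 by simp
  moreover have "- ln (1 - b) \<le> ln (1 + x e)"
  proof -
    have "ln (1 / (1 + x e)) \<le> ln (1 - b)" using b1 xe b0 by (subst ln_le_cancel_iff) auto
    then show ?thesis using xe by (simp add: ln_div)
  qed
  ultimately show "ln (rc_pr q E ?y A) - ln (rc_pr q E x A) \<le> ln (1 + x e)" unfolding eq by simp
  have "ln (1 - a) - ln (1 - b) = ln ((1 - a) / (1 - b))" using a1 b0 by (simp add: ln_div)
  also have "\<dots> \<le> (1 - a) / (1 - b) - 1" using a1 b0 by (intro ln_le_minus_one) simp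
  also have "\<dots> = (b - a) * (1 / (1 - b))" using b0 by (simp add: field_simps)
  also have "\<dots> \<le> (b - a) * (1 + x e)"
  proof (rule mult_left_mono)
    show "1 / (1 - b) \<le> 1 + x e" using b1 b0 xe by (simp add: field_simps)
    show "0 \<le> b - a" unfolding ab by (rule influence_nonneg[OF x A e])
  qed
  finally show "ln (rc_pr q E ?y A) - ln (rc_pr q E x A) \<le> x e * (1 + x e) * influence x A e"
    unfolding eq ab by (simp add: mult_ac)
qed

lemma rc_tot_derivative:
  "((\<lambda>s. rc_tot q E (odds s J) A) has_real_derivative
      (\<Sum>e\<in>E. J e * exp (s * J e) * rc_open (odds s J) A e)) (at s)"
proof -
  have d: "((\<lambda>s. odds s J e) has_real_derivative J e * exp (s * J e)) (at s)" for e
    unfolding odds_def by (auto intro!: derivative_eq_intros)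
  have "((\<lambda>s. rc_tot q E (odds s J) A) has_real_derivative
      (\<Sum>\<omega>\<in>Pow E \<inter> A. (\<Sum>e\<in>\<omega>. (J e * exp (s * J e)) * (\<Prod>e'\<in>\<omega> - {e}. odds s J e')) * q ^ num_clusters E wired \<omega>)) (at s)"
    unfolding rc_tot_def rc_wt_def
    by (intro DERIV_sum DERIV_cmult_right has_field_derivative_prod d)
  also have "(\<Sum>\<omega>\<in>Pow E \<inter> A. (\<Sum>e\<in>\<omega>. (J e * exp (s * J e)) * (\<Prod>e'\<in>\<omega> - {e}. odds s J e')) * q ^ num_clusters E wired \<omega>)
     = (\<Sum>\<omega>\<in>Pow E \<inter> A. \<Sum>e\<in>{e\<in>E. e \<in> \<omega>}. (J e * exp (s * J e)) * ((\<Prod>e'\<in>\<omega> - {e}. odds s J e') * q ^ num_clusters E wired \<omega>))"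
  proof (intro sum.cong refl)
    fix \<omega> assume "\<omega> \<in> Pow E \<inter> A"
    then have "{e \<in> E. e \<in> \<omega>} = \<omega>" by auto
    then show "(\<Sum>e\<in>\<omega>. (J e * exp (s * J e)) * (\<Prod>e'\<in>\<omega> - {e}. odds s J e')) * q ^ num_clusters E wired \<omega>
      = (\<Sum>e\<in>{e\<in>E. e \<in> \<omega>}. (J e * exp (s * J e)) * ((\<Prod>e'\<in>\<omega> - {e}. odds s J e') * q ^ num_clusters E wired \<omega>))"
      by (simp add: sum_distrib_right mult.assoc)
  qed
  also have "\<dots> = (\<Sum>e\<in>E. J e * exp (s * J e) * rc_open (odds s J) A e)"
    unfolding rc_open_def sum_distrib_left using finE by (subst sum.swap_restrict) (auto intro!: sum.cong)
  finally show ?thesis .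
qed

lemma cost_derivative:
  assumes J: "\<And>e. e \<in> E \<Longrightarrow> 0 \<le> J e" and s: "0 \<le> s" and A: "{} \<in> A"
  shows "((\<lambda>s. cost q E A s J) has_real_derivative
      (\<Sum>e\<in>E. J e * exp (s * J e) * influence (odds s J) A e)) (at s within S)"
proof -
  have x: "0 \<le> odds s J e" if "e \<in> E" for e using J s that by (simp add: odds_nonneg)
  let ?T = "\<lambda>s. rc_tot q E (odds s J) UNIV" and ?TA = "\<lambda>s. rc_tot q E (odds s J) A"
  have T: "0 < ?T s" "0 < ?TA s" using rc_tot_pos x A by auto
  have "((\<lambda>s. - ln (?TA s / ?T s)) has_real_derivative
     (- (((\<Sum>e\<in>E. J e * exp (s * J e) * rc_open (odds s J) A e) * ?T s - ?TA s * (\<Sum>e\<in>E. J e * exp (s * J e) * rc_open (odds s J) UNIV e)) / (?T s * ?T s)) * (1 / (?TA s / ?T s)))) (at s)"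
    using T by (auto intro!: derivative_eq_intros rc_tot_derivative simp: field_simps)
  also have "(- (((\<Sum>e\<in>E. J e * exp (s * J e) * rc_open (odds s J) A e) * ?T s - ?TA s * (\<Sum>e\<in>E. J e * exp (s * J e) * rc_open (odds s J) UNIV e)) / (?T s * ?T s)) * (1 / (?TA s / ?T s)))
     = (\<Sum>e\<in>E. J e * exp (s * J e) * rc_open (odds s J) UNIV e) / ?T s - (\<Sum>e\<in>E. J e * exp (s * J e) * rc_open (odds s J) A e) / ?TA s"
    using T by (simp add: field_simps)
  also have "\<dots> = (\<Sum>e\<in>E. J e * exp (s * J e) * influence (odds s J) A e)"
    by (simp add: influence_def right_diff_distrib sum_subtractf sum_divide_distrib)
  finally show ?thesis unfolding cost_def rc_pr_def by (rule has_field_derivative_at_within)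
qed

lemma cost_nonneg: "(\<And>e. e \<in> E \<Longrightarrow> 0 \<le> J e) \<Longrightarrow> 0 \<le> \<beta> \<Longrightarrow> {} \<in> A \<Longrightarrow> 0 \<le> cost q E A \<beta> J"
  unfolding cost_def using rc_pr_le_1[of "odds \<beta> J" A] rc_pr_pos[of "odds \<beta> J" A]
  by (simp add: odds_nonneg)

lemma cost_mono:
  assumes "\<And>e. e \<in> E \<Longrightarrow> 0 \<le> J e" "\<And>e. e \<in> E \<Longrightarrow> J e \<le> J' e" "0 \<le> \<beta>" "\<beta> \<le> \<beta>'" "decreasing E A" "{} \<in> A"
  shows "cost q E A \<beta> J \<le> cost q E A \<beta>' J'"
proof -
  have J': "0 \<le> J' e" if "e \<in> E" for e using assms(1,2)[OF that] by simp
  have "rc_pr q E (odds \<beta>' J') A \<le> rc_pr q E (odds \<beta> J) A"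
    by (rule rc_pr_antimono_odds) (use assms in \<open>auto intro!: odds_nonneg odds_mono\<close>)
  moreover have "0 < rc_pr q E (odds \<beta>' J') A"
    using assms J' by (intro rc_pr_pos odds_nonneg) auto
  ultimately show ?thesis unfolding cost_def by simp
qed

text \<open>
  The right-hand side of the last estimate is, up to the factor \<open>s * exp s\<close>, the term of \<open>e\<close> in the derivative of
  the cost: the change caused by one edge is controlled by its share in the change caused by the temperature.
\<close>

lemma cost_close_edge:
  assumes J: "\<And>e. e \<in> E \<Longrightarrow> 0 \<le> J e" "\<And>e. e \<in> E \<Longrightarrow> J e \<le> 1" and s: "0 \<le> s"
    and A: "decreasing E A" "{} \<in> A" and e: "e \<in> E"
  shows "cost q E A s (J(e := 0)) \<le> cost q E A s J"
    and "cost q E A s J - cost q E A s (J(e := 0)) \<le> s"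
    and "cost q E A s J - cost q E A s (J(e := 0)) \<le> s * exp s * (J e * exp (s * J e) * influence (odds s J) A e)"
proof -
  let ?x = "odds s J"
  have x: "0 \<le> ?x e" if "e \<in> E" for e using J s that by (simp add: odds_nonneg)
  note c = close_edge_cost[of ?x, OF x A e]
  have y: "0 \<le> (?x(e := 0)) e'" if "e' \<in> E" for e' using x that by simp
  show "cost q E A s (J(e := 0)) \<le> cost q E A s J"
    unfolding cost_def odds_upd_0 using c(1) rc_pr_pos[of ?x A, OF x A(2)] rc_pr_pos[of "?x(e := 0)" A, OF y A(2)] by simp
  have "ln (1 + ?x e) = s * J e" by (simp add: odds_def)
  also have "\<dots> \<le> s" using J[OF e] s by (simp add: mult_left_le)
  finally show "cost q E A s J - cost q E A s (J(e := 0)) \<le> s"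
    unfolding cost_def odds_upd_0 using c(2) by simp
  have "?x e * (1 + ?x e) * influence ?x A e \<le> s * exp s * (J e * exp (s * J e) * influence ?x A e)"
  proof (cases "?x e = 0")
    case True
    then have "s = 0 \<or> J e = 0" by (simp add: odds_def)
    then show ?thesis using True by auto
  next
    case False
    then have i: "0 \<le> influence ?x A e"
      using influence_nonneg[of ?x, OF x A e] x[OF e] by (simp add: zero_le_mult_iff)
    have "1 - s * J e \<le> exp (- (s * J e))" using exp_ge_add_one_self[of "- (s * J e)"] by simp
    then have "(1 - s * J e) * exp (s * J e) \<le> exp (- (s * J e)) * exp (s * J e)" by (intro mult_right_mono) auto
    then have 1: "?x e \<le> s * (J e * exp (s * J e))"
      by (simp add: odds_def algebra_simps exp_minus_inverse flip: exp_add)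
    have "s * J e \<le> s" using J[OF e] s by (simp add: mult_left_le)
    then have 2: "1 + ?x e \<le> exp s" by (simp add: odds_def)
    have "?x e * (1 + ?x e) \<le> s * (J e * exp (s * J e)) * exp s"
      using 1 2 x[OF e] J[OF e] s by (intro mult_mono) auto
    from mult_right_mono[OF this i] show ?thesis by (simp add: mult_ac)
  qed
  then show "cost q E A s J - cost q E A s (J(e := 0)) \<le> s * exp s * (J e * exp (s * J e) * influence ?x A e)"
    unfolding cost_def odds_upd_0 using c(3) by simp
qed

end

section \<open>Disconnecting a region by disconnecting disjoint tiles\<close>

text \<open>
  The map \<open>\<sigma>\<close> tells on which side a vertex lies. When the sides are the half-spaces of the normal direction, this is the
  disconnection event of a rectangle.
\<close>

definition sep :: "(int ^ 'd) set \<Rightarrow> (int ^ 'd \<Rightarrow> bool) \<Rightarrow> ('d::finite) edge set set" where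
  "sep \<Lambda> \<sigma> = {\<omega>. \<omega> \<subseteq> lattice_edges \<Lambda> \<and> \<not> (\<exists>y\<in>bdry \<Lambda>. \<exists>z\<in>bdry \<Lambda>. \<sigma> y \<and> \<not> \<sigma> z \<and> joined \<omega> y z)}"

lemma disconnection_eq_sep:
  "disconnection x L H S n = sep (hat (rect x L H S n)) (\<lambda>y. (emb y - x) \<bullet> n \<ge> 0)"
  unfolding disconnection_def sep_def Let_def bdry_plus_def bdry_minus_def
  by (intro Collect_cong conj_cong refl) (auto simp: not_le)

lemma joined_empty: "joined {} x y \<Longrightarrow> x = y"
  by (simp add: joined_def)

lemma empty_in_sep [simp]: "{} \<in> sep \<Lambda> \<sigma>"
  by (auto simp: sep_def dest: joined_empty)

lemma decreasing_sep: "decreasing (lattice_edges \<Lambda>) (sep \<Lambda> \<sigma>)"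
  unfolding decreasing_def
proof safe
  fix \<omega> \<eta> assume w: "\<omega> \<in> sep \<Lambda> \<sigma>" and "\<eta> \<subseteq> \<omega>" "\<eta> \<subseteq> lattice_edges \<Lambda>"
  then show "\<eta> \<in> sep \<Lambda> \<sigma>" using joined_mono[of \<eta> \<omega>] unfolding sep_def by blast
qed

lemma sep_subset: "sep \<Lambda> \<sigma> \<subseteq> Pow (lattice_edges \<Lambda>)"
  by (auto simp: sep_def)

lemma lattice_edges_mono: "\<Lambda> \<subseteq> \<Lambda>' \<Longrightarrow> lattice_edges \<Lambda> \<subseteq> lattice_edges \<Lambda>'"
  by (auto simp: lattice_edges_def)

lemma finite_lattice_edges: "finite \<Lambda> \<Longrightarrow> finite (lattice_edges \<Lambda>)"
  by (rule finite_subset[of _ "Pow \<Lambda>"]) (auto simp: lattice_edges_def)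

lemma adjacent_sym: "x \<sim>\<^sub>Z y \<longleftrightarrow> y \<sim>\<^sub>Z x"
  by (simp add: adjacent_def norm_minus_commute)

lemma lattice_edges_doubleton: "{a, b} \<in> lattice_edges \<Lambda> \<longleftrightarrow> a \<in> \<Lambda> \<and> b \<in> \<Lambda> \<and> a \<sim>\<^sub>Z b"
  using adjacent_sym by (fastforce simp: lattice_edges_def doubleton_eq_iff)

lemma rc_region_lattice: "1 \<le> q \<Longrightarrow> finite \<Lambda> \<Longrightarrow> rc_region q (lattice_edges \<Lambda>)"
  by unfold_locales (auto simp: finite_lattice_edges wired_def intro: lattice_edges_mono[THEN subsetD])

definition seam ::
  "(int ^ 'd) set \<Rightarrow> 'i set \<Rightarrow> ('i \<Rightarrow> (int ^ 'd) set) \<Rightarrow> (int ^ 'd \<Rightarrow> bool) \<Rightarrow> ('d::finite) edge set" where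
  "seam \<Lambda> I \<Lambda>' \<tau> = {e\<in>lattice_edges \<Lambda>. (\<forall>i\<in>I. e \<notin> lattice_edges (\<Lambda>' i)) \<and> (\<exists>v w. e = {v, w} \<and> \<tau> v \<and> \<not> \<tau> w)}"

text \<open>
  The map \<open>\<tau>\<close> extends the sides of the tiles and of the outer region to a single partition of \<open>\<Lambda>\<close>; the seam
  consists of the edges that cross this partition without being interior to a tile.
\<close>

locale tiling =
  fixes \<Lambda> :: "(int ^ 'd::finite) set" and \<sigma> :: "int ^ 'd \<Rightarrow> bool"
    and I :: "'i set" and \<Lambda>' :: "'i \<Rightarrow> (int ^ 'd) set" and \<sigma>' :: "'i \<Rightarrow> int ^ 'd \<Rightarrow> bool"
    and \<tau> :: "int ^ 'd \<Rightarrow> bool"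
  assumes sub: "\<And>i. i \<in> I \<Longrightarrow> \<Lambda>' i \<subseteq> \<Lambda>"
    and disj: "\<And>i j v. i \<in> I \<Longrightarrow> j \<in> I \<Longrightarrow> v \<in> \<Lambda>' i \<Longrightarrow> v \<in> \<Lambda>' j \<Longrightarrow> i = j"
    and away: "\<And>i. i \<in> I \<Longrightarrow> \<Lambda>' i \<inter> bdry \<Lambda> = {}"
    and tau_in: "\<And>i v. i \<in> I \<Longrightarrow> v \<in> \<Lambda>' i \<Longrightarrow> \<tau> v \<longleftrightarrow> \<sigma>' i v"
    and tau_out: "\<And>v. v \<in> \<Lambda> \<Longrightarrow> (\<And>i. i \<in> I \<Longrightarrow> v \<notin> \<Lambda>' i) \<Longrightarrow> \<tau> v \<longleftrightarrow> \<sigma> v"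
    and finite_region: "finite \<Lambda>" and finite_tiles: "finite I"
begin

text \<open>
  Inside a tile replace the upper side by the set of vertices that are reached from the upper boundary of the tile,
  and outside the tiles keep the upper side. No open edge leaves the resulting set \<open>U\<close>, which contains the
  upper boundary of \<open>\<Lambda>\<close> and misses the lower one.
\<close>

lemma sep_tiles:
  assumes w: "\<omega> \<subseteq> lattice_edges \<Lambda>"
    and tiles: "\<And>i. i \<in> I \<Longrightarrow> \<omega> \<inter> lattice_edges (\<Lambda>' i) \<in> sep (\<Lambda>' i) (\<sigma>' i)"
    and closed: "\<And>e. e \<in> seam \<Lambda> I \<Lambda>' \<tau> \<Longrightarrow> e \<notin> \<omega>"
  shows "\<omega> \<in> sep \<Lambda> \<sigma>"
proof -
  \<comment> \<open>In a tile: reached from the upper part of its boundary. Outside the tiles: on the upper side.\<close>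
  define U where "U v \<longleftrightarrow> (\<exists>i\<in>I. v \<in> \<Lambda>' i \<and> (\<exists>y\<in>bdry (\<Lambda>' i). \<sigma>' i y \<and> joined (\<omega> \<inter> lattice_edges (\<Lambda>' i)) y v))
      \<or> ((\<forall>i\<in>I. v \<notin> \<Lambda>' i) \<and> \<sigma> v)" for v
  have step: "U b" if ab: "{a, b} \<in> \<omega>" and Ua: "U a" for a b
  proof (cases "\<exists>i\<in>I. {a, b} \<in> lattice_edges (\<Lambda>' i) \<and> (\<exists>y\<in>bdry (\<Lambda>' i). \<sigma>' i y \<and> joined (\<omega> \<inter> lattice_edges (\<Lambda>' i)) y a)")
    case True
    then obtain i y where i: "i \<in> I" "{a, b} \<in> lattice_edges (\<Lambda>' i)"
      and y: "y \<in> bdry (\<Lambda>' i)" "\<sigma>' i y" "joined (\<omega> \<inter> lattice_edges (\<Lambda>' i)) y a" by blast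
    have "joined (\<omega> \<inter> lattice_edges (\<Lambda>' i)) y b"
      using y(3) joined_trans[OF _ joined_edge] i(2) ab by blast
    moreover have "b \<in> \<Lambda>' i" using i(2) by (simp add: lattice_edges_doubleton)
    ultimately show ?thesis unfolding U_def using i(1) y(1,2) by blast
  next
    case out: False
    have L: "a \<in> \<Lambda>" "b \<in> \<Lambda>" "a \<sim>\<^sub>Z b" using ab w lattice_edges_doubleton[of a b \<Lambda>] by blast+
    have "\<tau> a \<and> (\<forall>i\<in>I. {a, b} \<notin> lattice_edges (\<Lambda>' i))"
    proof (cases "\<exists>i\<in>I. a \<in> \<Lambda>' i \<and> (\<exists>y\<in>bdry (\<Lambda>' i). \<sigma>' i y \<and> joined (\<omega> \<inter> lattice_edges (\<Lambda>' i)) y a)")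
      case True
      then obtain i y where i: "i \<in> I" "a \<in> \<Lambda>' i"
        and y: "y \<in> bdry (\<Lambda>' i)" "\<sigma>' i y" "joined (\<omega> \<inter> lattice_edges (\<Lambda>' i)) y a" by blast
      have b: "b \<notin> \<Lambda>' i" using out i y L by (auto simp: lattice_edges_doubleton)
      then have ab': "a \<in> bdry (\<Lambda>' i)" using i(2) L(3) adjacent_sym unfolding bdry_def by blast
      have "\<sigma>' i a" using tiles[OF i(1)] y ab' unfolding sep_def by blast
      then have ta: "\<tau> a" using tau_in i by blast
      show ?thesis
      proof (intro conjI ta ballI notI)
        fix k assume k: "k \<in> I" "{a, b} \<in> lattice_edges (\<Lambda>' k)"
        then have ak: "a \<in> \<Lambda>' k" "b \<in> \<Lambda>' k" by (auto simp: lattice_edges_doubleton)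
        show False using disj i k ak b by blast
      qed
    next
      case False
      then have "\<forall>i\<in>I. a \<notin> \<Lambda>' i" "\<sigma> a" using Ua unfolding U_def by blast+
      then show ?thesis using tau_out[OF L(1)] by (auto simp: lattice_edges_doubleton)
    qed
    moreover have "{a, b} \<in> lattice_edges \<Lambda>" using ab w by blast
    ultimately have tb: "\<tau> b" and nt: "\<forall>i\<in>I. {a, b} \<notin> lattice_edges (\<Lambda>' i)"
      using closed[of "{a, b}"] ab unfolding seam_def by blast+
    show ?thesis
    proof (cases "\<exists>i\<in>I. b \<in> \<Lambda>' i")
      case True
      then obtain i where i: "i \<in> I" "b \<in> \<Lambda>' i" by blast
      then have "a \<notin> \<Lambda>' i" using nt L by (auto simp: lattice_edges_doubleton)
      then have "b \<in> bdry (\<Lambda>' i)" using i(2) L(3) unfolding bdry_def by blast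
      moreover have "\<sigma>' i b" using tau_in i tb by blast
      ultimately show ?thesis unfolding U_def using i joined_refl by blast
    next
      case False
      then show ?thesis unfolding U_def using tau_out[OF L(2)] tb by blast
    qed
  qed
  show ?thesis unfolding sep_def
  proof (intro CollectI conjI w notI)
    assume "\<exists>y\<in>bdry \<Lambda>. \<exists>z\<in>bdry \<Lambda>. \<sigma> y \<and> \<not> \<sigma> z \<and> joined \<omega> y z"
    then obtain y z where yz: "y \<in> bdry \<Lambda>" "z \<in> bdry \<Lambda>" "\<sigma> y" "\<not> \<sigma> z" "joined \<omega> y z" by blast
    have "U y" using yz away unfolding U_def by blast
    then have "U z" using joined_invariant[of \<omega> y z U] yz(5) step by blast
    then show False using yz away unfolding U_def by blast
  qed
qed

text \<open>
  FKG for the disconnection of the tiles and the closing of the seam. Each tile can be considered with its own wired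
  measure by comparison of domains, and closing an edge costs at most \<open>\<beta>\<close>.
\<close>

lemma cost_tiles:
  assumes q: "1 \<le> q" and \<beta>: "0 \<le> \<beta>"
    and J: "\<And>e. e \<in> lattice_edges \<Lambda> \<Longrightarrow> 0 \<le> J e" "\<And>e. e \<in> lattice_edges \<Lambda> \<Longrightarrow> J e \<le> 1"
  shows "cost q (lattice_edges \<Lambda>) (sep \<Lambda> \<sigma>) \<beta> J
      \<le> (\<Sum>i\<in>I. cost q (lattice_edges (\<Lambda>' i)) (sep (\<Lambda>' i) (\<sigma>' i)) \<beta> J) + \<beta> * card (seam \<Lambda> I \<Lambda>' \<tau>)"
proof -
  let ?E = "lattice_edges \<Lambda>" and ?E' = "\<lambda>i. lattice_edges (\<Lambda>' i)"
  let ?S = "\<lambda>i. sep (\<Lambda>' i) (\<sigma>' i)" and ?F = "seam \<Lambda> I \<Lambda>' \<tau>"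
  let ?x = "odds \<beta> J"
  have reg: "rc_region q ?E" using q finite_region by (rule rc_region_lattice)
  have reg': "rc_region q (?E' i)" if "i \<in> I" for i
    using q finite_subset[OF sub[OF that] finite_region] by (rule rc_region_lattice)
  interpret rc_region q ?E by (rule reg)
  have F: "?F \<subseteq> ?E" by (auto simp: seam_def)
  have finF: "finite ?F" using F finE finite_subset by blast
  have x: "0 \<le> ?x e" if "e \<in> ?E" for e using that J \<beta> by (simp add: odds_nonneg)
  have x': "0 \<le> ?x e" if "i \<in> I" "e \<in> ?E' i" for e i
    using that lattice_edges_mono[OF sub[OF that(1)]] by (intro x) blast
  let ?A = "\<Inter>i\<in>I. {\<omega>. \<omega> \<inter> ?E' i \<in> ?S i}" and ?B = "\<Inter>e\<in>?F. {\<omega>. e \<notin> \<omega>}"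
  have decA: "decreasing ?E {\<omega>. \<omega> \<inter> ?E' i \<in> ?S i}" for i
    unfolding decreasing_def
  proof safe
    fix \<omega> \<eta> assume "\<omega> \<inter> ?E' i \<in> ?S i" "\<eta> \<subseteq> \<omega>"
    then show "\<eta> \<inter> ?E' i \<in> ?S i"
      using decreasingD[OF decreasing_sep, of "\<omega> \<inter> ?E' i" "\<Lambda>' i" "\<sigma>' i" "\<eta> \<inter> ?E' i"] by auto
  qed
  have pos: "0 < rc_pr q (?E' i) ?x (?S i)" if "i \<in> I" for i
    using rc_region.rc_pr_pos[OF reg'[OF that], of ?x "?S i"] x'[OF that] by auto
  have "(\<Prod>i\<in>I. rc_pr q (?E' i) ?x (?S i)) \<le> (\<Prod>i\<in>I. rc_pr q ?E ?x {\<omega>. \<omega> \<inter> ?E' i \<in> ?S i})"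
    using pos by (intro prod_mono conjI rc_pr_subregion[OF reg lattice_edges_mono[OF sub] x decreasing_sep]) (auto intro: less_imp_le)
  also have "\<dots> \<le> rc_pr q ?E ?x ?A" by (rule rc_pr_fkg_INT[OF x finite_tiles decA])
  finally have A: "(\<Prod>i\<in>I. rc_pr q (?E' i) ?x (?S i)) \<le> rc_pr q ?E ?x ?A" .
  have "exp (- \<beta>) ^ card ?F \<le> (\<Prod>e\<in>?F. rc_pr q ?E ?x {\<omega>. e \<notin> \<omega>})"
  proof -
    have "exp (- \<beta>) \<le> rc_pr q ?E ?x {\<omega>. e \<notin> \<omega>}" if "e \<in> ?F" for e
    proof -
      have e: "e \<in> ?E" using that F by blast
      have "\<beta> * J e \<le> \<beta>" using J[OF e] \<beta> by (simp add: mult_left_le)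
      then have "exp (- \<beta>) \<le> exp (- (\<beta> * J e))" by simp
      also have "\<dots> = 1 / (1 + ?x e)" by (simp add: odds_def exp_minus divide_simps)
      also have "\<dots> \<le> rc_pr q ?E ?x {\<omega>. e \<notin> \<omega>}" using rc_pr_closed[of ?x, OF x e] .
      finally show ?thesis .
    qed
    then have "(\<Prod>e\<in>?F. exp (- \<beta>)) \<le> (\<Prod>e\<in>?F. rc_pr q ?E ?x {\<omega>. e \<notin> \<omega>})"
      by (intro prod_mono) auto
    then show ?thesis by simp
  qed
  also have "\<dots> \<le> rc_pr q ?E ?x ?B" by (rule rc_pr_fkg_INT[OF x finF decreasing_closed])
  finally have B: "exp (- \<beta>) ^ card ?F \<le> rc_pr q ?E ?x ?B" .
  have "(\<Prod>i\<in>I. rc_pr q (?E' i) ?x (?S i)) * exp (- \<beta>) ^ card ?F \<le> rc_pr q ?E ?x ?A * rc_pr q ?E ?x ?B"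
    using A B by (intro mult_mono rc_pr_nonneg x) auto
  also have "\<dots> \<le> rc_pr q ?E ?x (?A \<inter> ?B)"
    by (intro rc_pr_fkg x decreasing_INT decA decreasing_closed)
  also have "\<dots> \<le> rc_pr q ?E ?x (sep \<Lambda> \<sigma>)"
    using sep_tiles by (intro rc_pr_mono x) auto
  finally have main: "(\<Prod>i\<in>I. rc_pr q (?E' i) ?x (?S i)) * exp (- \<beta>) ^ card ?F \<le> rc_pr q ?E ?x (sep \<Lambda> \<sigma>)" .
  have P: "0 < (\<Prod>i\<in>I. rc_pr q (?E' i) ?x (?S i))" using pos by (intro prod_pos) auto
  then have "0 < (\<Prod>i\<in>I. rc_pr q (?E' i) ?x (?S i)) * exp (- \<beta>) ^ card ?F" by simp
  then have "ln ((\<Prod>i\<in>I. rc_pr q (?E' i) ?x (?S i)) * exp (- \<beta>) ^ card ?F) \<le> ln (rc_pr q ?E ?x (sep \<Lambda> \<sigma>))"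
    using main by simp
  also have "ln ((\<Prod>i\<in>I. rc_pr q (?E' i) ?x (?S i)) * exp (- \<beta>) ^ card ?F)
      = (\<Sum>i\<in>I. ln (rc_pr q (?E' i) ?x (?S i))) - \<beta> * card ?F"
    using P pos finite_tiles by (simp add: ln_mult ln_prod ln_realpow less_imp_neq[symmetric])
  finally show ?thesis unfolding cost_def by (simp add: sum_negf)
qed

end

section \<open>Orthonormal frames, volumes and lattice points\<close>

definition frame :: "(nat \<Rightarrow> real ^ 'd::finite) \<Rightarrow> bool" where
  "frame u \<longleftrightarrow> (\<forall>i\<in>{1..CARD('d)}. \<forall>j\<in>{1..CARD('d)}. u i \<bullet> u j = (if i = j then 1 else 0))
     \<and> span (u ` {1..CARD('d)}) = UNIV"

definition base_cube :: "(nat \<Rightarrow> real ^ 'd::finite) \<Rightarrow> (real ^ 'd) set" where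
  "base_cube u = {(\<Sum>k\<in>{1..<CARD('d)}. t k *\<^sub>R u k) | t. \<forall>k\<in>{1..<CARD('d)}. t k \<in> {-1/2..1/2}}"

lemma unit_cubes_frame:
  "S \<in> unit_cubes n \<longleftrightarrow> (\<exists>u::nat \<Rightarrow> real ^ 'd::finite. frame u \<and> u CARD('d) = n \<and> S = base_cube u)"
  unfolding unit_cubes_def frame_def base_cube_def by blast

lemma card_pos: "0 < CARD('d::finite)" by simp

lemma norm_le_card:
  fixes v :: "real ^ 'd::finite"
  assumes "\<And>i. \<bar>v $ i\<bar> \<le> c"
  shows "norm v \<le> real CARD('d) * c"
proof -
  have "norm v \<le> (\<Sum>i\<in>UNIV. \<bar>v $ i\<bar>)" by (rule norm_le_l1_cart)
  also have "\<dots> \<le> real CARD('d) * c" using sum_bounded_above[of UNIV "\<lambda>i. \<bar>v $ i\<bar>" c] assms by simp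
  finally show ?thesis .
qed

locale frame_loc =
  fixes u :: "nat \<Rightarrow> real ^ 'd::finite"
  assumes fr: "frame u"
begin

lemma ortho: "i \<in> {1..CARD('d)} \<Longrightarrow> j \<in> {1..CARD('d)} \<Longrightarrow> u i \<bullet> u j = (if i = j then 1 else 0)"
  using fr by (simp add: frame_def)

lemma norm_u: "i \<in> {1..CARD('d)} \<Longrightarrow> norm (u i) = 1"
  by (simp add: norm_eq_sqrt_inner ortho)

lemma inner_le: "i \<in> {1..CARD('d)} \<Longrightarrow> \<bar>v \<bullet> u i\<bar> \<le> norm v"
  using Cauchy_Schwarz_ineq2[of v "u i"] by (simp add: norm_u)

lemma expand: "(\<Sum>k\<in>{1..CARD('d)}. (v \<bullet> u k) *\<^sub>R u k) = v"
proof -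
  have inj: "inj_on u {1..CARD('d)}"
  proof (rule inj_onI)
    fix i j assume "i \<in> {1..CARD('d)}" "j \<in> {1..CARD('d)}" "u i = u j"
    then show "i = j" using ortho[of i j] ortho[of j j] by (auto split: if_splits)
  qed
  have "(\<Sum>b\<in>u ` {1..CARD('d)}. (v \<bullet> b) *\<^sub>R b) = v"
  proof (rule orthonormal_basis_expand)
    show "pairwise orthogonal (u ` {1..CARD('d)})"
      unfolding pairwise_def orthogonal_def using ortho by fastforce
    show "v \<in> span (u ` {1..CARD('d)})" using fr by (simp add: frame_def)
  qed (auto simp: norm_u)
  then show ?thesis unfolding sum.reindex[OF inj] by (simp add: o_def)
qed

lemma inner_sum: "j \<in> {1..CARD('d)} \<Longrightarrow> (\<Sum>k\<in>{1..CARD('d)}. c k *\<^sub>R u k) \<bullet> u j = c j"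
proof -
  assume j: "j \<in> {1..CARD('d)}"
  have "(\<Sum>k\<in>{1..CARD('d)}. c k *\<^sub>R u k) \<bullet> u j = (\<Sum>k\<in>{1..CARD('d)}. if k = j then c k else 0)"
    unfolding inner_sum_left using j by (intro sum.cong refl) (simp add: ortho)
  then show ?thesis using j by simp
qed

lemma inner_sum': "j \<in> {1..CARD('d)} \<Longrightarrow> K \<subseteq> {1..CARD('d)} \<Longrightarrow>
   (\<Sum>k\<in>K. c k *\<^sub>R u k) \<bullet> u j = (if j \<in> K then c j else 0)"
proof -
  assume j: "j \<in> {1..CARD('d)}" and K: "K \<subseteq> {1..CARD('d)}"
  have "(\<Sum>k\<in>K. c k *\<^sub>R u k) = (\<Sum>k\<in>{1..CARD('d)}. (if k \<in> K then c k else 0) *\<^sub>R u k)"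
    using K by (intro sum.mono_neutral_cong_left) auto
  then show ?thesis using inner_sum[OF j, of "\<lambda>k. if k \<in> K then c k else 0"] by simp
qed

lemma norm_le_coords:
  assumes "\<And>k. k \<in> {1..CARD('d)} \<Longrightarrow> \<bar>v \<bullet> u k\<bar> \<le> c"
  shows "norm v \<le> real CARD('d) * c"
proof -
  have "norm v = norm (\<Sum>k\<in>{1..CARD('d)}. (v \<bullet> u k) *\<^sub>R u k)" by (simp only: expand)
  also have "\<dots> \<le> (\<Sum>k\<in>{1..CARD('d)}. c)"
    by (intro order_trans[OF norm_sum] sum_mono) (use assms norm_u in auto)
  finally show ?thesis by simp
qed

end

definition fbox :: "(nat \<Rightarrow> real ^ 'd::finite) \<Rightarrow> real ^ 'd \<Rightarrow> (nat \<Rightarrow> real) \<Rightarrow> (real ^ 'd) set" where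
  "fbox u x a = {y. \<forall>k\<in>{1..CARD('d)}. \<bar>(y - x) \<bullet> u k\<bar> < a k}"

text \<open>
  Fill \<open>S\<close> by disjoint balls up to a null set (Vitali); an orthogonal map preserves the volume of each ball.
\<close>

lemma orthogonal_image_volume_le:
  fixes f :: "real ^ 'd::finite \<Rightarrow> real ^ 'd"
  assumes f: "orthogonal_transformation f" and S: "open S"
  shows "emeasure lebesgue S \<le> emeasure lebesgue (f ` S)"
proof -
  let ?K = "{(x, r). 0 < r \<and> cball x r \<subseteq> S}"
  have op: "open (f ` S)"
    using S f open_surjective_linear_image orthogonal_transformation_linear orthogonal_transformation_surj by blast
  obtain C where C: "countable C" "C \<subseteq> ?K"
    "pairwise (\<lambda>i j. disjnt (cball (fst i) (snd i)) (cball (fst j) (snd j))) C"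
    "negligible (S - (\<Union>i\<in>C. cball (fst i) (snd i)))"
  proof (rule Vitali_covering_theorem_cballs[of ?K snd S fst])
    fix x d assume x: "x \<in> S" "0 < (d::real)"
    then obtain e where e: "0 < e" "cball x e \<subseteq> S" using S open_contains_cball by metis
    have "cball x (min e (d/2)) \<subseteq> S" using e by (meson order_trans subset_cball min.cobounded1)
    then show "\<exists>i. i \<in> ?K \<and> x \<in> cball (fst i) (snd i) \<and> snd i < d"
      using e(1) x by (intro exI[of _ "(x, min e (d/2))"]) simp
  next
    show "0 < snd i" if "i \<in> ?K" for i using that by (simp add: case_prod_beta)
  qed (rule that)
  let ?U = "\<Union>i\<in>C. cball (fst i) (snd i)"
  have US: "?U \<subseteq> S" using C(2) by fastforce
  have disj: "disjoint_family_on (\<lambda>i. cball (fst i) (snd i)) C"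
    using C(3) by (auto simp: pairwise_def disjoint_family_on_def disjnt_def)
  have fcb: "f ` cball x r = cball (f x) r" for x r using f by (rule image_orthogonal_transformation_cball)
  have inj: "inj f" using f by (rule orthogonal_transformation_inj)
  have disj': "disjoint_family_on (\<lambda>i. cball (f (fst i)) (snd i)) C"
    using disj unfolding disjoint_family_on_def fcb[symmetric] image_Int[OF inj, symmetric] by blast
  have r: "0 \<le> snd i" if "i \<in> C" for i using that C(2) by force
  have "emeasure lebesgue S = emeasure lebesgue (S - (S - ?U))"
  proof -
    have "S - ?U \<in> null_sets lebesgue" using C(4) by (simp add: negligible_iff_null_sets)
    then show ?thesis using S by (intro emeasure_Diff_null_set[symmetric]) auto
  qed
  also have "S - (S - ?U) = ?U" using US by auto
  also have "emeasure lebesgue ?U = (\<integral>\<^sup>+i. emeasure lebesgue (cball (fst i) (snd i)) \<partial>count_space C)"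
    by (rule emeasure_UN_countable[OF _ C(1) disj]) auto
  also have "\<dots> = (\<integral>\<^sup>+i. emeasure lebesgue (cball (f (fst i)) (snd i)) \<partial>count_space C)"
    using r by (intro nn_integral_cong) (simp add: emeasure_cball)
  also have "\<dots> = emeasure lebesgue (\<Union>i\<in>C. cball (f (fst i)) (snd i))"
    by (rule emeasure_UN_countable[OF _ C(1) disj', symmetric]) auto
  also have "\<dots> \<le> emeasure lebesgue (f ` S)"
  proof (rule emeasure_mono)
    have "(\<Union>i\<in>C. cball (f (fst i)) (snd i)) = f ` ?U" by (auto simp: fcb[symmetric])
    then show "(\<Union>i\<in>C. cball (f (fst i)) (snd i)) \<subseteq> f ` S" using US by blast
    show "f ` S \<in> sets lebesgue" using op by auto
  qed
  finally show ?thesis .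
qed

lemma orthogonal_image_volume:
  fixes f :: "real ^ 'd::finite \<Rightarrow> real ^ 'd"
  assumes f: "orthogonal_transformation f" and S: "open S" "bounded S"
  shows "f ` S \<in> lmeasurable" "measure lebesgue (f ` S) = measure lebesgue S"
proof -
  have op: "open (f ` S)"
    using S f open_surjective_linear_image orthogonal_transformation_linear orthogonal_transformation_surj by blast
  have bd: "bounded (f ` S)"
    using S(2) f by (intro bounded_linear_image) (auto intro: linear_linear[THEN iffD2] orthogonal_transformation_linear)
  show "f ` S \<in> lmeasurable" using op bd by (rule lmeasurable_open[rotated])
  obtain g where g: "orthogonal_transformation g" "\<And>x. g (f x) = x"
    using orthogonal_transformation_inv[OF f] orthogonal_transformation_inj[OF f] by (metis inv_f_f)
  have "g ` f ` S = S" using g by (auto simp: image_iff)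
  then have "emeasure lebesgue (f ` S) \<le> emeasure lebesgue S"
    using orthogonal_image_volume_le[OF g(1) op] by simp
  then have "emeasure lebesgue (f ` S) = emeasure lebesgue S"
    using orthogonal_image_volume_le[OF f S(1)] by (rule antisym)
  then show "measure lebesgue (f ` S) = measure lebesgue S" by (simp add: measure_def)
qed

lemma measure_lebesgue_box_cart:
  fixes a b :: "real ^ 'd::finite"
  assumes "\<And>i. a $ i \<le> b $ i"
  shows "box a b \<in> lmeasurable" "measure lebesgue (box a b) = (\<Prod>i\<in>UNIV. b $ i - a $ i)"
proof -
  show "box a b \<in> lmeasurable" by (intro lmeasurable_open bounded_box open_box)
  have ne: "cbox a b \<noteq> {}" using assms by (simp add: interval_ne_empty_cart)
  have "measure lebesgue (box a b) = measure lborel (box a b)" by (simp add: measure_completion)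
  also have "\<dots> = measure lborel (cbox a b)" by (simp add: measure_lborel_box_eq measure_lborel_cbox_eq)
  also have "\<dots> = (\<Prod>i\<in>UNIV. b $ i - a $ i)" by (rule content_cbox_cart[OF ne])
  finally show "measure lebesgue (box a b) = (\<Prod>i\<in>UNIV. b $ i - a $ i)" .
qed

context frame_loc
begin

lemma fbox_volume:
  assumes a: "\<And>k. k \<in> {1..CARD('d)} \<Longrightarrow> 0 \<le> a k"
  shows "fbox u x a \<in> lmeasurable" "measure lebesgue (fbox u x a) = (\<Prod>k\<in>{1..CARD('d)}. 2 * a k)"
proof -
  have "card {1..CARD('d)} = card (UNIV :: 'd set)" by simp
  then obtain h where h: "bij_betw h {1..CARD('d)} (UNIV :: 'd set)"
    by (metis finite_same_card_bij finite_atLeastAtMost finite)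
  define g where "g = inv_into {1..CARD('d)} h"
  have g: "g i \<in> {1..CARD('d)}" "h (g i) = i" for i
    using h inv_into_into[of i h "{1..CARD('d)}"] f_inv_into_f[of i h "{1..CARD('d)}"]
    unfolding g_def bij_betw_def by auto
  have gh: "g (h k) = k" if "k \<in> {1..CARD('d)}" for k
    using h that unfolding g_def by (auto simp: bij_betw_def inv_into_f_f)
  define f where "f v = (\<Sum>k\<in>{1..CARD('d)}. (v $ h k) *\<^sub>R u k)" for v :: "real ^ 'd"
  have fu: "f v \<bullet> u k = v $ h k" if "k \<in> {1..CARD('d)}" for v k
    unfolding f_def using that by (rule inner_sum)
  have lin: "linear f"
    unfolding f_def by (intro linearI) (simp_all add: sum.distrib scaleR_add_left scaleR_sum_right)
  have "f v \<bullet> f w = v \<bullet> w" for v w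
  proof -
    have "f v \<bullet> f w = (\<Sum>k\<in>{1..CARD('d)}. v $ h k * w $ h k)"
      by (subst (2) f_def) (auto simp: inner_sum_right fu mult.commute intro!: sum.cong)
    also have "\<dots> = (\<Sum>i\<in>UNIV. v $ i * w $ i)" by (rule sum.reindex_bij_betw[OF h])
    finally show ?thesis by (simp add: inner_vec_def)
  qed
  then have orth: "orthogonal_transformation f" using lin by (simp add: orthogonal_transformation_def)
  define b where "b = (\<chi> i. a (g i))"
  have eq: "fbox u x a = (+) x ` f ` box (- b) b"
  proof (intro equalityI subsetI)
    fix y assume y: "y \<in> fbox u x a"
    define v where "v = (\<chi> i. (y - x) \<bullet> u (g i))"
    have "f v = (\<Sum>k\<in>{1..CARD('d)}. ((y - x) \<bullet> u k) *\<^sub>R u k)"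
      unfolding f_def v_def by (intro sum.cong) (auto simp: gh)
    then have "f v = y - x" by (simp only: expand)
    moreover have "v \<in> box (- b) b"
    proof -
      have "\<bar>(y - x) \<bullet> u (g i)\<bar> < a (g i)" for i using y g(1)[of i] unfolding fbox_def by blast
      then show ?thesis by (auto simp: mem_box_cart v_def b_def abs_less_iff) (smt (verit))
    qed
    ultimately show "y \<in> (+) x ` f ` box (- b) b" by (force intro: image_eqI[of _ _ "f v"])
  next
    fix y assume "y \<in> (+) x ` f ` box (- b) b"
    then obtain v where v: "v \<in> box (- b) b" "y = x + f v" by blast
    have "\<bar>v $ i\<bar> < a (g i)" for i using v(1) by (auto simp: mem_box_cart b_def abs_less_iff) (smt (verit))
    then show "y \<in> fbox u x a" unfolding fbox_def v(2) using gh by (auto simp: fu) (metis abs_less_iff)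
  qed
  have bb: "(- b) $ i \<le> b $ i" for i using a[OF g(1)[of i]] by (simp add: b_def)
  note m = measure_lebesgue_box_cart[OF bb]
  show "fbox u x a \<in> lmeasurable"
    unfolding eq by (intro measurable_translation orthogonal_image_volume orth bounded_box open_box)
  have "measure lebesgue (fbox u x a) = (\<Prod>i\<in>UNIV. b $ i - (- b) $ i)"
    unfolding eq measure_translation using orthogonal_image_volume(2)[OF orth open_box bounded_box] m(2) by simp
  also have "\<dots> = (\<Prod>i\<in>UNIV. 2 * a (g i))" by (simp add: b_def)
  also have "\<dots> = (\<Prod>k\<in>{1..CARD('d)}. 2 * a (g (h k)))" by (rule prod.reindex_bij_betw[OF h, symmetric])
  also have "\<dots> = (\<Prod>k\<in>{1..CARD('d)}. 2 * a k)" by (intro prod.cong) (auto simp: gh)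
  finally show "measure lebesgue (fbox u x a) = (\<Prod>k\<in>{1..CARD('d)}. 2 * a k)" .
qed

end

lemma packing:
  fixes c :: real and G :: "(real ^ 'd::finite) set"
  assumes A: "\<And>i. i \<in> I \<Longrightarrow> A i \<in> lmeasurable" "\<And>i. i \<in> I \<Longrightarrow> measure lebesgue (A i) = c" "\<And>i. i \<in> I \<Longrightarrow> A i \<subseteq> G"
    and disj: "disjoint_family_on A I" and G: "G \<in> lmeasurable" and c: "0 < c"
  shows "finite I" "card I * c \<le> measure lebesgue G"
proof -
  have *: "card K * c \<le> measure lebesgue G" if K: "K \<subseteq> I" "finite K" for K
  proof -
    have "measure lebesgue (\<Union>i\<in>K. A i) = (\<Sum>i\<in>K. measure lebesgue (A i))"
      using K A disj unfolding disjoint_family_on_def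
      by (intro measure_UNION') (auto simp: pairwise_def disjnt_def subset_iff)
    also have "\<dots> = card K * c" using K A by (simp add: subset_eq)
    finally have "card K * c = measure lebesgue (\<Union>i\<in>K. A i)" by simp
    also have "\<dots> \<le> measure lebesgue G"
    proof (rule measure_mono_fmeasurable[OF _ _ G])
      show "(\<Union>i\<in>K. A i) \<subseteq> G" using K A(3) by blast
      show "(\<Union>i\<in>K. A i) \<in> sets lebesgue" using K A(1) by (intro sets.finite_UN) (auto intro: fmeasurableD)
    qed
    finally show ?thesis .
  qed
  have "card K \<le> nat \<lceil>measure lebesgue G / c\<rceil>" if "K \<subseteq> I" "finite K" for K
  proof -
    have "real (card K) \<le> measure lebesgue G / c" using *[OF that] c by (simp add: field_simps)
    then show ?thesis by linarith
  qed
  then show "finite I" using finite_if_finite_subsets_card_bdd by blast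
  then show "card I * c \<le> measure lebesgue G" using * by blast
qed

definition lattice_cell :: "int ^ 'd::finite \<Rightarrow> (real ^ 'd) set" where
  "lattice_cell v = box (\<chi> i. of_int (v $ i) - 1/2) (\<chi> i. of_int (v $ i) + 1/2)"

lemma lattice_cell_dist:
  fixes v :: "int ^ 'd::finite"
  assumes "p \<in> lattice_cell v" shows "norm (p - emb v) \<le> real CARD('d) / 2"
proof -
  have "\<bar>(p - emb v) $ i\<bar> \<le> 1/2" for i
    using assms unfolding lattice_cell_def by (auto simp: mem_box_cart emb_def abs_le_iff) (smt (verit) field_sum_of_halves)+
  then show ?thesis using norm_le_card[of "p - emb v" "1/2"] by simp
qed

lemma lattice_points_le_volume:
  fixes V :: "(int ^ 'd::finite) set"
  assumes "\<And>v. v \<in> V \<Longrightarrow> lattice_cell v \<subseteq> G" "G \<in> lmeasurable"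
  shows "finite V" "card V \<le> measure lebesgue G"
proof -
  have m: "lattice_cell v \<in> lmeasurable \<and> measure lebesgue (lattice_cell v) = 1" for v :: "int ^ 'd"
    unfolding lattice_cell_def using measure_lebesgue_box_cart[of "\<chi> i. of_int (v $ i) - 1/2" "\<chi> i. of_int (v $ i) + 1/2"] by simp
  have d: "disjoint_family_on lattice_cell V"
    unfolding disjoint_family_on_def
  proof (intro ballI impI equals0I)
    fix v w :: "int ^ 'd" and p assume "v \<noteq> w" "p \<in> lattice_cell v \<inter> lattice_cell w"
    then have p: "of_int (v $ i) - 1/2 < p $ i" "p $ i < of_int (v $ i) + 1/2"
      "of_int (w $ i) - 1/2 < p $ i" "p $ i < of_int (w $ i) + 1/2" for i
      unfolding lattice_cell_def by (auto simp: mem_box_cart)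
    have "v $ i = w $ i" for i using p[of i] by linarith
    then show False using \<open>v \<noteq> w\<close> by (simp add: vec_eq_iff)
  qed
  show "finite V" "card V \<le> measure lebesgue G"
    using packing[of V lattice_cell 1 G] assms m d by auto
qed

lemma adjacent_inner:
  assumes "v \<sim>\<^sub>Z w" "norm u = 1" shows "\<bar>emb v \<bullet> u - emb w \<bullet> u\<bar> \<le> 1"
  using Cauchy_Schwarz_ineq2[of "emb v - emb w" u] assms by (simp add: adjacent_def inner_diff_left)

lemma finite_card_neighbours:
  fixes v :: "int ^ 'd::finite"
  shows "finite {w. v \<sim>\<^sub>Z w}" "card {w. v \<sim>\<^sub>Z w} \<le> (3::real) ^ CARD('d)"
proof -
  let ?G = "box (emb v - (\<chi> i. 3/2)) (emb v + (\<chi> i. 3/2))"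
  have "lattice_cell w \<subseteq> ?G" if "v \<sim>\<^sub>Z w" for w
  proof
    fix p assume p: "p \<in> lattice_cell w"
    have "\<bar>(emb v - emb w) $ i\<bar> \<le> 1" for i
      using component_le_norm_cart[of "emb v - emb w" i] that by (simp add: adjacent_def)
    then show "p \<in> ?G" using p unfolding lattice_cell_def
      by (auto simp: mem_box_cart emb_def abs_le_iff) (smt (verit) field_sum_of_halves)+
  qed
  note l = lattice_points_le_volume[of "{w. v \<sim>\<^sub>Z w}" ?G]
  have m: "?G \<in> lmeasurable" "measure lebesgue ?G = 3 ^ CARD('d)"
    using measure_lebesgue_box_cart[of "emb v - (\<chi> i. 3/2)" "emb v + (\<chi> i. 3/2)"] by auto
  show "finite {w. v \<sim>\<^sub>Z w}" "card {w. v \<sim>\<^sub>Z w} \<le> (3::real) ^ CARD('d)"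
    using l m \<open>\<And>w. v \<sim>\<^sub>Z w \<Longrightarrow> lattice_cell w \<subseteq> ?G\<close> by auto
qed

text \<open>
  Edges are counted by volume: lattice cells are disjoint and of volume \<open>1\<close>, and a vertex has at most \<open>3 ^ d\<close> neighbours.
\<close>

lemma edges_le_volume:
  fixes F :: "('d::finite) edge set"
  assumes F: "F \<subseteq> wired" and v: "\<And>e. e \<in> F \<Longrightarrow> \<exists>v\<in>e. lattice_cell v \<subseteq> G" and G: "G \<in> lmeasurable"
  shows "card F \<le> 3 ^ CARD('d) * measure lebesgue G"
proof -
  define V where "V = {v. lattice_cell v \<subseteq> G}"
  have V: "finite V" "card V \<le> measure lebesgue G"
    using lattice_points_le_volume[of V G] G by (auto simp: V_def)
  have "F \<subseteq> (\<Union>v\<in>V. (\<lambda>w. {v, w}) ` {w. v \<sim>\<^sub>Z w})"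
  proof
    fix e assume e: "e \<in> F"
    then obtain v where "v \<in> e" "v \<in> V" using assms unfolding V_def by blast
    moreover obtain x y where "e = {x, y}" "x \<sim>\<^sub>Z y" using e F by (auto simp: wired_def lattice_edges_def)
    ultimately show "e \<in> (\<Union>v\<in>V. (\<lambda>w. {v, w}) ` {w. v \<sim>\<^sub>Z w})"
      using adjacent_sym[of x y] by (auto simp: insert_commute)
  qed
  then have "card F \<le> card (\<Union>v\<in>V. (\<lambda>w. {v, w}) ` {w. v \<sim>\<^sub>Z w})"
    using V finite_card_neighbours(1) by (intro card_mono) auto
  also have "\<dots> \<le> (\<Sum>v\<in>V. card ((\<lambda>w. {v, w}) ` {w. v \<sim>\<^sub>Z w}))" by (rule card_UN_le[OF V(1)])
  also have "\<dots> \<le> (\<Sum>v\<in>V. card {w. v \<sim>\<^sub>Z w})" by (intro sum_mono card_image_le finite_card_neighbours)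
  finally have "real (card F) \<le> (\<Sum>v\<in>V. real (card {w. v \<sim>\<^sub>Z w}))" by (simp flip: of_nat_sum)
  also have "\<dots> \<le> (\<Sum>v\<in>V. 3 ^ CARD('d))" by (intro sum_mono finite_card_neighbours(2))
  also have "\<dots> \<le> 3 ^ CARD('d) * measure lebesgue G" using V by simp
  finally show ?thesis .
qed

section \<open>Rectangles and their tilings\<close>

definition region :: "(nat \<Rightarrow> real ^ 'd::finite) \<Rightarrow> real \<Rightarrow> real \<Rightarrow> int ^ 'd \<Rightarrow> (int ^ 'd) set" where
  "region u L h z = hat (rect (emb z) L h (base_cube u) (u CARD('d)))"

definition above :: "(nat \<Rightarrow> real ^ 'd::finite) \<Rightarrow> int ^ 'd \<Rightarrow> int ^ 'd \<Rightarrow> bool" where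
  "above u z v \<longleftrightarrow> (emb v - emb z) \<bullet> u CARD('d) \<ge> 0"

definition rect_cost ::
  "real \<Rightarrow> real \<Rightarrow> (nat \<Rightarrow> real ^ 'd::finite) \<Rightarrow> real \<Rightarrow> real \<Rightarrow> int ^ 'd \<Rightarrow> ('d edge \<Rightarrow> real) \<Rightarrow> real" where
  "rect_cost q \<beta> u L h z J = cost q (lattice_edges (region u L h z)) (sep (region u L h z) (above u z)) \<beta> J"

lemma emb_diff: "emb (v - z) = emb v - emb z"
  by (simp add: emb_def vec_eq_iff)

lemma emb_0 [simp]: "emb 0 = 0"
  by (simp add: emb_def vec_eq_iff)

text \<open>
  The open rectangle with centre \<open>x\<close>, tangential half-side \<open>r\<close> and half-height \<open>h\<close>.
\<close>

definition slab :: "(nat \<Rightarrow> real ^ 'd::finite) \<Rightarrow> real ^ 'd \<Rightarrow> real \<Rightarrow> real \<Rightarrow> (real ^ 'd) set" where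
  "slab u x r h = fbox u x (\<lambda>k. if k = CARD('d) then h else r)"

lemma slab_iff:
  "y \<in> slab (u :: nat \<Rightarrow> real ^ 'd::finite) x r h \<longleftrightarrow>
     (\<forall>k\<in>{1..<CARD('d)}. \<bar>(y - x) \<bullet> u k\<bar> < r) \<and> \<bar>(y - x) \<bullet> u CARD('d)\<bar> < h"
proof -
  have "{1..CARD('d)} = insert CARD('d) {1..<CARD('d)}" using card_pos[where 'd='d] by auto
  then show ?thesis unfolding slab_def fbox_def by auto
qed

context frame_loc
begin

lemma slab_volume:
  assumes "0 \<le> r" "0 \<le> h"
  shows "slab u x r h \<in> lmeasurable" "measure lebesgue (slab u x r h) = (2 * r) ^ (CARD('d) - 1) * (2 * h)"
proof -
  have e: "{1..CARD('d)} = insert CARD('d) {1..<CARD('d)}" using card_pos[where 'd='d] by auto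
  show "slab u x r h \<in> lmeasurable" unfolding slab_def using assms by (intro fbox_volume) auto
  have "measure lebesgue (slab u x r h) = (\<Prod>k\<in>{1..CARD('d)}. 2 * (if k = CARD('d) then h else r))"
    unfolding slab_def using assms by (intro fbox_volume) auto
  also have "\<dots> = 2 * h * (\<Prod>k\<in>{1..<CARD('d)}. 2 * r)"
    unfolding e by (subst prod.insert) (auto intro!: prod.cong)
  finally show "measure lebesgue (slab u x r h) = (2 * r) ^ (CARD('d) - 1) * (2 * h)" by (simp add: mult_ac)
qed

lemma rect_eq:
  assumes L: "0 < L" and h: "0 < h"
  shows "rect x L h (base_cube u) (u CARD('d)) =
    {y. (\<forall>k\<in>{1..<CARD('d)}. \<bar>(y - x) \<bullet> u k\<bar> \<le> L / 2) \<and> \<bar>(y - x) \<bullet> u CARD('d)\<bar> \<le> h}"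
    (is "_ = ?R")
proof (intro equalityI subsetI)
  let ?I = "{1..<CARD('d)}"
  have I: "?I \<subseteq> {1..CARD('d)}" "CARD('d) \<in> {1..CARD('d)}" "CARD('d) \<notin> ?I" using card_pos[where 'd='d] by auto
  fix y assume "y \<in> rect x L h (base_cube u) (u CARD('d))"
  then obtain t s where t: "\<And>k. k \<in> ?I \<Longrightarrow> t k \<in> {-1/2..1/2}" and s: "s \<in> {-h..h}"
    and y: "y = x + L *\<^sub>R (\<Sum>k\<in>?I. t k *\<^sub>R u k) + s *\<^sub>R u CARD('d)"
    unfolding rect_def base_cube_def by blast
  have yx: "y - x = L *\<^sub>R (\<Sum>k\<in>?I. t k *\<^sub>R u k) + s *\<^sub>R u CARD('d)" using y by simp
  have 1: "(y - x) \<bullet> u k = L * t k" if "k \<in> ?I" for k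
    unfolding yx using that I(1) inner_sum'[of k ?I t] ortho[of "CARD('d)" k]
    by (auto simp: inner_add_left)
  have 2: "(y - x) \<bullet> u CARD('d) = s"
    unfolding yx using I inner_sum'[of "CARD('d)" ?I t] ortho[of "CARD('d)" "CARD('d)"]
    by (auto simp: inner_add_left)
  have "\<bar>L * t k\<bar> \<le> L / 2" if "k \<in> ?I" for k
  proof -
    have "\<bar>t k\<bar> \<le> 1/2" using t[OF that] by auto
    then have "L * \<bar>t k\<bar> \<le> L * (1/2)" using L by (intro mult_left_mono) auto
    then show ?thesis using L by (simp add: abs_mult)
  qed
  then show "y \<in> ?R" using 1 2 s by auto
next
  let ?I = "{1..<CARD('d)}"
  fix y assume y: "y \<in> ?R"
  have e: "{1..CARD('d)} = insert CARD('d) ?I" using card_pos[where 'd='d] by auto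
  have "y - x = (\<Sum>k\<in>{1..CARD('d)}. ((y - x) \<bullet> u k) *\<^sub>R u k)" by (rule expand[symmetric])
  also have "\<dots> = (\<Sum>k\<in>?I. ((y - x) \<bullet> u k) *\<^sub>R u k) + ((y - x) \<bullet> u CARD('d)) *\<^sub>R u CARD('d)"
    unfolding e by (subst sum.insert) auto
  also have "(\<Sum>k\<in>?I. ((y - x) \<bullet> u k) *\<^sub>R u k) = L *\<^sub>R (\<Sum>k\<in>?I. (((y - x) \<bullet> u k) / L) *\<^sub>R u k)"
    using L by (simp add: scaleR_sum_right)
  finally have "y = x + L *\<^sub>R (\<Sum>k\<in>?I. (((y - x) \<bullet> u k) / L) *\<^sub>R u k) + ((y - x) \<bullet> u CARD('d)) *\<^sub>R u CARD('d)"
    by (simp add: algebra_simps)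
  moreover have "(y - x) \<bullet> u CARD('d) \<in> {-h..h}" using y by (auto simp: abs_le_iff)
  moreover have "((y - x) \<bullet> u k) / L \<in> {-1/2..1/2}" if "k \<in> ?I" for k
  proof -
    have "\<bar>(y - x) \<bullet> u k\<bar> \<le> L / 2" using y that by blast
    then show ?thesis using L by (auto simp: abs_le_iff field_simps)
  qed
  then have "(\<Sum>k\<in>?I. (((y - x) \<bullet> u k) / L) *\<^sub>R u k) \<in> base_cube u"
    unfolding base_cube_def by (intro CollectI exI[of _ "\<lambda>k. ((y - x) \<bullet> u k) / L"]) auto
  ultimately show "y \<in> rect x L h (base_cube u) (u CARD('d))" unfolding rect_def by blast
qed

lemma interior_rect:
  assumes L: "0 < L" and h: "0 < h"
  shows "interior (rect x L h (base_cube u) (u CARD('d))) = slab u x (L / 2) h"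
    (is "interior ?R = _")
proof (intro equalityI subsetI)
  fix y assume "y \<in> interior ?R"
  then obtain e where e: "0 < e" "cball y e \<subseteq> ?R" by (meson mem_interior_cball)
  have I: "{1..<CARD('d)} \<subseteq> {1..CARD('d)}" "CARD('d) \<in> {1..CARD('d)}" using card_pos[where 'd='d] by auto
  have *: "\<bar>(y - x) \<bullet> u k\<bar> + e \<le> c"
    if k: "k \<in> {1..CARD('d)}" and c: "\<And>p. p \<in> ?R \<Longrightarrow> \<bar>(p - x) \<bullet> u k\<bar> \<le> c" for k c
  proof -
    have "y + e *\<^sub>R u k \<in> ?R" "y - e *\<^sub>R u k \<in> ?R"
      using e norm_u[OF k] by (auto simp: subset_iff dist_norm)
    from c[OF this(1)] c[OF this(2)] ortho[OF k k] show ?thesis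
      by (simp add: inner_add_left inner_diff_left)
  qed
  have "\<bar>(y - x) \<bullet> u k\<bar> + e \<le> L / 2" if "k \<in> {1..<CARD('d)}" for k
    using that I by (intro *) (auto simp: rect_eq[OF L h])
  moreover have "\<bar>(y - x) \<bullet> u CARD('d)\<bar> + e \<le> h"
    using I by (intro *) (auto simp: rect_eq[OF L h])
  ultimately show "y \<in> slab u x (L / 2) h" unfolding slab_iff using e(1) by (smt (verit))
next
  fix y assume y: "y \<in> slab u x (L / 2) h"
  have "open (slab u x (L / 2) h)"
    unfolding slab_def fbox_def Collect_ball_eq
    by (intro open_INT finite_atLeastAtMost ballI open_Collect_less continuous_intros)
  moreover have "slab u x (L / 2) h \<subseteq> ?R" unfolding rect_eq[OF L h] by (auto simp: slab_iff less_imp_le)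
  ultimately show "y \<in> interior ?R" using y by (meson interiorI)
qed

lemma region_iff:
  assumes "0 < L" "0 < h"
  shows "v \<in> region u L h z \<longleftrightarrow> emb v \<in> slab u (emb z) (L / 2) h"
  unfolding region_def hat_def using interior_rect[OF assms] by simp

lemma cell_coord:
  assumes "p \<in> lattice_cell v" "k \<in> {1..CARD('d)}"
  shows "\<bar>(p - x) \<bullet> u k - (emb v - x) \<bullet> u k\<bar> \<le> real CARD('d) / 2"
proof -
  have "(p - x) \<bullet> u k - (emb v - x) \<bullet> u k = (p - emb v) \<bullet> u k" by (simp add: inner_diff_left)
  then show ?thesis using inner_le[OF assms(2), of "p - emb v"] lattice_cell_dist[OF assms(1)] by linarith
qed

lemma cell_in_slab:
  assumes "emb v \<in> slab u x r h"
  shows "lattice_cell v \<subseteq> slab u x (r + real CARD('d)) (h + real CARD('d))"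
proof
  fix p assume p: "p \<in> lattice_cell v"
  have I: "{1..<CARD('d)} \<subseteq> {1..CARD('d)}" "CARD('d) \<in> {1..CARD('d)}" using card_pos[where 'd='d] by auto
  have D: "0 < real CARD('d)" by simp
  show "p \<in> slab u x (r + real CARD('d)) (h + real CARD('d))"
    unfolding slab_iff
  proof (intro conjI ballI)
    show "\<bar>(p - x) \<bullet> u k\<bar> < r + real CARD('d)" if "k \<in> {1..<CARD('d)}" for k
    proof -
      have "\<bar>(emb v - x) \<bullet> u k\<bar> < r" using assms that unfolding slab_iff by blast
      then show ?thesis using cell_coord[OF p, of k x] that I D by (smt (verit) field_sum_of_halves subsetD)
    qed
    have "\<bar>(emb v - x) \<bullet> u CARD('d)\<bar> < h" using assms unfolding slab_iff by blast
    then show "\<bar>(p - x) \<bullet> u CARD('d)\<bar> < h + real CARD('d)"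
      using cell_coord[OF p I(2), of x] D by (smt (verit) field_sum_of_halves)
  qed
qed

lemma finite_region:
  assumes "0 < L" "0 < h" shows "finite (region u L h z)"
proof (rule lattice_points_le_volume(1))
  show "lattice_cell v \<subseteq> slab u (emb z) (L / 2 + real CARD('d)) (h + real CARD('d))" if "v \<in> region u L h z" for v
    using that assms by (intro cell_in_slab) (simp add: region_iff)
  show "slab u (emb z) (L / 2 + real CARD('d)) (h + real CARD('d)) \<in> lmeasurable"
    using assms by (intro slab_volume) auto
qed

end

lemma surf_tension_eq:
  fixes u :: "nat \<Rightarrow> real ^ 'd::finite"
  assumes "frame u" "1 \<le> q" "0 \<le> \<beta>" "0 < L" "0 < h" and J: "\<And>e. e \<in> lattice_edges (region u L h z) \<Longrightarrow> 0 \<le> J e"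
  shows "surf_tension q \<beta> J (emb z) L h (base_cube u) (u CARD('d)) = rect_cost q \<beta> u L h z J / L ^ (CARD('d) - 1)"
proof -
  interpret frame_loc u by unfold_locales fact
  have "measure (rc_measure q \<beta> (lattice_edges (region u L h z)) wired J) (sep (region u L h z) (above u z))
     = rc_pr q (lattice_edges (region u L h z)) (odds \<beta> J) (sep (region u L h z) (above u z))"
    using assms by (intro rc_measure_eq rc_region_lattice finite_region sep_subset) auto
  moreover have "disconnection (emb z) L h (base_cube u) (u CARD('d)) = sep (region u L h z) (above u z)"
    unfolding disconnection_eq_sep region_def above_def by simp
  ultimately show ?thesis
    unfolding surf_tension_def rect_cost_def cost_def region_def[symmetric] by simp
qed

text \<open>
  Rectangles with the same normal whose tangential frames \<open>u\<close> and \<open>w\<close> differ by a rotation: both the limits and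
  their independence of the frame come from tiling a rectangle of frame \<open>w\<close> with rectangles of frame \<open>u\<close>.
\<close>

locale two_frames = tile: frame_loc u + big: frame_loc w for u w :: "nat \<Rightarrow> real ^ 'd::finite" +
  fixes L h N H :: real
  assumes same_normal: "u CARD('d) = w CARD('d)"
    and L_large: "4 * real CARD('d) + 2 < L" and h_large: "2 * real CARD('d) + 2 < h"
    and H_large: "h + real CARD('d) + 2 < H"
    and N_large: "4 * real CARD('d) * (L + 2 * real CARD('d)) + 2 * real CARD('d) + 4 < N"
begin

definition spacing where "spacing = L + 2 * real CARD('d)"

definition centre :: "(nat \<Rightarrow> int) \<Rightarrow> real ^ 'd" where
  "centre j = (\<Sum>k\<in>{1..<CARD('d)}. (spacing * of_int (j k)) *\<^sub>R u k)"

text \<open>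
  Tiles are centred at lattice points, so that they are translates of one another and their costs have the same law.
  Rounding moves a centre off the grid by at most \<open>d\<close>, which is why the spacing exceeds \<open>L\<close> by \<open>2 * d\<close>.
\<close>

definition lattice_centre :: "(nat \<Rightarrow> int) \<Rightarrow> int ^ 'd" where
  "lattice_centre j = (\<chi> i. \<lfloor>centre j $ i\<rfloor>)"

definition cells :: "(nat \<Rightarrow> int) set" where
  "cells = {j \<in> {1..<CARD('d)} \<rightarrow>\<^sub>E UNIV. \<forall>k\<in>{1..<CARD('d)}. \<bar>centre j \<bullet> w k\<bar> + real CARD('d) * spacing + real CARD('d) + 2 \<le> N / 2}"

lemma index_facts: "{1..<CARD('d)} \<subseteq> {1..CARD('d)}" "CARD('d) \<in> {1..CARD('d)}" "{1..CARD('d)} = insert CARD('d) {1..<CARD('d)}" "1 \<le> real CARD('d)"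
  using card_pos[where 'd='d] by auto

lemma spacing_pos: "0 < spacing" "0 < L" "0 < h" "0 < H" "0 < N"
proof -
  show L: "0 < L" "0 < spacing" "0 < h" unfolding spacing_def using L_large h_large index_facts(4) by auto
  then show "0 < H" using H_large index_facts(4) by auto
  have "0 \<le> 4 * real CARD('d) * spacing" using L index_facts(4) by simp
  then show "0 < N" using N_large index_facts(4) unfolding spacing_def[symmetric] by linarith
qed

lemma lattice_centre_close:
  assumes "norm v = 1" shows "\<bar>(emb (lattice_centre j) - centre j) \<bullet> v\<bar> \<le> real CARD('d)"
proof -
  have "\<bar>(emb (lattice_centre j) - centre j) $ i\<bar> \<le> 1" for i
    by (simp add: emb_def lattice_centre_def abs_le_iff) linarith
  then have "norm (emb (lattice_centre j) - centre j) \<le> real CARD('d) * 1" by (rule norm_le_card)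
  then show ?thesis
    using Cauchy_Schwarz_ineq2[of "emb (lattice_centre j) - centre j" v] assms by simp
qed

lemma centre_coord: "k \<in> {1..<CARD('d)} \<Longrightarrow> centre j \<bullet> u k = spacing * of_int (j k)"
  unfolding centre_def using index_facts by (subst tile.inner_sum') auto

lemma centre_normal: "centre j \<bullet> u CARD('d) = 0"
  unfolding centre_def using index_facts by (subst tile.inner_sum') auto

text \<open>
  As \<open>u\<close> and \<open>w\<close> share the normal, tangential coordinates in one frame depend on tangential coordinates in the other one only.
\<close>

lemma tangential_bound:
  assumes c: "\<And>k. k \<in> {1..<CARD('d)} \<Longrightarrow> \<bar>v \<bullet> u k\<bar> \<le> c" and k: "k \<in> {1..<CARD('d)}"
  shows "\<bar>v \<bullet> w k\<bar> \<le> real CARD('d) * c"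
proof -
  have kd: "k \<in> {1..CARD('d)}" using k index_facts by blast
  have c0: "0 \<le> c" using c[OF k] by linarith
  have "v \<bullet> w k = (\<Sum>i\<in>{1..CARD('d)}. (v \<bullet> u i) *\<^sub>R u i) \<bullet> w k" by (simp only: tile.expand)
  also have "\<dots> = (\<Sum>i\<in>{1..CARD('d)}. (v \<bullet> u i) * (u i \<bullet> w k))" by (simp add: inner_sum_left)
  also have "\<dots> = (\<Sum>i\<in>{1..<CARD('d)}. (v \<bullet> u i) * (u i \<bullet> w k))"
    unfolding index_facts(3) using same_normal big.ortho[of "CARD('d)" k] kd index_facts k
    by (subst sum.insert) auto
  also have "\<bar>\<dots>\<bar> \<le> (\<Sum>i\<in>{1..<CARD('d)}. c * 1)"
  proof (intro order_trans[OF sum_abs] sum_mono)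
    fix i assume i: "i \<in> {1..<CARD('d)}"
    have "\<bar>u i \<bullet> w k\<bar> \<le> norm (u i)" by (rule big.inner_le[OF kd])
    also have "\<dots> = 1" using i index_facts by (intro tile.norm_u) blast
    finally show "\<bar>(v \<bullet> u i) * (u i \<bullet> w k)\<bar> \<le> c * 1" unfolding abs_mult using c[OF i] c0 by (intro mult_mono) auto
  qed
  also have "\<dots> \<le> real CARD('d) * c" using c0 by (simp add: mult_right_mono)
  finally show ?thesis .
qed

lemma cells_unique:
  assumes "j \<in> cells" "j' \<in> cells"
    and "\<And>k. k \<in> {1..<CARD('d)} \<Longrightarrow> \<bar>(p - centre j) \<bullet> u k\<bar> < spacing / 2" "\<And>k. k \<in> {1..<CARD('d)} \<Longrightarrow> \<bar>(p - centre j') \<bullet> u k\<bar> < spacing / 2"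
  shows "j = j'"
proof -
  have "j k = j' k" if k: "k \<in> {1..<CARD('d)}" for k
  proof -
    have "\<bar>centre j \<bullet> u k - centre j' \<bullet> u k\<bar> < spacing"
      using assms(3,4)[OF k] unfolding inner_diff_left by linarith
    then have "\<bar>spacing * (of_int (j k) - of_int (j' k))\<bar> < spacing * 1"
      unfolding centre_coord[OF k] by (simp add: right_diff_distrib)
    then have "\<bar>of_int (j k) - (of_int (j' k) :: real)\<bar> < 1"
      unfolding abs_mult using spacing_pos(1) by (simp add: mult_less_cancel_left_pos)
    then show ?thesis by linarith
  qed
  moreover have "j \<in> {1..<CARD('d)} \<rightarrow>\<^sub>E UNIV" "j' \<in> {1..<CARD('d)} \<rightarrow>\<^sub>E UNIV"
    using assms(1,2) unfolding cells_def by blast+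
  ultimately show ?thesis using PiE_ext by metis
qed

lemma cells_disjoint:
  "r \<le> spacing / 2 \<Longrightarrow> disjoint_family_on (\<lambda>j. slab u (centre j) r c) cells"
proof (unfold disjoint_family_on_def, intro ballI impI equals0I)
  fix j j' p assume r: "r \<le> spacing / 2" and j: "j \<in> cells" "j' \<in> cells" "j \<noteq> j'"
    and p: "p \<in> slab u (centre j) r c \<inter> slab u (centre j') r c"
  have "\<bar>(p - centre j) \<bullet> u k\<bar> < spacing / 2" "\<bar>(p - centre j') \<bullet> u k\<bar> < spacing / 2" if "k \<in> {1..<CARD('d)}" for k
    using p r that unfolding Int_iff slab_iff by (meson less_le_trans)+
  then show False using cells_unique j by blast
qed

lemma cells_packing: "finite cells" "card cells * L ^ (CARD('d) - 1) \<le> N ^ (CARD('d) - 1)"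
proof -
  have sub: "slab u (centre j) (spacing / 2) 1 \<subseteq> slab w 0 (N / 2) 1" if j: "j \<in> cells" for j
  proof
    fix p assume p: "p \<in> slab u (centre j) (spacing / 2) 1"
    have "\<bar>p \<bullet> w k\<bar> < N / 2" if k: "k \<in> {1..<CARD('d)}" for k
    proof -
      have "\<bar>(p - centre j) \<bullet> w k\<bar> \<le> real CARD('d) * (spacing / 2)"
        using p k by (intro tangential_bound) (auto simp: slab_iff less_imp_le)
      also have "\<dots> \<le> real CARD('d) * spacing" using spacing_pos(1) by (intro mult_left_mono) auto
      finally have "\<bar>p \<bullet> w k\<bar> \<le> \<bar>centre j \<bullet> w k\<bar> + real CARD('d) * spacing" by (simp add: inner_diff_left)
      moreover have "\<bar>centre j \<bullet> w k\<bar> + real CARD('d) * spacing + real CARD('d) + 2 \<le> N / 2" using j k unfolding cells_def by blast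
      ultimately show ?thesis using index_facts(4) by linarith
    qed
    moreover have "\<bar>p \<bullet> w CARD('d)\<bar> < 1"
      using p centre_normal[of j] by (simp add: slab_iff inner_diff_left same_normal)
    ultimately show "p \<in> slab w 0 (N / 2) 1" by (simp add: slab_iff)
  qed
  have v: "slab u x (spacing / 2) 1 \<in> lmeasurable"
      "measure lebesgue (slab u x (spacing / 2) 1) = spacing ^ (CARD('d) - 1) * 2" for x
    using tile.slab_volume[of "spacing / 2" 1 x] spacing_pos by auto
  have v': "slab w 0 (N / 2) 1 \<in> lmeasurable"
      "measure lebesgue (slab w 0 (N / 2) 1) = N ^ (CARD('d) - 1) * 2"
    using big.slab_volume[of "N / 2" 1 0] spacing_pos by auto
  have pk: "finite cells" "card cells * (spacing ^ (CARD('d) - 1) * 2) \<le> measure lebesgue (slab w 0 (N / 2) 1)"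
    using packing[of cells "\<lambda>j. slab u (centre j) (spacing / 2) 1" "spacing ^ (CARD('d) - 1) * 2" "slab w 0 (N / 2) 1"]
      v v'(1) sub cells_disjoint[of "spacing / 2" 1] spacing_pos(1) by auto
  show "finite cells" by (rule pk(1))
  have "L ^ (CARD('d) - 1) \<le> spacing ^ (CARD('d) - 1)" using spacing_pos by (intro power_mono) (auto simp: spacing_def)
  then have "card cells * L ^ (CARD('d) - 1) \<le> card cells * spacing ^ (CARD('d) - 1)" by (intro mult_left_mono) auto
  also have "\<dots> \<le> N ^ (CARD('d) - 1)" using pk(2) v'(2) by simp
  finally show "card cells * L ^ (CARD('d) - 1) \<le> N ^ (CARD('d) - 1)" .
qed

text \<open>
  The cells of the grid cover the rectangle up to a margin, so there are nearly \<open>(N / L) ^ (d - 1)\<close> tiles.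
  The sides are enlarged by \<open>1\<close> because cells are open.
\<close>

lemma cells_cover:
  "(N - 4 * real CARD('d) * spacing - 2 * real CARD('d) - 4) ^ (CARD('d) - 1) \<le> card cells * (spacing + 1) ^ (CARD('d) - 1)"
proof -
  let ?r = "N / 2 - 2 * real CARD('d) * spacing - real CARD('d) - 2"
  have r: "0 \<le> ?r" using N_large unfolding spacing_def by linarith
  have "slab w 0 ?r 1 \<subseteq> (\<Union>j\<in>cells. slab u (centre j) ((spacing + 1) / 2) 1)"
  proof
    fix p assume p: "p \<in> slab w 0 ?r 1"
    define j where "j = (\<lambda>k\<in>{1..<CARD('d)}. round (p \<bullet> u k / spacing))"
    have c: "\<bar>(p - centre j) \<bullet> u k\<bar> \<le> spacing / 2" if k: "k \<in> {1..<CARD('d)}" for k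
    proof -
      have "(p - centre j) \<bullet> u k = p \<bullet> u k - spacing * of_int (round (p \<bullet> u k / spacing))"
        using k by (simp add: inner_diff_left centre_coord j_def)
      also have "\<dots> = spacing * (p \<bullet> u k / spacing - of_int (round (p \<bullet> u k / spacing)))"
        using spacing_pos(1) by (simp add: right_diff_distrib)
      finally have "\<bar>(p - centre j) \<bullet> u k\<bar> = spacing * \<bar>of_int (round (p \<bullet> u k / spacing)) - p \<bullet> u k / spacing\<bar>"
        using spacing_pos(1) by (simp add: abs_mult abs_minus_commute)
      also have "\<dots> \<le> spacing * (1/2)"
        using of_int_round_abs_le[of "p \<bullet> u k / spacing"] spacing_pos(1) by (intro mult_left_mono) auto
      finally show ?thesis by simp
    qed
    have "j \<in> cells" unfolding cells_def
    proof (intro CollectI conjI ballI)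
      fix k assume k: "k \<in> {1..<CARD('d)}"
      have "\<bar>(p - centre j) \<bullet> w k\<bar> \<le> real CARD('d) * (spacing / 2)" using c k by (rule tangential_bound)
      then have "\<bar>centre j \<bullet> w k\<bar> \<le> \<bar>p \<bullet> w k\<bar> + real CARD('d) * spacing / 2" unfolding inner_diff_left by (simp; linarith)
      moreover have "\<bar>p \<bullet> w k\<bar> < ?r" using p k by (simp add: slab_iff)
      moreover have "0 \<le> real CARD('d) * spacing" using spacing_pos(1) by simp
      ultimately show "\<bar>centre j \<bullet> w k\<bar> + real CARD('d) * spacing + real CARD('d) + 2 \<le> N / 2" by linarith
    qed (simp add: j_def)
    moreover have "p \<in> slab u (centre j) ((spacing + 1) / 2) 1"
      unfolding slab_iff using c p centre_normal[of j] by (fastforce simp: slab_iff inner_diff_left same_normal)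
    ultimately show "p \<in> (\<Union>j\<in>cells. slab u (centre j) ((spacing + 1) / 2) 1)" by blast
  qed
  moreover have v: "slab u x ((spacing + 1) / 2) 1 \<in> lmeasurable"
      "measure lebesgue (slab u x ((spacing + 1) / 2) 1) = (spacing + 1) ^ (CARD('d) - 1) * 2" for x
  proof -
    have "2 * ((spacing + 1) / 2) = spacing + 1" "0 \<le> (spacing + 1) / 2" using spacing_pos by auto
    then show "slab u x ((spacing + 1) / 2) 1 \<in> lmeasurable"
      "measure lebesgue (slab u x ((spacing + 1) / 2) 1) = (spacing + 1) ^ (CARD('d) - 1) * 2"
      using tile.slab_volume[of "(spacing + 1) / 2" 1 x] by (simp_all only: zero_le_one mult_1_right)
  qed
  moreover have v': "slab w 0 ?r 1 \<in> lmeasurable" "measure lebesgue (slab w 0 ?r 1) = (2 * ?r) ^ (CARD('d) - 1) * 2"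
    using big.slab_volume[OF r, of 1 0] by auto
  ultimately have "measure lebesgue (slab w 0 ?r 1) \<le> measure lebesgue (\<Union>j\<in>cells. slab u (centre j) ((spacing + 1) / 2) 1)"
    using cells_packing(1) by (intro measure_mono_fmeasurable fmeasurable.finite_UN) (auto intro: fmeasurableD)
  also have "\<dots> \<le> (\<Sum>j\<in>cells. measure lebesgue (slab u (centre j) ((spacing + 1) / 2) 1))"
    using cells_packing(1) v(1) by (intro measure_UNION_le) (auto intro: fmeasurableD)
  also have "\<dots> = card cells * ((spacing + 1) ^ (CARD('d) - 1) * 2)" by (simp add: v(2))
  finally have "(2 * ?r) ^ (CARD('d) - 1) * 2 \<le> card cells * ((spacing + 1) ^ (CARD('d) - 1) * 2)" by (simp add: v'(2))
  then have "(2 * ?r) ^ (CARD('d) - 1) \<le> card cells * (spacing + 1) ^ (CARD('d) - 1)" by simp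
  moreover have "2 * ?r = N - 4 * real CARD('d) * spacing - 2 * real CARD('d) - 4" by (simp add: algebra_simps)
  ultimately show ?thesis by (simp only:)
qed

definition tiles :: "(int ^ 'd) set" where "tiles = lattice_centre ` cells"

lemma region_close:
  assumes v: "v \<in> region u L h (lattice_centre j)"
  shows "\<And>k. k \<in> {1..<CARD('d)} \<Longrightarrow> \<bar>(emb v - centre j) \<bullet> u k\<bar> < spacing / 2"
    and "\<bar>emb v \<bullet> u CARD('d)\<bar> < h + real CARD('d)"
proof -
  have m: "emb v \<in> slab u (emb (lattice_centre j)) (L / 2) h"
    using v spacing_pos by (simp add: tile.region_iff)
  fix k assume k: "k \<in> {1..<CARD('d)}"
  then have "norm (u k) = 1" using index_facts by (intro tile.norm_u) blast
  then have "\<bar>(emb (lattice_centre j) - centre j) \<bullet> u k\<bar> \<le> real CARD('d)" by (rule lattice_centre_close)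
  moreover have "\<bar>(emb v - emb (lattice_centre j)) \<bullet> u k\<bar> < L / 2" using m k by (simp add: slab_iff)
  moreover have "spacing / 2 = L / 2 + real CARD('d)" by (simp add: spacing_def)
  ultimately show "\<bar>(emb v - centre j) \<bullet> u k\<bar> < spacing / 2"
    unfolding inner_diff_left by linarith
next
  have m: "emb v \<in> slab u (emb (lattice_centre j)) (L / 2) h"
    using v spacing_pos by (simp add: tile.region_iff)
  have "norm (u CARD('d)) = 1" by (rule tile.norm_u[OF index_facts(2)])
  then have "\<bar>(emb (lattice_centre j) - centre j) \<bullet> u CARD('d)\<bar> \<le> real CARD('d)" by (rule lattice_centre_close)
  moreover have "\<bar>(emb v - emb (lattice_centre j)) \<bullet> u CARD('d)\<bar> < h" using m by (simp add: slab_iff)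
  ultimately show "\<bar>emb v \<bullet> u CARD('d)\<bar> < h + real CARD('d)"
    unfolding inner_diff_left centre_normal by linarith
qed

lemma centre_in_region: "lattice_centre j \<in> region u L h (lattice_centre j)"
  using spacing_pos by (simp add: tile.region_iff slab_iff)

lemma tiles_unique:
  assumes "j \<in> cells" "j' \<in> cells"
    "v \<in> region u L h (lattice_centre j)" "v \<in> region u L h (lattice_centre j')"
  shows "j = j'"
  using cells_unique[OF assms(1,2), of "emb v"] region_close(1)[OF assms(3)] region_close(1)[OF assms(4)] by blast

lemma tiles_disjoint:
  "z \<in> tiles \<Longrightarrow> z' \<in> tiles \<Longrightarrow> v \<in> region u L h z \<Longrightarrow> v \<in> region u L h z' \<Longrightarrow> z = z'"
  unfolding tiles_def using tiles_unique by blast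

lemma inj_lattice_centre: "inj_on lattice_centre cells"
  using tiles_unique centre_in_region by (metis inj_onI)

lemma card_tiles: "finite tiles" "card tiles * L ^ (CARD('d) - 1) \<le> N ^ (CARD('d) - 1)"
  using cells_packing inj_lattice_centre by (auto simp: tiles_def card_image)

lemma tile_deep:
  assumes z: "z \<in> tiles" and v: "v \<in> region u L h z"
  shows "emb v \<in> slab w 0 (N / 2 - 1) (H - 1)"
proof -
  obtain j where j: "j \<in> cells" "z = lattice_centre j" using z by (auto simp: tiles_def)
  note c = region_close[of v j] v[unfolded j(2)]
  have "\<bar>emb v \<bullet> w k\<bar> < N / 2 - 1" if k: "k \<in> {1..<CARD('d)}" for k
  proof -
    have "\<bar>(emb v - centre j) \<bullet> w k\<bar> \<le> real CARD('d) * (spacing / 2)"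
      using c k by (intro tangential_bound) (auto simp: less_imp_le)
    also have "\<dots> \<le> real CARD('d) * spacing" using spacing_pos(1) by (intro mult_left_mono) auto
    finally have "\<bar>emb v \<bullet> w k\<bar> \<le> \<bar>centre j \<bullet> w k\<bar> + real CARD('d) * spacing" unfolding inner_diff_left by linarith
    moreover have "\<bar>centre j \<bullet> w k\<bar> + real CARD('d) * spacing + real CARD('d) + 2 \<le> N / 2"
      using j(1) k unfolding cells_def by blast
    ultimately show ?thesis using index_facts(4) by linarith
  qed
  moreover have "\<bar>emb v \<bullet> w CARD('d)\<bar> < H - 1" using c H_large by (simp add: same_normal)
  ultimately show ?thesis by (simp add: slab_iff)
qed

lemma tile_sub: "z \<in> tiles \<Longrightarrow> region u L h z \<subseteq> region w N H 0"
proof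
  fix v assume "z \<in> tiles" "v \<in> region u L h z"
  then have "emb v \<in> slab w 0 (N / 2 - 1) (H - 1)" by (rule tile_deep)
  then show "v \<in> region w N H 0" using spacing_pos by (fastforce simp: big.region_iff slab_iff)
qed

lemma tile_away: "z \<in> tiles \<Longrightarrow> region u L h z \<inter> bdry (region w N H 0) = {}"
proof (intro equals0I)
  fix v assume z: "z \<in> tiles" and v: "v \<in> region u L h z \<inter> bdry (region w N H 0)"
  then have d: "emb v \<in> slab w 0 (N / 2 - 1) (H - 1)" using tile_deep by blast
  obtain y where y: "y \<notin> region w N H 0" "y \<sim>\<^sub>Z v" using v by (auto simp: bdry_def)
  have a: "\<bar>emb y \<bullet> w k - emb v \<bullet> w k\<bar> \<le> 1" if "k \<in> {1..CARD('d)}" for k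
    using y(2) big.norm_u[OF that] by (rule adjacent_inner)
  have "\<bar>emb y \<bullet> w k\<bar> < N / 2" if k: "k \<in> {1..<CARD('d)}" for k
  proof -
    have "\<bar>emb v \<bullet> w k\<bar> < N / 2 - 1" using d k by (simp add: slab_iff)
    then show ?thesis using a[of k] k index_facts by (smt (verit) subsetD)
  qed
  moreover have "\<bar>emb y \<bullet> w CARD('d)\<bar> < H"
    using d a[OF index_facts(2)] by (simp add: slab_iff; linarith)
  ultimately have "y \<in> region w N H 0" using spacing_pos by (simp add: big.region_iff slab_iff)
  then show False using y(1) by simp
qed

definition side :: "int ^ 'd \<Rightarrow> bool" where
  "side v \<longleftrightarrow> (if \<exists>z\<in>tiles. v \<in> region u L h z then \<exists>z\<in>tiles. v \<in> region u L h z \<and> above u z v else above w 0 v)"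

sublocale tiling "region w N H 0" "above w 0" tiles "region u L h" "above u" side
proof
  show "side v \<longleftrightarrow> above u z v" if "z \<in> tiles" "v \<in> region u L h z" for z v
    unfolding side_def using that tiles_disjoint by metis
  show "side v \<longleftrightarrow> above w 0 v" if "\<And>z. z \<in> tiles \<Longrightarrow> v \<notin> region u L h z" for v
    unfolding side_def using that by metis
qed (use tiles_disjoint tile_sub tile_away card_tiles spacing_pos big.finite_region in auto)

lemma side_normal:
  "side v \<Longrightarrow> - real CARD('d) \<le> emb v \<bullet> u CARD('d)" "\<not> side v \<Longrightarrow> emb v \<bullet> u CARD('d) < real CARD('d)"
proof -
  have n: "norm (u CARD('d)) = 1" by (rule tile.norm_u[OF index_facts(2)])
  have z: "\<bar>emb z \<bullet> u CARD('d)\<bar> \<le> real CARD('d)" if z: "z \<in> tiles" for z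
  proof -
    obtain j where "z = lattice_centre j" using z by (auto simp: tiles_def)
    then show ?thesis using lattice_centre_close[OF n, of j] by (simp add: inner_diff_left centre_normal)
  qed
  have d: "0 < real CARD('d)" using index_facts by simp
  have "\<exists>z. (z = 0 \<or> z \<in> tiles) \<and> (side v \<longleftrightarrow> 0 \<le> (emb v - emb z) \<bullet> u CARD('d))"
  proof (cases "\<exists>z\<in>tiles. v \<in> region u L h z")
    case True
    then obtain z where z: "z \<in> tiles" "v \<in> region u L h z" by blast
    then have "side v \<longleftrightarrow> above u z v" by (rule tau_in)
    then show ?thesis using z(1) unfolding above_def by blast
  next
    case False
    then have "side v \<longleftrightarrow> above w 0 v" unfolding side_def by simp
    then show ?thesis by (auto simp: above_def same_normal)
  qed
  then obtain z where "z = 0 \<or> z \<in> tiles" "side v \<longleftrightarrow> 0 \<le> (emb v - emb z) \<bullet> u CARD('d)" by blast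
  moreover from this(1) have "\<bar>emb z \<bullet> u CARD('d)\<bar> \<le> real CARD('d)" using z d by auto
  ultimately show "side v \<Longrightarrow> - real CARD('d) \<le> emb v \<bullet> u CARD('d)"
    "\<not> side v \<Longrightarrow> emb v \<bullet> u CARD('d) < real CARD('d)"
    by (simp_all add: inner_diff_left abs_le_iff)
qed

text \<open>
  The part of a thickened hyperplane that is left free by slightly shrunken tiles.
\<close>

definition gap :: "(real ^ 'd) set" where
  "gap = slab w 0 (N / 2 + real CARD('d)) (2 * real CARD('d) + 2)
     - (\<Union>j\<in>cells. slab u (centre j) (L / 2 - 2 * real CARD('d) - 1) (2 * real CARD('d) + 2))"

text \<open>
  The shrunken tiles are disjoint and contained in the thickened hyperplane, and \<open>cells_cover\<close> bounds their number from below.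
\<close>

lemma gap_volume:
  "gap \<in> lmeasurable"
  "measure lebesgue gap \<le> (4 * real CARD('d) + 4) * ((N + 2 * real CARD('d)) ^ (CARD('d) - 1)
      - (N - 4 * real CARD('d) * spacing - 2 * real CARD('d) - 4) ^ (CARD('d) - 1)
        * ((L - 4 * real CARD('d) - 2) / (spacing + 1)) ^ (CARD('d) - 1))"
proof -
  let ?r = "L / 2 - 2 * real CARD('d) - 1" and ?h = "2 * real CARD('d) + 2"
  let ?B = "slab w 0 (N / 2 + real CARD('d)) ?h" and ?C = "\<lambda>j. slab u (centre j) ?r ?h"
  have r: "0 \<le> ?r" "0 \<le> ?h" using L_large by auto
  have B: "?B \<in> lmeasurable" "measure lebesgue ?B = (N + 2 * real CARD('d)) ^ (CARD('d) - 1) * (2 * ?h)"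
    using big.slab_volume[of "N / 2 + real CARD('d)" ?h 0] spacing_pos by (auto simp: distrib_left)
  have C: "?C j \<in> lmeasurable" "measure lebesgue (?C j) = (L - 4 * real CARD('d) - 2) ^ (CARD('d) - 1) * (2 * ?h)" for j
    using tile.slab_volume[OF r, of "centre j"] by (auto simp: right_diff_distrib)
  have sub: "?C j \<subseteq> ?B" if j: "j \<in> cells" for j
  proof
    fix p assume p: "p \<in> ?C j"
    have "\<bar>p \<bullet> w k\<bar> < N / 2 + real CARD('d)" if k: "k \<in> {1..<CARD('d)}" for k
    proof -
      have "\<bar>(p - centre j) \<bullet> w k\<bar> \<le> real CARD('d) * ?r"
        using p k by (intro tangential_bound) (auto simp: slab_iff less_imp_le)
      also have "\<dots> \<le> real CARD('d) * spacing" using L_large index_facts(4) by (intro mult_left_mono) (auto simp: spacing_def)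
      finally have "\<bar>p \<bullet> w k\<bar> \<le> \<bar>centre j \<bullet> w k\<bar> + real CARD('d) * spacing" unfolding inner_diff_left by linarith
      moreover have "\<bar>centre j \<bullet> w k\<bar> + real CARD('d) * spacing + real CARD('d) + 2 \<le> N / 2" using j k unfolding cells_def by blast
      ultimately show ?thesis using index_facts(4) by linarith
    qed
    moreover have "\<bar>p \<bullet> w CARD('d)\<bar> < ?h"
      using p centre_normal[of j] by (simp add: slab_iff inner_diff_left same_normal)
    ultimately show "p \<in> ?B" by (simp add: slab_iff)
  qed
  have disj: "disjoint_family_on ?C cells" by (rule cells_disjoint) (use index_facts(4) in \<open>simp add: spacing_def\<close>)
  have UC: "(\<Union>j\<in>cells. ?C j) \<in> lmeasurable" using cells_packing(1) C by (intro fmeasurable.finite_UN) auto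
  show "gap \<in> lmeasurable" unfolding gap_def by (intro fmeasurable_Diff B fmeasurableD UC)
  have "measure lebesgue (\<Union>j\<in>cells. ?C j) = (\<Sum>j\<in>cells. measure lebesgue (?C j))"
    using cells_packing(1) C disj unfolding disjoint_family_on_def
    by (intro measure_UNION') (auto simp: pairwise_def disjnt_def)
  also have "\<dots> = card cells * ((L - 4 * real CARD('d) - 2) ^ (CARD('d) - 1) * (2 * ?h))" using C by simp
  finally have mU: "measure lebesgue (\<Union>j\<in>cells. ?C j) = card cells * ((L - 4 * real CARD('d) - 2) ^ (CARD('d) - 1) * (2 * ?h))" .
  let ?b = "L - 4 * real CARD('d) - 2" and ?n = "CARD('d) - 1"
  have "(N - 4 * real CARD('d) * spacing - 2 * real CARD('d) - 4) ^ ?n * (?b / (spacing + 1)) ^ ?n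
     \<le> (card cells * (spacing + 1) ^ ?n) * (?b / (spacing + 1)) ^ ?n"
    using cells_cover r spacing_pos(1) by (intro mult_right_mono) auto
  also have "\<dots> = card cells * ?b ^ ?n" using spacing_pos(1) by (simp add: power_divide)
  finally have low: "(N - 4 * real CARD('d) * spacing - 2 * real CARD('d) - 4) ^ ?n * (?b / (spacing + 1)) ^ ?n \<le> card cells * ?b ^ ?n" .
  have "measure lebesgue gap = measure lebesgue ?B - measure lebesgue (\<Union>j\<in>cells. ?C j)"
    unfolding gap_def using B UC sub by (intro measurable_measure_Diff) (auto intro: fmeasurableD)
  also have "\<dots> = (2 * ?h) * ((N + 2 * real CARD('d)) ^ ?n - card cells * ?b ^ ?n)"
    unfolding B(2) mU by (simp add: algebra_simps)
  also have "\<dots> \<le> (2 * ?h) * ((N + 2 * real CARD('d)) ^ ?n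
     - (N - 4 * real CARD('d) * spacing - 2 * real CARD('d) - 4) ^ ?n * (?b / (spacing + 1)) ^ ?n)"
    using low r(2) by (intro mult_left_mono) auto
  finally show "measure lebesgue gap \<le> (4 * real CARD('d) + 4) * ((N + 2 * real CARD('d)) ^ ?n
      - (N - 4 * real CARD('d) * spacing - 2 * real CARD('d) - 4) ^ ?n * (?b / (spacing + 1)) ^ ?n)" by (simp add: algebra_simps)
qed

text \<open>
  The sides change near the hyperplane only, so a seam edge lies in the thickened hyperplane; in a shrunken tile it
  would have both ends in the tile.
\<close>

lemma seam_in_gap:
  assumes e: "e \<in> seam (region w N H 0) tiles (region u L h) side"
  shows "\<exists>v\<in>e. lattice_cell v \<subseteq> gap"
proof -
  obtain v v' where vv: "e = {v, v'}" "side v" "\<not> side v'" using e by (auto simp: seam_def)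
  then have V: "v \<in> region w N H 0" "v' \<in> region w N H 0" "v \<sim>\<^sub>Z v'"
    using e lattice_edges_doubleton[of v v' "region w N H 0"] by (auto simp: seam_def)
  have a: "\<bar>emb v \<bullet> u k - emb v' \<bullet> u k\<bar> \<le> 1" if "k \<in> {1..CARD('d)}" for k
    using V(3) tile.norm_u[OF that] by (rule adjacent_inner)
  have n: "\<bar>emb v \<bullet> u CARD('d)\<bar> \<le> real CARD('d) + 1"
    using side_normal(1)[OF vv(2)] side_normal(2)[OF vv(3)] a[OF index_facts(2)] by linarith
  have "lattice_cell v \<subseteq> gap"
  proof
    fix p assume p: "p \<in> lattice_cell v"
    have "emb v \<in> slab w 0 (N / 2) (real CARD('d) + 2)"
      using V(1) n spacing_pos by (simp add: big.region_iff slab_iff same_normal)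
    from big.cell_in_slab[OF this] have 1: "p \<in> slab w 0 (N / 2 + real CARD('d)) (2 * real CARD('d) + 2)"
      using p by (auto simp: algebra_simps)
    have 2: "p \<notin> slab u (centre j) (L / 2 - 2 * real CARD('d) - 1) (2 * real CARD('d) + 2)" if j: "j \<in> cells" for j
    proof
      assume s: "p \<in> slab u (centre j) (L / 2 - 2 * real CARD('d) - 1) (2 * real CARD('d) + 2)"
      let ?z = "lattice_centre j"
      have k: "\<bar>(emb v - emb ?z) \<bullet> u k\<bar> < L / 2 - 1" if k: "k \<in> {1..<CARD('d)}" for k
      proof -
        have kd: "k \<in> {1..CARD('d)}" using k by auto
        have "\<bar>(p - centre j) \<bullet> u k\<bar> < L / 2 - 2 * real CARD('d) - 1" using s k by (simp add: slab_iff)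
        moreover have "\<bar>(p - centre j) \<bullet> u k - (emb v - centre j) \<bullet> u k\<bar> \<le> real CARD('d) / 2"
          by (rule tile.cell_coord[OF p kd])
        moreover have "\<bar>(emb ?z - centre j) \<bullet> u k\<bar> \<le> real CARD('d)" by (rule lattice_centre_close[OF tile.norm_u[OF kd]])
        moreover have "(emb v - emb ?z) \<bullet> u k = (emb v - centre j) \<bullet> u k - (emb ?z - centre j) \<bullet> u k" by (simp add: inner_diff_left)
        ultimately show ?thesis using index_facts(4) by linarith
      qed
      have nn: "\<bar>(emb v - emb ?z) \<bullet> u CARD('d)\<bar> < h - 1"
      proof -
        have "\<bar>(emb ?z - centre j) \<bullet> u CARD('d)\<bar> \<le> real CARD('d)"
          by (rule lattice_centre_close[OF tile.norm_u[OF index_facts(2)]])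
        then show ?thesis using n h_large unfolding inner_diff_left centre_normal by linarith
      qed
      have v: "v \<in> region u L h ?z" using k nn spacing_pos by (fastforce simp: tile.region_iff slab_iff)
      have "v' \<in> region u L h ?z"
        unfolding tile.region_iff[OF spacing_pos(2,3)] slab_iff
      proof (intro conjI ballI)
        show "\<bar>(emb v' - emb ?z) \<bullet> u i\<bar> < L / 2" if "i \<in> {1..<CARD('d)}" for i
        proof -
          have "i \<in> {1..CARD('d)}" using that by auto
          from k[OF that] a[OF this] show ?thesis unfolding inner_diff_left by linarith
        qed
        show "\<bar>(emb v' - emb ?z) \<bullet> u CARD('d)\<bar> < h"
          using nn a[OF index_facts(2)] unfolding inner_diff_left by linarith
      qed
      then have "e \<in> lattice_edges (region u L h ?z)" using v V(3) vv(1) by (simp add: lattice_edges_doubleton)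
      moreover have "?z \<in> tiles" using j by (simp add: tiles_def)
      ultimately show False using e by (auto simp: seam_def)
    qed
    show "p \<in> gap" unfolding gap_def using 1 2 by blast
  qed
  then show ?thesis using vv(1) by blast
qed

lemma rect_cost_tiles:
  assumes "1 \<le> q" "0 \<le> \<beta>" "\<And>e. e \<in> wired \<Longrightarrow> 0 \<le> J e" "\<And>e. e \<in> wired \<Longrightarrow> J e \<le> 1"
  shows "rect_cost q \<beta> w N H 0 J \<le> (\<Sum>z\<in>tiles. rect_cost q \<beta> u L h z J)
     + \<beta> * (3 ^ CARD('d) * measure lebesgue gap)"
proof -
  let ?F = "seam (region w N H 0) tiles (region u L h) side"
  have W: "lattice_edges \<Lambda> \<subseteq> wired" for \<Lambda> :: "(int ^ 'd) set"
    unfolding wired_def by (rule lattice_edges_mono) simp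
  have "?F \<subseteq> wired" using W by (auto simp: seam_def)
  then have "card ?F \<le> 3 ^ CARD('d) * measure lebesgue gap"
    using seam_in_gap gap_volume(1) by (intro edges_le_volume) auto
  then have "\<beta> * card ?F \<le> \<beta> * (3 ^ CARD('d) * measure lebesgue gap)"
    using assms(2) by (rule mult_left_mono)
  moreover have "rect_cost q \<beta> w N H 0 J \<le> (\<Sum>z\<in>tiles. rect_cost q \<beta> u L h z J) + \<beta> * card ?F"
    unfolding rect_cost_def using assms W by (intro cost_tiles) auto
  ultimately show ?thesis by linarith
qed

end

section \<open>Subadditivity of the disconnection cost\<close>

text \<open>
  The case without tiles: it suffices to close the edges across the middle hyperplane.
\<close>

lemma (in frame_loc) rect_cost_bound:
  assumes "1 \<le> q" "0 \<le> \<beta>" "\<And>e. e \<in> wired \<Longrightarrow> 0 \<le> J e" "\<And>e. e \<in> wired \<Longrightarrow> J e \<le> 1"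
    and N: "1 \<le> N" "0 < H"
  shows "rect_cost q \<beta> u N H 0 J \<le>
    \<beta> * (3 ^ CARD('d) * (2 * real CARD('d) + 4) * (1 + 2 * real CARD('d)) ^ (CARD('d) - 1)) * N ^ (CARD('d) - 1)"
proof -
  let ?\<Lambda> = "region u N H 0" and ?D = "real CARD('d)"
  let ?F = "seam ?\<Lambda> {} (\<lambda>_::unit. {}) (above u 0)"
  let ?G = "slab u 0 (N / 2 + ?D) (2 + ?D)"
  have I: "CARD('d) \<in> {1..CARD('d)}" using card_pos[where 'd='d] by auto
  have W: "lattice_edges \<Lambda> \<subseteq> wired" for \<Lambda> :: "(int ^ 'd) set"
    unfolding wired_def by (rule lattice_edges_mono) simp
  interpret tiling ?\<Lambda> "above u 0" "{}" "\<lambda>_::unit. {}" "\<lambda>_ _. True" "above u 0"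
    by unfold_locales (use N finite_region in auto)
  have G: "?G \<in> lmeasurable" "measure lebesgue ?G = (N + 2 * ?D) ^ (CARD('d) - 1) * (2 * (2 + ?D))"
    using slab_volume[of "N / 2 + ?D" "2 + ?D" 0] N by (auto simp: distrib_left)
  have "card ?F \<le> 3 ^ CARD('d) * measure lebesgue ?G"
  proof (rule edges_le_volume[OF _ _ G(1)])
    show "?F \<subseteq> wired" using W by (auto simp: seam_def)
    fix e assume e: "e \<in> ?F"
    obtain v v' where vv: "e = {v, v'}" "above u 0 v" "\<not> above u 0 v'" using e by (auto simp: seam_def)
    then have V: "v \<in> ?\<Lambda>" "v \<sim>\<^sub>Z v'" using e lattice_edges_doubleton[of v v' ?\<Lambda>] by (auto simp: seam_def)
    have "\<bar>emb v \<bullet> u CARD('d) - emb v' \<bullet> u CARD('d)\<bar> \<le> 1" using V(2) norm_u[OF I] by (rule adjacent_inner)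
    then have "\<bar>emb v \<bullet> u CARD('d)\<bar> < 2" using vv(2,3) by (simp add: above_def)
    then have "emb v \<in> slab u 0 (N / 2) 2" using V(1) N by (simp add: region_iff slab_iff)
    from cell_in_slab[OF this] show "\<exists>v\<in>e. lattice_cell v \<subseteq> ?G" using vv(1) by auto
  qed
  also have "\<dots> = 3 ^ CARD('d) * (2 * ?D + 4) * (N + 2 * ?D) ^ (CARD('d) - 1)"
    unfolding G(2) by (simp add: algebra_simps)
  also have "\<dots> \<le> 3 ^ CARD('d) * (2 * ?D + 4) * ((1 + 2 * ?D) * N) ^ (CARD('d) - 1)"
  proof (intro mult_left_mono power_mono)
    have "2 * ?D * 1 \<le> 2 * ?D * N" using N by (intro mult_left_mono) auto
    then show "N + 2 * ?D \<le> (1 + 2 * ?D) * N" by (simp add: algebra_simps)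
  qed (use N in auto)
  finally have "card ?F \<le> 3 ^ CARD('d) * (2 * ?D + 4) * (1 + 2 * ?D) ^ (CARD('d) - 1) * N ^ (CARD('d) - 1)"
    by (simp add: power_mult_distrib mult_ac)
  then have "\<beta> * card ?F \<le> \<beta> * (3 ^ CARD('d) * (2 * ?D + 4) * (1 + 2 * ?D) ^ (CARD('d) - 1) * N ^ (CARD('d) - 1))"
    using assms(2) by (rule mult_left_mono)
  moreover have "rect_cost q \<beta> u N H 0 J \<le> \<beta> * card ?F"
    using cost_tiles[of q \<beta> J] assms W unfolding rect_cost_def by auto
  ultimately show ?thesis by (simp add: mult_ac)
qed

lemma eventually_gap_small:
  fixes D :: real and n :: nat
  assumes "0 < D" "0 < \<epsilon>" "0 < K"
  shows "\<forall>\<^sub>F L in sequentially. \<forall>\<^sub>F N in sequentially.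
    K * ((real N + 2 * D) ^ n - (real N - 4 * D * (real L + 2 * D) - 2 * D - 4) ^ n
      * ((real L - 4 * D - 2) / (real L + 2 * D + 1)) ^ n) \<le> \<epsilon> * real N ^ n"
proof -
  have "((\<lambda>L. (real L - 4 * D - 2) / (real L + 2 * D + 1)) \<longlongrightarrow> 1) sequentially" by real_asymp
  then have "((\<lambda>L. K * (1 - ((real L - 4 * D - 2) / (real L + 2 * D + 1)) ^ n)) \<longlongrightarrow> K * (1 - 1 ^ n)) sequentially"
    by (intro tendsto_intros)
  then have "\<forall>\<^sub>F L in sequentially. K * (1 - ((real L - 4 * D - 2) / (real L + 2 * D + 1)) ^ n) < \<epsilon>"
    using assms by (intro order_tendstoD(2)) auto
  then show ?thesis
  proof eventually_elim
    case (elim L)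
    define \<rho> where "\<rho> = ((real L - 4 * D - 2) / (real L + 2 * D + 1)) ^ n"
    define a where "a = 4 * D * (real L + 2 * D) + 2 * D + 4"
    have t1: "((\<lambda>N. (real N + 2 * D) / real N) \<longlongrightarrow> 1) sequentially"
      and t2: "((\<lambda>N. (real N - a) / real N) \<longlongrightarrow> 1) sequentially" by real_asymp+
    then have "((\<lambda>N. K * (((real N + 2 * D) / real N) ^ n - ((real N - a) / real N) ^ n * \<rho>)) \<longlongrightarrow> K * (1 ^ n - 1 ^ n * \<rho>)) sequentially"
      by (intro tendsto_intros)
    then have "\<forall>\<^sub>F N in sequentially. K * (((real N + 2 * D) / real N) ^ n - ((real N - a) / real N) ^ n * \<rho>) < \<epsilon>"
      using elim by (intro order_tendstoD(2)) (auto simp: \<rho>_def)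
    then show ?case
      using eventually_gt_at_top[of 0]
    proof eventually_elim
      case (elim N)
      have "K * ((real N + 2 * D) ^ n - (real N - a) ^ n * \<rho>)
         = K * (((real N + 2 * D) / real N) ^ n - ((real N - a) / real N) ^ n * \<rho>) * real N ^ n"
        using elim(2) by (simp add: power_divide field_simps)
      also have "\<dots> \<le> \<epsilon> * real N ^ n" using elim by (intro mult_right_mono) auto
      finally show ?case unfolding \<rho>_def a_def by (simp add: algebra_simps)
    qed
  qed
qed

text \<open>
  What the probabilistic arguments need from a tiling: disjoint tiles, not more area than the whole, and subadditivity of
  the cost up to an arbitrarily small surface term, uniformly in the couplings.
\<close>

definition good_tiling ::
  "(nat \<Rightarrow> real ^ 'd::finite) \<Rightarrow> (nat \<Rightarrow> real ^ 'd) \<Rightarrow> real \<Rightarrow> real \<Rightarrow> real \<Rightarrow> nat \<Rightarrow> nat \<Rightarrow> (int ^ 'd) set \<Rightarrow> bool" where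
  "good_tiling u w \<delta> \<delta>' \<epsilon> L N T \<longleftrightarrow>
     finite T \<and> card T * real L ^ (CARD('d) - 1) \<le> real N ^ (CARD('d) - 1)
     \<and> (\<forall>z\<in>T. \<forall>z'\<in>T. z \<noteq> z' \<longrightarrow> region u L (\<delta> * L) z \<inter> region u L (\<delta> * L) z' = {})
     \<and> (\<forall>q \<beta> J. 1 \<le> q \<longrightarrow> 0 \<le> \<beta> \<longrightarrow> (\<forall>e\<in>wired. 0 \<le> J e \<and> J e \<le> 1) \<longrightarrow>
          rect_cost q \<beta> w N (\<delta>' * N) 0 J \<le> (\<Sum>z\<in>T. rect_cost q \<beta> u L (\<delta> * L) z J) + \<beta> * (\<epsilon> * real N ^ (CARD('d) - 1)))"

lemma good_tiling_exists:
  fixes u w :: "nat \<Rightarrow> real ^ 'd::finite"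
  assumes "frame u" "frame w" "u CARD('d) = w CARD('d)" "0 < \<delta>" "0 < \<delta>'" "0 < \<epsilon>"
  shows "\<forall>\<^sub>F L in sequentially. \<forall>\<^sub>F N in sequentially. \<exists>T. good_tiling u w \<delta> \<delta>' \<epsilon> L N T"
proof -
  let ?D = "real CARD('d)" and ?n = "CARD('d) - 1"
  let ?K = "3 ^ CARD('d) * (4 * ?D + 4)"
  have D: "0 < ?D" by simp
  have "\<forall>\<^sub>F L in sequentially. 4 * ?D + 2 < real L" "\<forall>\<^sub>F L in sequentially. 2 * ?D + 2 < \<delta> * real L"
    using assms(4) by real_asymp+
  moreover have "\<forall>\<^sub>F L in sequentially. \<forall>\<^sub>F N in sequentially.
      ?K * ((real N + 2 * ?D) ^ ?n - (real N - 4 * ?D * (real L + 2 * ?D) - 2 * ?D - 4) ^ ?n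
      * ((real L - 4 * ?D - 2) / (real L + 2 * ?D + 1)) ^ ?n) \<le> \<epsilon> * real N ^ ?n"
    using assms D by (intro eventually_gap_small) auto
  ultimately show ?thesis
  proof eventually_elim
    case (elim L)
    have "\<forall>\<^sub>F N in sequentially. \<delta> * real L + ?D + 2 < \<delta>' * real N"
      "\<forall>\<^sub>F N in sequentially. 4 * ?D * (real L + 2 * ?D) + 2 * ?D + 4 < real N"
      using assms(5) by real_asymp+
    with elim(3) show ?case
    proof eventually_elim
      case elN: (elim N)
      interpret two_frames u w "real L" "\<delta> * real L" "real N" "\<delta>' * real N"
        using assms(1-3) elim(1,2) elN by unfold_locales auto
      have "3 ^ CARD('d) * measure lebesgue gap \<le> 3 ^ CARD('d) * ((4 * ?D + 4) * ((real N + 2 * ?D) ^ ?n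
         - (real N - 4 * ?D * spacing - 2 * ?D - 4) ^ ?n * ((real L - 4 * ?D - 2) / (spacing + 1)) ^ ?n))"
        by (intro mult_left_mono gap_volume) auto
      also have "\<dots> \<le> \<epsilon> * real N ^ ?n" using elN(1) by (simp add: spacing_def mult.assoc)
      finally have g: "3 ^ CARD('d) * measure lebesgue gap \<le> \<epsilon> * real N ^ ?n" .
      have "good_tiling u w \<delta> \<delta>' \<epsilon> L N tiles"
        unfolding good_tiling_def
      proof (intro conjI allI impI ballI)
        show "finite tiles" "card tiles * real L ^ ?n \<le> real N ^ ?n" using card_tiles by auto
        show "region u L (\<delta> * L) z \<inter> region u L (\<delta> * L) z' = {}" if "z \<in> tiles" "z' \<in> tiles" "z \<noteq> z'" for z z'
          using tiles_disjoint that by blast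
        fix q \<beta> :: real and J :: "'d edge \<Rightarrow> real"
        assume "1 \<le> q" "0 \<le> \<beta>" "\<forall>e\<in>wired. 0 \<le> J e \<and> J e \<le> 1"
        then have "rect_cost q \<beta> w N (\<delta>' * N) 0 J \<le> (\<Sum>z\<in>tiles. rect_cost q \<beta> u L (\<delta> * L) z J) + \<beta> * (3 ^ CARD('d) * measure lebesgue gap)"
          by (intro rect_cost_tiles) auto
        also have "\<dots> \<le> (\<Sum>z\<in>tiles. rect_cost q \<beta> u L (\<delta> * L) z J) + \<beta> * (\<epsilon> * real N ^ ?n)"
          using g \<open>0 \<le> \<beta>\<close> by (intro add_left_mono mult_left_mono)
        finally show "rect_cost q \<beta> w N (\<delta>' * N) 0 J \<le> (\<Sum>z\<in>tiles. rect_cost q \<beta> u L (\<delta> * L) z J) + \<beta> * (\<epsilon> * real N ^ ?n)" .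
      qed
      then show ?case by blast
    qed
  qed
qed

section \<open>Translation invariance\<close>

definition shift :: "int ^ 'd \<Rightarrow> ('d::finite) edge \<Rightarrow> 'd edge" where
  "shift z e = (\<lambda>v. v + z) ` e"

lemma inj_shift: "inj_on (shift z) A"
  unfolding shift_def by (rule inj_onI) (metis inj_image_eq_iff add_right_imp_eq injI)

lemma inj_image_shift: "inj_on ((`) (shift z)) X"
  by (rule inj_onI) (simp add: inj_image_eq_iff[OF inj_shift])

lemma shift_doubleton: "shift z {x, y} = {x + z, y + z}"
  by (simp add: shift_def)

lemma shift_shift [simp]: "shift z (shift (- z) e) = e" "shift (- z) (shift z e) = e"
  by (simp_all add: shift_def image_image)

lemma shift_wired:
  fixes e :: "('d::finite) edge"
  shows "shift z e \<in> wired \<longleftrightarrow> e \<in> wired"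
proof -
  have *: "shift z e \<in> wired" if e: "e \<in> wired" for z and e :: "'d edge"
  proof -
    obtain x y where "e = {x, y}" "x \<sim>\<^sub>Z y" using e unfolding wired_def lattice_edges_def by blast
    then have "shift z e = {x + z, y + z}" "x + z \<sim>\<^sub>Z y + z"
      by (simp_all add: shift_doubleton adjacent_def emb_diff[symmetric])
    then show ?thesis by (simp add: wired_def lattice_edges_doubleton)
  qed
  show ?thesis using *[of e z] *[of "shift z e" "- z"] unfolding shift_shift by blast
qed

lemma joined_shift_imp: "joined F x y \<Longrightarrow> joined (shift z ` F) (x + z) (y + z)"
proof (erule joined_invariant)
  fix u v assume "{u, v} \<in> F" and j: "joined (shift z ` F) (x + z) (u + z)"
  then have "{u + z, v + z} \<in> shift z ` F" by (simp flip: shift_doubleton)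
  then show "joined (shift z ` F) (x + z) (v + z)" using joined_trans[OF j joined_edge] by blast
qed simp

lemma joined_shift: "joined (shift z ` F) (x + z) (y + z) \<longleftrightarrow> joined F x y"
  using joined_shift_imp[of F x y z] joined_shift_imp[of "shift z ` F" "x + z" "y + z" "- z"]
  by (auto simp: image_image)

lemma cluster_shift: "cluster (shift z ` F) (x + z) = (\<lambda>v. v + z) ` cluster F x"
proof (intro equalityI subsetI)
  fix y assume "y \<in> cluster (shift z ` F) (x + z)"
  then have "joined (shift z ` F) (x + z) ((y - z) + z)" by (simp add: cluster_def)
  then have "joined F x (y - z)" by (simp only: joined_shift)
  then show "y \<in> (\<lambda>v. v + z) ` cluster F x" unfolding cluster_def by (intro image_eqI[of _ _ "y - z"]) auto
qed (auto simp: cluster_def joined_shift)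

lemma num_clusters_shift: "num_clusters (shift z ` E) wired (shift z ` \<omega>) = num_clusters E wired \<omega>"
proof -
  have w: "wired = shift z ` wired"
    using shift_wired[of z] shift_wired[of "- z"] by (auto simp: image_iff) (metis shift_shift(1))
  have "(shift z ` \<omega> \<inter> shift z ` E) \<union> (wired - shift z ` E) = shift z ` ((\<omega> \<inter> E) \<union> (wired - E))"
    by (subst w) (simp add: image_Un image_Int[OF inj_shift] image_set_diff[OF inj_shift])
  then have "num_clusters (shift z ` E) wired (shift z ` \<omega>) = card (cluster (shift z ` ((\<omega> \<inter> E) \<union> (wired - E))) ` \<Union>(shift z ` E))"
    by (simp add: num_clusters_def cluster_def)
  also have "\<Union>(shift z ` E) = (\<lambda>v. v + z) ` \<Union>E" by (auto simp: shift_def)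
  also have "cluster (shift z ` ((\<omega> \<inter> E) \<union> (wired - E))) ` (\<lambda>v. v + z) ` \<Union>E
     = (`) (\<lambda>v. v + z) ` cluster ((\<omega> \<inter> E) \<union> (wired - E)) ` \<Union>E"
    by (simp add: image_image cluster_shift)
  also have "card \<dots> = card (cluster ((\<omega> \<inter> E) \<union> (wired - E)) ` \<Union>E)"
    by (intro card_image inj_onI) (metis inj_image_eq_iff add_right_imp_eq injI)
  finally show ?thesis by (simp add: num_clusters_def cluster_def)
qed

lemma rc_tot_shift:
  "rc_tot q (shift z ` E) x ((`) (shift z) ` A) = rc_tot q E (\<lambda>e. x (shift z e)) A"
proof -
  have "Pow (shift z ` E) \<inter> (`) (shift z) ` A = (`) (shift z) ` (Pow E \<inter> A)"
  proof (intro equalityI subsetI)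
    fix \<eta> assume "\<eta> \<in> Pow (shift z ` E) \<inter> (`) (shift z) ` A"
    then obtain \<omega> where "\<omega> \<in> A" "\<eta> = shift z ` \<omega>" "shift z ` \<omega> \<subseteq> shift z ` E" by auto
    then show "\<eta> \<in> (`) (shift z) ` (Pow E \<inter> A)" by (auto simp: inj_image_subset_iff[OF inj_shift])
  qed auto
  then have "rc_tot q (shift z ` E) x ((`) (shift z) ` A) = (\<Sum>\<omega>\<in>Pow E \<inter> A. rc_wt q (shift z ` E) x (shift z ` \<omega>))"
    unfolding rc_tot_def
    by (simp add: sum.reindex[OF inj_image_shift])
  also have "\<dots> = (\<Sum>\<omega>\<in>Pow E \<inter> A. rc_wt q E (\<lambda>e. x (shift z e)) \<omega>)"
    by (intro sum.cong refl) (simp add: rc_wt_def num_clusters_shift prod.reindex[OF inj_shift] o_def)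
  finally show ?thesis by (simp add: rc_tot_def)
qed

lemma adjacent_shift: "(x + z) \<sim>\<^sub>Z (y + z) \<longleftrightarrow> x \<sim>\<^sub>Z y"
  by (simp add: adjacent_def emb_diff[symmetric])

lemma lattice_edges_shift: "lattice_edges ((\<lambda>v. v + z) ` \<Lambda>) = shift z ` lattice_edges \<Lambda>"
proof (intro equalityI subsetI)
  fix e assume "e \<in> lattice_edges ((\<lambda>v. v + z) ` \<Lambda>)"
  then obtain x y where "x \<in> \<Lambda>" "y \<in> \<Lambda>" "e = {x + z, y + z}" "(x + z) \<sim>\<^sub>Z (y + z)"
    unfolding lattice_edges_def by blast
  then have "{x, y} \<in> lattice_edges \<Lambda>" "e = shift z {x, y}"
    unfolding adjacent_shift lattice_edges_doubleton shift_doubleton by auto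
  then show "e \<in> shift z ` lattice_edges \<Lambda>" by blast
next
  fix e assume "e \<in> shift z ` lattice_edges \<Lambda>"
  then obtain x y where "e = {x + z, y + z}" "x \<in> \<Lambda>" "y \<in> \<Lambda>" "x \<sim>\<^sub>Z y"
    unfolding lattice_edges_def using shift_doubleton[of z] by blast
  then show "e \<in> lattice_edges ((\<lambda>v. v + z) ` \<Lambda>)"
    by (simp add: lattice_edges_doubleton adjacent_shift)
qed

lemma bdry_shift: "v + z \<in> bdry ((\<lambda>v. v + z) ` \<Lambda>) \<longleftrightarrow> v \<in> bdry \<Lambda>"
proof -
  have m: "y + z \<in> (\<lambda>v. v + z) ` \<Lambda> \<longleftrightarrow> y \<in> \<Lambda>" for y by auto
  have "(\<exists>y. y \<notin> (\<lambda>v. v + z) ` \<Lambda> \<and> y \<sim>\<^sub>Z v + z) \<longleftrightarrow> (\<exists>y. y + z \<notin> (\<lambda>v. v + z) ` \<Lambda> \<and> y + z \<sim>\<^sub>Z v + z)"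
    by (metis diff_add_cancel)
  then show ?thesis unfolding bdry_def mem_Collect_eq m adjacent_shift by blast
qed

lemma sep_shift:
  "sep ((\<lambda>v. v + z) ` \<Lambda>) \<sigma> = (`) (shift z) ` sep \<Lambda> (\<lambda>v. \<sigma> (v + z))"
proof -
  have iff: "shift z ` \<omega> \<in> sep ((\<lambda>v. v + z) ` \<Lambda>) \<sigma> \<longleftrightarrow> \<omega> \<in> sep \<Lambda> (\<lambda>v. \<sigma> (v + z))" for \<omega>
  proof -
    have b: "(\<exists>y\<in>bdry ((\<lambda>v. v + z) ` \<Lambda>). R y) \<longleftrightarrow> (\<exists>y\<in>bdry \<Lambda>. R (y + z))" for R
    proof
      assume "\<exists>y\<in>bdry ((\<lambda>v. v + z) ` \<Lambda>). R y"
      then obtain y where "y - z + z \<in> bdry ((\<lambda>v. v + z) ` \<Lambda>)" "R (y - z + z)" by auto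
      then show "\<exists>y\<in>bdry \<Lambda>. R (y + z)" unfolding bdry_shift by blast
    next
      assume "\<exists>y\<in>bdry \<Lambda>. R (y + z)"
      then show "\<exists>y\<in>bdry ((\<lambda>v. v + z) ` \<Lambda>). R y" using bdry_shift by blast
    qed
    show ?thesis unfolding sep_def lattice_edges_shift
      unfolding b joined_shift mem_Collect_eq inj_image_subset_iff[OF inj_shift[of z UNIV]] by (rule refl)
  qed
  show ?thesis
  proof (intro equalityI subsetI)
    fix \<omega> assume w: "\<omega> \<in> sep ((\<lambda>v. v + z) ` \<Lambda>) \<sigma>"
    define \<eta> where "\<eta> = shift (- z) ` \<omega>"
    have e: "shift z ` \<eta> = \<omega>" by (simp add: \<eta>_def image_image)
    have "\<eta> \<in> sep \<Lambda> (\<lambda>v. \<sigma> (v + z))" using w iff[of \<eta>] by (simp only: e)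
    then have "shift z ` \<eta> \<in> (`) (shift z) ` sep \<Lambda> (\<lambda>v. \<sigma> (v + z))" by (rule imageI)
    then show "\<omega> \<in> (`) (shift z) ` sep \<Lambda> (\<lambda>v. \<sigma> (v + z))" by (simp only: e)
  next
    fix \<omega> assume "\<omega> \<in> (`) (shift z) ` sep \<Lambda> (\<lambda>v. \<sigma> (v + z))"
    then show "\<omega> \<in> sep ((\<lambda>v. v + z) ` \<Lambda>) \<sigma>" using iff by blast
  qed
qed

lemma region_shift:
  fixes u :: "nat \<Rightarrow> real ^ 'd::finite"
  assumes "frame u" "0 < L" "0 < h"
  shows "region u L h z = (\<lambda>v. v + z) ` region u L h 0"
proof -
  interpret frame_loc u by unfold_locales fact
  have iff: "v + z \<in> region u L h z \<longleftrightarrow> v \<in> region u L h 0" for v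
    using assms by (simp add: region_iff slab_iff emb_diff[symmetric])
  show ?thesis
  proof (intro equalityI subsetI)
    fix v assume "v \<in> region u L h z"
    then have "v - z + z \<in> region u L h z" by simp
    then have "v - z \<in> region u L h 0" unfolding iff .
    then have "(v - z) + z \<in> (\<lambda>v. v + z) ` region u L h 0" by (rule imageI)
    then show "v \<in> (\<lambda>v. v + z) ` region u L h 0" by simp
  qed (use iff in blast)
qed

lemma rect_cost_shift:
  fixes u :: "nat \<Rightarrow> real ^ 'd::finite"
  assumes "frame u" "0 < L" "0 < h"
  shows "rect_cost q \<beta> u L h z J = rect_cost q \<beta> u L h 0 (\<lambda>e. J (shift z e))"
proof -
  have s: "(\<lambda>v. above u z (v + z)) = above u 0"
    by (simp add: above_def emb_diff[symmetric] fun_eq_iff)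
  have o: "(\<lambda>e. odds \<beta> J (shift z e)) = odds \<beta> (\<lambda>e. J (shift z e))" by (simp add: odds_def fun_eq_iff)
  have "(`) (shift z) ` UNIV = (UNIV :: 'd edge set set)"
  proof (intro equalityI subsetI)
    fix \<omega> :: "'d edge set"
    have "\<omega> = shift z ` (shift (- z) ` \<omega>)" by (simp add: image_image)
    then show "\<omega> \<in> (`) (shift z) ` UNIV" by (metis UNIV_I imageI)
  qed simp
  then have U: "rc_tot q (shift z ` E) x UNIV = rc_tot q E (\<lambda>e. x (shift z e)) UNIV" for E :: "'d edge set" and x
    using rc_tot_shift[of q z E x UNIV] by simp
  show ?thesis
    unfolding rect_cost_def cost_def rc_pr_def region_shift[OF assms, of z] lattice_edges_shift sep_shift s rc_tot_shift U o by (rule refl)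
qed

section \<open>Concentration below the mean on product spaces\<close>

lemma log_lower: "0 < (s::real) \<Longrightarrow> 0 < t \<Longrightarrow> s - t \<le> s * ln (s / t)"
proof -
  assume st: "0 < s" "0 < t"
  have "ln (t / s) \<le> t / s - 1" using st by (intro ln_le_minus_one) auto
  then have "s * ln (t / s) \<le> s * (t / s - 1)" using st by (intro mult_left_mono) auto
  moreover have "ln (s / t) = - ln (t / s)" using st by (simp add: ln_div)
  ultimately show ?thesis using st by (simp add: algebra_simps)
qed

lemma (in prob_space) integrable_bounded:
  fixes f :: "'a \<Rightarrow> real"
  assumes "f \<in> borel_measurable M" "\<And>x. \<bar>f x\<bar> \<le> B"
  shows "integrable M f"
  using assms by (intro integrable_const_bound[of f B]) auto

lemma (in prob_space) expectation_bounds: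
  fixes f :: "'a \<Rightarrow> real"
  assumes "f \<in> borel_measurable M" "\<And>x. a \<le> f x" "\<And>x. f x \<le> b"
  shows "a \<le> expectation f" "expectation f \<le> b"
proof -
  have i: "integrable M f"
    by (rule integrable_bounded[of f "max \<bar>a\<bar> \<bar>b\<bar>"]) (use assms(1) in auto, use assms(2,3) in \<open>smt (verit)\<close>)
  show "a \<le> expectation f" "expectation f \<le> b"
    using integral_mono[OF integrable_const i, of a] integral_mono[OF i integrable_const, of b] assms(2,3)
    by (auto simp: prob_space)
qed

lemma log_ratio_bound:
  fixes a b s t :: real
  assumes "0 < a" "a \<le> s" "s \<le> b" "a \<le> t" "t \<le> b"
  shows "\<bar>s * ln (s / t)\<bar> \<le> b * ln (b / a)" "\<bar>s * ln (s / t) - s + t\<bar> \<le> b * ln (b / a) + 2 * b"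
    "\<bar>s * ln s\<bar> \<le> b * (\<bar>ln a\<bar> + \<bar>ln b\<bar>)"
proof -
  have ln: "ln a \<le> ln s" "ln s \<le> ln b" "ln a \<le> ln t" "ln t \<le> ln b"
    using assms by auto
  have "\<bar>ln (s / t)\<bar> \<le> ln (b / a)"
  proof -
    have "ln (s / t) = ln s - ln t" "ln (b / a) = ln b - ln a" using assms by (auto simp: ln_div)
    then show ?thesis using ln by linarith
  qed
  then show 1: "\<bar>s * ln (s / t)\<bar> \<le> b * ln (b / a)"
    unfolding abs_mult using assms by (intro mult_mono) auto
  show "\<bar>s * ln (s / t) - s + t\<bar> \<le> b * ln (b / a) + 2 * b"
    using 1 assms by linarith
  have "\<bar>ln s\<bar> \<le> \<bar>ln a\<bar> + \<bar>ln b\<bar>" using ln by linarith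
  then show "\<bar>s * ln s\<bar> \<le> b * (\<bar>ln a\<bar> + \<bar>ln b\<bar>)"
    unfolding abs_mult using assms by (intro mult_mono) auto
qed

text \<open>
  The variational formula for the entropy, with the constant \<open>C\<close> as trial value: the difference of both sides is
  \<open>C - E - E log (C / E)\<close>, where \<open>E\<close> is the mean of \<open>Y\<close>.
\<close>

lemma (in prob_space) entropy_one:
  fixes Y :: "'a \<Rightarrow> real"
  assumes Y: "Y \<in> borel_measurable M" "\<And>x. a \<le> Y x" "\<And>x. Y x \<le> b" and a: "0 < a" and C: "a \<le> C" "C \<le> b"
  shows "expectation (\<lambda>x. Y x * ln (Y x)) - expectation Y * ln (expectation Y)
     \<le> expectation (\<lambda>x. Y x * ln (Y x / C) - Y x + C)"
proof -
  have iY: "integrable M Y" using Y a by (intro integrable_bounded[of Y b]) (auto, smt (verit))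
  have iL: "integrable M (\<lambda>x. Y x * ln (Y x))"
    using Y log_ratio_bound(3)[OF a Y(2,3) C] by (intro integrable_bounded[where B="b * (\<bar>ln a\<bar> + \<bar>ln b\<bar>)"]) auto
  have pos: "0 < Y x" for x using Y(2)[of x] a by linarith
  have g: "0 < expectation Y" using expectation_bounds(1)[OF Y] a by linarith
  have "(\<lambda>x. Y x * ln (Y x / C) - Y x + C) = (\<lambda>x. Y x * ln (Y x) - Y x * (ln C + 1) + C)"
    using pos a C by (intro ext) (simp add: ln_div algebra_simps)
  then have "expectation (\<lambda>x. Y x * ln (Y x / C) - Y x + C)
     = expectation (\<lambda>x. Y x * ln (Y x)) - expectation Y * (ln C + 1) + C"
    using iY iL by (simp add: prob_space)
  moreover have "expectation Y - C \<le> expectation Y * ln (expectation Y / C)"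
    using g a C by (intro log_lower) auto
  then have "expectation Y - C \<le> expectation Y * (ln (expectation Y) - ln C)"
    using g a C by (simp add: ln_div)
  ultimately show ?thesis by (simp add: algebra_simps)
qed

text \<open>
  Convexity of \<open>(s, t) \<mapsto> s log (s / t) - s + t\<close>.
\<close>

lemma (in prob_space) log_sum:
  fixes Y C :: "'a \<Rightarrow> real"
  assumes Y: "Y \<in> borel_measurable M" "\<And>x. a \<le> Y x" "\<And>x. Y x \<le> b" and a: "0 < a"
    and C: "C \<in> borel_measurable M" "\<And>x. a \<le> C x" "\<And>x. C x \<le> b"
  shows "expectation Y * ln (expectation Y / expectation C) - expectation Y + expectation C
     \<le> expectation (\<lambda>x. Y x * ln (Y x / C x) - Y x + C x)"
proof -
  have iY: "integrable M Y" using Y a by (intro integrable_bounded[of Y b]) (auto, smt (verit))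
  have iC: "integrable M C" using C a by (intro integrable_bounded[of C b]) (auto, smt (verit))
  have iL: "integrable M (\<lambda>x. Y x * ln (Y x / C x))"
    using Y C log_ratio_bound(1)[OF a Y(2,3) C(2,3)] by (intro integrable_bounded[where B="b * ln (b / a)"]) auto
  define g c where "g = expectation Y" and "c = expectation C"
  have gc: "0 < g" "0 < c"
    using expectation_bounds(1)[OF Y] expectation_bounds(1)[OF C] a by (auto simp: g_def c_def)
  have "Y x * ln (g / c) + Y x - C x * (g / c) \<le> Y x * ln (Y x / C x)" for x
  proof -
    have p: "0 < Y x" "0 < C x" using Y(2)[of x] C(2)[of x] a by linarith+
    have "Y x - C x * (g / c) \<le> Y x * ln (Y x / (C x * (g / c)))" using p gc by (intro log_lower) auto
    also have "ln (Y x / (C x * (g / c))) = ln (Y x / C x) - ln (g / c)"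
      using p gc by (simp add: ln_div ln_mult)
    finally show ?thesis by (simp add: algebra_simps)
  qed
  then have "expectation (\<lambda>x. Y x * ln (g / c) + Y x - C x * (g / c)) \<le> expectation (\<lambda>x. Y x * ln (Y x / C x))"
    using iY iC iL by (intro integral_mono) auto
  moreover have "expectation (\<lambda>x. Y x * ln (g / c) + Y x - C x * (g / c)) = g * ln (g / c) + g - c * (g / c)"
    using iY iC by (simp add: g_def c_def)
  moreover have "c * (g / c) = g" using gc by simp
  moreover have "expectation (\<lambda>x. Y x * ln (Y x / C x) - Y x + C x) = expectation (\<lambda>x. Y x * ln (Y x / C x)) - g + c"
    using iY iC iL by (simp add: g_def c_def)
  ultimately show ?thesis by (simp add: g_def c_def)
qed

text \<open>
  Entropy on a product is at most the sum of the entropies in the single coordinates. Here each of these is already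
  replaced by the variational bound with a trial value \<open>C i\<close> that does not depend on coordinate \<open>i\<close>. The induction
  integrates one coordinate at a time: \<open>entropy_one\<close> handles the new coordinate, and by \<open>log_sum\<close> averaging over it only
  decreases the terms of the others.
\<close>

theorem entropy_tensorization:
  fixes Y :: "('i \<Rightarrow> 'b) \<Rightarrow> real"
  assumes M: "prob_space M" and I: "finite I"
    and Y: "Y \<in> borel_measurable (PiM I (\<lambda>_. M))" "\<And>x. a \<le> Y x" "\<And>x. Y x \<le> b" and a: "0 < a"
    and C: "\<And>i. i \<in> I \<Longrightarrow> C i \<in> borel_measurable (PiM I (\<lambda>_. M))" "\<And>i x. a \<le> C i x" "\<And>i x. C i x \<le> b"
    and indep: "\<And>i x y. i \<in> I \<Longrightarrow> C i (x(i := y)) = C i x"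
  shows "(\<integral>x. Y x * ln (Y x) \<partial>PiM I (\<lambda>_. M)) - (\<integral>x. Y x \<partial>PiM I (\<lambda>_. M)) * ln (\<integral>x. Y x \<partial>PiM I (\<lambda>_. M))
     \<le> (\<Sum>i\<in>I. \<integral>x. Y x * ln (Y x / C i x) - Y x + C i x \<partial>PiM I (\<lambda>_. M))"
  using I Y C indep
proof (induction I arbitrary: Y C rule: finite_induct)
  case empty
  interpret m: prob_space M by (rule M)
  interpret product_prob_space "\<lambda>_::'i. M" "UNIV :: 'i set" by unfold_locales
  show ?case by (simp add: PiM_empty lebesgue_integral_count_space_finite)
next
  case (insert k I)
  interpret m: prob_space M by (rule M)
  interpret product_prob_space "\<lambda>_::'i. M" "UNIV :: 'i set" by unfold_locales
  let ?P = "PiM I (\<lambda>_. M)" and ?Q = "PiM (insert k I) (\<lambda>_. M)"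
  interpret pI: prob_space ?P by (intro prob_space_PiM M)
  interpret pQ: prob_space ?Q by (intro prob_space_PiM M)
  have upd: "(\<lambda>p. (fst p)(k := snd p)) \<in> measurable (?P \<Otimes>\<^sub>M M) ?Q"
    using measurable_add_dim[of k I "\<lambda>_. M"] by (simp add: case_prod_beta')
  have joint: "(\<lambda>p. f ((fst p)(k := snd p))) \<in> borel_measurable (?P \<Otimes>\<^sub>M M)"
    if "f \<in> borel_measurable ?Q" for f :: "_ \<Rightarrow> real"
    using measurable_compose[OF upd that] .
  have sect: "(\<lambda>y. f (x(k := y))) \<in> borel_measurable M" if "f \<in> borel_measurable ?Q" "x \<in> space ?P" for f :: "_ \<Rightarrow> real" and x
    using measurable_Pair2[OF joint[OF that(1)] that(2)] by simp
  have int: "(\<lambda>x. \<integral>y. f (x(k := y)) \<partial>M) \<in> borel_measurable ?P" if "f \<in> borel_measurable ?Q" for f :: "_ \<Rightarrow> real"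
    using m.borel_measurable_lebesgue_integral[of "\<lambda>x y. f (x(k := y))" ?P] joint[OF that] by (simp add: case_prod_beta')
  have fub: "(\<integral>x. f x \<partial>?Q) = (\<integral>x. (\<integral>y. f (x(k := y)) \<partial>M) \<partial>?P)"
    if "f \<in> borel_measurable ?Q" "\<And>x. \<bar>f x\<bar> \<le> B" for f :: "_ \<Rightarrow> real" and B
    using insert.hyps pQ.integrable_bounded[OF that] by (intro product_integral_insert) auto
  have bd: "\<bar>\<integral>y. f (x(k := y)) \<partial>M\<bar> \<le> B" if "\<And>x. \<bar>f x\<bar> \<le> B" for f :: "_ \<Rightarrow> real" and x B
  proof (cases "integrable M (\<lambda>y. f (x(k := y)))")
    case True
    have "\<bar>\<integral>y. f (x(k := y)) \<partial>M\<bar> \<le> (\<integral>y. \<bar>f (x(k := y))\<bar> \<partial>M)" by (rule integral_abs_bound)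
    also have "\<dots> \<le> (\<integral>y. B \<partial>M)" using True that by (intro integral_mono) auto
    finally show ?thesis by (simp add: m.prob_space)
  next
    case False
    then show ?thesis using that[of x] by (simp add: not_integrable_integral_eq)
  qed
  note Y = insert.prems(1-3) and C = insert.prems(4-6) and ind = insert.prems(7)
  have b0: "a \<le> b" using Y(2,3) order_trans by blast
  \<comment> \<open>The average over the new coordinate, kept within the bounds where it is undefined.\<close>
  define clip where "clip f = (\<lambda>x. max a (min b (\<integral>y. f (x(k := y)) \<partial>M)))" for f :: "('i \<Rightarrow> 'b) \<Rightarrow> real"
  have clip_eq: "clip f x = (\<integral>y. f (x(k := y)) \<partial>M)"
    if "f \<in> borel_measurable ?Q" "\<And>x. a \<le> f x" "\<And>x. f x \<le> b" "x \<in> space ?P" for f x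
    using m.expectation_bounds[OF sect[OF that(1,4)] that(2,3)] by (simp add: clip_def)
  have clip_meas: "clip f \<in> borel_measurable ?P" if "f \<in> borel_measurable ?Q" for f
    unfolding clip_def using int[OF that] by simp
  have clip_bd: "a \<le> clip f x" "clip f x \<le> b" for f x using b0 by (auto simp: clip_def)
  let ?g = "clip Y"
  have IH: "(\<integral>x. ?g x * ln (?g x) \<partial>?P) - (\<integral>x. ?g x \<partial>?P) * ln (\<integral>x. ?g x \<partial>?P)
     \<le> (\<Sum>i\<in>I. \<integral>x. ?g x * ln (?g x / clip (C i) x) - ?g x + clip (C i) x \<partial>?P)"
  proof (rule insert.IH)
    show "clip (C i) (x(i := y)) = clip (C i) x" if "i \<in> I" for i x y
    proof -
      have "i \<noteq> k" using that insert.hyps by auto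
      then have "C i (x(i := y, k := z)) = C i (x(k := z, i := y))" for z by (subst fun_upd_twist) auto
      also have "C i (x(k := z, i := y)) = C i (x(k := z))" for z using that by (intro ind) simp
      finally have "C i (x(i := y, k := z)) = C i (x(k := z))" for z .
      then show ?thesis by (simp only: clip_def)
    qed
  qed (use Y(1) C(1) in \<open>auto intro!: clip_meas clip_bd\<close>)
  let ?BL = "b * (\<bar>ln a\<bar> + \<bar>ln b\<bar>)" and ?BC = "b * ln (b / a) + 2 * b"
  have mL: "(\<lambda>x. Y x * ln (Y x)) \<in> borel_measurable ?Q" using Y by simp
  have bL: "\<bar>Y x * ln (Y x)\<bar> \<le> ?BL" for x using log_ratio_bound(3)[OF a Y(2,3) Y(2,3)] .
  have mC: "(\<lambda>x. Y x * ln (Y x / C i x) - Y x + C i x) \<in> borel_measurable ?Q" if "i \<in> insert k I" for i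
    using Y C(1)[OF that] by simp
  have bC: "\<bar>Y x * ln (Y x / C i x) - Y x + C i x\<bar> \<le> ?BC" for x i
    using log_ratio_bound(2)[OF a Y(2,3) C(2,3)] .
  have EY: "(\<integral>x. Y x \<partial>?Q) = (\<integral>x. ?g x \<partial>?P)"
  proof -
    have "\<bar>Y x\<bar> \<le> b" for x using Y(2,3)[of x] a by auto
    then have "(\<integral>x. Y x \<partial>?Q) = (\<integral>x. (\<integral>y. Y (x(k := y)) \<partial>M) \<partial>?P)" using Y(1) by (intro fub)
    also have "\<dots> = (\<integral>x. ?g x \<partial>?P)" by (intro Bochner_Integration.integral_cong refl clip_eq[OF Y, symmetric])
    finally show ?thesis .
  qed
  have iL: "integrable ?P (\<lambda>x. \<integral>y. Y (x(k := y)) * ln (Y (x(k := y))) \<partial>M)"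
    by (rule pI.integrable_bounded[OF int[OF mL]]) (rule bd[of "\<lambda>x. Y x * ln (Y x)", OF bL])
  have ig: "integrable ?P (\<lambda>x. ?g x * ln (?g x))"
    using log_ratio_bound(3)[OF a clip_bd[of Y] clip_bd[of Y]] clip_meas[OF Y(1)]
    by (intro pI.integrable_bounded[where B="?BL"]) auto
  have iC: "integrable ?P (\<lambda>x. \<integral>y. Y (x(k := y)) * ln (Y (x(k := y)) / C i (x(k := y))) - Y (x(k := y)) + C i (x(k := y)) \<partial>M)"
    if "i \<in> insert k I" for i
    by (rule pI.integrable_bounded[OF int[OF mC[OF that]]]) (rule bd[of "\<lambda>x. Y x * ln (Y x / C i x) - Y x + C i x", OF bC])
  have one: "(\<integral>x. (\<integral>y. Y (x(k := y)) * ln (Y (x(k := y))) \<partial>M) - ?g x * ln (?g x) \<partial>?P)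
     \<le> (\<integral>x. Y x * ln (Y x / C k x) - Y x + C k x \<partial>?Q)"
  proof -
    have "(\<integral>x. (\<integral>y. Y (x(k := y)) * ln (Y (x(k := y))) \<partial>M) - ?g x * ln (?g x) \<partial>?P)
       \<le> (\<integral>x. (\<integral>y. Y (x(k := y)) * ln (Y (x(k := y)) / C k (x(k := y))) - Y (x(k := y)) + C k (x(k := y)) \<partial>M) \<partial>?P)"
    proof (rule integral_mono)
      fix x assume x: "x \<in> space ?P"
      have Ck: "C k (x(k := y)) = C k x" for y by (rule ind) simp
      show "(\<integral>y. Y (x(k := y)) * ln (Y (x(k := y))) \<partial>M) - ?g x * ln (?g x)
        \<le> (\<integral>y. Y (x(k := y)) * ln (Y (x(k := y)) / C k (x(k := y))) - Y (x(k := y)) + C k (x(k := y)) \<partial>M)"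
        unfolding clip_eq[OF Y x] Ck by (rule m.entropy_one[OF sect[OF Y(1) x] Y(2,3) a C(2,3)])
    next
      show "integrable ?P (\<lambda>x. (\<integral>y. Y (x(k := y)) * ln (Y (x(k := y))) \<partial>M) - ?g x * ln (?g x))"
        using iL ig by (rule Bochner_Integration.integrable_diff)
    qed (rule iC, simp)
    also have "\<dots> = (\<integral>x. Y x * ln (Y x / C k x) - Y x + C k x \<partial>?Q)"
      by (rule fub[OF mC bC, symmetric]) simp
    finally show ?thesis .
  qed
  have rest: "(\<integral>x. ?g x * ln (?g x / clip (C i) x) - ?g x + clip (C i) x \<partial>?P)
     \<le> (\<integral>x. Y x * ln (Y x / C i x) - Y x + C i x \<partial>?Q)" if i: "i \<in> I" for i
  proof -
    have i': "i \<in> insert k I" using i by simp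
    have "(\<integral>x. ?g x * ln (?g x / clip (C i) x) - ?g x + clip (C i) x \<partial>?P)
       \<le> (\<integral>x. (\<integral>y. Y (x(k := y)) * ln (Y (x(k := y)) / C i (x(k := y))) - Y (x(k := y)) + C i (x(k := y)) \<partial>M) \<partial>?P)"
    proof (rule integral_mono)
      show "integrable ?P (\<lambda>x. ?g x * ln (?g x / clip (C i) x) - ?g x + clip (C i) x)"
        using log_ratio_bound(2)[OF a clip_bd[of Y] clip_bd[of "C i"]] clip_meas[OF Y(1)] clip_meas[OF C(1)[OF i']]
        by (intro pI.integrable_bounded[where B="?BC"]) auto
      fix x assume x: "x \<in> space ?P"
      show "?g x * ln (?g x / clip (C i) x) - ?g x + clip (C i) x
        \<le> (\<integral>y. Y (x(k := y)) * ln (Y (x(k := y)) / C i (x(k := y))) - Y (x(k := y)) + C i (x(k := y)) \<partial>M)"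
        unfolding clip_eq[OF Y x] clip_eq[OF C(1)[OF i'] C(2,3) x]
        by (rule m.log_sum[OF sect[OF Y(1) x] Y(2,3) a sect[OF C(1)[OF i'] x] C(2,3)])
    qed (rule iC[OF i'])
    also have "\<dots> = (\<integral>x. Y x * ln (Y x / C i x) - Y x + C i x \<partial>?Q)"
      by (rule fub[OF mC[OF i'] bC, symmetric])
    finally show ?thesis .
  qed
  have "(\<integral>x. Y x * ln (Y x) \<partial>?Q) = (\<integral>x. (\<integral>y. Y (x(k := y)) * ln (Y (x(k := y))) \<partial>M) \<partial>?P)"
    by (rule fub[OF mL bL])
  then have "(\<integral>x. Y x * ln (Y x) \<partial>?Q) - (\<integral>x. Y x \<partial>?Q) * ln (\<integral>x. Y x \<partial>?Q)
     = (\<integral>x. (\<integral>y. Y (x(k := y)) * ln (Y (x(k := y))) \<partial>M) - ?g x * ln (?g x) \<partial>?P)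
       + ((\<integral>x. ?g x * ln (?g x) \<partial>?P) - (\<integral>x. ?g x \<partial>?P) * ln (\<integral>x. ?g x \<partial>?P))"
    unfolding EY using iL ig by simp
  also have "\<dots> \<le> (\<integral>x. Y x * ln (Y x / C k x) - Y x + C k x \<partial>?Q) + (\<Sum>i\<in>I. \<integral>x. Y x * ln (Y x / C i x) - Y x + C i x \<partial>?Q)"
    by (intro add_mono one order_trans[OF IH] sum_mono rest)
  finally show ?case using insert.hyps by simp
qed

lemma exp_quadratic: "0 \<le> u \<Longrightarrow> u \<le> 1 \<Longrightarrow> exp u - 1 - u \<le> (u::real)\<^sup>2"
  using exp_bound[of u] by simp

lemma exp_quadratic_abs: "\<bar>u\<bar> \<le> 1 \<Longrightarrow> exp u \<le> 1 + u + (u::real)\<^sup>2"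
proof (cases "0 \<le> u")
  case False
  assume u: "\<bar>u\<bar> \<le> 1"
  define v where "v = - u"
  have v: "0 \<le> v" "v \<le> 1" using False u by (auto simp: v_def)
  have "1 + v + v\<^sup>2 / 2 \<le> exp v" using exp_lower_Taylor_quadratic[OF v(1)] by simp
  moreover have "1 \<le> (1 - v + v\<^sup>2) * (1 + v + v\<^sup>2 / 2)"
  proof -
    have "(1 - v + v\<^sup>2) * (1 + v + v\<^sup>2 / 2) = 1 + v\<^sup>2 * (1/2 + v / 2 + v\<^sup>2 / 2)"
      by (simp add: field_simps power2_eq_square)
    then show ?thesis using v by simp
  qed
  moreover have "0 < 1 - v + v\<^sup>2" using v by (smt (verit) zero_less_power2 zero_le_power2 power_one)
  ultimately have "1 \<le> (1 - v + v\<^sup>2) * exp v" by (meson less_imp_le mult_left_mono order_trans)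
  then have "exp (- v) \<le> 1 - v + v\<^sup>2" by (simp add: exp_minus field_simps)
  then show ?thesis by (simp add: v_def)
qed (use exp_bound[of u] in auto)

text \<open>
  Apply the entropy bound to \<open>Y = exp (- l Z)\<close> with \<open>exp (- l W\<^sub>i)\<close> as trial values. In place of a differential
  inequality in \<open>l\<close>, the entropy is compared with the Laplace transform at \<open>l / 2\<close> by Jensen's inequality.
\<close>

lemma laplace_halving:
  fixes Z :: "('i \<Rightarrow> 'b) \<Rightarrow> real"
  assumes M: "prob_space M" and I: "finite I"
    and Z: "Z \<in> borel_measurable (PiM I (\<lambda>_. M))" "\<And>x. \<bar>Z x\<bar> \<le> B"
    and W: "\<And>i. i \<in> I \<Longrightarrow> W i \<in> borel_measurable (PiM I (\<lambda>_. M))" "\<And>i x y. i \<in> I \<Longrightarrow> W i (x(i := y)) = W i x"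
    and drop: "\<And>i x. W i x \<le> Z x" "\<And>i x. Z x - W i x \<le> b" "\<And>x. (\<Sum>i\<in>I. (Z x - W i x)\<^sup>2) \<le> V"
    and l: "0 < l" "l * b \<le> 1"
  shows "ln (\<integral>x. exp (- l * Z x) \<partial>PiM I (\<lambda>_. M)) \<le> 2 * ln (\<integral>x. exp (- (l / 2) * Z x) \<partial>PiM I (\<lambda>_. M)) + l\<^sup>2 * V"
proof -
  let ?P = "PiM I (\<lambda>_. M)"
  interpret P: prob_space ?P by (intro prob_space_PiM M)
  have B0: "0 \<le> B" using Z(2)[of undefined] by linarith
  have b0: "0 \<le> b" using drop(1)[of _ undefined] drop(2)[of undefined] by (meson diff_ge_0_iff_ge order_trans)
  define Y where "Y x = exp (- l * Z x)" for x
  define C where "C i x = exp (- l * W i x)" for i x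
  have pos: "0 < Y x" for x by (simp add: Y_def)
  have Yb: "exp (- (l * (B + b))) \<le> Y x" "Y x \<le> exp (l * (B + b))" for x
  proof -
    have "- (B + b) \<le> Z x" "Z x \<le> B + b" using Z(2)[of x] b0 by linarith+
    then have "l * - (B + b) \<le> l * Z x" "l * Z x \<le> l * (B + b)" using l(1) by (intro mult_left_mono; simp)+
    then show "exp (- (l * (B + b))) \<le> Y x" "Y x \<le> exp (l * (B + b))" by (auto simp: Y_def algebra_simps)
  qed
  have Cb: "exp (- (l * (B + b))) \<le> C i x" "C i x \<le> exp (l * (B + b))" for i x
  proof -
    have "- (B + b) \<le> W i x" "W i x \<le> B + b" using Z(2)[of x] b0 drop(1)[of i x] drop(2)[of x i] by linarith+
    then have "l * - (B + b) \<le> l * W i x" "l * W i x \<le> l * (B + b)" using l(1) by (intro mult_left_mono; simp)+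
    then show "exp (- (l * (B + b))) \<le> C i x" "C i x \<le> exp (l * (B + b))" by (auto simp: C_def algebra_simps)
  qed
  have mY: "Y \<in> borel_measurable ?P" unfolding Y_def using Z(1) by simp
  have mC: "C i \<in> borel_measurable ?P" if "i \<in> I" for i unfolding C_def using W(1)[OF that] by simp
  have iY: "integrable ?P Y" using mY Yb(2) pos by (intro P.integrable_bounded[where B="exp (l * (B + b))"]) (auto simp: less_imp_le)
  have iZY: "integrable ?P (\<lambda>x. Z x * Y x)"
  proof (rule P.integrable_bounded)
    show "\<bar>Z x * Y x\<bar> \<le> B * exp (l * (B + b))" for x
      unfolding abs_mult using Z(2)[of x] Yb(2)[of x] pos[of x] B0 by (intro mult_mono) auto
  qed (use Z(1) mY in simp)
  define G A where "G = (\<integral>x. Y x \<partial>?P)" and "A = (\<integral>x. Z x * Y x \<partial>?P)"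
  have G: "0 < G" using P.expectation_bounds(1)[OF mY Yb] unfolding G_def by (smt (verit) exp_gt_zero)
  \<comment> \<open>Entropy of \<open>Y\<close>: the relative drop \<open>v = l (Z - W\<^sub>i)\<close> enters through \<open>exp v - 1 - v \<le> v\<^sup>2\<close>.\<close>
  have piece: "(\<integral>x. Y x * ln (Y x / C i x) - Y x + C i x \<partial>?P) \<le> (\<integral>x. l\<^sup>2 * (Z x - W i x)\<^sup>2 * Y x \<partial>?P)" if i: "i \<in> I" for i
  proof (rule integral_mono)
    show "integrable ?P (\<lambda>x. Y x * ln (Y x / C i x) - Y x + C i x)"
      using mY mC[OF i] log_ratio_bound(2)[OF _ Yb Cb] by (intro P.integrable_bounded) auto
    show "integrable ?P (\<lambda>x. l\<^sup>2 * (Z x - W i x)\<^sup>2 * Y x)"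
    proof (rule P.integrable_bounded)
      show "\<bar>l\<^sup>2 * (Z x - W i x)\<^sup>2 * Y x\<bar> \<le> l\<^sup>2 * b\<^sup>2 * exp (l * (B + b))" for x
        unfolding abs_mult using drop(1)[of i x] drop(2)[of x i] Yb(2)[of x] pos[of x]
        by (intro mult_mono) (auto intro!: power_mono)
    qed (use Z(1) W(1)[OF i] mY in simp)
    fix x
    define v where "v = l * (Z x - W i x)"
    have "v \<le> l * b" unfolding v_def using drop(2)[of x i] l by (intro mult_left_mono) auto
    then have v: "0 \<le> v" "v \<le> 1" using drop(1)[of i x] l by (simp add: v_def, linarith)
    have "C i x = Y x * exp v" by (simp add: C_def Y_def v_def algebra_simps flip: exp_add)
    moreover have "ln (Y x / C i x) = - v" unfolding \<open>C i x = Y x * exp v\<close> using pos[of x] by (simp add: ln_div ln_mult)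
    ultimately have "Y x * ln (Y x / C i x) - Y x + C i x = Y x * (exp v - 1 - v)" by (simp add: algebra_simps)
    also have "\<dots> \<le> Y x * v\<^sup>2" using exp_quadratic[OF v] pos[of x] by (intro mult_left_mono) auto
    finally show "Y x * ln (Y x / C i x) - Y x + C i x \<le> l\<^sup>2 * (Z x - W i x)\<^sup>2 * Y x"
      by (simp add: v_def power_mult_distrib mult_ac)
  qed
  have iW: "integrable ?P (\<lambda>x. l\<^sup>2 * (Z x - W i x)\<^sup>2 * Y x)" if i: "i \<in> I" for i
  proof (rule P.integrable_bounded)
    show "\<bar>l\<^sup>2 * (Z x - W i x)\<^sup>2 * Y x\<bar> \<le> l\<^sup>2 * b\<^sup>2 * exp (l * (B + b))" for x
      unfolding abs_mult using drop(1)[of i x] drop(2)[of x i] Yb(2)[of x] pos[of x]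
      by (intro mult_mono) (auto intro!: power_mono)
  qed (use Z(1) W(1)[OF i] mY in simp)
  have "(\<integral>x. Y x * ln (Y x) \<partial>?P) - G * ln G \<le> (\<Sum>i\<in>I. \<integral>x. Y x * ln (Y x / C i x) - Y x + C i x \<partial>?P)"
    unfolding G_def
    by (rule entropy_tensorization[OF M I mY Yb _ mC Cb]) (use W(2) in \<open>auto simp: C_def simp del: fun_upd_apply\<close>)
  also have "\<dots> \<le> (\<Sum>i\<in>I. \<integral>x. l\<^sup>2 * (Z x - W i x)\<^sup>2 * Y x \<partial>?P)" by (intro sum_mono piece)
  also have "\<dots> = (\<integral>x. (\<Sum>i\<in>I. l\<^sup>2 * (Z x - W i x)\<^sup>2 * Y x) \<partial>?P)"
    by (rule Bochner_Integration.integral_sum[symmetric, OF iW])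
  also have "\<dots> \<le> (\<integral>x. l\<^sup>2 * V * Y x \<partial>?P)"
  proof (rule integral_mono)
    fix x
    have "(\<Sum>i\<in>I. l\<^sup>2 * (Z x - W i x)\<^sup>2 * Y x) = l\<^sup>2 * (\<Sum>i\<in>I. (Z x - W i x)\<^sup>2) * Y x"
      by (simp add: sum_distrib_left sum_distrib_right)
    also have "\<dots> \<le> l\<^sup>2 * V * Y x" using drop(3)[of x] pos[of x] by (intro mult_right_mono mult_left_mono) auto
    finally show "(\<Sum>i\<in>I. l\<^sup>2 * (Z x - W i x)\<^sup>2 * Y x) \<le> l\<^sup>2 * V * Y x" .
  qed (use iY iW in auto)
  also have "\<dots> = l\<^sup>2 * V * G" by (simp add: G_def)
  also have "(\<integral>x. Y x * ln (Y x) \<partial>?P) = - l * A"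
  proof -
    have "(\<lambda>x. Y x * ln (Y x)) = (\<lambda>x. - l * (Z x * Y x))" by (simp add: Y_def fun_eq_iff)
    then show ?thesis unfolding A_def by (simp only: Bochner_Integration.integral_mult_right_zero)
  qed
  finally have ent: "- l * A - G * ln G \<le> l\<^sup>2 * V * G" .
  \<comment> \<open>Jensen under the measure with density \<open>Y / G\<close>, where \<open>m\<close> is the mean of \<open>(l / 2) Z\<close>.\<close>
  define m where "m = (l / 2) * (A / G)"
  have "exp m * ((1 - m) * G + (l / 2) * A) \<le> (\<integral>x. exp (- (l / 2) * Z x) \<partial>?P)"
  proof -
    have "exp m * ((1 - m) * G + (l / 2) * A) = (\<integral>x. exp m * ((1 - m) * Y x + (l / 2) * (Z x * Y x)) \<partial>?P)"
      using iY iZY by (simp add: G_def A_def)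
    also have "\<dots> \<le> (\<integral>x. exp (- (l / 2) * Z x) \<partial>?P)"
    proof (rule integral_mono)
      show "integrable ?P (\<lambda>x. exp m * ((1 - m) * Y x + (l / 2) * (Z x * Y x)))" using iY iZY by simp
      show "integrable ?P (\<lambda>x. exp (- (l / 2) * Z x))"
      proof (rule P.integrable_bounded)
        show "\<bar>exp (- (l / 2) * Z x)\<bar> \<le> exp (l / 2 * B)" for x
        proof -
          have "- Z x \<le> B" using Z(2)[of x] by linarith
          then have "l / 2 * - Z x \<le> l / 2 * B" using l(1) by (intro mult_left_mono) auto
          then show ?thesis by simp
        qed
      qed (use Z(1) in simp)
      fix x
      have "1 + (l / 2 * Z x - m) \<le> exp (l / 2 * Z x - m)" by (rule exp_ge_add_one_self)
      then have "(exp m * Y x) * (1 + (l / 2 * Z x - m)) \<le> (exp m * Y x) * exp (l / 2 * Z x - m)"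
        using pos[of x] by (intro mult_left_mono) auto
      also have "\<dots> = exp (- (l / 2) * Z x)" by (simp add: Y_def algebra_simps flip: exp_add)
      finally show "exp m * ((1 - m) * Y x + (l / 2) * (Z x * Y x)) \<le> exp (- (l / 2) * Z x)"
        by (simp add: algebra_simps)
    qed
    finally show ?thesis .
  qed
  moreover have "(1 - m) * G + (l / 2) * A = G" using G by (simp add: m_def field_simps)
  ultimately have "exp m * G \<le> (\<integral>x. exp (- (l / 2) * Z x) \<partial>?P)" by simp
  moreover have "0 < exp m * G" using G by simp
  ultimately have "ln (exp m * G) \<le> ln (\<integral>x. exp (- (l / 2) * Z x) \<partial>?P)" by (meson ln_le_cancel_iff less_le_trans)
  then have j: "m + ln G \<le> ln (\<integral>x. exp (- (l / 2) * Z x) \<partial>?P)" using G by (simp add: ln_mult)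
  have "- l * (A / G) - ln G \<le> l\<^sup>2 * V"
    using ent G by (simp add: field_simps)
  then show ?thesis using j by (simp add: m_def G_def Y_def)
qed

text \<open>
  Iterate the halving down to \<open>l / 2 ^ n\<close>, where the Laplace transform is governed by the mean; the errors form a geometric
  series. Then Markov's inequality. Here \<open>W i\<close> is a lower bound of \<open>Z\<close> that ignores coordinate \<open>i\<close>.
\<close>

theorem concentration_below:
  fixes Z :: "('i \<Rightarrow> 'b) \<Rightarrow> real"
  assumes M: "prob_space M" and I: "finite I"
    and Z: "Z \<in> borel_measurable (PiM I (\<lambda>_. M))" "\<And>x. \<bar>Z x\<bar> \<le> B"
    and W: "\<And>i. i \<in> I \<Longrightarrow> W i \<in> borel_measurable (PiM I (\<lambda>_. M))" "\<And>i x y. i \<in> I \<Longrightarrow> W i (x(i := y)) = W i x"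
    and drop: "\<And>i x. W i x \<le> Z x" "\<And>i x. Z x - W i x \<le> b" "\<And>x. (\<Sum>i\<in>I. (Z x - W i x)\<^sup>2) \<le> V"
    and l: "0 < l" "l * b \<le> 1"
  shows "measure (PiM I (\<lambda>_. M)) {x\<in>space (PiM I (\<lambda>_. M)). Z x \<le> (\<integral>x. Z x \<partial>PiM I (\<lambda>_. M)) - t}
     \<le> exp (- l * t + 2 * l\<^sup>2 * V)"
proof -
  let ?P = "PiM I (\<lambda>_. M)"
  interpret P: prob_space ?P by (intro prob_space_PiM M)
  define E where "E = (\<integral>x. Z x \<partial>?P)"
  define G where "G h = (\<integral>x. exp (- h * Z x) \<partial>?P)" for h
  have B0: "0 \<le> B" using Z(2)[of undefined] by linarith
  have b0: "0 \<le> b" using drop(1)[of _ undefined] drop(2)[of undefined] by (meson diff_ge_0_iff_ge order_trans)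
  have V0: "0 \<le> V" using drop(3)[of undefined] sum_nonneg[of I "\<lambda>i. (Z undefined - W i undefined)\<^sup>2"] by simp
  have iZ: "integrable ?P Z" using Z by (rule P.integrable_bounded)
  have iE: "integrable ?P (\<lambda>x. exp (- h * Z x))" if "0 \<le> h" for h
  proof (rule P.integrable_bounded)
    show "\<bar>exp (- h * Z x)\<bar> \<le> exp (h * B)" for x
    proof -
      have "- Z x \<le> B" using Z(2)[of x] by linarith
      then have "h * - Z x \<le> h * B" using that by (intro mult_left_mono) auto
      then show ?thesis by simp
    qed
  qed (use Z(1) in simp)
  have Gpos: "0 < G h" if "0 \<le> h" for h
  proof -
    have "exp (- h * B) \<le> exp (- h * Z x)" for x
      using Z(2)[of x] that by (auto intro!: mult_left_mono)
    then have "(\<integral>x. exp (- h * B) \<partial>?P) \<le> G h" unfolding G_def using iE[OF that] by (intro integral_mono) auto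
    moreover have "(\<integral>x. exp (- h * B) \<partial>?P) = exp (- h * B)" by (simp add: P.prob_space)
    ultimately show ?thesis using exp_gt_zero[of "- h * B"] by linarith
  qed
  have halve: "ln (G (l / 2 ^ k)) \<le> 2 * ln (G (l / 2 ^ Suc k)) + (l / 2 ^ k)\<^sup>2 * V" for k
  proof -
    have "l / 2 ^ k * b \<le> l * b" using l(1) b0 by (intro mult_right_mono) (auto simp: field_simps)
    then have "l / 2 ^ k * b \<le> 1" using l(2) by linarith
    from laplace_halving[OF M I Z W drop _ this] l(1) show ?thesis by (simp add: G_def mult.commute)
  qed
  have iter: "ln (G l) \<le> 2 ^ n * ln (G (l / 2 ^ n)) + 2 * l\<^sup>2 * V * (1 - (1/2) ^ n)" for n
  proof (induction n)
    case (Suc n)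
    have "2 ^ n * ln (G (l / 2 ^ n)) \<le> 2 ^ n * (2 * ln (G (l / 2 ^ Suc n)) + (l / 2 ^ n)\<^sup>2 * V)"
      using halve by (intro mult_left_mono) auto
    also have "\<dots> = 2 ^ Suc n * ln (G (l / 2 ^ Suc n)) + l\<^sup>2 * V * (1/2) ^ n"
      by (simp add: distrib_left power_divide power2_eq_square)
    finally show ?case using Suc by (simp add: algebra_simps)
  qed simp
  have small: "2 ^ n * ln (G (l / 2 ^ n)) \<le> - l * E + l\<^sup>2 * B\<^sup>2 * (1/2) ^ n" if "l * B \<le> 2 ^ n" for n
  proof -
    let ?h = "l / 2 ^ n"
    have h: "0 \<le> ?h" using l(1) by simp
    have q: "exp (- ?h * Z x) \<le> 1 + (- ?h * Z x) + ?h\<^sup>2 * B\<^sup>2" for x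
    proof -
      have "\<bar>?h * Z x\<bar> \<le> ?h * B" unfolding abs_mult using h Z(2)[of x] by (intro mult_mono) auto
      also have "\<dots> \<le> 1" using that by (simp add: field_simps)
      finally have "exp (- ?h * Z x) \<le> 1 + (- ?h * Z x) + (- ?h * Z x)\<^sup>2" by (intro exp_quadratic_abs) simp
      also have "(- ?h * Z x)\<^sup>2 = ?h\<^sup>2 * (Z x)\<^sup>2" by (simp only: power_mult_distrib power2_minus)
      also have "?h\<^sup>2 * (Z x)\<^sup>2 \<le> ?h\<^sup>2 * B\<^sup>2"
        using Z(2)[of x] abs_le_square_iff[of "Z x" B] B0 by (intro mult_left_mono) auto
      finally show ?thesis by simp
    qed
    have "G ?h \<le> (\<integral>x. 1 + (- ?h * Z x) + ?h\<^sup>2 * B\<^sup>2 \<partial>?P)"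
      unfolding G_def using iE[OF h] iZ q by (intro integral_mono) auto
    also have "\<dots> = 1 + (- ?h * E + ?h\<^sup>2 * B\<^sup>2)" using iZ by (simp add: E_def P.prob_space)
    finally have "G ?h - 1 \<le> - ?h * E + ?h\<^sup>2 * B\<^sup>2" by simp
    moreover have "ln (G ?h) \<le> G ?h - 1" using Gpos[OF h] by (rule ln_le_minus_one)
    ultimately have "ln (G ?h) \<le> - ?h * E + ?h\<^sup>2 * B\<^sup>2" by linarith
    then have "2 ^ n * ln (G ?h) \<le> 2 ^ n * (- ?h * E + ?h\<^sup>2 * B\<^sup>2)" by (intro mult_left_mono) auto
    also have "\<dots> = - l * E + l\<^sup>2 * B\<^sup>2 * (1/2) ^ n"
      by (simp add: field_simps power2_eq_square)
    finally show ?thesis .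
  qed
  have lnG: "ln (G l) \<le> - l * E + 2 * l\<^sup>2 * V"
  proof (rule LIMSEQ_le_const)
    show "(\<lambda>n. - l * E + l\<^sup>2 * B\<^sup>2 * (1/2) ^ n + 2 * l\<^sup>2 * V) \<longlonglongrightarrow> - l * E + 2 * l\<^sup>2 * V"
      by (auto intro!: tendsto_eq_intros LIMSEQ_realpow_zero)
    obtain n0 where n0: "l * B < 2 ^ n0" using real_arch_pow[of 2 "l * B"] by auto
    have "ln (G l) \<le> - l * E + l\<^sup>2 * B\<^sup>2 * (1/2) ^ n + 2 * l\<^sup>2 * V" if "n0 \<le> n" for n
    proof -
      have "(2::real) ^ n0 \<le> 2 ^ n" using that by simp
      then have "l * B \<le> 2 ^ n" using n0 by linarith
      moreover have "2 * l\<^sup>2 * V * (1 - (1/2) ^ n) \<le> 2 * l\<^sup>2 * V * 1" using V0 by (intro mult_left_mono) auto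
      ultimately show ?thesis using small[of n] iter[of n] by linarith
    qed
    then show "\<exists>N. \<forall>n\<ge>N. ln (G l) \<le> - l * E + l\<^sup>2 * B\<^sup>2 * (1/2) ^ n + 2 * l\<^sup>2 * V" by blast
  qed
  have "P.prob {x \<in> space ?P. Z x \<le> E - t} = P.prob {x \<in> space ?P. exp (- l * (E - t)) \<le> exp (- l * Z x)}"
    using l(1) by (simp add: mult_le_cancel_left)
  also have "\<dots> \<le> G l / exp (- l * (E - t))"
    unfolding G_def using iE[of l] l(1) by (intro integral_Markov_inequality_measure[where A="{}"]) auto
  also have "exp (- l * (E - t)) = inverse (exp (l * (E - t)))" by (simp add: exp_minus[symmetric] algebra_simps)
  also have "G l / inverse (exp (l * (E - t))) = exp (ln (G l)) * exp (l * (E - t))" using Gpos[of l] l(1) by (simp add: divide_inverse)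
  also have "\<dots> \<le> exp (- l * E + 2 * l\<^sup>2 * V) * exp (l * (E - t))" using lnG by (intro mult_right_mono) auto
  also have "\<dots> = exp (- l * t + 2 * l\<^sup>2 * V)" by (simp add: algebra_simps flip: exp_add)
  finally show ?thesis unfolding E_def .
qed

section \<open>The lower tail of the disconnection cost\<close>

text \<open>
  Couplings lie in \<open>[0, 1]\<close> almost surely only. After clipping all bounds hold for every \<open>J\<close>; almost-sure
  arguments are confined to the comparison with the surface tension itself.
\<close>

definition clip :: "('e \<Rightarrow> real) \<Rightarrow> 'e \<Rightarrow> real" where
  "clip J e = max 0 (min 1 (J e))"

lemma clip_bounds: "0 \<le> clip J e" "clip J e \<le> 1"
  by (auto simp: clip_def)

lemma clip_upd_0: "clip (J(e := 0)) = (clip J)(e := 0)"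
  by (auto simp: clip_def fun_eq_iff)

lemma clip_id: "0 \<le> J e \<Longrightarrow> J e \<le> 1 \<Longrightarrow> clip J e = J e"
  by (simp add: clip_def)

lemma rc_tot_cong: "(\<And>e. e \<in> E \<Longrightarrow> x e = y e) \<Longrightarrow> rc_tot q E x A = rc_tot q E y A"
  unfolding rc_tot_def rc_wt_def by (intro sum.cong arg_cong2[where f="(*)"] prod.cong refl) auto

lemma cost_cong: "(\<And>e. e \<in> E \<Longrightarrow> J e = J' e) \<Longrightarrow> cost q E A \<beta> J = cost q E A \<beta> J'"
  unfolding cost_def rc_pr_def using rc_tot_cong[of E "odds \<beta> J" "odds \<beta> J'" q] by (simp add: odds_def)

context rc_region
begin

lemma rc_tot_measurable:
  assumes "\<And>e. e \<in> E \<Longrightarrow> (\<lambda>x. X x e) \<in> borel_measurable M"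
  shows "(\<lambda>x. rc_tot q E (X x) A) \<in> borel_measurable M"
  unfolding rc_tot_def rc_wt_def
  using assms by (intro borel_measurable_sum borel_measurable_times borel_measurable_prod) auto

lemma cost_measurable:
  assumes "\<And>e. e \<in> E \<Longrightarrow> (\<lambda>x. J x e) \<in> borel_measurable M" "s \<in> borel_measurable M"
  shows "(\<lambda>x. cost q E A (s x) (J x)) \<in> borel_measurable M"
  unfolding cost_def rc_pr_def odds_def using assms
  by (intro borel_measurable_uminus borel_measurable_ln borel_measurable_divide rc_tot_measurable) auto

lemma influence_continuous:
  assumes J: "\<And>e. e \<in> E \<Longrightarrow> 0 \<le> J e" and A: "{} \<in> A" and S: "S \<subseteq> {0..}"
  shows "continuous_on S (\<lambda>s. influence (odds s J) A e)"
proof -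
  have "0 < rc_tot q E (odds s J) A \<and> 0 < rc_tot q E (odds s J) UNIV" if "s \<in> S" for s
    using that S J A by (intro conjI rc_tot_pos odds_nonneg) auto
  moreover have "continuous_on S (\<lambda>s. rc_tot q E (odds s J) B)" "continuous_on S (\<lambda>s. rc_open (odds s J) B e)" for B
    unfolding rc_tot_def rc_open_def rc_wt_def odds_def by (intro continuous_intros)+
  ultimately show ?thesis unfolding influence_def by (intro continuous_intros) force+
qed

text \<open>
  Averaging over inverse temperatures is what makes the changes due to single edges summable: the derivative of the
  cost is bounded by surface order on average over inverse temperatures.
\<close>

definition mean_cost :: "'d edge set set \<Rightarrow> real \<Rightarrow> real \<Rightarrow> ('d edge \<Rightarrow> real) \<Rightarrow> real" where
  "mean_cost A \<beta>' \<beta> J = (LINT s|lborel. indicator {\<beta>'..\<beta>} s *\<^sub>R cost q E A s (clip J)) / (\<beta> - \<beta>')"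

context
  fixes A :: "'d edge set set" and \<beta>' \<beta> :: real
  assumes A: "decreasing E A" "{} \<in> A" and b: "0 < \<beta>'" "\<beta>' < \<beta>"
begin

lemma cost_continuous: "continuous_on {\<beta>'..\<beta>} (\<lambda>s. cost q E A s (clip J))"
proof (rule DERIV_continuous_on)
  fix s assume "s \<in> {\<beta>'..\<beta>}"
  then show "((\<lambda>s. cost q E A s (clip J)) has_field_derivative
      (\<Sum>e\<in>E. clip J e * exp (s * clip J e) * influence (odds s (clip J)) A e)) (at s within {\<beta>'..\<beta>})"
    using b A by (intro cost_derivative) (auto simp: clip_bounds)
qed

lemma cost_integrable: "integrable lborel (\<lambda>s. indicator {\<beta>'..\<beta>} s *\<^sub>R cost q E A s (clip J))"
  using borel_integrable_compact[OF compact_Icc cost_continuous] by (simp add: set_integrable_def)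

lemma mean_const: "(LINT s|lborel. indicator {\<beta>'..\<beta>} s *\<^sub>R c) = (\<beta> - \<beta>') * (c :: real)"
  using b by simp

lemma mean_cost_bounds: "cost q E A \<beta>' (clip J) \<le> mean_cost A \<beta>' \<beta> J" "mean_cost A \<beta>' \<beta> J \<le> cost q E A \<beta> (clip J)"
proof -
  have int: "integrable lborel (\<lambda>s. indicator {\<beta>'..\<beta>} s *\<^sub>R (c :: real))" for c
    by (intro borel_integrable_compact compact_Icc continuous_on_const)
  have "cost q E A \<beta>' (clip J) \<le> cost q E A s (clip J)" "cost q E A s (clip J) \<le> cost q E A \<beta> (clip J)" if "s \<in> {\<beta>'..\<beta>}" for s
    using that b A by (auto intro!: cost_mono simp: clip_bounds)
  then have "(LINT s|lborel. indicator {\<beta>'..\<beta>} s *\<^sub>R cost q E A \<beta>' (clip J)) \<le> (LINT s|lborel. indicator {\<beta>'..\<beta>} s *\<^sub>R cost q E A s (clip J))"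
    "(LINT s|lborel. indicator {\<beta>'..\<beta>} s *\<^sub>R cost q E A s (clip J)) \<le> (LINT s|lborel. indicator {\<beta>'..\<beta>} s *\<^sub>R cost q E A \<beta> (clip J))"
    by (intro integral_mono cost_integrable int; simp add: indicator_def)+
  then show "cost q E A \<beta>' (clip J) \<le> mean_cost A \<beta>' \<beta> J" "mean_cost A \<beta>' \<beta> J \<le> cost q E A \<beta> (clip J)"
    unfolding mean_const mean_cost_def using b by (auto simp: field_simps)
qed

lemma mean_cost_measurable: "mean_cost A \<beta>' \<beta> \<in> borel_measurable (PiM E (\<lambda>_. M))"
  if M: "sets M = sets (borel :: real measure)"
proof -
  have "(\<lambda>p. cost q E A (snd p) (clip (fst p))) \<in> borel_measurable (PiM E (\<lambda>_. M) \<Otimes>\<^sub>M lborel)"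
  proof (rule cost_measurable)
    fix e assume e: "e \<in> E"
    have "(\<lambda>J. J e) \<in> measurable (PiM E (\<lambda>_. M)) M" using e by (rule measurable_component_singleton)
    then have "(\<lambda>J. J e) \<in> borel_measurable (PiM E (\<lambda>_. M))" using measurable_cong_sets[OF refl M] by blast
    then show "(\<lambda>x. clip (fst x) e) \<in> borel_measurable (PiM E (\<lambda>_. M) \<Otimes>\<^sub>M lborel)"
      unfolding clip_def by (intro borel_measurable_max borel_measurable_min borel_measurable_const)
        (rule measurable_compose[OF measurable_fst])
  qed simp
  then have "(\<lambda>(J, s). indicator {\<beta>'..\<beta>} s *\<^sub>R cost q E A s (clip J)) \<in> borel_measurable (PiM E (\<lambda>_. M) \<Otimes>\<^sub>M lborel)"
    by (simp add: case_prod_beta')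
  then show ?thesis
    unfolding mean_cost_def by (intro borel_measurable_divide lborel.borel_measurable_lebesgue_integral) auto
qed

text \<open>
  The sum of the drops at inverse temperature \<open>s\<close> is at most \<open>\<beta> * exp \<beta>\<close> times the derivative of the cost at \<open>s\<close>,
  and the integral of the derivative is at most the cost at \<open>\<beta>\<close>.
\<close>

lemma mean_cost_drop:
  shows "e \<in> E \<Longrightarrow> mean_cost A \<beta>' \<beta> (J(e := 0)) \<le> mean_cost A \<beta>' \<beta> J"
    and "e \<in> E \<Longrightarrow> mean_cost A \<beta>' \<beta> J - mean_cost A \<beta>' \<beta> (J(e := 0)) \<le> \<beta>"
    and "(\<Sum>e\<in>E. mean_cost A \<beta>' \<beta> J - mean_cost A \<beta>' \<beta> (J(e := 0))) \<le> \<beta> * exp \<beta> * cost q E A \<beta> (clip J) / (\<beta> - \<beta>')"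
proof -
  let ?f = "\<lambda>s. cost q E A s (clip J)" and ?g = "\<lambda>e s. cost q E A s ((clip J)(e := 0))"
  let ?L = "\<lambda>h. LINT s|lborel. indicator {\<beta>'..\<beta>} s *\<^sub>R (h s :: real)"
  have ig: "integrable lborel (\<lambda>s. indicator {\<beta>'..\<beta>} s *\<^sub>R ?g e s)" for e
    using cost_integrable[of "J(e := 0)"] by (simp add: clip_upd_0)
  have diff: "mean_cost A \<beta>' \<beta> J - mean_cost A \<beta>' \<beta> (J(e := 0)) = ?L (\<lambda>s. ?f s - ?g e s) / (\<beta> - \<beta>')" for e
    unfolding mean_cost_def clip_upd_0 diff_divide_distrib[symmetric] scaleR_diff_right
    using cost_integrable ig by simp
  have step: "0 \<le> ?f s - ?g e s" "?f s - ?g e s \<le> s"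
    "?f s - ?g e s \<le> s * exp s * (clip J e * exp (s * clip J e) * influence (odds s (clip J)) A e)"
    if "s \<in> {\<beta>'..\<beta>}" "e \<in> E" for s e
    using cost_close_edge[of "clip J" s A e] that b A by (auto simp: clip_bounds)
  have "0 \<le> ?L (\<lambda>s. ?f s - ?g e s)" if "e \<in> E" for e
    using step(1)[OF _ that] by (intro Bochner_Integration.integral_nonneg) (auto simp: indicator_def)
  then have "0 \<le> mean_cost A \<beta>' \<beta> J - mean_cost A \<beta>' \<beta> (J(e := 0))" if "e \<in> E" for e
    unfolding diff using b that by (intro divide_nonneg_pos) auto
  then show "mean_cost A \<beta>' \<beta> (J(e := 0)) \<le> mean_cost A \<beta>' \<beta> J" if "e \<in> E" for e
    using that by force
  have "?L (\<lambda>s. ?f s - ?g e s) \<le> ?L (\<lambda>s. \<beta>)" if "e \<in> E" for e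
  proof (rule integral_mono)
    show "integrable lborel (\<lambda>s. indicator {\<beta>'..\<beta>} s *\<^sub>R (?f s - ?g e s))"
      unfolding scaleR_diff_right using cost_integrable ig by (rule Bochner_Integration.integrable_diff)
    show "indicator {\<beta>'..\<beta>} s *\<^sub>R (?f s - ?g e s) \<le> indicator {\<beta>'..\<beta>} s *\<^sub>R \<beta>" for s
      using step(2)[OF _ that, of s] by (auto simp: indicator_def)
    show "integrable lborel (\<lambda>s. indicator {\<beta>'..\<beta>} s *\<^sub>R \<beta>)"
      by (intro borel_integrable_compact compact_Icc continuous_on_const)
  qed
  then show "mean_cost A \<beta>' \<beta> J - mean_cost A \<beta>' \<beta> (J(e := 0)) \<le> \<beta>" if "e \<in> E" for e
    using diff[of e] b that unfolding mean_const by (simp add: divide_le_eq mult.commute)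
  let ?D = "\<lambda>s. \<Sum>e\<in>E. clip J e * exp (s * clip J e) * influence (odds s (clip J)) A e"
  have cD: "continuous_on {\<beta>'..\<beta>} ?D"
    using b A by (intro continuous_intros influence_continuous) (auto simp: clip_bounds)
  have iD: "integrable lborel (\<lambda>s. indicator {\<beta>'..\<beta>} s *\<^sub>R ?D s)"
    using borel_integrable_compact[OF compact_Icc cD] by (simp add: set_integrable_def)
  have FTC: "?L ?D = ?f \<beta> - ?f \<beta>'"
  proof (rule integral_FTC_atLeastAtMost)
    show "(?f has_vector_derivative ?D s) (at s within {\<beta>'..\<beta>})" if "\<beta>' \<le> s" "s \<le> \<beta>" for s
      unfolding has_real_derivative_iff_has_vector_derivative[symmetric]
      using b A that by (intro cost_derivative) (auto simp: clip_bounds)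
  qed (use b cD in auto)
  have "(\<Sum>e\<in>E. ?L (\<lambda>s. ?f s - ?g e s)) = (LINT s|lborel. (\<Sum>e\<in>E. indicator {\<beta>'..\<beta>} s *\<^sub>R (?f s - ?g e s)))"
    unfolding scaleR_diff_right using cost_integrable ig by (subst Bochner_Integration.integral_sum) auto
  also have "\<dots> \<le> ?L (\<lambda>s. \<beta> * exp \<beta> * ?D s)"
  proof (rule integral_mono)
    show "integrable lborel (\<lambda>s. \<Sum>e\<in>E. indicator {\<beta>'..\<beta>} s *\<^sub>R (?f s - ?g e s))"
      unfolding scaleR_diff_right using cost_integrable ig
      by (intro Bochner_Integration.integrable_sum Bochner_Integration.integrable_diff)
    show "integrable lborel (\<lambda>s. indicator {\<beta>'..\<beta>} s *\<^sub>R (\<beta> * exp \<beta> * ?D s))"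
      using integrable_mult_right[OF iD, of "\<beta> * exp \<beta>"] by (simp add: mult_ac)
    fix s
    have "(\<Sum>e\<in>E. ?f s - ?g e s) \<le> \<beta> * exp \<beta> * ?D s" if s: "s \<in> {\<beta>'..\<beta>}"
    proof -
      let ?t = "\<lambda>e. clip J e * exp (s * clip J e) * influence (odds s (clip J)) A e"
      have "?f s - ?g e s \<le> \<beta> * exp \<beta> * ?t e" if e: "e \<in> E" for e
      proof -
        have ss: "0 < s * exp s" "s * exp s \<le> \<beta> * exp \<beta>" using s b by (auto intro!: mult_mono)
        have "0 \<le> s * exp s * ?t e" using step(1,3)[OF s e] by linarith
        then have "0 \<le> ?t e" using ss(1) by (simp add: zero_le_mult_iff)
        then have "s * exp s * ?t e \<le> \<beta> * exp \<beta> * ?t e" using ss(2) by (intro mult_right_mono)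
        then show ?thesis using step(3)[OF s e] by linarith
      qed
      then have "(\<Sum>e\<in>E. ?f s - ?g e s) \<le> (\<Sum>e\<in>E. \<beta> * exp \<beta> * ?t e)" by (rule sum_mono)
      then show ?thesis by (simp add: sum_distrib_left)
    qed
    then show "(\<Sum>e\<in>E. indicator {\<beta>'..\<beta>} s *\<^sub>R (?f s - ?g e s)) \<le> indicator {\<beta>'..\<beta>} s *\<^sub>R (\<beta> * exp \<beta> * ?D s)"
      by (cases "s \<in> {\<beta>'..\<beta>}") (simp_all add: indicator_def)
  qed
  also have "\<dots> = \<beta> * exp \<beta> * ?L ?D"
    unfolding Bochner_Integration.integral_mult_right_zero[symmetric] by (intro Bochner_Integration.integral_cong) auto
  also have "\<dots> \<le> \<beta> * exp \<beta> * ?f \<beta>"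
    unfolding FTC using b cost_nonneg[of "clip J" \<beta>' A] A by (intro mult_left_mono) (auto simp: clip_bounds)
  finally show "(\<Sum>e\<in>E. mean_cost A \<beta>' \<beta> J - mean_cost A \<beta>' \<beta> (J(e := 0))) \<le> \<beta> * exp \<beta> * ?f \<beta> / (\<beta> - \<beta>')"
    unfolding diff sum_divide_distrib[symmetric] using b by (intro divide_right_mono) auto
qed

text \<open>
  Concentration is applied to the averaged cost, which lies between the costs at \<open>\<beta>'\<close> and \<open>\<beta>\<close>. Squared drops are
  at most \<open>\<beta>\<close> times the drops.
\<close>

theorem cost_lower_tail:
  assumes M: "prob_space M" "sets M = sets (borel :: real measure)"
    and K: "\<And>J. cost q E A \<beta> (clip J) \<le> K"
    and l: "0 < l" "l * \<beta> \<le> 1"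
  shows "measure (PiM E (\<lambda>_. M)) {J\<in>space (PiM E (\<lambda>_. M)).
        cost q E A \<beta> (clip J) \<le> (\<integral>J. cost q E A \<beta>' (clip J) \<partial>PiM E (\<lambda>_. M)) - t}
     \<le> exp (- l * t + 2 * l\<^sup>2 * (\<beta>\<^sup>2 * exp \<beta> * K / (\<beta> - \<beta>')))"
proof -
  let ?P = "PiM E (\<lambda>_. M)" and ?Z = "mean_cost A \<beta>' \<beta>"
  interpret P: prob_space ?P by (intro prob_space_PiM M)
  define W where "W e = (if e \<in> E then (\<lambda>J. ?Z (J(e := 0))) else ?Z)" for e
  have zero: "0 \<in> space M" using sets_eq_imp_space_eq[OF M(2)] by simp
  have Zm: "?Z \<in> borel_measurable ?P" by (rule mean_cost_measurable[OF M(2)])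
  have c0: "0 \<le> cost q E A \<beta>' (clip J)" for J using A b by (intro cost_nonneg) (auto simp: clip_bounds)
  have Zb: "\<bar>?Z J\<bar> \<le> K" for J using mean_cost_bounds[of J] K[of J] c0[of J] by linarith
  have Wm: "W e \<in> borel_measurable ?P" if "e \<in> E" for e
  proof -
    have "(\<lambda>J. J(e := 0)) \<in> measurable ?P ?P"
    proof (rule measurable_fun_upd[where J = E])
      show "E = E \<union> {e}" using that by auto
      show "(\<lambda>x. 0) \<in> measurable ?P M" using zero by simp
    qed auto
    then show ?thesis unfolding W_def using that measurable_compose Zm by auto
  qed
  have ind: "W e (J(e := y)) = W e J" if "e \<in> E" for e J y using that by (simp add: W_def)
  have drop: "W e J \<le> ?Z J" "?Z J - W e J \<le> \<beta>" for e J
    using mean_cost_drop(1,2)[of e J] b by (auto simp: W_def)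
  have sq: "(\<Sum>e\<in>E. (?Z J - W e J)\<^sup>2) \<le> \<beta>\<^sup>2 * exp \<beta> * K / (\<beta> - \<beta>')" for J
  proof -
    have "(\<Sum>e\<in>E. (?Z J - W e J)\<^sup>2) \<le> (\<Sum>e\<in>E. \<beta> * (?Z J - W e J))"
      unfolding power2_eq_square using drop by (intro sum_mono mult_right_mono) auto
    also have "\<dots> = \<beta> * (\<Sum>e\<in>E. ?Z J - ?Z (J(e := 0)))" by (simp add: sum_distrib_left W_def)
    also have "\<dots> \<le> \<beta> * (\<beta> * exp \<beta> * cost q E A \<beta> (clip J) / (\<beta> - \<beta>'))"
      using mean_cost_drop(3) b by (intro mult_left_mono) auto
    also have "\<dots> \<le> \<beta> * (\<beta> * exp \<beta> * K / (\<beta> - \<beta>'))"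
      using K b by (intro mult_left_mono divide_right_mono) auto
    finally show ?thesis by (simp add: power2_eq_square mult_ac)
  qed
  have cm: "(\<lambda>J. cost q E A s (clip J)) \<in> borel_measurable ?P" for s
  proof (rule cost_measurable)
    fix e assume e: "e \<in> E"
    have "(\<lambda>J. J e) \<in> measurable ?P M" using e by (rule measurable_component_singleton)
    then have "(\<lambda>J. J e) \<in> borel_measurable ?P" using measurable_cong_sets[OF refl M(2)] by blast
    then show "(\<lambda>J. clip J e) \<in> borel_measurable ?P"
      unfolding clip_def by (intro borel_measurable_max borel_measurable_min borel_measurable_const)
  qed simp
  have "(\<integral>J. cost q E A \<beta>' (clip J) \<partial>?P) \<le> (\<integral>J. ?Z J \<partial>?P)"
  proof (rule integral_mono)
    show "integrable ?P (\<lambda>J. cost q E A \<beta>' (clip J))"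
    proof (rule P.integrable_bounded[OF cm])
      show "\<bar>cost q E A \<beta>' (clip J)\<bar> \<le> K" for J using mean_cost_bounds[of J] K[of J] c0[of J] by linarith
    qed
    show "integrable ?P ?Z" by (rule P.integrable_bounded[OF Zm Zb])
  qed (rule mean_cost_bounds)
  then have "{J\<in>space ?P. cost q E A \<beta> (clip J) \<le> (\<integral>J. cost q E A \<beta>' (clip J) \<partial>?P) - t}
      \<subseteq> {J\<in>space ?P. ?Z J \<le> (\<integral>J. ?Z J \<partial>?P) - t}"
  proof safe
    fix J assume "cost q E A \<beta> (clip J) \<le> (\<integral>J. cost q E A \<beta>' (clip J) \<partial>?P) - t"
      "(\<integral>J. cost q E A \<beta>' (clip J) \<partial>?P) \<le> (\<integral>J. ?Z J \<partial>?P)"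
    then show "?Z J \<le> (\<integral>J. ?Z J \<partial>?P) - t" using mean_cost_bounds(2)[of J] by linarith
  qed
  then have "P.prob {J\<in>space ?P. cost q E A \<beta> (clip J) \<le> (\<integral>J. cost q E A \<beta>' (clip J) \<partial>?P) - t}
      \<le> P.prob {J\<in>space ?P. ?Z J \<le> (\<integral>J. ?Z J \<partial>?P) - t}"
    using Zm by (intro P.finite_measure_mono) auto
  also have "\<dots> \<le> exp (- l * t + 2 * l\<^sup>2 * (\<beta>\<^sup>2 * exp \<beta> * K / (\<beta> - \<beta>')))"
    by (rule concentration_below[OF M(1) finE Zm Zb Wm ind drop sq l])
  finally show ?thesis .
qed

end

end

section \<open>Random couplings: stationarity and independence\<close>

text \<open>
  A version of the surface tension that is bounded for all couplings; the two agree almost surely.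
\<close>

definition tension :: "real \<Rightarrow> real \<Rightarrow> (nat \<Rightarrow> real ^ 'd::finite) \<Rightarrow> real \<Rightarrow> nat \<Rightarrow> ('d edge \<Rightarrow> real) \<Rightarrow> real" where
  "tension q \<beta> u \<delta> N J = rect_cost q \<beta> u N (\<delta> * N) 0 (clip J) / real N ^ (CARD('d) - 1)"

locale media =
  fixes \<mu> :: "real measure" and q :: real
  assumes law: "prob_space \<mu>" "sets \<mu> = sets borel" "measure \<mu> {0..1} = 1" and q: "1 \<le> q"
begin

lemma coupling_prob_space: "prob_space (coupling_space \<mu>)"
  unfolding coupling_space_def by (intro prob_space_PiM law)

lemma coupling_space_wired: "coupling_space \<mu> = PiM wired (\<lambda>_. \<mu>)"
  by (simp add: coupling_space_def wired_def)

lemma edge_measurable: "e \<in> E \<Longrightarrow> (\<lambda>J. J e) \<in> borel_measurable (PiM E (\<lambda>_. \<mu>))"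
  using measurable_component_singleton[of e E "\<lambda>_. \<mu>"] measurable_cong_sets[OF refl law(2)] by blast

lemma cost_clip_measurable:
  assumes "rc_region q E" "E \<subseteq> F"
  shows "(\<lambda>J. cost q E A \<beta> (clip J)) \<in> borel_measurable (PiM F (\<lambda>_. \<mu>))"
proof (rule rc_region.cost_measurable[OF assms(1)])
  fix e assume "e \<in> E"
  then have "(\<lambda>J. J e) \<in> borel_measurable (PiM F (\<lambda>_. \<mu>))" using assms(2) by (intro edge_measurable) blast
  then show "(\<lambda>J. clip J e) \<in> borel_measurable (PiM F (\<lambda>_. \<mu>))"
    unfolding clip_def by (intro borel_measurable_max borel_measurable_min borel_measurable_const)
qed simp

lemma lattice_edges_wired: "lattice_edges \<Lambda> \<subseteq> wired"
  unfolding wired_def by (rule lattice_edges_mono) simp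

lemma rect_region: "frame u \<Longrightarrow> 0 < L \<Longrightarrow> 0 < h \<Longrightarrow> rc_region q (lattice_edges (region u L h z))"
  by (intro rc_region_lattice q frame_loc.finite_region frame_loc.intro)

lemma rect_cost_measurable:
  assumes "frame u" "0 < L" "0 < h"
  shows "(\<lambda>J. rect_cost q \<beta> u L h z (clip J)) \<in> borel_measurable (coupling_space \<mu>)"
  unfolding rect_cost_def coupling_space_wired
  by (intro cost_clip_measurable rect_region assms lattice_edges_wired)

lemma rect_cost_cong:
  assumes "\<And>e. e \<in> lattice_edges (region u L h z) \<Longrightarrow> J e = J' e"
  shows "rect_cost q \<beta> u L h z J = rect_cost q \<beta> u L h z J'"
  unfolding rect_cost_def using assms by (intro cost_cong)

lemma restrict_law:
  assumes "E \<subseteq> wired"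
  shows "distr (coupling_space \<mu>) (PiM E (\<lambda>_. \<mu>)) (\<lambda>J. restrict J E) = PiM E (\<lambda>_. \<mu>)"
proof -
  have "(\<lambda>J. restrict J E) = (\<lambda>J. \<lambda>e\<in>E. J (id e))" by (simp add: restrict_def)
  moreover have "id \<in> E \<rightarrow> wired" using assms by auto
  ultimately show ?thesis
    unfolding coupling_space_wired using distr_PiM_reindex[of wired "\<lambda>_. \<mu>" id E] law(1) by simp
qed

lemma shift_measurable:
  "(\<lambda>J. \<lambda>e\<in>wired. J (shift z e)) \<in> measurable (coupling_space \<mu>) (coupling_space \<mu>)"
  unfolding coupling_space_wired
  by (intro measurable_restrict measurable_component_singleton) (simp add: shift_wired)

lemma shift_law:
  "distr (coupling_space \<mu>) (coupling_space \<mu>) (\<lambda>J. \<lambda>e\<in>wired. J (shift z e)) = coupling_space \<mu>"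
  unfolding coupling_space_wired using distr_PiM_reindex[of wired "\<lambda>_. \<mu>" "shift z" wired] law(1) inj_shift[of z]
  by (auto simp: shift_wired)

lemma rect_cost_shift_clip:
  assumes "frame u" "0 < L" "0 < h"
  shows "rect_cost q \<beta> u L h z (clip J) = rect_cost q \<beta> u L h 0 (clip (\<lambda>e\<in>wired. J (shift z e)))"
proof -
  have "rect_cost q \<beta> u L h z (clip J) = rect_cost q \<beta> u L h 0 (\<lambda>e. clip J (shift z e))"
    by (rule rect_cost_shift[OF assms])
  also have "\<dots> = rect_cost q \<beta> u L h 0 (clip (\<lambda>e\<in>wired. J (shift z e)))"
    by (rule rect_cost_cong) (use lattice_edges_wired in \<open>auto simp: clip_def\<close>)
  finally show ?thesis .
qed

lemma rect_cost_prob_shift: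
  fixes u :: "nat \<Rightarrow> real ^ 'd::finite"
  assumes "frame u" "0 < L" "0 < h"
  shows "measure (coupling_space \<mu>) {J\<in>space (coupling_space \<mu>). rect_cost q \<beta> u L h z (clip J) \<le> t}
       = measure (coupling_space \<mu>) {J\<in>space (coupling_space \<mu>). rect_cost q \<beta> u L h 0 (clip J) \<le> t}"
proof -
  let ?M = "coupling_space \<mu> :: ('d edge \<Rightarrow> real) measure" and ?s = "\<lambda>J. \<lambda>e\<in>wired. J (shift z e)"
  let ?A = "{J\<in>space ?M. rect_cost q \<beta> u L h 0 (clip J) \<le> t}"
  have A: "?A \<in> sets ?M" using rect_cost_measurable[OF assms, of \<beta> 0] by simp
  have "measure ?M ?A = measure (distr ?M ?M ?s) ?A" by (simp only: shift_law)
  also have "\<dots> = measure ?M (?s -` ?A \<inter> space ?M)" by (rule measure_distr[OF shift_measurable A])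
  also have "?s -` ?A \<inter> space ?M = {J\<in>space ?M. rect_cost q \<beta> u L h z (clip J) \<le> t}"
    using measurable_space[OF shift_measurable[of z]] by (auto simp: rect_cost_shift_clip[OF assms, of \<beta> z])
  finally show ?thesis by simp
qed

lemma rect_cost_expectation_shift:
  fixes u :: "nat \<Rightarrow> real ^ 'd::finite"
  assumes "frame u" "0 < L" "0 < h"
  shows "(\<integral>J. rect_cost q \<beta> u L h z (clip J) \<partial>coupling_space \<mu>) = (\<integral>J. rect_cost q \<beta> u L h 0 (clip J) \<partial>coupling_space \<mu>)"
proof -
  let ?M = "coupling_space \<mu> :: ('d edge \<Rightarrow> real) measure" and ?s = "\<lambda>J. \<lambda>e\<in>wired. J (shift z e)"
  have "(\<integral>J. rect_cost q \<beta> u L h 0 (clip J) \<partial>?M) = (\<integral>J. rect_cost q \<beta> u L h 0 (clip J) \<partial>distr ?M ?M ?s)"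
    by (simp only: shift_law)
  also have "\<dots> = (\<integral>J. rect_cost q \<beta> u L h 0 (clip (?s J)) \<partial>?M)"
    by (rule integral_distr[OF shift_measurable rect_cost_measurable[OF assms]])
  finally show ?thesis by (simp only: rect_cost_shift_clip[OF assms, of \<beta> z])
qed

lemma indep_couplings:
  "prob_space.indep_vars (coupling_space \<mu>) (\<lambda>_. \<mu>) (\<lambda>e J. J e) (wired :: ('d::finite) edge set)"
proof -
  let ?M = "coupling_space \<mu> :: ('d edge \<Rightarrow> real) measure"
  interpret prob_space ?M by (rule coupling_prob_space)
  show ?thesis
  proof (cases "wired = ({} :: 'd edge set)")
    case True
    then show ?thesis by (simp add: indep_vars_def indep_sets_def)
  next
    case False
    have rv: "(\<lambda>J. J e) \<in> measurable ?M \<mu>" if "e \<in> wired" for e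
      unfolding coupling_space_wired using that by (rule measurable_component_singleton)
    have "distr ?M (PiM wired (\<lambda>_. \<mu>)) (\<lambda>J. \<lambda>e\<in>wired. J e) = PiM wired (\<lambda>e. distr ?M \<mu> (\<lambda>J. J e))"
    proof -
      have "PiM wired (\<lambda>e. distr ?M \<mu> (\<lambda>J. J e)) = PiM wired (\<lambda>_. \<mu>)"
        unfolding coupling_space_wired using law(1) by (intro PiM_cong refl distr_PiM_component)
      moreover have "distr ?M (PiM wired (\<lambda>_. \<mu>)) (\<lambda>J. \<lambda>e\<in>wired. J e) = PiM wired (\<lambda>_. \<mu>)"
        by (rule restrict_law) simp
      ultimately show ?thesis by simp
    qed
    then show ?thesis using False rv by (subst indep_vars_iff_distr_eq_PiM') auto
  qed
qed

lemma indep_tiles: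
  fixes u :: "nat \<Rightarrow> real ^ 'd::finite"
  assumes u: "frame u" "0 < L" "0 < h"
    and disj: "\<And>z z'. z \<in> T \<Longrightarrow> z' \<in> T \<Longrightarrow> z \<noteq> z' \<Longrightarrow> region u L h z \<inter> region u L h z' = {}"
  shows "prob_space.indep_vars (coupling_space \<mu>) (\<lambda>_. borel) (\<lambda>z J. rect_cost q \<beta> u L h z (clip J)) T"
proof -
  let ?M = "coupling_space \<mu> :: ('d edge \<Rightarrow> real) measure"
  interpret prob_space ?M by (rule coupling_prob_space)
  let ?E = "\<lambda>z. lattice_edges (region u L h z)"
  have "disjoint_family_on ?E T"
    unfolding disjoint_family_on_def
  proof (intro ballI impI equals0I)
    fix z z' e assume z: "z \<in> T" "z' \<in> T" "z \<noteq> z'" and e: "e \<in> ?E z \<inter> ?E z'"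
    then obtain x y where "e = {x, y}" "x \<in> region u L h z" by (auto simp: lattice_edges_def)
    moreover from this e have "x \<in> region u L h z'" by (simp add: lattice_edges_doubleton)
    ultimately show False using disj[OF z] by blast
  qed
  then have "indep_vars (\<lambda>z. PiM (?E z) (\<lambda>_. \<mu>)) (\<lambda>z J. restrict (\<lambda>e. J e) (?E z)) T"
    using lattice_edges_wired by (intro indep_vars_restrict[OF indep_couplings])
  then have "indep_vars (\<lambda>_. borel) (\<lambda>z J. rect_cost q \<beta> u L h z (clip (restrict (\<lambda>e. J e) (?E z)))) T"
  proof (rule indep_vars_compose2)
    show "(\<lambda>J. rect_cost q \<beta> u L h z (clip J)) \<in> borel_measurable (PiM (?E z) (\<lambda>_. \<mu>))" for z
      unfolding rect_cost_def by (intro cost_clip_measurable rect_region u order_refl)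
  qed
  moreover have "rect_cost q \<beta> u L h z (clip (restrict (\<lambda>e. J e) (?E z))) = rect_cost q \<beta> u L h z (clip J)" for z J
    by (rule rect_cost_cong) (simp add: clip_def)
  ultimately show ?thesis by simp
qed

lemma coupling_bounds_AE:
  assumes "finite E" "E \<subseteq> (wired :: ('d::finite) edge set)"
  shows "AE J in coupling_space \<mu>. \<forall>e\<in>E. 0 \<le> J e \<and> J e \<le> 1"
proof (rule AE_finite_allI[OF assms(1)])
  fix e assume "e \<in> E"
  then have e: "e \<in> wired" using assms(2) by blast
  interpret prob_space \<mu> by (rule law)
  have "AE x in \<mu>. x \<in> {0..1}" using law(2,3) by (intro AE_prob_1) auto
  then show "AE J in coupling_space \<mu>. 0 \<le> J e \<and> J e \<le> 1"
    unfolding coupling_space_wired using AE_PiM_component[of wired "\<lambda>_. \<mu>" e "\<lambda>x. 0 \<le> x \<and> x \<le> 1"] law(1) e by simp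
qed

lemma surf_tension_AE:
  fixes u :: "nat \<Rightarrow> real ^ 'd::finite"
  assumes "frame u" "0 \<le> \<beta>" "0 < \<delta>" "0 < N"
  shows "AE J in coupling_space \<mu>.
    surf_tension q \<beta> J 0 (real N) (\<delta> * real N) (base_cube u) (u CARD('d)) = tension q \<beta> u \<delta> N J"
proof -
  let ?E = "lattice_edges (region u N (\<delta> * N) 0)"
  have p: "0 < real N" "0 < \<delta> * real N" using assms by auto
  interpret rc_region q ?E by (rule rect_region[OF assms(1) p])
  have "AE J in coupling_space \<mu>. \<forall>e\<in>?E. 0 \<le> J e \<and> J e \<le> 1"
    using finE Ewired by (rule coupling_bounds_AE)
  then show ?thesis
  proof eventually_elim
    case (elim J)
    have "surf_tension q \<beta> J (emb 0) (real N) (\<delta> * real N) (base_cube u) (u CARD('d))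
       = rect_cost q \<beta> u N (\<delta> * N) 0 J / real N ^ (CARD('d) - 1)"
      using elim by (intro surf_tension_eq assms q p) auto
    also have "rect_cost q \<beta> u N (\<delta> * N) 0 J = rect_cost q \<beta> u N (\<delta> * N) 0 (clip J)"
      using elim by (intro rect_cost_cong) (simp add: clip_id)
    finally show ?case by (simp add: tension_def)
  qed
qed

lemma tension_measurable:
  assumes "frame u" "0 < \<delta>" "0 < N"
  shows "tension q \<beta> u \<delta> N \<in> borel_measurable (coupling_space \<mu>)"
  unfolding tension_def using assms by (intro borel_measurable_divide rect_cost_measurable) auto

end

text \<open>
  \<open>\<beta>\<close> times a bound for the number of edges across the middle hyperplane per unit of area.
\<close>

definition tension_bound :: "real \<Rightarrow> ('d::finite) itself \<Rightarrow> real" where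
  "tension_bound \<beta> _ = \<beta> * (3 ^ CARD('d) * (2 * real CARD('d) + 4) * (1 + 2 * real CARD('d)) ^ (CARD('d) - 1))"

lemma tension_bound_nonneg: "0 \<le> \<beta> \<Longrightarrow> 0 \<le> tension_bound \<beta> TYPE('d::finite)"
  by (simp add: tension_bound_def)

context media
begin

lemma rect_cost_bounds:
  fixes u :: "nat \<Rightarrow> real ^ 'd::finite"
  assumes "frame u" "0 \<le> \<beta>" "0 < h" "1 \<le> N"
  shows "0 \<le> rect_cost q \<beta> u N h z (clip J)" "rect_cost q \<beta> u N h z (clip J) \<le> tension_bound \<beta> TYPE('d) * N ^ (CARD('d) - 1)"
proof -
  have N: "0 < N" using assms by simp
  interpret rc_region q "lattice_edges (region u N h z)" by (rule rect_region[OF assms(1) N assms(3)])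
  show "0 \<le> rect_cost q \<beta> u N h z (clip J)"
    unfolding rect_cost_def using assms by (intro cost_nonneg) (auto simp: clip_bounds)
  show "rect_cost q \<beta> u N h z (clip J) \<le> tension_bound \<beta> TYPE('d) * N ^ (CARD('d) - 1)"
    unfolding rect_cost_shift[OF assms(1) N assms(3), of q \<beta> z] tension_bound_def
    using assms q by (intro frame_loc.rect_cost_bound frame_loc.intro) (auto simp: clip_bounds)
qed

lemma tension_bounds:
  fixes u :: "nat \<Rightarrow> real ^ 'd::finite"
  assumes "frame u" "0 \<le> \<beta>" "0 < \<delta>" "0 < N"
  shows "0 \<le> tension q \<beta> u \<delta> N J" "tension q \<beta> u \<delta> N J \<le> tension_bound \<beta> TYPE('d)"
  using rect_cost_bounds[of u \<beta> "\<delta> * real N" "real N" 0 J] assms by (auto simp: tension_def divide_le_eq)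

lemma tension_mono:
  fixes u :: "nat \<Rightarrow> real ^ 'd::finite"
  assumes "frame u" "0 \<le> \<beta>" "\<beta> \<le> \<beta>'" "0 < \<delta>" "0 < N" "\<And>e. J e \<le> J' e"
  shows "tension q \<beta> u \<delta> N J \<le> tension q \<beta>' u \<delta> N J'"
proof -
  have p: "0 < real N" "0 < \<delta> * real N" using assms by auto
  interpret rc_region q "lattice_edges (region u N (\<delta> * N) 0)" by (rule rect_region[OF assms(1) p])
  have "clip J e \<le> clip J' e" for e using assms(6)[of e] by (auto simp: clip_def)
  then have "rect_cost q \<beta> u N (\<delta> * N) 0 (clip J) \<le> rect_cost q \<beta>' u N (\<delta> * N) 0 (clip J')"
    unfolding rect_cost_def using assms by (intro cost_mono decreasing_sep) (auto simp: clip_bounds)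
  then show ?thesis unfolding tension_def by (intro divide_right_mono) auto
qed

end

section \<open>Existence of the surface tension\<close>

text \<open>
  Comparing each sequence with itself gives convergence, comparing different sequences gives equality of the limits.
\<close>

lemma common_limit:
  fixes f :: "'i \<Rightarrow> nat \<Rightarrow> ereal"
  assumes "\<And>i j. i \<in> I \<Longrightarrow> j \<in> I \<Longrightarrow> limsup (f j) \<le> liminf (f i)" and "I \<noteq> {}"
  obtains l where "\<And>i. i \<in> I \<Longrightarrow> f i \<longlonglongrightarrow> l"
proof -
  obtain i0 where i0: "i0 \<in> I" using assms(2) by blast
  have "f i \<longlonglongrightarrow> liminf (f i0)" if i: "i \<in> I" for i
  proof -
    have "liminf (f i) \<le> limsup (f i)" "liminf (f i0) \<le> limsup (f i0)" by (simp_all add: Liminf_le_Limsup)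
    then have "liminf (f i) = liminf (f i0)" "limsup (f i) = liminf (f i0)"
      using assms(1)[OF i i0] assms(1)[OF i0 i] assms(1)[OF i i] assms(1)[OF i0 i0] by (auto intro: antisym order_trans)
    then show ?thesis by (intro Liminf_eq_Limsup) auto
  qed
  then show ?thesis using that by blast
qed

lemma limsup_le_liminf_of_eventually:
  fixes f g :: "nat \<Rightarrow> real"
  assumes "\<And>\<epsilon>. 0 < \<epsilon> \<Longrightarrow> \<forall>\<^sub>F L in sequentially. \<forall>\<^sub>F N in sequentially. f N \<le> g L + \<epsilon>"
  shows "limsup (\<lambda>N. ereal (f N)) \<le> liminf (\<lambda>L. ereal (g L))"
proof (rule ereal_le_epsilon2)
    fix e :: real assume e: "0 < e"
    have "\<forall>\<^sub>F L in sequentially. limsup (\<lambda>N. ereal (f N)) \<le> ereal (g L) + ereal e"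
      using assms[OF e]
    proof eventually_elim
      case (elim L)
      then show ?case by (intro Limsup_bounded) (auto elim!: eventually_mono)
    qed
    then have "\<forall>\<^sub>F L in sequentially. limsup (\<lambda>N. ereal (f N)) - ereal e \<le> ereal (g L)"
      by eventually_elim (simp add: ereal_minus_le_iff add.commute)
    then have "limsup (\<lambda>N. ereal (f N)) - ereal e \<le> liminf (\<lambda>L. ereal (g L))" by (rule Liminf_bounded)
    then show "limsup (\<lambda>N. ereal (f N)) \<le> liminf (\<lambda>L. ereal (g L)) + ereal e"
      by (simp add: ereal_minus_le_iff add.commute)
qed

lemma common_real_limit:
  fixes f :: "'i \<Rightarrow> nat \<Rightarrow> real"
  assumes "\<And>i j \<epsilon>. i \<in> I \<Longrightarrow> j \<in> I \<Longrightarrow> 0 < \<epsilon> \<Longrightarrow> \<forall>\<^sub>F L in sequentially. \<forall>\<^sub>F N in sequentially. f j N \<le> f i L + \<epsilon>"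
    and "I \<noteq> {}" and b: "\<And>i. i \<in> I \<Longrightarrow> \<exists>a b. \<forall>\<^sub>F N in sequentially. f i N \<in> {a..b}"
  obtains l where "\<And>i. i \<in> I \<Longrightarrow> f i \<longlonglongrightarrow> l"
proof -
  obtain l where l: "\<And>i. i \<in> I \<Longrightarrow> (\<lambda>N. ereal (f i N)) \<longlonglongrightarrow> l"
  proof (rule common_limit[of I "\<lambda>i N. ereal (f i N)"])
    show "limsup (\<lambda>N. ereal (f j N)) \<le> liminf (\<lambda>N. ereal (f i N))" if "i \<in> I" "j \<in> I" for i j
      using assms(1)[OF that] by (rule limsup_le_liminf_of_eventually)
  qed (use assms(2) in auto)
  obtain i0 where i0: "i0 \<in> I" using assms(2) by blast
  obtain a b where ab: "\<forall>\<^sub>F N in sequentially. f i0 N \<in> {a..b}" using b[OF i0] by blast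
  have "l \<le> ereal b"
    using l[OF i0] by (rule tendsto_upperbound) (use ab in \<open>auto elim!: eventually_mono\<close>)
  moreover have "ereal a \<le> l"
    using l[OF i0] by (rule tendsto_lowerbound) (use ab in \<open>auto elim!: eventually_mono\<close>)
  ultimately obtain r where "l = ereal r" by (cases l) auto
  then show ?thesis using l that[of r] by simp
qed

lemma unit_cubes_nonempty:
  fixes n :: "real ^ 'd::finite"
  assumes "norm n = 1" obtains u where "frame u" "u CARD('d) = n"
proof -
  obtain S where S: "n \<in> S" "pairwise orthogonal S" "\<And>x. x \<in> S \<Longrightarrow> norm x = 1"
    "independent S" "card S = DIM(real ^ 'd)" "span S = UNIV"
    using vector_in_orthonormal_basis[OF assms] by metis
  have fin: "finite S" using S(4) by (rule independent_imp_finite)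
  have "card {1..<CARD('d)} = card (S - {n})" using S fin by simp
  then obtain h where h: "bij_betw h {1..<CARD('d)} (S - {n})"
    using fin by (metis finite_same_card_bij finite_atLeastLessThan finite_Diff)
  define u where "u k = (if k = CARD('d) then n else h k)" for k
  have e: "{1..CARD('d)} = insert CARD('d) {1..<CARD('d)}" using card_pos[where 'd='d] by auto
  have im: "u ` {1..CARD('d)} = S"
  proof -
    have "u ` {1..<CARD('d)} = h ` {1..<CARD('d)}" by (rule image_cong) (auto simp: u_def)
    then have "u ` {1..<CARD('d)} = S - {n}" using h by (simp add: bij_betw_def)
    moreover have "u CARD('d) = n" by (simp add: u_def)
    ultimately show ?thesis unfolding e image_insert using S(1) by blast
  qed
  have inj: "inj_on u {1..CARD('d)}"
    by (rule eq_card_imp_inj_on) (use im S in auto)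
  have "frame u"
    unfolding frame_def
  proof (intro conjI ballI)
    fix i j assume ij: "i \<in> {1..CARD('d)}" "j \<in> {1..CARD('d)}"
    then have uS: "u i \<in> S" "u j \<in> S" using im by auto
    show "u i \<bullet> u j = (if i = j then 1 else 0)"
    proof (cases "i = j")
      case True
      then show ?thesis using S(3)[OF uS(1)] by (simp add: dot_square_norm)
    next
      case False
      then have "u i \<noteq> u j" using inj ij by (auto dest: inj_onD)
      then show ?thesis using S(2) uS False by (auto simp: pairwise_def orthogonal_def)
    qed
  qed (simp only: im S(6))
  then show ?thesis using that by (simp add: u_def)
qed

context media
begin

lemma tiling_bound:
  fixes u w :: "nat \<Rightarrow> real ^ 'd::finite"
  assumes g: "good_tiling u w \<delta> \<delta>' \<epsilon> L N T" and b: "0 \<le> \<beta>" and N: "0 < N"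
  shows "tension q \<beta> w \<delta>' N J \<le> (\<Sum>z\<in>T. rect_cost q \<beta> u L (\<delta> * L) z (clip J)) / real N ^ (CARD('d) - 1) + \<beta> * \<epsilon>"
proof -
  have "rect_cost q \<beta> w N (\<delta>' * N) 0 (clip J) \<le> (\<Sum>z\<in>T. rect_cost q \<beta> u L (\<delta> * L) z (clip J)) + \<beta> * (\<epsilon> * real N ^ (CARD('d) - 1))"
    using g b q unfolding good_tiling_def by (auto simp: clip_bounds)
  then have "tension q \<beta> w \<delta>' N J \<le> ((\<Sum>z\<in>T. rect_cost q \<beta> u L (\<delta> * L) z (clip J)) + \<beta> * (\<epsilon> * real N ^ (CARD('d) - 1))) / real N ^ (CARD('d) - 1)"
    unfolding tension_def by (intro divide_right_mono) auto
  then show ?thesis using N by (simp add: add_divide_distrib)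
qed

definition mean_tension :: "real \<Rightarrow> (nat \<Rightarrow> real ^ 'd::finite) \<Rightarrow> real \<Rightarrow> nat \<Rightarrow> real" where
  "mean_tension \<beta> u \<delta> N = (\<integral>J. tension q \<beta> u \<delta> N J \<partial>coupling_space \<mu>)"

lemma tension_integrable:
  assumes "frame u" "0 \<le> \<beta>" "0 < \<delta>" "0 < N"
  shows "integrable (coupling_space \<mu>) (tension q \<beta> u \<delta> N)"
proof (rule prob_space.integrable_bounded[OF coupling_prob_space tension_measurable])
  show "\<bar>tension q \<beta> u \<delta> N J\<bar> \<le> tension_bound \<beta> TYPE('a)" for J
    using tension_bounds[OF assms, of J] by simp
qed (use assms in auto)

lemma mean_tension_bounds:
  fixes u :: "nat \<Rightarrow> real ^ 'd::finite"
  assumes "frame u" "0 \<le> \<beta>" "0 < \<delta>" "0 < N"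
  shows "mean_tension \<beta> u \<delta> N \<in> {0..tension_bound \<beta> TYPE('d)}"
  unfolding mean_tension_def
  using prob_space.expectation_bounds[OF coupling_prob_space tension_measurable[OF assms(1,3,4)], of 0 \<beta> "tension_bound \<beta> TYPE('d)"]
    tension_bounds[OF assms] by auto

lemma expectation_tile:
  fixes u :: "nat \<Rightarrow> real ^ 'd::finite"
  assumes "frame u" "0 < \<delta>" "0 < L"
  shows "(\<integral>J. rect_cost q \<beta> u L (\<delta> * L) z (clip J) \<partial>coupling_space \<mu>) = mean_tension \<beta> u \<delta> L * real L ^ (CARD('d) - 1)"
proof -
  have "(\<integral>J. rect_cost q \<beta> u L (\<delta> * L) z (clip J) \<partial>coupling_space \<mu>) = (\<integral>J. rect_cost q \<beta> u L (\<delta> * L) 0 (clip J) \<partial>coupling_space \<mu>)"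
    using assms by (intro rect_cost_expectation_shift) auto
  then show ?thesis using assms by (simp add: mean_tension_def tension_def)
qed

lemma rect_cost_integrable:
  fixes u :: "nat \<Rightarrow> real ^ 'd::finite"
  assumes "frame u" "0 \<le> \<beta>" "0 < \<delta>" "0 < L"
  shows "integrable (coupling_space \<mu>) (\<lambda>J. rect_cost q \<beta> u (real L) (\<delta> * real L) z (clip J))"
proof -
  have p: "0 < real L" "0 < \<delta> * real L" "1 \<le> real L" using assms by auto
  show ?thesis
    using rect_cost_bounds[OF assms(1,2) p(2,3), of z] rect_cost_measurable[OF assms(1) p(1,2), of \<beta> z]
    by (intro prob_space.integrable_bounded[OF coupling_prob_space, where B="tension_bound \<beta> TYPE('d) * real L ^ (CARD('d) - 1)"]) auto
qed

lemma mean_tension_tiling: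
  fixes u w :: "nat \<Rightarrow> real ^ 'd::finite"
  assumes g: "good_tiling u w \<delta> \<delta>' \<epsilon> L N T" and f: "frame u" "frame w" and b: "0 \<le> \<beta>"
    and p: "0 < \<delta>" "0 < \<delta>'" "0 < L" "0 < N"
  shows "mean_tension \<beta> w \<delta>' N \<le> mean_tension \<beta> u \<delta> L + \<beta> * \<epsilon>"
proof -
  interpret prob_space "coupling_space \<mu> :: ('d edge \<Rightarrow> real) measure" by (rule coupling_prob_space)
  let ?n = "CARD('d) - 1"
  let ?c = "\<lambda>z J. rect_cost q \<beta> u L (\<delta> * L) z (clip J)"
  have i: "integrable (coupling_space \<mu>) (?c z)" for z using f(1) b p(1,3) by (rule rect_cost_integrable)
  have m0: "0 \<le> mean_tension \<beta> u \<delta> L" using mean_tension_bounds[OF f(1) b p(1,3)] by simp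
  have "mean_tension \<beta> w \<delta>' N \<le> (\<integral>J. (\<Sum>z\<in>T. ?c z J) / real N ^ ?n + \<beta> * \<epsilon> \<partial>coupling_space \<mu>)"
    unfolding mean_tension_def using i
    by (intro integral_mono tension_integrable tiling_bound[OF g] f b p) auto
  also have "\<dots> = (\<Sum>z\<in>T. mean_tension \<beta> u \<delta> L * real L ^ ?n) / real N ^ ?n + \<beta> * \<epsilon>"
    using i expectation_tile[OF f(1) p(1,3)] by (simp add: prob_space)
  also have "(\<Sum>z\<in>T. mean_tension \<beta> u \<delta> L * real L ^ ?n) / real N ^ ?n \<le> mean_tension \<beta> u \<delta> L"
  proof -
    have "card T * real L ^ ?n \<le> real N ^ ?n" using g by (simp add: good_tiling_def)
    then have "mean_tension \<beta> u \<delta> L * (card T * real L ^ ?n) \<le> mean_tension \<beta> u \<delta> L * real N ^ ?n"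
      using m0 by (intro mult_left_mono)
    then show ?thesis using p by (simp add: divide_le_eq mult_ac)
  qed
  finally show ?thesis by simp
qed

text \<open>
  Hoeffding's inequality for the independent costs of the tiles.
\<close>

lemma tension_upper_tail:
  fixes u w :: "nat \<Rightarrow> real ^ 'd::finite"
  assumes g: "good_tiling u w \<delta> \<delta>' \<epsilon> L N T" and f: "frame u" "frame w" and b: "0 \<le> \<beta>"
    and p: "0 < \<delta>" "0 < \<delta>'" "0 < L" "0 < N" and \<eta>: "0 < \<eta>"
  shows "measure (coupling_space \<mu>) {J\<in>space (coupling_space \<mu>). tension q \<beta> w \<delta>' N J \<ge> mean_tension \<beta> u \<delta> L + \<beta> * \<epsilon> + \<eta>}
     \<le> exp (- 2 * \<eta>\<^sup>2 * real N ^ (CARD('d) - 1) / (real L ^ (CARD('d) - 1) * (tension_bound \<beta> TYPE('d) + 1)\<^sup>2))"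
proof -
  let ?M = "coupling_space \<mu> :: ('d edge \<Rightarrow> real) measure" and ?n = "CARD('d) - 1"
  let ?c = "\<lambda>z J. rect_cost q \<beta> u L (\<delta> * L) z (clip J)" and ?B = "tension_bound \<beta> TYPE('d) + 1"
  let ?m = "mean_tension \<beta> u \<delta> L"
  interpret prob_space ?M by (rule coupling_prob_space)
  have LL: "0 < real L ^ ?n" "0 < real N ^ ?n" using p by auto
  have B: "0 < ?B" using tension_bound_nonneg[OF b, where 'd='d] by simp
  have T: "finite T" "card T * real L ^ ?n \<le> real N ^ ?n" using g by (auto simp: good_tiling_def)
  have m0: "0 \<le> ?m" using mean_tension_bounds[OF f(1) b p(1,3)] by simp
  have meas: "?c z \<in> borel_measurable ?M" for z using p by (intro rect_cost_measurable f) auto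
  have sub: "{J\<in>space ?M. tension q \<beta> w \<delta>' N J \<ge> ?m + \<beta> * \<epsilon> + \<eta>}
      \<subseteq> {J\<in>space ?M. (\<Sum>z\<in>T. ?c z J) \<ge> card T * (?m * real L ^ ?n) + \<eta> * real N ^ ?n}"
  proof safe
    fix J assume J: "?m + \<beta> * \<epsilon> + \<eta> \<le> tension q \<beta> w \<delta>' N J"
    have "?m + \<eta> \<le> (\<Sum>z\<in>T. ?c z J) / real N ^ ?n"
      using J tiling_bound[OF g b p(4), of J] by linarith
    then have "(?m + \<eta>) * real N ^ ?n \<le> (\<Sum>z\<in>T. ?c z J)" using LL by (simp add: le_divide_eq)
    moreover have "?m * (card T * real L ^ ?n) \<le> ?m * real N ^ ?n" using T(2) m0 by (rule mult_left_mono)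
    ultimately show "card T * (?m * real L ^ ?n) + \<eta> * real N ^ ?n \<le> (\<Sum>z\<in>T. ?c z J)" by (simp add: algebra_simps)
  qed
  show ?thesis
  proof (cases "T = {}")
    case True
    have "(\<Sum>z\<in>T. ?c z J) < card T * (?m * real L ^ ?n) + \<eta> * real N ^ ?n" for J using True \<eta> LL by simp
    then have "{J\<in>space ?M. tension q \<beta> w \<delta>' N J \<ge> ?m + \<beta> * \<epsilon> + \<eta>} = {}"
      using sub not_le by blast
    then have "prob {J\<in>space ?M. tension q \<beta> w \<delta>' N J \<ge> ?m + \<beta> * \<epsilon> + \<eta>} = 0" by (metis measure_empty)
    then show ?thesis by (metis exp_ge_zero)
  next
    case False
    interpret Hoeffding_ineq ?M T ?c "\<lambda>_. 0" "\<lambda>_. ?B * real L ^ ?n" "card T * (?m * real L ^ ?n)"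
    proof unfold_locales
      show "indep_vars (\<lambda>_. borel) ?c T"
        using g p by (intro indep_tiles f) (auto simp: good_tiling_def)
      have "0 \<le> ?c z J \<and> ?c z J \<le> ?B * real L ^ ?n" for z J
        using rect_cost_bounds[of u \<beta> "\<delta> * L" "real L" z J] f b p LL by (simp add: distrib_right add_increasing2)
      then show "AE J in ?M. ?c z J \<in> {0..?B * real L ^ ?n}" for z by auto
      have "card T * (?m * real L ^ ?n) = (\<Sum>z\<in>T. expectation (?c z))"
        using expectation_tile[OF f(1) p(1,3), of \<beta>] by simp
      then show "card T * (?m * real L ^ ?n) \<equiv> (\<Sum>z\<in>T. expectation (?c z))" by (rule eq_reflection)
    qed (use T in auto)
    have cT: "0 < real (card T)" using False T by (simp add: card_gt_0_iff)
    have S: "(\<Sum>z\<in>T. (?B * real L ^ ?n - 0)\<^sup>2) = card T * (?B * real L ^ ?n)\<^sup>2" by simp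
    have "prob {J\<in>space ?M. tension q \<beta> w \<delta>' N J \<ge> ?m + \<beta> * \<epsilon> + \<eta>}
        \<le> prob {J\<in>space ?M. (\<Sum>z\<in>T. ?c z J) \<ge> card T * (?m * real L ^ ?n) + \<eta> * real N ^ ?n}"
      using meas by (intro finite_measure_mono sub) auto
    also have "\<dots> \<le> exp (- 2 * (\<eta> * real N ^ ?n)\<^sup>2 / (\<Sum>z\<in>T. (?B * real L ^ ?n - 0)\<^sup>2))"
      using \<eta> LL B cT by (intro Hoeffding_ineq_ge) auto
    also have "\<dots> \<le> exp (- 2 * \<eta>\<^sup>2 * real N ^ ?n / (real L ^ ?n * ?B\<^sup>2))"
    proof -
      have "\<eta>\<^sup>2 * real N ^ ?n / (real L ^ ?n * ?B\<^sup>2) = (\<eta> * real N ^ ?n)\<^sup>2 / (real N ^ ?n * real L ^ ?n * ?B\<^sup>2)"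
        using LL(2) by (simp add: power_mult_distrib power2_eq_square)
      also have "\<dots> \<le> (\<eta> * real N ^ ?n)\<^sup>2 / (card T * (?B * real L ^ ?n)\<^sup>2)"
      proof (rule divide_left_mono)
        have "card T * (?B * real L ^ ?n)\<^sup>2 = (card T * real L ^ ?n) * (real L ^ ?n * ?B\<^sup>2)"
          by (simp add: power2_eq_square)
        also have "\<dots> \<le> real N ^ ?n * (real L ^ ?n * ?B\<^sup>2)" using T(2) by (intro mult_right_mono) auto
        finally show "card T * (?B * real L ^ ?n)\<^sup>2 \<le> real N ^ ?n * real L ^ ?n * ?B\<^sup>2" by (simp add: mult.assoc)
      qed (use LL B cT in auto)
      finally show ?thesis unfolding S by simp
    qed
    finally show ?thesis .
  qed
qed

lemma mean_tension_eventually: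
  fixes u w :: "nat \<Rightarrow> real ^ 'd::finite"
  assumes f: "frame u" "frame w" "u CARD('d) = w CARD('d)" and b: "0 \<le> \<beta>" and p: "0 < \<delta>" "0 < \<delta>'" "0 < \<epsilon>"
  shows "\<forall>\<^sub>F L in sequentially. \<forall>\<^sub>F N in sequentially. mean_tension \<beta> w \<delta>' N \<le> mean_tension \<beta> u \<delta> L + \<epsilon>"
proof -
  define \<epsilon>' where "\<epsilon>' = \<epsilon> / (\<beta> + 1)"
  have e': "0 < \<epsilon>'" "\<beta> * \<epsilon>' \<le> \<epsilon>" using b p by (auto simp: \<epsilon>'_def field_simps)
  show ?thesis using good_tiling_exists[OF f p(1,2) e'(1)] eventually_gt_at_top[of 0]
  proof eventually_elim
    case (elim L)
    show ?case using elim(1) eventually_gt_at_top[of 0]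
    proof eventually_elim
      case elN: (elim N)
      then obtain T where "good_tiling u w \<delta> \<delta>' \<epsilon>' L N T" by blast
      then show ?case using mean_tension_tiling[OF _ f(1,2) b p(1,2) elim(2) elN(2)] e'(2) by fastforce
    qed
  qed
qed

lemma mean_tension_limit:
  fixes n :: "real ^ 'd::finite"
  assumes n: "norm n = 1" and b: "0 \<le> \<beta>"
  shows "\<exists>l. \<forall>u \<delta>. frame u \<longrightarrow> u CARD('d) = n \<longrightarrow> 0 < \<delta> \<longrightarrow> mean_tension \<beta> u \<delta> \<longlonglongrightarrow> l"
proof -
  let ?I = "{(u, \<delta>). frame u \<and> u CARD('d) = n \<and> 0 < (\<delta>::real)}"
  obtain u0 where "frame u0" "u0 CARD('d) = n" using unit_cubes_nonempty[OF n] .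
  then have ne: "(u0, 1) \<in> ?I" by simp
  obtain l where l: "\<And>i. i \<in> ?I \<Longrightarrow> (\<lambda>N. mean_tension \<beta> (fst i) (snd i) N) \<longlonglongrightarrow> l"
  proof (rule common_real_limit[of ?I "\<lambda>i N. mean_tension \<beta> (fst i) (snd i) N"])
    show "\<forall>\<^sub>F L in sequentially. \<forall>\<^sub>F N in sequentially. mean_tension \<beta> (fst j) (snd j) N \<le> mean_tension \<beta> (fst i) (snd i) L + \<epsilon>"
      if "i \<in> ?I" "j \<in> ?I" "0 < \<epsilon>" for i j \<epsilon>
      using that b by (intro mean_tension_eventually) auto
    have "\<forall>\<^sub>F N in sequentially. mean_tension \<beta> (fst i) (snd i) N \<in> {0..tension_bound \<beta> TYPE('d)}" if "i \<in> ?I" for i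
      using eventually_gt_at_top[of 0]
    proof eventually_elim
      case (elim N)
      then show ?case using that b by (intro mean_tension_bounds) auto
    qed
    then show "\<exists>a b. \<forall>\<^sub>F N in sequentially. mean_tension \<beta> (fst i) (snd i) N \<in> {a..b}" if "i \<in> ?I" for i
      using that by blast
    show "?I \<noteq> {}" using ne by blast
  qed (rule that)
  show ?thesis
  proof (intro exI allI impI)
    show "mean_tension \<beta> u \<delta> \<longlonglongrightarrow> l" if "frame u" "u CARD('d) = n" "0 < \<delta>" for u \<delta>
      using l[of "(u, \<delta>)"] that by simp
  qed
qed

text \<open>
  Values above the limit are excluded by the upper tail. Values below it are then excluded by the mean, which would
  otherwise be too small; this uses that the tension is bounded.
\<close>

lemma tension_in_prob:
  fixes u :: "nat \<Rightarrow> real ^ 'd::finite"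
  assumes dim: "2 \<le> CARD('d)" and f: "frame u" and b: "0 \<le> \<beta>" and d: "0 < \<delta>" and lim: "mean_tension \<beta> u \<delta> \<longlonglongrightarrow> l"
  shows "tends_in_prob (coupling_space \<mu>) (tension q \<beta> u \<delta>) l"
proof -
  let ?M = "coupling_space \<mu> :: ('d edge \<Rightarrow> real) measure"
  let ?X = "tension q \<beta> u \<delta>" and ?B = "tension_bound \<beta> TYPE('d)"
  interpret prob_space ?M by (rule coupling_prob_space)
  have meas: "?X N \<in> borel_measurable ?M" if "0 < N" for N using that f d by (intro tension_measurable)
  have l0: "0 \<le> l"
    using lim by (rule tendsto_lowerbound)
      (use eventually_gt_at_top[of 0] in \<open>eventually_elim, use mean_tension_bounds[OF f b d] in auto\<close>)
  have up: "(\<lambda>N. prob {J\<in>space ?M. ?X N J \<ge> l + \<epsilon>}) \<longlonglongrightarrow> 0" if e: "0 < \<epsilon>" for \<epsilon>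
  proof -
    define \<epsilon>' where "\<epsilon>' = \<epsilon> / (4 * (\<beta> + 1))"
    have e': "0 < \<epsilon>'" "\<beta> * \<epsilon>' \<le> \<epsilon> / 4" using b e by (auto simp: \<epsilon>'_def field_simps)
    have "\<forall>\<^sub>F L in sequentially. mean_tension \<beta> u \<delta> L < l + \<epsilon> / 4" using lim e by (intro order_tendstoD(2)) auto
    then have "\<forall>\<^sub>F L in sequentially. 0 < L \<and> mean_tension \<beta> u \<delta> L < l + \<epsilon> / 4 \<and> (\<forall>\<^sub>F N in sequentially. \<exists>T. good_tiling u u \<delta> \<delta> \<epsilon>' L N T)"
      using good_tiling_exists[OF f f refl d d e'(1)] eventually_gt_at_top[of 0] by eventually_elim auto
    then obtain L where L: "0 < L" "mean_tension \<beta> u \<delta> L < l + \<epsilon> / 4" "\<forall>\<^sub>F N in sequentially. \<exists>T. good_tiling u u \<delta> \<delta> \<epsilon>' L N T"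
      using eventually_happens'[OF sequentially_bot] by blast
    define c where "c = 2 * (\<epsilon> / 4)\<^sup>2 / (real L ^ (CARD('d) - 1) * (?B + 1)\<^sup>2)"
    have c: "0 < c" unfolding c_def using e L(1) tension_bound_nonneg[OF b, where 'd='d] by (intro divide_pos_pos mult_pos_pos) auto
    show ?thesis
    proof (rule tendsto_sandwich[of "\<lambda>_. 0"])
      show "\<forall>\<^sub>F N in sequentially. prob {J\<in>space ?M. ?X N J \<ge> l + \<epsilon>} \<le> exp (- c * real N)"
        using L(3) eventually_gt_at_top[of 0]
      proof eventually_elim
        case (elim N)
        then obtain T where T: "good_tiling u u \<delta> \<delta> \<epsilon>' L N T" by blast
        have "prob {J\<in>space ?M. ?X N J \<ge> l + \<epsilon>} \<le> prob {J\<in>space ?M. ?X N J \<ge> mean_tension \<beta> u \<delta> L + \<beta> * \<epsilon>' + \<epsilon> / 4}"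
          using L(2) e'(2) e meas[OF elim(2)] by (intro finite_measure_mono) auto
        also have "\<dots> \<le> exp (- 2 * (\<epsilon> / 4)\<^sup>2 * real N ^ (CARD('d) - 1) / (real L ^ (CARD('d) - 1) * (?B + 1)\<^sup>2))"
          using e by (intro tension_upper_tail[OF T f f b d d L(1) elim(2)]) auto
        also have "\<dots> = exp (- c * real N ^ (CARD('d) - 1))" by (simp add: c_def)
        also have "\<dots> \<le> exp (- c * real N)"
        proof -
          have "real N ^ 1 \<le> real N ^ (CARD('d) - 1)" using elim(2) dim by (intro power_increasing) auto
          then show ?thesis using c by simp
        qed
        finally show ?case .
      qed
      show "(\<lambda>N. exp (- c * real N)) \<longlonglongrightarrow> 0" using c by real_asymp
    qed auto
  qed
  have low: "(\<lambda>N. prob {J\<in>space ?M. ?X N J \<le> l - \<epsilon>}) \<longlonglongrightarrow> 0" if e: "0 < \<epsilon>" for \<epsilon>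
  proof (rule tendstoI)
    fix \<kappa> :: real assume k: "0 < \<kappa>"
    define \<eta> where "\<eta> = \<epsilon> * \<kappa> / 4"
    have h: "0 < \<eta>" using e k by (simp add: \<eta>_def)
    have "(\<lambda>N. (l - mean_tension \<beta> u \<delta> N) + \<eta> + ?B * prob {J\<in>space ?M. ?X N J \<ge> l + \<eta>}) \<longlonglongrightarrow> (l - l) + \<eta> + ?B * 0"
      by (intro tendsto_intros lim up h)
    then have "\<forall>\<^sub>F N in sequentially. (l - mean_tension \<beta> u \<delta> N) + \<eta> + ?B * prob {J\<in>space ?M. ?X N J \<ge> l + \<eta>} < 2 * \<eta>"
      using h by (intro order_tendstoD(2)) auto
    then show "\<forall>\<^sub>F N in sequentially. dist (prob {J\<in>space ?M. ?X N J \<le> l - \<epsilon>}) 0 < \<kappa>"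
      using eventually_gt_at_top[of 0]
    proof eventually_elim
      case (elim N)
      let ?lo = "{J\<in>space ?M. ?X N J \<le> l - \<epsilon>}" and ?hi = "{J\<in>space ?M. ?X N J \<ge> l + \<eta>}"
      have s: "?lo \<in> sets ?M" "?hi \<in> sets ?M" using meas[OF elim(2)] by auto
      have iX: "integrable ?M (?X N)" using f b d elim(2) by (rule tension_integrable)
      have ii: "integrable ?M (indicator ?lo :: _ \<Rightarrow> real)" "integrable ?M (indicator ?hi :: _ \<Rightarrow> real)"
        using s by (auto intro!: integrable_real_indicator simp: less_top[symmetric])
      have "\<epsilon> * prob ?lo = (\<integral>J. \<epsilon> * indicator ?lo J \<partial>?M)" using s by simp
      also have "\<dots> \<le> (\<integral>J. (l - ?X N J) + \<eta> + ?B * indicator ?hi J \<partial>?M)"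
      proof (rule integral_mono)
        show "integrable ?M (\<lambda>J. \<epsilon> * indicator ?lo J)" using ii(1) by (rule integrable_mult_right)
        show "integrable ?M (\<lambda>J. (l - ?X N J) + \<eta> + ?B * indicator ?hi J)"
          using iX ii(2) by (intro Bochner_Integration.integrable_add Bochner_Integration.integrable_diff integrable_mult_right) auto
        fix J assume "J \<in> space ?M"
        then have i: "indicator ?lo J = (if ?X N J \<le> l - \<epsilon> then 1 else 0 :: real)"
            "indicator ?hi J = (if l + \<eta> \<le> ?X N J then 1 else 0 :: real)" by (simp_all add: indicator_def)
        show "\<epsilon> * indicator ?lo J \<le> (l - ?X N J) + \<eta> + ?B * indicator ?hi J"
          unfolding i using tension_bounds(2)[OF f b d elim(2), of J] l0 h e by simp
      qed
      also have "\<dots> = (l - mean_tension \<beta> u \<delta> N) + \<eta> + ?B * prob ?hi"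
      proof -
        have "(\<integral>J. (l - ?X N J) + \<eta> + ?B * indicator ?hi J \<partial>?M)
            = (\<integral>J. (l + \<eta>) - ?X N J + ?B * indicator ?hi J \<partial>?M)" by (intro Bochner_Integration.integral_cong) auto
        also have "\<dots> = (\<integral>J. (l + \<eta>) - ?X N J \<partial>?M) + (\<integral>J. ?B * indicator ?hi J \<partial>?M)"
          using iX ii(2) by (intro Bochner_Integration.integral_add) auto
        also have "(\<integral>J. (l + \<eta>) - ?X N J \<partial>?M) = (l + \<eta>) - mean_tension \<beta> u \<delta> N"
          using iX by (subst Bochner_Integration.integral_diff) (auto simp: mean_tension_def prob_space)
        also have "(\<integral>J. ?B * indicator ?hi J \<partial>?M) = ?B * prob ?hi" using s(2) by simp
        finally show ?thesis by simp
      qed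
      also have "\<dots> < 2 * \<eta>" by (rule elim(1))
      also have "\<dots> = \<epsilon> * (\<kappa> / 2)" by (simp add: \<eta>_def)
      finally have "prob ?lo < \<kappa> / 2" using e by simp
      then show ?case using k by (simp add: dist_real_def)
    qed
  qed
  show ?thesis
    unfolding tends_in_prob_def
  proof (intro allI impI)
    fix \<epsilon> :: real assume e: "0 < \<epsilon>"
    show "(\<lambda>N. prob {J\<in>space ?M. \<epsilon> \<le> \<bar>?X N J - l\<bar>}) \<longlonglongrightarrow> 0"
    proof (rule tendsto_sandwich[of "\<lambda>_. 0"])
      show "\<forall>\<^sub>F N in sequentially. prob {J\<in>space ?M. \<epsilon> \<le> \<bar>?X N J - l\<bar>}
          \<le> prob {J\<in>space ?M. ?X N J \<ge> l + \<epsilon>} + prob {J\<in>space ?M. ?X N J \<le> l - \<epsilon>}"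
        using eventually_gt_at_top[of 0]
      proof eventually_elim
        case (elim N)
        have s: "{J\<in>space ?M. ?X N J \<ge> l + \<epsilon>} \<in> sets ?M" "{J\<in>space ?M. ?X N J \<le> l - \<epsilon>} \<in> sets ?M"
          using meas[OF elim] by auto
        have "{J\<in>space ?M. \<epsilon> \<le> \<bar>?X N J - l\<bar>} = {J\<in>space ?M. ?X N J \<ge> l + \<epsilon>} \<union> {J\<in>space ?M. ?X N J \<le> l - \<epsilon>}"
          by (auto simp: abs_real_def)
        then show ?case using measure_Un_le[OF s] by simp
      qed
      show "(\<lambda>N. prob {J\<in>space ?M. ?X N J \<ge> l + \<epsilon>} + prob {J\<in>space ?M. ?X N J \<le> l - \<epsilon>}) \<longlonglongrightarrow> 0"
        using tendsto_add[OF up[OF e] low[OF e]] by simp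
    qed auto
  qed
qed

lemma surf_tension_measurable:
  fixes u :: "nat \<Rightarrow> real ^ 'd::finite"
  assumes "frame u" "0 < L" "0 < h"
  shows "(\<lambda>J. surf_tension q \<beta> J 0 L h (base_cube u) (u CARD('d))) \<in> borel_measurable (coupling_space \<mu>)"
proof -
  let ?E = "lattice_edges (region u L h 0)" and ?D = "disconnection 0 L h (base_cube u) (u CARD('d))"
  have E: "lattice_edges (hat (rect 0 L h (base_cube u) (u CARD('d)))) = ?E" by (simp add: region_def)
  interpret rc_region q ?E by (rule rect_region[OF assms])
  have D: "?D \<subseteq> Pow ?E" unfolding disconnection_eq_sep E[symmetric] by (rule sep_subset)
  have m: "(\<lambda>J. J e) \<in> borel_measurable (coupling_space \<mu>)" if "e \<in> ?E" for e
    unfolding coupling_space_wired using that Ewired by (intro edge_measurable) blast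
  have "(\<lambda>J. if e \<in> \<omega> then edge_prob \<beta> J e else 1 - edge_prob \<beta> J e) \<in> borel_measurable (coupling_space \<mu>)" if "e \<in> ?E" for e \<omega>
    using m[OF that] by (cases "e \<in> \<omega>") (auto simp: edge_prob_def)
  then have w: "(\<lambda>J. rc_weight q \<beta> ?E wired J \<omega>) \<in> borel_measurable (coupling_space \<mu>)" for \<omega>
    unfolding rc_weight_def by (intro borel_measurable_times borel_measurable_prod) auto
  then have Z: "(\<lambda>J. rc_partition q \<beta> ?E wired J) \<in> borel_measurable (coupling_space \<mu>)"
    unfolding rc_partition_def by (intro borel_measurable_sum)
  have "measure (rc_measure q \<beta> ?E wired J) ?D
      = enn2real (\<Sum>\<omega>\<in>?D. ennreal (rc_weight q \<beta> ?E wired J \<omega> / rc_partition q \<beta> ?E wired J))" for J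
    unfolding measure_def rc_measure_def using finE D by (subst emeasure_point_measure_finite) auto
  then show ?thesis unfolding surf_tension_def E using w Z by simp
qed

lemma tends_in_prob_surf_tension:
  fixes u :: "nat \<Rightarrow> real ^ 'd::finite"
  assumes f: "frame u" "0 \<le> \<beta>" "0 < \<delta>"
  shows "tends_in_prob (coupling_space \<mu>) (\<lambda>N J. surf_tension q \<beta> J 0 (real N) (\<delta> * real N) (base_cube u) (u CARD('d))) l
    \<longleftrightarrow> tends_in_prob (coupling_space \<mu>) (tension q \<beta> u \<delta>) l"
proof -
  let ?M = "coupling_space \<mu> :: ('d edge \<Rightarrow> real) measure"
  interpret prob_space ?M by (rule coupling_prob_space)
  let ?S = "\<lambda>N J. surf_tension q \<beta> J 0 (real N) (\<delta> * real N) (base_cube u) (u CARD('d))"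
  have "\<forall>\<^sub>F N in sequentially. prob {J\<in>space ?M. \<epsilon> \<le> \<bar>?S N J - l\<bar>} = prob {J\<in>space ?M. \<epsilon> \<le> \<bar>tension q \<beta> u \<delta> N J - l\<bar>}" for \<epsilon>
    using eventually_gt_at_top[of 0]
  proof eventually_elim
    case (elim N)
    have "?S N \<in> borel_measurable ?M" using f elim by (intro surf_tension_measurable) auto
    moreover have "tension q \<beta> u \<delta> N \<in> borel_measurable ?M" using f elim by (intro tension_measurable) auto
    moreover have "AE J in ?M. ?S N J = tension q \<beta> u \<delta> N J" by (rule surf_tension_AE[OF f elim])
    ultimately show ?case by (intro finite_measure_eq_AE) auto
  qed
  note cong = tendsto_cong[OF this]
  show ?thesis unfolding tends_in_prob_def cong ..
qed

lemma tends_in_prob_unique: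
  assumes "prob_space M" and X: "\<forall>\<^sub>F N in sequentially. X N \<in> borel_measurable M"
    and l: "tends_in_prob M X l" "tends_in_prob M X l'"
  shows "l = l'"
proof (rule ccontr)
  assume ne: "l \<noteq> l'"
  interpret prob_space M by fact
  define e where "e = \<bar>l - l'\<bar> / 2"
  have e: "0 < e" using ne by (simp add: e_def)
  have "(\<lambda>N. prob {x\<in>space M. e \<le> \<bar>X N x - l\<bar>} + prob {x\<in>space M. e \<le> \<bar>X N x - l'\<bar>}) \<longlonglongrightarrow> 0 + 0"
    using l e unfolding tends_in_prob_def by (intro tendsto_add) auto
  then have "\<forall>\<^sub>F N in sequentially. prob {x\<in>space M. e \<le> \<bar>X N x - l\<bar>} + prob {x\<in>space M. e \<le> \<bar>X N x - l'\<bar>} < 1"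
    by (intro order_tendstoD(2)) auto
  then have "\<forall>\<^sub>F N in sequentially. False"
    using X
  proof eventually_elim
    case (elim N)
    have s: "{x\<in>space M. e \<le> \<bar>X N x - l\<bar>} \<in> sets M" "{x\<in>space M. e \<le> \<bar>X N x - l'\<bar>} \<in> sets M"
      using elim(2) by auto
    have "space M \<subseteq> {x\<in>space M. e \<le> \<bar>X N x - l\<bar>} \<union> {x\<in>space M. e \<le> \<bar>X N x - l'\<bar>}"
      unfolding e_def by (auto simp: abs_real_def split: if_splits)
    then have "prob (space M) \<le> prob ({x\<in>space M. e \<le> \<bar>X N x - l\<bar>} \<union> {x\<in>space M. e \<le> \<bar>X N x - l'\<bar>})"
      using s by (intro finite_measure_mono) auto
    then have "1 \<le> prob {x\<in>space M. e \<le> \<bar>X N x - l\<bar>} + prob {x\<in>space M. e \<le> \<bar>X N x - l'\<bar>}"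
      using measure_Un_le[OF s] by (simp add: prob_space)
    then show False using elim(1) by simp
  qed
  then show False by simp
qed

text \<open>
  The limit in probability agrees with the limit of the means, and limits in probability are unique, so the description
  that defines \<open>tau_quenched\<close> denotes this limit.
\<close>

theorem tau_quenched_limit:
  fixes u :: "nat \<Rightarrow> real ^ 'd::finite"
  assumes dim: "2 \<le> CARD('d)" and b: "0 \<le> \<beta>" and f: "frame u" and d: "0 < \<delta>"
  shows "mean_tension \<beta> u \<delta> \<longlonglongrightarrow> tau_quenched \<mu> q \<beta> (u CARD('d))"
proof -
  let ?n = "u CARD('d)"
  have n: "norm ?n = 1" by (rule frame_loc.norm_u[OF frame_loc.intro[OF f]]) (simp add: Suc_leI)
  obtain l where l: "\<And>w \<delta>. frame w \<Longrightarrow> w CARD('d) = ?n \<Longrightarrow> 0 < \<delta> \<Longrightarrow> mean_tension \<beta> w \<delta> \<longlonglongrightarrow> l"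
    using mean_tension_limit[OF n b] by blast
  let ?P = "\<lambda>l. \<forall>\<delta>>0. \<forall>S\<in>unit_cubes ?n. tends_in_prob (coupling_space \<mu>)
          (\<lambda>N J. surf_tension q \<beta> J 0 (real N) (\<delta> * real N) S ?n) l"
  have P: "?P l"
  proof (intro allI impI ballI)
    fix \<delta> :: real and S assume d: "0 < \<delta>" and S: "S \<in> unit_cubes ?n"
    obtain w where w: "frame w" "w CARD('d) = ?n" "S = base_cube w" using S unfolding unit_cubes_frame by blast
    have "tends_in_prob (coupling_space \<mu>) (tension q \<beta> w \<delta>) l"
      by (rule tension_in_prob[OF dim w(1) b d l[OF w(1,2) d]])
    then show "tends_in_prob (coupling_space \<mu>) (\<lambda>N J. surf_tension q \<beta> J 0 (real N) (\<delta> * real N) S ?n) l"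
      using tends_in_prob_surf_tension[OF w(1) b d, of l] w by simp
  qed
  have uniq: "l' = l" if l': "?P l'" for l'
  proof (rule tends_in_prob_unique[OF coupling_prob_space])
    let ?X = "\<lambda>N J. surf_tension q \<beta> J 0 (real N) (1 * real N) (base_cube u) ?n"
    have S: "base_cube u \<in> unit_cubes ?n" using f unfolding unit_cubes_frame by blast
    show "tends_in_prob (coupling_space \<mu>) ?X l'" "tends_in_prob (coupling_space \<mu>) ?X l"
      using l' P S zero_less_one by blast+
    show "\<forall>\<^sub>F N in sequentially. ?X N \<in> borel_measurable (coupling_space \<mu>)"
      using eventually_gt_at_top[of 0] by eventually_elim (intro surf_tension_measurable f, auto)
  qed
  have "tau_quenched \<mu> q \<beta> ?n = l"
    unfolding tau_quenched_def by (rule the_equality[where P = ?P, OF P uniq])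
  then show ?thesis using l[OF f refl d] by simp
qed

end

section \<open>Existence of the minimal surface tension and of the rate function\<close>

context media
begin

lemma J_min_facts: "0 \<le> J_min \<mu>" "J_min \<mu> \<le> 1" "\<And>l. J_min \<mu> < l \<Longrightarrow> 0 < measure \<mu> {..<l}"
proof -
  interpret prob_space \<mu> by (rule law)
  let ?S = "{l. 0 \<le> l \<and> measure \<mu> {..<l} > 0}"
  have big: "l \<in> ?S" if "1 < l" for l
  proof -
    have "measure \<mu> {0..1} \<le> measure \<mu> {..<l}" using that law(2) by (intro finite_measure_mono) auto
    then show ?thesis using law(3) that by simp
  qed
  have bdd: "bdd_below ?S" by (intro bdd_belowI[of _ 0]) auto
  have "2 \<in> ?S" by (rule big) simp
  then have ne: "?S \<noteq> {}" by (metis empty_iff)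
  show "0 \<le> J_min \<mu>" unfolding J_min_def by (rule cInf_greatest[OF ne]) simp
  show "J_min \<mu> \<le> 1"
  proof (rule dense_ge)
    show "J_min \<mu> \<le> l" if "1 < l" for l unfolding J_min_def using big[OF that] bdd by (rule cInf_lower)
  qed
  show "0 < measure \<mu> {..<l}" if "J_min \<mu> < l" for l
  proof -
    have "\<exists>l'\<in>?S. l' < l"
      using that unfolding J_min_def by (rule cInf_less_iff[OF ne bdd, THEN iffD1])
    then obtain l' where l': "l' \<in> ?S" "l' < l" by (rule bexE)
    then have "measure \<mu> {..<l'} \<le> measure \<mu> {..<l}" using law(2) by (intro finite_measure_mono) auto
    then show ?thesis using l' by simp
  qed
qed

abbreviation "ground \<equiv> (\<lambda>_. J_min \<mu>)"

lemma tension_const_tiling: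
  fixes u w :: "nat \<Rightarrow> real ^ 'd::finite"
  assumes g: "good_tiling u w \<delta> \<delta>' \<epsilon> L N T" and f: "frame u" and b: "0 \<le> \<beta>" and p: "0 < \<delta>" "0 < L" "0 < N"
  shows "tension q \<beta> w \<delta>' N (\<lambda>_. c) \<le> tension q \<beta> u \<delta> L (\<lambda>_. c) + \<beta> * \<epsilon>"
proof -
  let ?n = "CARD('d) - 1" and ?J = "\<lambda>_. c"
  have cl: "clip ?J = (\<lambda>_. max 0 (min 1 c))" by (simp add: clip_def fun_eq_iff)
  have pp: "0 < real L" "0 < \<delta> * real L" using p by auto
  have "rect_cost q \<beta> u L (\<delta> * L) z (clip ?J) = tension q \<beta> u \<delta> L ?J * real L ^ ?n" for z
    unfolding rect_cost_shift[OF f pp, of q \<beta> z] cl tension_def using p by simp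
  then have "tension q \<beta> w \<delta>' N ?J \<le> (card T * (tension q \<beta> u \<delta> L ?J * real L ^ ?n)) / real N ^ ?n + \<beta> * \<epsilon>"
    using tiling_bound[OF g b p(3), of ?J] by simp
  moreover have "(card T * (tension q \<beta> u \<delta> L ?J * real L ^ ?n)) / real N ^ ?n \<le> tension q \<beta> u \<delta> L ?J"
  proof -
    have "card T * real L ^ ?n \<le> real N ^ ?n" using g by (simp add: good_tiling_def)
    then have "tension q \<beta> u \<delta> L ?J * (card T * real L ^ ?n) \<le> tension q \<beta> u \<delta> L ?J * real N ^ ?n"
      using tension_bounds(1)[OF f b p(1,2)] by (intro mult_left_mono)
    then show ?thesis using p by (simp add: divide_le_eq mult_ac)
  qed
  ultimately show ?thesis by linarith
qed

lemma eps_for: "0 \<le> \<beta> \<Longrightarrow> 0 < \<epsilon> \<Longrightarrow> \<exists>\<epsilon>'>0. \<beta> * \<epsilon>' \<le> (\<epsilon>::real)"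
  by (intro exI[of _ "\<epsilon> / (\<beta> + 1)"]) (auto simp: field_simps)

theorem tau_min_limit:
  fixes u :: "nat \<Rightarrow> real ^ 'd::finite"
  assumes b: "0 \<le> \<beta>" and f: "frame u" and d: "0 < \<delta>"
  shows "(\<lambda>N. tension q \<beta> u \<delta> N ground) \<longlonglongrightarrow> tau_min \<mu> q \<beta> (u CARD('d))"
proof -
  let ?n = "u CARD('d)"
  let ?I = "{(w, \<delta>). frame w \<and> w CARD('d) = ?n \<and> 0 < (\<delta>::real)}"
  obtain l where l: "\<And>i. i \<in> ?I \<Longrightarrow> (\<lambda>N. tension q \<beta> (fst i) (snd i) N ground) \<longlonglongrightarrow> l"
  proof (rule common_real_limit[of ?I "\<lambda>i N. tension q \<beta> (fst i) (snd i) N ground"])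
    fix i j and \<epsilon> :: real assume i: "i \<in> ?I" "j \<in> ?I" "0 < \<epsilon>"
    obtain \<epsilon>' where e': "0 < \<epsilon>'" "\<beta> * \<epsilon>' \<le> \<epsilon>" using eps_for[OF b i(3)] by blast
    have I: "frame (fst i)" "frame (fst j)" "fst i CARD('d) = fst j CARD('d)" "0 < snd i" "0 < snd j"
      using i by auto
    show "\<forall>\<^sub>F L in sequentially. \<forall>\<^sub>F N in sequentially. tension q \<beta> (fst j) (snd j) N ground \<le> tension q \<beta> (fst i) (snd i) L ground + \<epsilon>"
      using good_tiling_exists[OF I e'(1)] eventually_gt_at_top[of 0]
    proof eventually_elim
      case (elim L)
      show ?case using elim(1) eventually_gt_at_top[of 0]
      proof eventually_elim
        case elN: (elim N)
        then obtain T where "good_tiling (fst i) (fst j) (snd i) (snd j) \<epsilon>' L N T" by blast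
        from tension_const_tiling[OF this I(1) b I(4) elim(2) elN(2), of "J_min \<mu>"] show ?case using e'(2) by linarith
      qed
    qed
  next
    fix i assume i: "i \<in> ?I"
    have "\<forall>\<^sub>F N in sequentially. tension q \<beta> (fst i) (snd i) N ground \<in> {0..tension_bound \<beta> TYPE('d)}"
      using eventually_gt_at_top[of 0]
    proof eventually_elim
      case (elim N)
      then show ?case using i b tension_bounds[of "fst i" \<beta> "snd i" N ground] by auto
    qed
    then show "\<exists>a b. \<forall>\<^sub>F N in sequentially. tension q \<beta> (fst i) (snd i) N ground \<in> {a..b}" by blast
  next
    show "?I \<noteq> {}" using f zero_less_one by blast
  qed (rule that)
  have surf: "\<forall>\<^sub>F N in sequentially. tension q \<beta> w \<delta> N ground = surf_tension q \<beta> ground 0 (real N) (\<delta> * real N) (base_cube w) ?n"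
    if w: "frame w" "w CARD('d) = ?n" "0 < \<delta>" for w \<delta>
    using eventually_gt_at_top[of 0]
  proof eventually_elim
    case (elim N)
    have "clip ground = (ground :: 'd edge \<Rightarrow> real)" using J_min_facts(1,2) by (simp add: clip_def fun_eq_iff)
    moreover have "surf_tension q \<beta> ground (emb 0) (real N) (\<delta> * real N) (base_cube w) (w CARD('d))
       = rect_cost q \<beta> w N (\<delta> * N) 0 ground / real N ^ (CARD('d) - 1)"
      using J_min_facts(1) w elim by (intro surf_tension_eq w q b) auto
    ultimately show ?case using w(2) by (simp add: tension_def)
  qed
  let ?P = "\<lambda>l. \<forall>\<delta>>0. \<forall>S\<in>unit_cubes ?n. (\<lambda>N. surf_tension q \<beta> ground 0 (real N) (\<delta> * real N) S ?n) \<longlonglongrightarrow> l"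
  have P: "?P l"
  proof (intro allI impI ballI)
    fix \<delta> :: real and S assume d: "0 < \<delta>" and "S \<in> unit_cubes ?n"
    then obtain w where w: "frame w" "w CARD('d) = ?n" "S = base_cube w" unfolding unit_cubes_frame by blast
    have "(\<lambda>N. tension q \<beta> w \<delta> N ground) \<longlonglongrightarrow> l" using l[of "(w, \<delta>)"] w d by simp
    then show "(\<lambda>N. surf_tension q \<beta> ground 0 (real N) (\<delta> * real N) S ?n) \<longlonglongrightarrow> l"
      unfolding w(3) by (rule Lim_transform_eventually[OF _ surf[OF w(1,2) d]])
  qed
  have uniq: "l' = l" if l': "?P l'" for l'
  proof -
    have S: "base_cube u \<in> unit_cubes ?n" using f unfolding unit_cubes_frame by blast
    let ?X = "\<lambda>N. surf_tension q \<beta> ground 0 (real N) (1 * real N) (base_cube u) ?n"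
    have "?X \<longlonglongrightarrow> l'" "?X \<longlonglongrightarrow> l" using l' P S zero_less_one by blast+
    then show ?thesis by (rule LIMSEQ_unique)
  qed
  have "tau_min \<mu> q \<beta> ?n = l" unfolding tau_min_def by (rule the_equality[where P = ?P, OF P uniq])
  then show ?thesis using l[of "(u, \<delta>)"] f d by simp
qed

lemma tau_min_nonneg:
  assumes "0 \<le> \<beta>" "frame (u :: nat \<Rightarrow> real ^ 'd::finite)" shows "0 \<le> tau_min \<mu> q \<beta> (u CARD('d))"
  using tau_min_limit[OF assms zero_less_one]
  by (rule tendsto_lowerbound) (use eventually_gt_at_top[of 0] in \<open>eventually_elim, use tension_bounds(1)[OF assms(2,1) zero_less_one] in auto\<close>)

definition low_prob :: "real \<Rightarrow> (nat \<Rightarrow> real ^ 'd::finite) \<Rightarrow> real \<Rightarrow> nat \<Rightarrow> real \<Rightarrow> real" where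
  "low_prob \<beta> u \<delta> N t = measure (coupling_space \<mu>) {J\<in>space (coupling_space \<mu>). tension q \<beta> u \<delta> N J \<le> t}"

text \<open>
  Agrees with the extended-valued expression in the definition of the rate function when the probability is positive,
  which is the case for large \<open>N\<close> above \<open>\<tau>_min\<close>.
\<close>

definition low_rate :: "real \<Rightarrow> (nat \<Rightarrow> real ^ 'd::finite) \<Rightarrow> real \<Rightarrow> nat \<Rightarrow> real \<Rightarrow> real" where
  "low_rate \<beta> u \<delta> N t = - ln (low_prob \<beta> u \<delta> N t) / real N ^ (CARD('d) - 1)"

lemma low_prob_mono:
  assumes "frame u" "0 < \<delta>" "0 < N" "s \<le> t" shows "low_prob \<beta> u \<delta> N s \<le> low_prob \<beta> u \<delta> N t"
proof -
  interpret prob_space "coupling_space \<mu> :: ('a edge \<Rightarrow> real) measure" by (rule coupling_prob_space)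
  show ?thesis unfolding low_prob_def using tension_measurable[OF assms(1-3)] assms(4)
    by (intro finite_measure_mono) auto
qed

lemma low_prob_le_1: "low_prob \<beta> u \<delta> N t \<le> 1"
  unfolding low_prob_def by (rule prob_space.prob_le_1[OF coupling_prob_space])

lemma low_prob_tile:
  fixes u :: "nat \<Rightarrow> real ^ 'd::finite"
  assumes "frame u" "0 < \<delta>" "0 < L"
  shows "measure (coupling_space \<mu>) {J\<in>space (coupling_space \<mu>). rect_cost q \<beta> u L (\<delta> * L) z (clip J) \<le> t * real L ^ (CARD('d) - 1)}
    = low_prob \<beta> u \<delta> L t"
proof -
  have "measure (coupling_space \<mu>) {J\<in>space (coupling_space \<mu>). rect_cost q \<beta> u L (\<delta> * L) z (clip J) \<le> t * real L ^ (CARD('d) - 1)}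
     = measure (coupling_space \<mu>) {J\<in>space (coupling_space \<mu>). rect_cost q \<beta> u L (\<delta> * L) 0 (clip J) \<le> t * real L ^ (CARD('d) - 1)}"
    using assms by (intro rect_cost_prob_shift) auto
  then show ?thesis using assms unfolding low_prob_def tension_def by (simp add: divide_le_eq)
qed

text \<open>
  If every tile has tension at most \<open>t\<close>, the large rectangle has tension at most \<open>t + \<beta> * \<epsilon>\<close>. To remove the error, a
  proportion \<open>l\<close> of the tiles is required to have the smaller tension \<open>t0\<close>; for small \<open>l\<close> this hardly changes the
  probability, by independence of the tiles.
\<close>

lemma low_prob_tiling:
  fixes u w :: "nat \<Rightarrow> real ^ 'd::finite"
  assumes g: "good_tiling u w \<delta> \<delta>' \<epsilon> L N T" and f: "frame u" "frame w" and b: "0 \<le> \<beta>"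
    and p: "0 < \<delta>" "0 < \<delta>'" "0 < L" "0 < N"
    and t: "0 \<le> t0" "t0 \<le> t" and l: "0 \<le> l" "l \<le> 1" and t': "t - l * (t - t0) + \<beta> * \<epsilon> \<le> t'"
    and p0: "0 < low_prob \<beta> u \<delta> L t0"
  shows "0 < low_prob \<beta> w \<delta>' N t'"
    and "- ln (low_prob \<beta> w \<delta>' N t') \<le> (l * (real N ^ (CARD('d) - 1) / real L ^ (CARD('d) - 1)) + 1) * - ln (low_prob \<beta> u \<delta> L t0)
        + real N ^ (CARD('d) - 1) / real L ^ (CARD('d) - 1) * - ln (low_prob \<beta> u \<delta> L t)"
proof -
  let ?M = "coupling_space \<mu> :: ('d edge \<Rightarrow> real) measure" and ?n = "CARD('d) - 1"
  let ?c = "\<lambda>z J. rect_cost q \<beta> u L (\<delta> * L) z (clip J)"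
  let ?r = "low_prob \<beta> u \<delta> L t0" and ?p = "low_prob \<beta> u \<delta> L t"
  interpret prob_space ?M by (rule coupling_prob_space)
  define m where "m = real N ^ ?n / real L ^ ?n"
  have LL: "0 < real L ^ ?n" "0 < real N ^ ?n" using p by auto
  have m0: "0 \<le> m" by (simp add: m_def)
  have T: "finite T" "card T \<le> m" using g LL by (auto simp: good_tiling_def m_def le_divide_eq)
  \<comment> \<open>The number of tiles with the smaller tension: a proportion \<open>l\<close>, rounded up.\<close>
  define k where "k = min (card T) (nat \<lceil>l * m\<rceil>)"
  have lm: "0 \<le> l * m" using l m0 by simp
  have k: "k \<le> card T" "k \<le> l * m + 1" using lm unfolding k_def by linarith+
  obtain T0 where T0: "T0 \<subseteq> T" "card T0 = k" using k(1) by (metis obtain_subset_with_card_n)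
  have pp: "?r \<le> ?p" using f p t by (intro low_prob_mono) auto
  define s where "s z = (if z \<in> T0 then t0 else t)" for z
  have sums: "(\<Sum>z\<in>T. s z) = k * t0 + (real (card T) - k) * t"
  proof -
    have "(\<Sum>z\<in>T. s z) = (\<Sum>z\<in>T0. s z) + (\<Sum>z\<in>T - T0. s z)" by (rule sum.subset_diff[OF T0(1) T(1), THEN trans]) simp
    also have "\<dots> = k * t0 + real (card (T - T0)) * t" using T0(2) by (simp add: s_def)
    also have "card (T - T0) = card T - k" using T0 T by (simp add: card_Diff_subset finite_subset)
    finally show ?thesis using k(1) by (simp add: of_nat_diff)
  qed
  have "(\<Sum>z\<in>T. s z) \<le> m * (t - l * (t - t0))"
  proof (cases "l * m \<le> k")
    case True
    have "k * t0 + (real (card T) - k) * t = card T * t - k * (t - t0)" by (simp add: algebra_simps)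
    also have "\<dots> \<le> m * t - (l * m) * (t - t0)" using T(2) t True by (intro diff_mono mult_right_mono) auto
    finally show ?thesis unfolding sums by (simp add: algebra_simps)
  next
    case False
    then have "k = card T" unfolding k_def using lm by linarith
    then have "(\<Sum>z\<in>T. s z) = card T * t0" unfolding sums by simp
    also have "\<dots> \<le> m * t0" using T(2) t by (intro mult_right_mono) auto
    also have "\<dots> \<le> m * (t - l * (t - t0))"
    proof (rule mult_left_mono[OF _ m0])
      have "l * (t - t0) \<le> 1 * (t - t0)" using l t by (intro mult_right_mono) auto
      then show "t0 \<le> t - l * (t - t0)" by simp
    qed
    finally show ?thesis .
  qed
  then have cs: "(\<Sum>z\<in>T. s z * real L ^ ?n) / real N ^ ?n \<le> t - l * (t - t0)"
  proof -
    assume a: "(\<Sum>z\<in>T. s z) \<le> m * (t - l * (t - t0))"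
    have "(\<Sum>z\<in>T. s z * real L ^ ?n) / real N ^ ?n = (\<Sum>z\<in>T. s z) * (real L ^ ?n / real N ^ ?n)"
      by (simp add: sum_distrib_right[symmetric])
    also have "\<dots> \<le> m * (t - l * (t - t0)) * (real L ^ ?n / real N ^ ?n)" using a by (rule mult_right_mono) simp
    also have "\<dots> = t - l * (t - t0)"
    proof -
      have "(b / a) * x * (a / b) = x" if "a \<noteq> 0" "b \<noteq> 0" for a b x :: real using that by simp
      then show ?thesis unfolding m_def using LL by (metis less_irrefl)
    qed
    finally show ?thesis .
  qed
  let ?A = "\<lambda>z. {J\<in>space ?M. ?c z J \<le> s z * real L ^ ?n}"
  have meas: "?c z \<in> borel_measurable ?M" for z using p by (intro rect_cost_measurable f) auto
  have "(\<Prod>z\<in>T. prob (?A z)) \<le> low_prob \<beta> w \<delta>' N t'"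
  proof -
    have "(\<Prod>z\<in>T. prob (?A z)) = prob {J\<in>space ?M. \<forall>z\<in>T. ?c z J \<le> s z * real L ^ ?n}"
    proof (cases "T = {}")
      case True
      then show ?thesis by (simp add: prob_space)
    next
      case False
      have "indep_vars (\<lambda>_. borel) ?c T" using g p by (intro indep_tiles f) (auto simp: good_tiling_def)
      from indep_varsD_finite[OF this False T(1), of "\<lambda>z. {..s z * real L ^ ?n}"]
      have "prob (\<Inter>z\<in>T. ?c z -` {..s z * real L ^ ?n} \<inter> space ?M) = (\<Prod>z\<in>T. prob (?c z -` {..s z * real L ^ ?n} \<inter> space ?M))" by simp
      moreover have "(\<Inter>z\<in>T. ?c z -` {..s z * real L ^ ?n} \<inter> space ?M) = {J\<in>space ?M. \<forall>z\<in>T. ?c z J \<le> s z * real L ^ ?n}"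
        using False by auto
      moreover have "?c z -` {..s z * real L ^ ?n} \<inter> space ?M = ?A z" for z by auto
      ultimately show ?thesis by simp
    qed
    also have "\<dots> \<le> low_prob \<beta> w \<delta>' N t'"
      unfolding low_prob_def
    proof (rule finite_measure_mono)
      show "{J \<in> space ?M. \<forall>z\<in>T. ?c z J \<le> s z * real L ^ ?n} \<subseteq> {J \<in> space ?M. tension q \<beta> w \<delta>' N J \<le> t'}"
      proof safe
        fix J assume J: "\<forall>z\<in>T. ?c z J \<le> s z * real L ^ ?n"
        have "(\<Sum>z\<in>T. ?c z J) / real N ^ ?n \<le> (\<Sum>z\<in>T. s z * real L ^ ?n) / real N ^ ?n"
          using J by (intro divide_right_mono sum_mono) auto
        then show "tension q \<beta> w \<delta>' N J \<le> t'" using tiling_bound[OF g b p(4), of J] cs t' by linarith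
      qed
      show "{J \<in> space ?M. tension q \<beta> w \<delta>' N J \<le> t'} \<in> sets ?M"
        using tension_measurable[OF f(2) p(2,4), of \<beta>] by simp
    qed
    finally show ?thesis .
  qed
  moreover have "prob (?A z) = (if z \<in> T0 then ?r else ?p)" for z
    using low_prob_tile[OF f(1) p(1,3), of \<beta> z t0] low_prob_tile[OF f(1) p(1,3), of \<beta> z t]
    by (cases "z \<in> T0") (simp_all add: s_def)
  moreover have "(\<Prod>z\<in>T. if z \<in> T0 then ?r else ?p) = ?r ^ k * ?p ^ (card T - k)"
  proof -
    have "T \<inter> T0 = T0" "card (T - T0) = card T - k" using T0 T by (auto simp: card_Diff_subset finite_subset)
    then show ?thesis using T(1) T0(2) by (simp add: prod.If_cases Int_def[symmetric] set_diff_eq[symmetric] Diff_eq[symmetric])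
  qed
  ultimately have low: "?r ^ k * ?p ^ (card T - k) \<le> low_prob \<beta> w \<delta>' N t'" by simp
  have ppos: "0 < ?p" using p0 pp by linarith
  have pw: "0 < ?r ^ k * ?p ^ (card T - k)" using p0 ppos by simp
  then show pos: "0 < low_prob \<beta> w \<delta>' N t'" using low by linarith
  have "ln (?r ^ k * ?p ^ (card T - k)) \<le> ln (low_prob \<beta> w \<delta>' N t')" using low pw pos by simp
  then have "- ln (low_prob \<beta> w \<delta>' N t') \<le> k * - ln ?r + (card T - k) * - ln ?p"
    using p0 ppos by (simp add: ln_mult ln_realpow)
  also have "\<dots> \<le> (l * m + 1) * - ln ?r + m * - ln ?p"
  proof -
    have "0 \<le> - ln ?r" "0 \<le> - ln ?p" using p0 ppos low_prob_le_1 by auto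
    moreover have "real (card T - k) \<le> m" using T(2) by linarith
    ultimately show ?thesis using k(2) by (intro add_mono mult_right_mono) auto
  qed
  finally show "- ln (low_prob \<beta> w \<delta>' N t') \<le> (l * (real N ^ ?n / real L ^ ?n) + 1) * - ln ?r
        + real N ^ ?n / real L ^ ?n * - ln ?p" by (simp add: m_def)
qed

text \<open>
  With constant couplings the cost depends only on the product of \<open>\<beta>\<close> and the clipped coupling, so that differentiability in the inverse temperature
  gives continuity in \<open>x\<close>.
\<close>

lemma tension_const_continuous:
  fixes u :: "nat \<Rightarrow> real ^ 'd::finite"
  assumes b: "0 \<le> \<beta>" and f: "frame u" "0 < \<delta>" "0 < N"
  shows "continuous_on UNIV (\<lambda>x. tension q \<beta> u \<delta> N (\<lambda>_. x))"
proof -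
  let ?E = "lattice_edges (region u N (\<delta> * N) 0)" and ?A = "sep (region u N (\<delta> * N) 0) (above u 0)"
  have p: "0 < real N" "0 < \<delta> * real N" using f by auto
  interpret rc_region q ?E by (rule rect_region[OF f(1) p])
  have "continuous_on {0..} (\<lambda>s. cost q ?E ?A s (\<lambda>_. 1))"
  proof (rule DERIV_continuous_on)
    fix s :: real assume "s \<in> {0..}"
    then show "((\<lambda>s. cost q ?E ?A s (\<lambda>_. 1)) has_field_derivative
      (\<Sum>e\<in>?E. 1 * exp (s * 1) * influence (odds s (\<lambda>_. 1)) ?A e)) (at s within {0..})"
      by (intro cost_derivative) auto
  qed
  moreover have "continuous_on UNIV (\<lambda>x. \<beta> * max 0 (min 1 x))"
    by (intro continuous_intros)
  ultimately have "continuous_on UNIV (\<lambda>x. cost q ?E ?A (\<beta> * max 0 (min 1 x)) (\<lambda>_. 1))"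
    by (rule continuous_on_compose2) (use b in auto)
  moreover have "cost q ?E ?A (\<beta> * max 0 (min 1 x)) (\<lambda>_. 1) = rect_cost q \<beta> u N (\<delta> * N) 0 (clip (\<lambda>_. x))" for x
    unfolding rect_cost_def cost_def by (simp add: odds_def[abs_def] clip_def)
  ultimately show ?thesis unfolding tension_def by (intro continuous_intros) (use p in auto)
qed

text \<open>
  With positive probability all the finitely many couplings of the rectangle are close to \<open>J_min \<mu>\<close>.
\<close>

lemma low_prob_pos_finite_volume:
  fixes u :: "nat \<Rightarrow> real ^ 'd::finite"
  assumes b: "0 \<le> \<beta>" and f: "frame u" "0 < \<delta>" "0 < L" and t: "tension q \<beta> u \<delta> L ground < t"
  shows "0 < low_prob \<beta> u \<delta> L t"
proof -
  let ?M = "coupling_space \<mu> :: ('d edge \<Rightarrow> real) measure" and ?E = "lattice_edges (region u L (\<delta> * L) 0)"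
  have p: "0 < real L" "0 < \<delta> * real L" using f by auto
  interpret rc_region q ?E by (rule rect_region[OF f(1) p])
  interpret prob_space ?M by (rule coupling_prob_space)
  have "((\<lambda>x. tension q \<beta> u \<delta> L (\<lambda>_. x)) \<longlongrightarrow> tension q \<beta> u \<delta> L ground) (at_right (J_min \<mu>))"
  proof (rule tendsto_mono[OF at_le])
    have "isCont (\<lambda>x. tension q \<beta> u \<delta> L (\<lambda>_. x)) (J_min \<mu>)"
      using tension_const_continuous[OF b f] by (simp add: continuous_on_eq_continuous_at)
    then show "((\<lambda>x. tension q \<beta> u \<delta> L (\<lambda>_. x)) \<longlongrightarrow> tension q \<beta> u \<delta> L ground) (at (J_min \<mu>))"
      by (simp add: isCont_def)
  qed simp
  then have "\<forall>\<^sub>F x in at_right (J_min \<mu>). tension q \<beta> u \<delta> L (\<lambda>_. x) < t"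
    using t by (rule order_tendstoD(2))
  then have "\<forall>\<^sub>F x in at_right (J_min \<mu>). tension q \<beta> u \<delta> L (\<lambda>_. x) < t \<and> J_min \<mu> < x"
    using eventually_at_right_less by (rule eventually_conj)
  then obtain x where x: "tension q \<beta> u \<delta> L (\<lambda>_. x) < t" "J_min \<mu> < x"
    using eventually_happens'[OF trivial_limit_at_right_real] by blast
  let ?A = "prod_emb wired (\<lambda>_. \<mu>) ?E (PiE ?E (\<lambda>_. {..<x}))"
  have AM: "?A \<in> sets ?M"
    unfolding coupling_space_wired using finE Ewired law(2) by (intro sets_PiM_I) auto
  have "emeasure ?M ?A = (\<Prod>e\<in>?E. emeasure \<mu> {..<x})"
    unfolding coupling_space_wired using finE Ewired law by (intro emeasure_PiM_emb) auto
  also have "\<dots> = emeasure \<mu> {..<x} ^ card ?E" by (rule prod_constant)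
  also have "emeasure \<mu> {..<x} = ennreal (measure \<mu> {..<x})"
    by (rule finite_measure.emeasure_eq_measure[OF prob_space.finite_measure[OF law(1)]])
  also have "ennreal (measure \<mu> {..<x}) ^ card ?E = ennreal (measure \<mu> {..<x} ^ card ?E)"
    by (rule ennreal_power) simp
  finally have "prob ?A = measure \<mu> {..<x} ^ card ?E"
    unfolding measure_def[of ?M] by (simp only: enn2real_ennreal measure_nonneg zero_le_power)
  then have "0 < prob ?A" using J_min_facts(3)[OF x(2)] by simp
  also have "prob ?A \<le> low_prob \<beta> u \<delta> L t"
    unfolding low_prob_def
  proof (rule finite_measure_mono)
    show "?A \<subseteq> {J\<in>space ?M. tension q \<beta> u \<delta> L J \<le> t}"
    proof
      fix J assume J: "J \<in> ?A"
      then have le: "J e \<le> x" if "e \<in> ?E" for e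
      proof -
        have "restrict J ?E \<in> PiE ?E (\<lambda>_. {..<x})" using J by (simp add: prod_emb_def)
        from PiE_mem[OF this that] show ?thesis using that by simp
      qed
      have "rect_cost q \<beta> u L (\<delta> * L) 0 (clip J) \<le> rect_cost q \<beta> u L (\<delta> * L) 0 (clip (\<lambda>_. x))"
        unfolding rect_cost_def
      proof (rule cost_mono)
        show "clip J e \<le> clip (\<lambda>_. x) e" if "e \<in> ?E" for e using le[OF that] by (auto simp: clip_def)
      qed (use b in \<open>auto simp: clip_bounds decreasing_sep\<close>)
      then have "tension q \<beta> u \<delta> L J \<le> tension q \<beta> u \<delta> L (\<lambda>_. x)"
        unfolding tension_def by (intro divide_right_mono) auto
      moreover have "J \<in> space ?M" using J AM sets.sets_into_space by blast
      ultimately show "J \<in> {J\<in>space ?M. tension q \<beta> u \<delta> L J \<le> t}" using x(1) by simp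
    qed
    show "{J\<in>space ?M. tension q \<beta> u \<delta> L J \<le> t} \<in> sets ?M" using tension_measurable[OF f, of \<beta>] by simp
  qed
  finally show ?thesis .
qed

lemma low_rate_finite:
  fixes u :: "nat \<Rightarrow> real ^ 'd::finite"
  assumes b: "0 \<le> \<beta>" and u: "frame u" and d: "0 < \<delta>" and t: "tau_min \<mu> q \<beta> (u CARD('d)) < t"
  obtains K where "0 \<le> K" "\<forall>\<^sub>F N in sequentially. 0 < low_prob \<beta> u \<delta> N t \<and> low_rate \<beta> u \<delta> N t \<le> K"
proof -
  let ?n = "CARD('d) - 1"
  obtain t1 where t1: "tau_min \<mu> q \<beta> (u CARD('d)) < t1" "t1 < t" using t dense by blast
  have t10: "0 \<le> t1" using tau_min_nonneg[OF b u] t1 by simp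
  obtain \<epsilon> where e: "0 < \<epsilon>" "\<beta> * \<epsilon> \<le> t - t1" using eps_for[OF b, of "t - t1"] t1 by auto
  have "\<forall>\<^sub>F L in sequentially. tension q \<beta> u \<delta> L ground < t1"
    using tau_min_limit[OF b u d] t1(1) by (intro order_tendstoD(2)) auto
  then have "\<forall>\<^sub>F L in sequentially. 0 < L \<and> tension q \<beta> u \<delta> L ground < t1 \<and> (\<forall>\<^sub>F N in sequentially. \<exists>T. good_tiling u u \<delta> \<delta> \<epsilon> L N T)"
    using good_tiling_exists[OF u u refl d d e(1)] eventually_gt_at_top[of 0] by eventually_elim auto
  then obtain L where L: "0 < L" "tension q \<beta> u \<delta> L ground < t1" "\<forall>\<^sub>F N in sequentially. \<exists>T. good_tiling u u \<delta> \<delta> \<epsilon> L N T"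
    using eventually_happens'[OF sequentially_bot] by blast
  define a where "a = - ln (low_prob \<beta> u \<delta> L t1)"
  have p1: "0 < low_prob \<beta> u \<delta> L t1" by (rule low_prob_pos_finite_volume[OF b u d L(1,2)])
  have a0: "0 \<le> a" unfolding a_def using p1 low_prob_le_1 by simp
  have "\<forall>\<^sub>F N in sequentially. 0 < low_prob \<beta> u \<delta> N t \<and> low_rate \<beta> u \<delta> N t \<le> 2 * a"
    using L(3) eventually_gt_at_top[of 0]
  proof eventually_elim
    case (elim N)
    then obtain T where T: "good_tiling u u \<delta> \<delta> \<epsilon> L N T" by blast
    note lp = low_prob_tiling[OF T u u b d d L(1) elim(2) t10 order_refl, of 0 t]
    have N1: "1 \<le> real N ^ ?n" "1 \<le> real L ^ ?n" using elim(2) L(1) by auto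
    have "- ln (low_prob \<beta> u \<delta> N t) \<le> a + real N ^ ?n / real L ^ ?n * a"
      using lp(2) e(2) p1 by (simp add: a_def)
    also have "real N ^ ?n / real L ^ ?n * a \<le> real N ^ ?n * a"
    proof (rule mult_right_mono[OF _ a0])
      have "real N ^ ?n / real L ^ ?n \<le> real N ^ ?n / 1" using N1 L(1) by (intro divide_left_mono) auto
      then show "real N ^ ?n / real L ^ ?n \<le> real N ^ ?n" by simp
    qed
    also have "a + real N ^ ?n * a \<le> real N ^ ?n * a + real N ^ ?n * a"
      using mult_right_mono[OF N1(1) a0] by (simp add: mult.commute)
    finally have "- ln (low_prob \<beta> u \<delta> N t) \<le> (2 * a) * real N ^ ?n" by (simp add: algebra_simps)
    moreover have "0 < real N ^ ?n" using elim(2) by simp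
    ultimately have "low_rate \<beta> u \<delta> N t \<le> 2 * a" unfolding low_rate_def by (simp only: pos_divide_le_eq)
    then show ?case using lp(1) e(2) p1 by simp
  qed
  then show ?thesis using that[of "2 * a"] a0 by simp
qed

text \<open>
  The finite-size rates are almost subadditive by \<open>low_prob_tiling\<close>. Above \<open>\<tau>_min\<close> they are bounded, which makes the
  price of the proportion \<open>l\<close> of better tiles negligible.
\<close>

theorem rate_above_limit:
  fixes u :: "nat \<Rightarrow> real ^ 'd::finite"
  assumes dim: "2 \<le> CARD('d)" and b: "0 \<le> \<beta>" and u: "frame u" and d: "0 < \<delta>" and t: "tau_min \<mu> q \<beta> (u CARD('d)) < t"
  shows "(\<lambda>N. ereal (low_rate \<beta> u \<delta> N t)) \<longlonglongrightarrow> rate_above \<mu> q \<beta> (u CARD('d)) t"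
    and "\<forall>\<^sub>F N in sequentially. 0 < low_prob \<beta> u \<delta> N t"
proof -
  let ?\<nu> = "u CARD('d)" and ?n = "CARD('d) - 1"
  let ?I = "{(w, \<delta>). frame w \<and> w CARD('d) = ?\<nu> \<and> 0 < (\<delta>::real)}"
  have fin: "\<exists>K\<ge>0. \<forall>\<^sub>F N in sequentially. 0 < low_prob \<beta> w \<delta> N s \<and> low_rate \<beta> w \<delta> N s \<le> K"
    if "frame w" "w CARD('d) = ?\<nu>" "0 < \<delta>" "tau_min \<mu> q \<beta> ?\<nu> < s" for w \<delta> s
    using low_rate_finite[OF b that(1,3), of s] that(2,4) by metis
  show pos: "\<forall>\<^sub>F N in sequentially. 0 < low_prob \<beta> u \<delta> N t"
    using fin[OF u refl d t] by (auto elim: eventually_mono)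
  obtain l where l: "\<And>i. i \<in> ?I \<Longrightarrow> (\<lambda>N. low_rate \<beta> (fst i) (snd i) N t) \<longlonglongrightarrow> l"
  proof (rule common_real_limit[of ?I "\<lambda>i N. low_rate \<beta> (fst i) (snd i) N t"])
    fix i assume "i \<in> ?I"
    then obtain w \<delta> where i: "i = (w, \<delta>)" "frame w" "w CARD('d) = ?\<nu>" "0 < \<delta>" by auto
    obtain K where "\<forall>\<^sub>F N in sequentially. 0 < low_prob \<beta> w \<delta> N t \<and> low_rate \<beta> w \<delta> N t \<le> K" using fin[OF i(2-4) t] by blast
    then have "\<forall>\<^sub>F N in sequentially. low_rate \<beta> w \<delta> N t \<in> {0..K}"
    proof eventually_elim
      case (elim N)
      then have "0 \<le> low_rate \<beta> w \<delta> N t" unfolding low_rate_def using low_prob_le_1[of \<beta> w \<delta> N t] by (intro divide_nonneg_nonneg) auto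
      then show ?case using elim by simp
    qed
    then show "\<exists>a b. \<forall>\<^sub>F N in sequentially. low_rate \<beta> (fst i) (snd i) N t \<in> {a..b}" unfolding i by auto
  next
    show "?I \<noteq> {}" using u zero_less_one by blast
  next
    fix i j and \<epsilon>0 :: real assume "i \<in> ?I" "j \<in> ?I" and e0: "0 < \<epsilon>0"
    then obtain v \<gamma> w \<delta>' where i: "i = (v, \<gamma>)" "frame v" "v CARD('d) = ?\<nu>" "0 < \<gamma>"
      and j: "j = (w, \<delta>')" "frame w" "w CARD('d) = ?\<nu>" "0 < \<delta>'" by auto
    obtain t0 where t0: "tau_min \<mu> q \<beta> ?\<nu> < t0" "t0 < t" using t dense by blast
    have t00: "0 \<le> t0" using tau_min_nonneg[OF b u] t0 by simp
    obtain K where K: "0 \<le> K" "\<forall>\<^sub>F N in sequentially. 0 < low_prob \<beta> v \<gamma> N t0 \<and> low_rate \<beta> v \<gamma> N t0 \<le> K"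
      using fin[OF i(2-4) t0(1)] by blast
    define l where "l = min 1 (\<epsilon>0 / (2 * (K + 1)))"
    have l: "0 < l" "l \<le> 1" "2 * l * K \<le> \<epsilon>0"
    proof -
      show "0 < l" "l \<le> 1" using e0 K by (auto simp: l_def)
      have "l * (2 * (K + 1)) \<le> \<epsilon>0 / (2 * (K + 1)) * (2 * (K + 1))" using K(1) by (intro mult_right_mono) (auto simp: l_def)
      then have "l * (2 * (K + 1)) \<le> \<epsilon>0" using K(1) by simp
      moreover have "2 * l * K \<le> l * (2 * (K + 1))" using \<open>0 < l\<close> by (simp add: algebra_simps)
      ultimately show "2 * l * K \<le> \<epsilon>0" by linarith
    qed
    obtain \<epsilon> where e: "0 < \<epsilon>" "\<beta> * \<epsilon> \<le> l * (t - t0)" using eps_for[OF b, of "l * (t - t0)"] l t0 by auto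
    have vw: "v CARD('d) = w CARD('d)" using i j by simp
    show "\<forall>\<^sub>F L in sequentially. \<forall>\<^sub>F N in sequentially. low_rate \<beta> (fst j) (snd j) N t \<le> low_rate \<beta> (fst i) (snd i) L t + \<epsilon>0"
      using good_tiling_exists[OF i(2) j(2) vw i(4) j(4) e(1)] K(2) eventually_gt_at_top[of 0]
    proof eventually_elim
      case (elim L)
      have L: "0 < real L ^ ?n" using elim(3) by simp
      have ev: "\<forall>\<^sub>F N in sequentially. real L ^ ?n \<le> l * real N ^ ?n"
      proof -
        have "filterlim (\<lambda>N. real N ^ ?n) at_top sequentially"
          using dim by (intro filterlim_pow_at_top filterlim_real_sequentially) auto
        then have "\<forall>\<^sub>F N in sequentially. real L ^ ?n / l \<le> real N ^ ?n" by (simp add: filterlim_at_top)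
        then show ?thesis by eventually_elim (use l in \<open>simp add: divide_le_eq mult.commute\<close>)
      qed
      show ?case using elim(1) ev eventually_gt_at_top[of 0]
      proof eventually_elim
        case elN: (elim N)
        obtain T where T: "good_tiling v w \<gamma> \<delta>' \<epsilon> L N T" using elN(1) by blast
        have N: "0 < real N ^ ?n" using elN(3) by simp
        note LN = elN(2)
        have bd: "t - l * (t - t0) + \<beta> * \<epsilon> \<le> t" using e by simp
        define P R S where "P = low_prob \<beta> w \<delta>' N t" and "R = low_rate \<beta> v \<gamma> L t0" and "S = low_rate \<beta> v \<gamma> L t"
        note lp = low_prob_tiling(2)[OF T i(2) j(2) b i(4) j(4) elim(3) elN(3) t00 less_imp_le[OF t0(2)] less_imp_le[OF l(1)] l(2) bd conjunct1[OF elim(2)]]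
        have "- ln (low_prob \<beta> v \<gamma> L t0) = R * real L ^ ?n" "- ln (low_prob \<beta> v \<gamma> L t) = S * real L ^ ?n"
          using elim(3) by (simp_all add: R_def S_def low_rate_def)
        then have "- ln P \<le> (l * (real N ^ ?n / real L ^ ?n) + 1) * (R * real L ^ ?n) + real N ^ ?n / real L ^ ?n * (S * real L ^ ?n)"
          using lp unfolding P_def by (simp only:)
        also have "\<dots> = (l * real N ^ ?n + real L ^ ?n) * R + real N ^ ?n * S"
        proof -
          have "(l * (a / c) + 1) * (R * c) + a / c * (S * c) = (l * a + c) * R + a * S" if "c \<noteq> 0" for a c :: real
            using that by (simp add: field_simps)
          then show ?thesis using L by (metis less_irrefl)
        qed
        also have "\<dots> \<le> (l * real N ^ ?n + real L ^ ?n) * K + real N ^ ?n * S"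
          using L N elim(2) l(1) unfolding R_def[symmetric] by (intro add_right_mono mult_left_mono) auto
        also have "\<dots> \<le> (l * real N ^ ?n + l * real N ^ ?n) * K + real N ^ ?n * S"
          using LN K(1) by (intro add_right_mono mult_right_mono) auto
        also have "\<dots> = (S + 2 * l * K) * real N ^ ?n" by (simp add: algebra_simps)
        also have "\<dots> \<le> (S + \<epsilon>0) * real N ^ ?n" using l(3) N by (intro mult_right_mono) auto
        finally have "- ln P / real N ^ ?n \<le> S + \<epsilon>0" using N by (simp only: pos_divide_le_eq)
        then show ?case unfolding P_def S_def i(1) j(1) by (simp add: low_rate_def)
      qed
    qed
  qed (rule that)
  have surf: "\<forall>\<^sub>F N in sequentially. ereal (low_rate \<beta> w \<delta> N t) =
      neg_log (measure (coupling_space \<mu>) {J\<in>space (coupling_space \<mu>).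
         surf_tension q \<beta> J 0 (real N) (\<delta> * real N) (base_cube w) ?\<nu> \<le> t}) / ereal (real N ^ ?n)"
    if w: "frame w" "w CARD('d) = ?\<nu>" "0 < \<delta>" for w \<delta>
  proof -
    have "\<forall>\<^sub>F N in sequentially. 0 < low_prob \<beta> w \<delta> N t"
      using fin[OF w t] by (auto elim: eventually_mono)
    then show ?thesis using eventually_gt_at_top[of 0]
    proof eventually_elim
      case (elim N)
      let ?M = "coupling_space \<mu> :: ('d edge \<Rightarrow> real) measure"
      interpret prob_space ?M by (rule coupling_prob_space)
      let ?S = "\<lambda>J. surf_tension q \<beta> J 0 (real N) (\<delta> * real N) (base_cube w) (w CARD('d))"
      have "prob {J\<in>space ?M. ?S J \<le> t} = low_prob \<beta> w \<delta> N t"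
        unfolding low_prob_def
      proof (rule finite_measure_eq_AE)
        show "AE J in ?M. J \<in> {J\<in>space ?M. ?S J \<le> t} \<longleftrightarrow> J \<in> {J\<in>space ?M. tension q \<beta> w \<delta> N J \<le> t}"
          using surf_tension_AE[OF w(1) b w(3) elim(2)] by eventually_elim simp
        show "{J\<in>space ?M. ?S J \<le> t} \<in> sets ?M"
          using surf_tension_measurable[OF w(1), of "real N" "\<delta> * real N" \<beta>] w(3) elim(2) by simp
        show "{J\<in>space ?M. tension q \<beta> w \<delta> N J \<le> t} \<in> sets ?M" using tension_measurable[OF w(1,3) elim(2), of \<beta>] by simp
      qed
      then show ?case unfolding w(2) low_rate_def neg_log_def using elim by simp
    qed
  qed
  let ?Q = "\<lambda>l. \<forall>\<delta>>0. \<forall>S\<in>unit_cubes ?\<nu>.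
        (\<lambda>N. neg_log (measure (coupling_space \<mu>) {J\<in>space (coupling_space \<mu>).
                           surf_tension q \<beta> J 0 (real N) (\<delta> * real N) S ?\<nu> \<le> t})
             / ereal (real N ^ ?n)) \<longlonglongrightarrow> l"
  have Q: "?Q (ereal l)"
  proof (intro allI impI ballI)
    fix \<delta> :: real and S assume d: "0 < \<delta>" and "S \<in> unit_cubes ?\<nu>"
    then obtain w where w: "frame w" "w CARD('d) = ?\<nu>" "S = base_cube w" unfolding unit_cubes_frame by blast
    have "(\<lambda>N. ereal (low_rate \<beta> w \<delta> N t)) \<longlonglongrightarrow> ereal l" using l[of "(w, \<delta>)"] w d by simp
    then show "(\<lambda>N. neg_log (measure (coupling_space \<mu>) {J\<in>space (coupling_space \<mu>).
        surf_tension q \<beta> J 0 (real N) (\<delta> * real N) S ?\<nu> \<le> t}) / ereal (real N ^ ?n)) \<longlonglongrightarrow> ereal l"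
      unfolding w(3) by (rule Lim_transform_eventually[OF _ surf[OF w(1,2) d]])
  qed
  have uniq: "l' = ereal l" if l': "?Q l'" for l'
  proof -
    have S: "base_cube u \<in> unit_cubes ?\<nu>" using u unfolding unit_cubes_frame by blast
    let ?X = "\<lambda>N. neg_log (measure (coupling_space \<mu>) {J\<in>space (coupling_space \<mu>).
        surf_tension q \<beta> J 0 (real N) (1 * real N) (base_cube u) ?\<nu> \<le> t}) / ereal (real N ^ ?n)"
    have "?X \<longlonglongrightarrow> l'" "?X \<longlonglongrightarrow> ereal l" using l' Q S zero_less_one by blast+
    then show ?thesis by (rule LIMSEQ_unique)
  qed
  have "rate_above \<mu> q \<beta> ?\<nu> t = ereal l" unfolding rate_above_def by (rule the_equality[where P = ?Q, OF Q uniq])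
  then show "(\<lambda>N. ereal (low_rate \<beta> u \<delta> N t)) \<longlonglongrightarrow> rate_above \<mu> q \<beta> ?\<nu> t" using l[of "(u, \<delta>)"] u d by simp
qed

lemma rate_above_antimono:
  fixes n :: "real ^ 'd::finite"
  assumes dim: "2 \<le> CARD('d)" and b: "0 \<le> \<beta>" and n: "norm n = 1" and t: "tau_min \<mu> q \<beta> n < s" "s \<le> t"
  shows "rate_above \<mu> q \<beta> n t \<le> rate_above \<mu> q \<beta> n s"
proof -
  obtain u where u: "frame u" "u CARD('d) = n" using unit_cubes_nonempty[OF n] .
  have t': "tau_min \<mu> q \<beta> (u CARD('d)) < s" "tau_min \<mu> q \<beta> (u CARD('d)) < t" using t u by auto
  note S = rate_above_limit[OF dim b u(1) zero_less_one t'(1)] and T = rate_above_limit[OF dim b u(1) zero_less_one t'(2)]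
  have "\<forall>\<^sub>F N in sequentially. ereal (low_rate \<beta> u 1 N t) \<le> ereal (low_rate \<beta> u 1 N s)"
    using S(2) eventually_gt_at_top[of 0]
  proof eventually_elim
    case (elim N)
    have "low_prob \<beta> u 1 N s \<le> low_prob \<beta> u 1 N t" using u elim t by (intro low_prob_mono) auto
    then have "ln (low_prob \<beta> u 1 N s) \<le> ln (low_prob \<beta> u 1 N t)" using elim(1) by simp
    then show ?case unfolding low_rate_def ereal_less_eq by (intro divide_right_mono) auto
  qed
  then show ?thesis using tendsto_le[OF sequentially_bot S(1) T(1)] u(2) by simp
qed

end

section \<open>Lower deviations are of surface order\<close>

context media
begin

text \<open>
  Only the couplings of the finitely many edges of the rectangle matter, so the estimate on a finite product carries
  over to the space of all couplings.
\<close>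

lemma rect_cost_lower_tail:
  fixes u :: "nat \<Rightarrow> real ^ 'd::finite"
  assumes f: "frame u" "0 < L" "0 < h" and b: "0 < \<beta>'" "\<beta>' < \<beta>" and l: "0 < l" "l * \<beta> \<le> 1"
    and K: "\<And>J. rect_cost q \<beta> u L h 0 (clip J) \<le> K"
  shows "measure (coupling_space \<mu>) {J\<in>space (coupling_space \<mu>). rect_cost q \<beta> u L h 0 (clip J)
        \<le> (\<integral>J. rect_cost q \<beta>' u L h 0 (clip J) \<partial>coupling_space \<mu>) - t}
     \<le> exp (- l * t + 2 * l\<^sup>2 * (\<beta>\<^sup>2 * exp \<beta> * K / (\<beta> - \<beta>')))"
proof -
  let ?E = "lattice_edges (region u L h 0)" and ?A = "sep (region u L h 0) (above u 0)"
  let ?M = "coupling_space \<mu> :: ('d edge \<Rightarrow> real) measure" and ?P = "PiM ?E (\<lambda>_. \<mu>)" and ?R = "\<lambda>J. restrict J ?E"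
  interpret rc_region q ?E by (rule rect_region[OF f])
  have law': "distr ?M ?P ?R = ?P" by (rule restrict_law[OF lattice_edges_wired])
  have R: "?R \<in> measurable ?M ?P"
    unfolding coupling_space_wired using lattice_edges_wired by (intro measurable_restrict_subset)
  have c: "(\<lambda>J. cost q ?E ?A s (clip J)) \<in> borel_measurable ?P" for s
    by (rule cost_clip_measurable[OF rc_region_axioms order_refl])
  have cR: "cost q ?E ?A s (clip (?R J)) = rect_cost q s u L h 0 (clip J)" for s J
    unfolding rect_cost_def by (rule cost_cong) (simp add: clip_def)
  have E: "(\<integral>J. rect_cost q s u L h 0 (clip J) \<partial>?M) = (\<integral>J. cost q ?E ?A s (clip J) \<partial>?P)" for s
  proof -
    have "(\<integral>J. cost q ?E ?A s (clip J) \<partial>?P) = (\<integral>J. cost q ?E ?A s (clip J) \<partial>distr ?M ?P ?R)" by (simp only: law')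
    also have "\<dots> = (\<integral>J. cost q ?E ?A s (clip (?R J)) \<partial>?M)" by (rule integral_distr[OF R c])
    finally show ?thesis by (simp only: cR)
  qed
  let ?X = "{J\<in>space ?P. cost q ?E ?A \<beta> (clip J) \<le> (\<integral>J. cost q ?E ?A \<beta>' (clip J) \<partial>?P) - t}"
  have X: "?X \<in> sets ?P" using c by simp
  have "measure ?P ?X = measure (distr ?M ?P ?R) ?X" by (simp only: law')
  also have "\<dots> = measure ?M (?R -` ?X \<inter> space ?M)" by (rule measure_distr[OF R X])
  also have "?R -` ?X \<inter> space ?M = {J\<in>space ?M. rect_cost q \<beta> u L h 0 (clip J)
        \<le> (\<integral>J. rect_cost q \<beta>' u L h 0 (clip J) \<partial>?M) - t}"
    unfolding E using measurable_space[OF R] by (auto simp: cR)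
  finally have "measure ?M {J\<in>space ?M. rect_cost q \<beta> u L h 0 (clip J)
        \<le> (\<integral>J. rect_cost q \<beta>' u L h 0 (clip J) \<partial>?M) - t} = measure ?P ?X" by (rule sym)
  also have "\<dots> \<le> exp (- l * t + 2 * l\<^sup>2 * (\<beta>\<^sup>2 * exp \<beta> * K / (\<beta> - \<beta>')))"
    using K unfolding rect_cost_def by (intro cost_lower_tail decreasing_sep empty_in_sep b law l)
  finally show ?thesis .
qed

text \<open>
  For large \<open>N\<close> the mean tension at \<open>\<beta>'\<close> exceeds \<open>t\<close> by a fixed amount \<open>r / 2\<close>. In the lower tail estimate, with \<open>t\<close>
  replaced by \<open>r / 2\<close> times the area, a small \<open>l\<close> makes the linear term dominate the quadratic one.
\<close>

lemma rate_above_pos: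
  fixes u :: "nat \<Rightarrow> real ^ 'd::finite"
  assumes dim: "2 \<le> CARD('d)" and u: "frame u" and b: "0 < \<beta>'" "\<beta>' < \<beta>"
    and t: "tau_min \<mu> q \<beta> (u CARD('d)) < t" "t < tau_quenched \<mu> q \<beta>' (u CARD('d))"
  shows "0 < rate_above \<mu> q \<beta> (u CARD('d)) t"
proof -
  let ?n = "CARD('d) - 1" and ?B = "tension_bound \<beta> TYPE('d)"
  have b0: "0 \<le> \<beta>" "0 \<le> \<beta>'" using b by auto
  define r where "r = tau_quenched \<mu> q \<beta>' (u CARD('d)) - t"
  have r: "0 < r" using t by (simp add: r_def)
  define C where "C = \<beta>\<^sup>2 * exp \<beta> * ?B / (\<beta> - \<beta>')"
  have C: "0 \<le> C" unfolding C_def using b tension_bound_nonneg[OF b0(1), where 'd='d] by auto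
  \<comment> \<open>The quadratic term is at most half of the linear term \<open>l * r / 2\<close>.\<close>
  define l where "l = min (1 / \<beta>) (r / (8 * (C + 1)))"
  have l: "0 < l" "l * \<beta> \<le> 1" "2 * l\<^sup>2 * C \<le> l * r / 4"
  proof -
    show l0: "0 < l" using b r C by (simp add: l_def)
    have "l * \<beta> \<le> 1 / \<beta> * \<beta>" using b by (intro mult_right_mono) (auto simp: l_def)
    then show "l * \<beta> \<le> 1" using b by simp
    have "l * (8 * (C + 1)) \<le> r / (8 * (C + 1)) * (8 * (C + 1))" using C by (intro mult_right_mono) (auto simp: l_def)
    then have "l * (8 * (C + 1)) \<le> r" using C by simp
    moreover have "l * (8 * C) \<le> l * (8 * (C + 1))" using l0 by simp
    ultimately have "l * (8 * C) \<le> r" by linarith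
    then have "l * (l * (8 * C)) \<le> l * r" using l0 by (intro mult_left_mono) auto
    then show "2 * l\<^sup>2 * C \<le> l * r / 4" by (simp add: power2_eq_square)
  qed
  have ev: "\<forall>\<^sub>F N in sequentially. t + r / 2 < mean_tension \<beta>' u 1 N"
    proof (rule order_tendstoD(1)[OF tau_quenched_limit[OF dim b0(2) u zero_less_one]])
    have "t + (x - t) / 2 < x" if "t < x" for x using that by (simp add: field_simps)
    then show "t + r / 2 < tau_quenched \<mu> q \<beta>' (u CARD('d))" unfolding r_def using t(2) by blast
  qed
  have "\<forall>\<^sub>F N in sequentially. ereal (l * r / 4) \<le> ereal (low_rate \<beta> u 1 N t)"
    using ev rate_above_limit(2)[OF dim b0(1) u zero_less_one t(1)] eventually_gt_at_top[of 0]
  proof eventually_elim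
    case (elim N)
    interpret prob_space "coupling_space \<mu> :: ('d edge \<Rightarrow> real) measure" by (rule coupling_prob_space)
    have N: "0 < real N" "0 < 1 * real N" "1 \<le> real N" "0 < real N ^ ?n" using elim by auto
    have E: "(\<integral>J. rect_cost q \<beta>' u N (1 * real N) 0 (clip J) \<partial>coupling_space \<mu>) = mean_tension \<beta>' u 1 N * real N ^ ?n"
      using u elim(3) by (intro expectation_tile) auto
    let ?c = "\<lambda>J. rect_cost q \<beta> u N (1 * real N) 0 (clip J)"
    have m: "?c \<in> borel_measurable (coupling_space \<mu>)" by (rule rect_cost_measurable[OF u N(1,2)])
    have "low_prob \<beta> u 1 N t = prob {J\<in>space (coupling_space \<mu>). ?c J \<le> t * real N ^ ?n}"
      unfolding low_prob_def tension_def using N by (simp add: divide_le_eq)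
    also have "\<dots> \<le> prob {J\<in>space (coupling_space \<mu>). ?c J \<le> mean_tension \<beta>' u 1 N * real N ^ ?n - r / 2 * real N ^ ?n}"
    proof (intro finite_measure_mono subsetI CollectI conjI)
      have "t * real N ^ ?n \<le> (mean_tension \<beta>' u 1 N - r / 2) * real N ^ ?n" using elim(1) N by (intro mult_right_mono) auto
      then have le: "t * real N ^ ?n \<le> mean_tension \<beta>' u 1 N * real N ^ ?n - r / 2 * real N ^ ?n" by (simp add: left_diff_distrib)
      fix J assume J: "J \<in> {J\<in>space (coupling_space \<mu>). ?c J \<le> t * real N ^ ?n}"
      then show "J \<in> space (coupling_space \<mu>)" by simp
      show "?c J \<le> mean_tension \<beta>' u 1 N * real N ^ ?n - r / 2 * real N ^ ?n" using J le by simp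
    qed (use m in simp)
    also have "\<dots> \<le> exp (- l * (r / 2 * real N ^ ?n) + 2 * l\<^sup>2 * (\<beta>\<^sup>2 * exp \<beta> * (?B * real N ^ ?n) / (\<beta> - \<beta>')))"
      unfolding E[symmetric] by (rule rect_cost_lower_tail[OF u N(1,2) b l(1,2) rect_cost_bounds(2)[OF u b0(1) N(2,3)]])
    also have "\<dots> = exp ((- l * (r / 2) + 2 * l\<^sup>2 * C) * real N ^ ?n)"
      by (simp add: C_def algebra_simps)
    also have "\<dots> \<le> exp (- (l * r / 4) * real N ^ ?n)"
    proof -
      have "- l * (r / 2) + 2 * l\<^sup>2 * C \<le> - (l * r / 4)" using l(3) by simp
      then have "(- l * (r / 2) + 2 * l\<^sup>2 * C) * real N ^ ?n \<le> - (l * r / 4) * real N ^ ?n" using N(4) by (intro mult_right_mono) auto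
      then show ?thesis by simp
    qed
    finally have "ln (low_prob \<beta> u 1 N t) \<le> - (l * r / 4) * real N ^ ?n"
      using elim(2) by (simp add: ln_le_cancel_iff[symmetric] del: ln_le_cancel_iff)
    then have "l * r / 4 * real N ^ ?n \<le> - ln (low_prob \<beta> u 1 N t)" by simp
    then show ?case unfolding low_rate_def ereal_less_eq using N(4) by (simp only: pos_le_divide_eq)
  qed
  then have "ereal (l * r / 4) \<le> rate_above \<mu> q \<beta> (u CARD('d)) t"
    by (rule tendsto_lowerbound[OF rate_above_limit(1)[OF dim b0(1) u zero_less_one t(1)]]) simp
  moreover have "0 < ereal (l * r / 4)" using l(1) r by simp
  ultimately show ?thesis by (rule less_le_trans[rotated])
qed

lemma left_approach:
  fixes f :: "real \<Rightarrow> real"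
  assumes c: "continuous (at \<beta> within S) f" and S: "{0..\<beta>} \<subseteq> S" and b: "0 < \<beta>" and e: "0 < e"
  shows "\<exists>\<beta>'>0. \<beta>' < \<beta> \<and> \<bar>f \<beta>' - f \<beta>\<bar> < e"
proof -
  obtain d where d: "0 < d" "\<And>x. x \<in> S \<Longrightarrow> dist x \<beta> < d \<Longrightarrow> dist (f x) (f \<beta>) < e"
    using c e unfolding continuous_within_eps_delta by blast
  define x where "x = max (\<beta> / 2) (\<beta> - d / 2)"
  have x: "0 < x" "x < \<beta>" "dist x \<beta> < d" using b d(1) by (auto simp: x_def dist_real_def max_def)
  moreover have "x \<in> S" using x b S by auto
  ultimately show ?thesis using d(2)[of x] by (intro exI[of _ x]) (auto simp: dist_real_def)
qed

lemma antimono_right_limit: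
  fixes g :: "real \<Rightarrow> ereal"
  assumes g: "\<And>x y. 0 < x \<Longrightarrow> x \<le> y \<Longrightarrow> g y \<le> g x" and e: "0 < e"
  shows "g e \<le> Lim (at_right 0) g"
proof -
  define l where "l = (SUP x\<in>{0<..}. g x)"
  have "(g \<longlongrightarrow> l) (at_right 0)"
  proof (rule order_tendstoI)
    fix a assume "a < l"
    then obtain x where x: "0 < x" "a < g x" unfolding l_def less_SUP_iff by auto
    show "\<forall>\<^sub>F y in at_right 0. a < g y"
      unfolding eventually_at_right_field using x g by (intro exI[of _ x]) (auto intro: less_le_trans)
  next
    fix a assume "l < a"
    then show "\<forall>\<^sub>F y in at_right 0. g y < a"
      unfolding eventually_at_right_field l_def
      by (intro exI[of _ 1]) (auto intro: le_less_trans[OF SUP_upper])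
  qed
  then have "Lim (at_right 0) g = l" by (intro tendsto_Lim trivial_limit_at_right_real)
  then show ?thesis unfolding l_def using e by (auto intro: SUP_upper)
qed

text \<open>
  By left continuity \<open>\<tau>\<^sup>q(\<beta>) - r\<close> is below \<open>\<tau>\<^sup>q(\<beta>')\<close> for some \<open>0 < \<beta>' < \<beta>\<close>. Three cases need separate attention: below
  \<open>\<tau>_min\<close> the rate is infinite; at \<open>\<tau>_min\<close> it is a limit from the right, which by monotonicity is at least
  the rate slightly above; and for \<open>\<beta> = 0\<close> the tension vanishes, so that the first case applies.
\<close>

theorem rate_pos_of_left_continuous:
  fixes n :: "real ^ 'd::finite"
  assumes dim: "2 \<le> CARD('d)" and n: "norm n = 1" and b: "0 \<le> \<beta>"
    and c: "continuous (at \<beta> within {0..\<beta>}) (\<lambda>\<beta>'. tau_quenched \<mu> q \<beta>' n)" and r: "0 < r"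
  shows "0 < rate \<mu> q \<beta> n (tau_quenched \<mu> q \<beta> n - r)"
proof -
  obtain u where u: "frame u" "u CARD('d) = n" using unit_cubes_nonempty[OF n] .
  let ?t = "tau_quenched \<mu> q \<beta> n - r" and ?m = "tau_min \<mu> q \<beta> n"
  have m0: "0 \<le> ?m" using tau_min_nonneg[OF b u(1)] u(2) by simp
  consider "?t < ?m" | "?m \<le> ?t" "0 < \<beta>" | "\<beta> = 0" "?m \<le> ?t" using b by linarith
  then show ?thesis
  proof cases
    case 1
    then show ?thesis by (simp add: rate_def)
  next
    case 2
    obtain \<beta>' where b': "0 < \<beta>'" "\<beta>' < \<beta>" "\<bar>tau_quenched \<mu> q \<beta>' n - tau_quenched \<mu> q \<beta> n\<bar> < r / 2"
      using left_approach[OF c order_refl 2(2), of "r / 2"] r by auto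
    have pos: "0 < rate_above \<mu> q \<beta> n s" if "?m < s" "s < ?t + r / 2" for s
    proof -
      have "s < tau_quenched \<mu> q \<beta>' n" using that(2) b'(3) by linarith
      then show ?thesis using rate_above_pos[OF dim u(1) b'(1,2), of s] that(1) u(2) by simp
    qed
    show ?thesis
    proof (cases "?m < ?t")
      case True
      then show ?thesis using pos[of ?t] r by (simp add: rate_def)
    next
      case False
      then have eq: "?t = ?m" using 2 by simp
      let ?g = "\<lambda>\<epsilon>. rate_above \<mu> q \<beta> n (?m + \<epsilon>)"
      have "0 < ?g (r / 4)" using r eq by (intro pos) auto
      also have "\<dots> \<le> Lim (at_right 0) ?g"
        by (rule antimono_right_limit) (use r in \<open>auto intro: rate_above_antimono[OF dim b n]\<close>)
      finally show ?thesis unfolding rate_def eq by simp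
    qed
  next
    case 3
    have "tau_quenched \<mu> q 0 n \<le> 0"
    proof (rule tendsto_upperbound)
      show "mean_tension 0 u 1 \<longlonglongrightarrow> tau_quenched \<mu> q 0 n"
        using tau_quenched_limit[OF dim order_refl u(1) zero_less_one] u(2) by simp
      show "\<forall>\<^sub>F N in sequentially. mean_tension 0 u 1 N \<le> 0"
        using eventually_gt_at_top[of 0]
      proof eventually_elim
        case (elim N)
        show ?case using mean_tension_bounds[OF u(1) order_refl zero_less_one elim] by (simp add: tension_bound_def)
      qed
    qed simp
    then show ?thesis using 3 m0 r by simp
  qed
qed

lemma tau_quenched_mono:
  fixes n :: "real ^ 'd::finite"
  assumes dim: "2 \<le> CARD('d)" and n: "norm n = 1" and b: "0 \<le> \<beta>" "\<beta> \<le> \<beta>'"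
  shows "tau_quenched \<mu> q \<beta> n \<le> tau_quenched \<mu> q \<beta>' n"
proof -
  obtain u where u: "frame u" "u CARD('d) = n" using unit_cubes_nonempty[OF n] .
  have b': "0 \<le> \<beta>'" using b by simp
  have "\<forall>\<^sub>F N in sequentially. mean_tension \<beta> u 1 N \<le> mean_tension \<beta>' u 1 N"
    using eventually_gt_at_top[of 0]
  proof eventually_elim
    case (elim N)
    then show ?case unfolding mean_tension_def using u b b' by (intro integral_mono tension_integrable tension_mono) auto
  qed
  then show ?thesis
    using tendsto_le[OF sequentially_bot tau_quenched_limit[OF dim b' u(1) zero_less_one] tau_quenched_limit[OF dim b(1) u(1) zero_less_one]] u(2)
    by simp
qed

end

section \<open>Continuity in the direction\<close>

lemma power_diff_le:
  fixes x y :: real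
  assumes "0 \<le> y" "y \<le> x"
  shows "x ^ Suc m - y ^ Suc m \<le> real (Suc m) * (x - y) * x ^ m"
proof (induction m)
  case (Suc m)
  have x: "0 \<le> x" using assms by simp
  have "x ^ Suc (Suc m) - y ^ Suc (Suc m) = x * (x ^ Suc m - y ^ Suc m) + y ^ Suc m * (x - y)" by (simp add: algebra_simps)
  also have "\<dots> \<le> x * (real (Suc m) * (x - y) * x ^ m) + x ^ Suc m * (x - y)"
    using Suc assms x by (intro add_mono mult_left_mono mult_right_mono power_mono) auto
  also have "\<dots> = real (Suc (Suc m)) * (x - y) * x ^ Suc m" by (simp add: algebra_simps)
  finally show ?case .
qed simp

text \<open>
  A single tile of frame \<open>v\<close> and side \<open>M\<close> in a rectangle of frame \<open>u\<close> and side \<open>N\<close>, with slightly different normals;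
  \<open>\<rho>\<close> bounds the difference of the coordinates in both frames of any point of the rectangle.
\<close>

locale tilted = tile: frame_loc v + big: frame_loc u for v u :: "nat \<Rightarrow> real ^ 'd::finite" +
  fixes \<rho> M N :: real
  assumes close: "\<And>k. k \<in> {1..CARD('d)} \<Longrightarrow> norm (u k - v k) * (real CARD('d) * N) \<le> \<rho>"
    and rho: "0 \<le> \<rho>" and N_large: "M + 2 * \<rho> + 2 \<le> N" and M_large: "2 * \<rho> + 2 * real CARD('d) + 4 \<le> M"
begin

lemma index: "{1..<CARD('d)} \<subseteq> {1..CARD('d)}" "CARD('d) \<in> {1..CARD('d)}" "{1..CARD('d)} = insert CARD('d) {1..<CARD('d)}" "1 \<le> real CARD('d)"
  using card_pos[where 'd='d] by auto

lemma sizes: "0 < M" "0 < N" "M \<le> N"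
  using rho N_large M_large index(4) by auto

lemma tilt_norm:
  assumes "norm y \<le> real CARD('d) * N" "k \<in> {1..CARD('d)}"
  shows "\<bar>y \<bullet> u k - y \<bullet> v k\<bar> \<le> \<rho>"
proof -
  have "\<bar>y \<bullet> (u k - v k)\<bar> \<le> norm y * norm (u k - v k)" by (rule Cauchy_Schwarz_ineq2)
  also have "\<dots> \<le> (real CARD('d) * N) * norm (u k - v k)" using assms(1) by (rule mult_right_mono) simp
  also have "\<dots> \<le> \<rho>" using close[OF assms(2)] by (simp add: mult_ac)
  finally show ?thesis by (simp add: inner_diff_right)
qed

lemma tile_iff: "a \<in> region v M M 0 \<longleftrightarrow> emb a \<in> slab v 0 (M / 2) M"
  using tile.region_iff[of M M a 0] sizes by simp

lemma big_iff: "a \<in> region u N N 0 \<longleftrightarrow> emb a \<in> slab u 0 (N / 2) N"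
  using big.region_iff[of N N a 0] sizes by simp

lemma tilt:
  assumes "a \<in> region v M M 0 \<or> a \<in> region u N N 0" "k \<in> {1..CARD('d)}"
  shows "\<bar>emb a \<bullet> u k - emb a \<bullet> v k\<bar> \<le> \<rho>"
proof (rule tilt_norm[OF _ assms(2)])
  have "norm (emb a) \<le> real CARD('d) * N" if "a \<in> region v M M 0"
  proof (rule tile.norm_le_coords)
    fix i assume "i \<in> {1..CARD('d)}"
    then show "\<bar>emb a \<bullet> v i\<bar> \<le> N" using that sizes unfolding tile_iff slab_iff index(3) by fastforce
  qed
  moreover have "norm (emb a) \<le> real CARD('d) * N" if "a \<in> region u N N 0"
  proof (rule big.norm_le_coords)
    fix i assume "i \<in> {1..CARD('d)}"
    then show "\<bar>emb a \<bullet> u i\<bar> \<le> N" using that sizes unfolding big_iff slab_iff index(3) by fastforce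
  qed
  ultimately show "norm (emb a) \<le> real CARD('d) * N" using assms(1) by blast
qed

lemma tile_deep:
  assumes "a \<in> region v M M 0" shows "emb a \<in> slab u 0 (N / 2 - 1) (N - 1)"
proof -
  have "\<bar>emb a \<bullet> u k\<bar> < N / 2 - 1" if k: "k \<in> {1..<CARD('d)}" for k
  proof -
    have "\<bar>emb a \<bullet> v k\<bar> < M / 2" using assms k unfolding tile_iff slab_iff by simp
    moreover have "\<bar>emb a \<bullet> u k - emb a \<bullet> v k\<bar> \<le> \<rho>" using assms k index(1) by (intro tilt) auto
    ultimately show ?thesis using N_large by linarith
  qed
  moreover have "\<bar>emb a \<bullet> u CARD('d)\<bar> < N - 1"
  proof -
    have "\<bar>emb a \<bullet> v CARD('d)\<bar> < M" using assms unfolding tile_iff slab_iff by simp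
    moreover have "\<bar>emb a \<bullet> u CARD('d) - emb a \<bullet> v CARD('d)\<bar> \<le> \<rho>" using assms index(2) by (intro tilt) auto
    ultimately show ?thesis using N_large rho by linarith
  qed
  ultimately show ?thesis by (simp add: slab_iff)
qed

lemma tile_sub: "region v M M 0 \<subseteq> region u N N 0"
proof
  fix a assume "a \<in> region v M M 0"
  then have "emb a \<in> slab u 0 (N / 2 - 1) (N - 1)" by (rule tile_deep)
  then show "a \<in> region u N N 0" by (fastforce simp: big_iff slab_iff)
qed

lemma tile_away: "region v M M 0 \<inter> bdry (region u N N 0) = {}"
proof (intro equals0I)
  fix a assume a: "a \<in> region v M M 0 \<inter> bdry (region u N N 0)"
  then have d: "emb a \<in> slab u 0 (N / 2 - 1) (N - 1)" using tile_deep by blast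
  obtain y where y: "y \<notin> region u N N 0" "y \<sim>\<^sub>Z a" using a by (auto simp: bdry_def)
  have n: "\<bar>emb y \<bullet> u k - emb a \<bullet> u k\<bar> \<le> 1" if "k \<in> {1..CARD('d)}" for k
    using y(2) big.norm_u[OF that] by (rule adjacent_inner)
  have "\<bar>emb y \<bullet> u k\<bar> < N / 2" if k: "k \<in> {1..<CARD('d)}" for k
  proof -
    have "\<bar>emb a \<bullet> u k\<bar> < N / 2 - 1" using d k by (simp add: slab_iff)
    moreover have "\<bar>emb y \<bullet> u k - emb a \<bullet> u k\<bar> \<le> 1" using k index(1) by (intro n) auto
    ultimately show ?thesis by linarith
  qed
  moreover have "\<bar>emb y \<bullet> u CARD('d)\<bar> < N"
  proof -
    have "\<bar>emb a \<bullet> u CARD('d)\<bar> < N - 1" using d by (simp add: slab_iff)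
    then show ?thesis using n[OF index(2)] by linarith
  qed
  ultimately show False using y(1) by (simp add: big_iff slab_iff)
qed

definition side :: "int ^ 'd \<Rightarrow> bool" where
  "side a \<longleftrightarrow> (if a \<in> region v M M 0 then above v 0 a else above u 0 a)"

sublocale tiling "region u N N 0" "above u 0" "{()}" "\<lambda>_. region v M M 0" "\<lambda>_. above v 0" side
  by unfold_locales (use tile_sub tile_away sizes big.finite_region in \<open>auto simp: side_def\<close>)

text \<open>
  Seam edges outside the tile lie near the hyperplane of \<open>u\<close> and beyond the tile.
\<close>

definition outer_gap :: "(real ^ 'd) set" where
  "outer_gap = slab u 0 (N / 2 + real CARD('d)) (2 + real CARD('d)) - slab u 0 (M / 2 - \<rho> - real CARD('d)) (2 + real CARD('d))"

text \<open>
  Seam edges with one end in the tile lie near its lateral boundary. Their height is at most of order \<open>\<rho>\<close>, since they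
  cross from one side of the hyperplane of \<open>v\<close> to the other side of that of \<open>u\<close>.
\<close>

definition rim :: "(real ^ 'd) set" where
  "rim = slab v 0 (M / 2 + real CARD('d)) (2 + \<rho> + real CARD('d)) - slab v 0 (M / 2 - 1 - real CARD('d)) (2 + \<rho> + real CARD('d))"

lemma (in frame_loc) cell_in_shell:
  assumes a: "emb a \<in> slab u 0 r h" and k: "k \<in> {1..<CARD('d)}" "s \<le> \<bar>emb a \<bullet> u k\<bar>"
  shows "lattice_cell a \<subseteq> slab u 0 (r + real CARD('d)) (h + real CARD('d)) - slab u 0 (s - real CARD('d)) (h + real CARD('d))"
proof -
  have "p \<notin> slab u 0 (s - real CARD('d)) (h + real CARD('d))" if p: "p \<in> lattice_cell a" for p
  proof
    assume "p \<in> slab u 0 (s - real CARD('d)) (h + real CARD('d))"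
    then have "\<bar>p \<bullet> u k\<bar> < s - real CARD('d)" using k(1) by (simp add: slab_iff)
    moreover have "\<bar>p \<bullet> u k - emb a \<bullet> u k\<bar> \<le> real CARD('d) / 2" using cell_coord[OF p, of k 0] k(1) by auto
    moreover have "0 \<le> real CARD('d)" by simp
    ultimately show False using k(2) by linarith
  qed
  then show ?thesis using cell_in_slab[OF a] by blast
qed

lemma seam_in_gaps:
  assumes e: "e \<in> seam (region u N N 0) {()} (\<lambda>_. region v M M 0) side"
  shows "\<exists>a\<in>e. lattice_cell a \<subseteq> outer_gap \<union> rim"
proof -
  let ?R = "region v M M 0" and ?L = "region u N N 0"
  obtain a b where ab: "e = {a, b}" "side a" "\<not> side b" using e by (auto simp: seam_def)
  then have V: "a \<in> ?L" "b \<in> ?L" "a \<sim>\<^sub>Z b" "b \<sim>\<^sub>Z a"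
    using e lattice_edges_doubleton[of a b ?L] adjacent_sym by (auto simp: seam_def)
  have nt: "\<not> (a \<in> ?R \<and> b \<in> ?R)" using e ab(1) V(3) by (auto simp: seam_def lattice_edges_doubleton)
  have nu: "\<bar>emb a \<bullet> u k - emb b \<bullet> u k\<bar> \<le> 1" if "k \<in> {1..CARD('d)}" for k
    using V(3) big.norm_u[OF that] by (rule adjacent_inner)
  have nv: "\<bar>emb a \<bullet> v k - emb b \<bullet> v k\<bar> \<le> 1" if "k \<in> {1..CARD('d)}" for k
    using V(3) tile.norm_u[OF that] by (rule adjacent_inner)
  have ta: "\<bar>emb a \<bullet> u k - emb a \<bullet> v k\<bar> \<le> \<rho>" "\<bar>emb b \<bullet> u k - emb b \<bullet> v k\<bar> \<le> \<rho>" if "k \<in> {1..CARD('d)}" for k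
    using that V by (auto intro: tilt)
  have outside: "\<exists>k\<in>{1..<CARD('d)}. M / 2 \<le> \<bar>emb x \<bullet> v k\<bar>" if "x \<notin> ?R" "\<bar>emb x \<bullet> v CARD('d)\<bar> < M" for x
    using that unfolding tile_iff slab_iff by (auto simp: not_less)
  have tilemem: "emb x \<in> slab v 0 (M / 2) (2 + \<rho>)" if "x \<in> ?R" "\<bar>emb x \<bullet> v CARD('d)\<bar> < 2 + \<rho>" for x
    using that unfolding tile_iff slab_iff by simp
  show ?thesis
  proof (cases "a \<in> ?R \<or> b \<in> ?R")
    case False
    then have s: "0 \<le> emb a \<bullet> u CARD('d)" "emb b \<bullet> u CARD('d) < 0" using ab(2,3) by (auto simp: side_def above_def)
    then have n: "\<bar>emb a \<bullet> u CARD('d)\<bar> \<le> 1" using nu[OF index(2)] by linarith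
    then have "\<bar>emb a \<bullet> v CARD('d)\<bar> < M" using ta(1)[OF index(2)] M_large rho index(4) by linarith
    then obtain k where k: "k \<in> {1..<CARD('d)}" "M / 2 \<le> \<bar>emb a \<bullet> v k\<bar>" using outside False by blast
    have "M / 2 - \<rho> \<le> \<bar>emb a \<bullet> u k\<bar>" using k ta(1)[of k] index(1) by (smt (verit) subsetD)
    moreover have "emb a \<in> slab u 0 (N / 2) 2" using V(1) n unfolding big_iff slab_iff by simp
    ultimately have "lattice_cell a \<subseteq> outer_gap" unfolding outer_gap_def using k(1) by (intro big.cell_in_shell)
    then show ?thesis using ab(1) by blast
  next
    case True
    have s: "(a \<in> ?R \<and> b \<notin> ?R \<and> 0 \<le> emb a \<bullet> v CARD('d) \<and> emb b \<bullet> u CARD('d) < 0)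
        \<or> (b \<in> ?R \<and> a \<notin> ?R \<and> emb b \<bullet> v CARD('d) < 0 \<and> 0 \<le> emb a \<bullet> u CARD('d))"
      using True nt ab(2,3) by (auto simp: side_def above_def)
    have "\<exists>x y. x \<in> e \<and> x \<in> ?R \<and> y \<notin> ?R \<and> \<bar>emb x \<bullet> v CARD('d)\<bar> \<le> 1 + \<rho>
        \<and> (\<forall>k\<in>{1..CARD('d)}. \<bar>emb x \<bullet> v k - emb y \<bullet> v k\<bar> \<le> 1)"
      using s
    proof
      assume s: "a \<in> ?R \<and> b \<notin> ?R \<and> 0 \<le> emb a \<bullet> v CARD('d) \<and> emb b \<bullet> u CARD('d) < 0"
      then have "\<bar>emb a \<bullet> v CARD('d)\<bar> \<le> 1 + \<rho>" using nu[OF index(2)] ta(1)[OF index(2)] by linarith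
      then show ?thesis using s ab(1) nv by blast
    next
      assume s: "b \<in> ?R \<and> a \<notin> ?R \<and> emb b \<bullet> v CARD('d) < 0 \<and> 0 \<le> emb a \<bullet> u CARD('d)"
      then have "\<bar>emb b \<bullet> v CARD('d)\<bar> \<le> 1 + \<rho>" using nu[OF index(2)] ta(2)[OF index(2)] by linarith
      moreover have "\<forall>k\<in>{1..CARD('d)}. \<bar>emb b \<bullet> v k - emb a \<bullet> v k\<bar> \<le> 1" using nv by (simp add: abs_minus_commute)
      ultimately show ?thesis using s ab(1) by blast
    qed
    then obtain x y where x: "x \<in> e" "x \<in> ?R" "\<bar>emb x \<bullet> v CARD('d)\<bar> \<le> 1 + \<rho>" and y: "y \<notin> ?R"
      and n: "\<And>k. k \<in> {1..CARD('d)} \<Longrightarrow> \<bar>emb x \<bullet> v k - emb y \<bullet> v k\<bar> \<le> 1" by blast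
    have "\<bar>emb y \<bullet> v CARD('d)\<bar> < M" using n[OF index(2)] x(3) M_large rho index(4) by linarith
    then obtain k where k: "k \<in> {1..<CARD('d)}" "M / 2 \<le> \<bar>emb y \<bullet> v k\<bar>" using outside y by blast
    have "M / 2 - 1 \<le> \<bar>emb x \<bullet> v k\<bar>" using k n[of k] index(1) by (smt (verit) subsetD)
    moreover have "emb x \<in> slab v 0 (M / 2) (2 + \<rho>)" using x by (intro tilemem) auto
    ultimately have "lattice_cell x \<subseteq> rim" unfolding rim_def using k(1) by (intro tile.cell_in_shell)
    then show ?thesis using x(1) by blast
  qed
qed

lemma (in frame_loc) shell_volume:
  assumes "CARD('d) = Suc (Suc m)" "0 \<le> s" "s \<le> r" "0 \<le> h"
  shows "slab u 0 r h - slab u 0 s h \<in> lmeasurable"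
    "measure lebesgue (slab u 0 r h - slab u 0 s h) \<le> real (Suc m) * (2 * r - 2 * s) * (2 * r) ^ m * (2 * h)"
proof -
  have r: "0 \<le> r" using assms by simp
  show m: "slab u 0 r h - slab u 0 s h \<in> lmeasurable" using slab_volume(1) assms r by (intro fmeasurable_Diff fmeasurableD) auto
  have sub: "slab u 0 s h \<subseteq> slab u 0 r h" using assms(3) unfolding slab_iff subset_iff by (meson less_le_trans)
  have "measure lebesgue (slab u 0 r h - slab u 0 s h) = measure lebesgue (slab u 0 r h) - measure lebesgue (slab u 0 s h)"
    using assms r slab_volume(1) sub by (intro measurable_measure_Diff fmeasurableD) auto
  also have "\<dots> = ((2 * r) ^ Suc m - (2 * s) ^ Suc m) * (2 * h)"
    using slab_volume(2)[of r h 0] slab_volume(2)[of s h 0] assms r by (simp add: left_diff_distrib)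
  also have "\<dots> \<le> real (Suc m) * (2 * r - 2 * s) * (2 * r) ^ m * (2 * h)"
    using assms by (intro mult_right_mono power_diff_le) auto
  finally show "measure lebesgue (slab u 0 r h - slab u 0 s h) \<le> real (Suc m) * (2 * r - 2 * s) * (2 * r) ^ m * (2 * h)" .
qed

lemma rect_cost_tilted:
  assumes "1 \<le> q" "0 \<le> \<beta>" "\<And>e. e \<in> wired \<Longrightarrow> 0 \<le> J e" "\<And>e. e \<in> wired \<Longrightarrow> J e \<le> 1"
    and d: "CARD('d) = Suc (Suc m)" and N: "N + 2 * real CARD('d) \<le> 2 * M"
  shows "rect_cost q \<beta> u N N 0 J \<le> rect_cost q \<beta> v M M 0 J
     + \<beta> * (3 ^ CARD('d) * (real (Suc m) * (2 * M) ^ m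
          * ((N - M + 2 * \<rho> + 4 * real CARD('d)) * (4 + 2 * real CARD('d)) + (2 + 4 * real CARD('d)) * (4 + 2 * \<rho> + 2 * real CARD('d)))))"
    (is "_ \<le> _ + \<beta> * (_ * ?V)")
proof -
  let ?D = "real CARD('d)"
  let ?F = "seam (region u N N 0) {()} (\<lambda>_. region v M M 0) side"
  have W: "lattice_edges \<Lambda> \<subseteq> wired" for \<Lambda> :: "(int ^ 'd) set"
    unfolding wired_def by (rule lattice_edges_mono) simp
  have o: "outer_gap \<in> lmeasurable" "measure lebesgue outer_gap \<le> real (Suc m) * (2 * (N / 2 + ?D) - 2 * (M / 2 - \<rho> - ?D)) * (2 * (N / 2 + ?D)) ^ m * (2 * (2 + ?D))"
    unfolding outer_gap_def using rho N_large M_large by (intro big.shell_volume[OF d]; simp)+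
  have r: "rim \<in> lmeasurable" "measure lebesgue rim \<le> real (Suc m) * (2 * (M / 2 + ?D) - 2 * (M / 2 - 1 - ?D)) * (2 * (M / 2 + ?D)) ^ m * (2 * (2 + \<rho> + ?D))"
    unfolding rim_def using rho M_large by (intro tile.shell_volume[OF d]; simp)+
  have "card ?F \<le> 3 ^ CARD('d) * measure lebesgue (outer_gap \<union> rim)"
    using seam_in_gaps W o(1) r(1) by (intro edges_le_volume fmeasurable.Un) (auto simp: seam_def)
  also have "\<dots> \<le> 3 ^ CARD('d) * (measure lebesgue outer_gap + measure lebesgue rim)"
    using o(1) r(1) by (intro mult_left_mono measure_Un_le fmeasurableD) auto
  also have "\<dots> \<le> 3 ^ CARD('d) * ?V"
  proof (rule mult_left_mono)
    have "measure lebesgue outer_gap \<le> real (Suc m) * (2 * (N / 2 + ?D) - 2 * (M / 2 - \<rho> - ?D)) * (2 * M) ^ m * (2 * (2 + ?D))"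
      using N N_large rho sizes by (intro order_trans[OF o(2)] mult_right_mono mult_left_mono power_mono) auto
    moreover have "measure lebesgue rim \<le> real (Suc m) * (2 * (M / 2 + ?D) - 2 * (M / 2 - 1 - ?D)) * (2 * M) ^ m * (2 * (2 + \<rho> + ?D))"
      using N sizes rho by (intro order_trans[OF r(2)] mult_right_mono mult_left_mono power_mono) auto
    moreover have "real (Suc m) * (2 * (N / 2 + ?D) - 2 * (M / 2 - \<rho> - ?D)) * (2 * M) ^ m * (2 * (2 + ?D))
       + real (Suc m) * (2 * (M / 2 + ?D) - 2 * (M / 2 - 1 - ?D)) * (2 * M) ^ m * (2 * (2 + \<rho> + ?D)) = ?V"
      by (simp add: algebra_simps)
    ultimately show "measure lebesgue outer_gap + measure lebesgue rim \<le> ?V" by linarith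
  qed simp
  finally have "\<beta> * card ?F \<le> \<beta> * (3 ^ CARD('d) * ?V)" using assms(2) by (rule mult_left_mono)
  moreover have "rect_cost q \<beta> u N N 0 J \<le> rect_cost q \<beta> v M M 0 J + \<beta> * card ?F"
    using cost_tiles[of q \<beta> J] assms W unfolding rect_cost_def by auto
  ultimately show ?thesis by linarith
qed

end

text \<open>
  A bound for the number of seam edges of a large tilted tile, per unit of area and of the angle \<open>\<theta>\<close>.
\<close>

definition tilt_constant :: "('d::finite) itself \<Rightarrow> real" where
  "tilt_constant _ = 3 ^ CARD('d) * (real (CARD('d) - 1) * 2 ^ (CARD('d) - 2) * (40 * real CARD('d) + 32 * (real CARD('d))\<^sup>2))"

context media
begin

text \<open>
  The outer side \<open>N = M + O(\<theta> M)\<close> is just large enough for the tilted tile to fit. Both parts of the seam then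
  contain \<open>O(\<theta> M ^ (d - 1) + M ^ (d - 2))\<close> edges.
\<close>

lemma mean_tension_tilted:
  fixes u v :: "nat \<Rightarrow> real ^ 'd::finite"
  assumes d: "CARD('d) = Suc (Suc m)" and f: "frame u" "frame v" and b: "0 \<le> \<beta>"
    and close: "\<And>k. k \<in> {1..CARD('d)} \<Longrightarrow> norm (u k - v k) \<le> \<theta>" and th: "0 \<le> \<theta>" "8 * real CARD('d) * \<theta> \<le> 1"
    and M: "8 * real CARD('d) + 8 \<le> real M"
    and N: "N = nat \<lceil>real M + 4 * \<theta> * real CARD('d) * real M + 2\<rceil>"
    and B: "B = 3 ^ CARD('d) * (real (Suc m) * 2 ^ m * ((5 + 8 * real CARD('d)) * (4 + 2 * real CARD('d))))"
  shows "mean_tension \<beta> u 1 N \<le> mean_tension \<beta> v 1 M + \<beta> * (tilt_constant TYPE('d) * \<theta> + B / real M)"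
proof -
  let ?D = "real CARD('d)"
  \<comment> \<open>Points of the outer rectangle have norm at most \<open>d N \<le> 2 d M\<close>.\<close>
  define \<rho> where "\<rho> = 2 * \<theta> * ?D * real M"
  have D: "1 \<le> ?D" using card_pos[where 'd='d] by simp
  have M0: "0 < real M" "0 < M" using M D by auto
  have rho: "0 \<le> \<rho>" "\<rho> \<le> real M / 4"
  proof -
    show "0 \<le> \<rho>" using th by (simp add: \<rho>_def)
    have "(8 * ?D * \<theta>) * real M \<le> 1 * real M" using th M0 by (intro mult_right_mono) auto
    moreover have "(8 * ?D * \<theta>) * real M = 4 * \<rho>" by (simp add: \<rho>_def)
    ultimately show "\<rho> \<le> real M / 4" by linarith
  qed
  have Nr: "real M + 2 * \<rho> + 2 \<le> real N" "real N \<le> real M + 2 * \<rho> + 3"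
  proof -
    define x where "x = real M + 2 * \<rho> + 2"
    have "real M + 4 * \<theta> * ?D * real M + 2 = x" by (simp add: x_def \<rho>_def)
    then have "N = nat \<lceil>x\<rceil>" unfolding N by (simp only:)
    moreover have "0 \<le> x" using rho(1) by (simp add: x_def)
    ultimately have "x \<le> real N" "real N \<le> x + 1" by linarith+
    then show "real M + 2 * \<rho> + 2 \<le> real N" "real N \<le> real M + 2 * \<rho> + 3" by (simp_all add: x_def)
  qed
  have NM: "real N + 2 * ?D \<le> 2 * real M" "real M \<le> real N" "0 < N" using Nr rho M D by auto
  interpret tilted v u \<rho> "real M" "real N"
  proof (unfold_locales)
    show "norm (u k - v k) * (?D * real N) \<le> \<rho>" if "k \<in> {1..CARD('d)}" for k
    proof -
      have "norm (u k - v k) * (?D * real N) \<le> \<theta> * (?D * (2 * real M))"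
        using close[OF that] NM th D by (intro mult_mono) auto
      then show ?thesis by (simp add: \<rho>_def)
    qed
    show "2 * \<rho> + 2 * ?D + 4 \<le> real M" using rho M D by linarith
  qed (use f rho Nr in auto)
  let ?n = "CARD('d) - 1"
  let ?V = "3 ^ CARD('d) * (real (Suc m) * (2 * real M) ^ m
          * ((real N - real M + 2 * \<rho> + 4 * ?D) * (4 + 2 * ?D) + (2 + 4 * ?D) * (4 + 2 * \<rho> + 2 * ?D)))"
  have n: "?n = Suc m" "CARD('d) - 2 = m" using d by auto
  have pw: "real M ^ ?n \<le> real N ^ ?n" "0 < real M ^ ?n" using NM M0 by (auto intro!: power_mono)
  have V0: "0 \<le> ?V" using NM rho D M0 by simp
  have V: "?V / real M ^ ?n \<le> tilt_constant TYPE('d) * \<theta> + B / real M"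
  proof -
    have "(real N - real M + 2 * \<rho> + 4 * ?D) * (4 + 2 * ?D) + (2 + 4 * ?D) * (4 + 2 * \<rho> + 2 * ?D)
       \<le> (4 * \<rho> + 3 + 4 * ?D) * (4 + 2 * ?D) + (2 + 4 * ?D) * (4 + 2 * \<rho> + 2 * ?D)"
      using Nr D by (intro add_right_mono mult_right_mono) auto
    also have "\<dots> = (40 * ?D + 32 * ?D\<^sup>2) * \<theta> * real M + (5 + 8 * ?D) * (4 + 2 * ?D)"
      by (simp add: \<rho>_def power2_eq_square algebra_simps)
    finally have "?V \<le> 3 ^ CARD('d) * (real (Suc m) * (2 * real M) ^ m * ((40 * ?D + 32 * ?D\<^sup>2) * \<theta> * real M + (5 + 8 * ?D) * (4 + 2 * ?D)))"
      using M0 by (intro mult_left_mono) auto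
    also have "\<dots> = (tilt_constant TYPE('d) * \<theta> + B / real M) * real M ^ ?n"
      unfolding B tilt_constant_def n power_mult_distrib power_Suc using M0 by (simp add: field_simps)
    finally show ?thesis using pw(2) by (simp only: pos_divide_le_eq)
  qed
  have "tension q \<beta> u 1 N J \<le> tension q \<beta> v 1 M J + \<beta> * (tilt_constant TYPE('d) * \<theta> + B / real M)" for J
  proof -
    have c0: "0 \<le> rect_cost q \<beta> v M M 0 (clip J)" using f(2) b M0 by (intro rect_cost_bounds) auto
    have "tension q \<beta> u 1 N J \<le> (rect_cost q \<beta> v M M 0 (clip J) + \<beta> * ?V) / real N ^ ?n"
      unfolding tension_def using rect_cost_tilted[of q \<beta> "clip J" m] q b d NM(1)
      by (intro divide_right_mono) (auto simp: clip_bounds)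
    also have "\<dots> \<le> (rect_cost q \<beta> v M M 0 (clip J) + \<beta> * ?V) / real M ^ ?n"
    proof (rule divide_left_mono[OF pw(1)])
      show "0 \<le> rect_cost q \<beta> v M M 0 (clip J) + \<beta> * ?V" by (rule add_nonneg_nonneg[OF c0 mult_nonneg_nonneg[OF b V0]])
      show "0 < real N ^ ?n * real M ^ ?n" by (rule mult_pos_pos[OF less_le_trans[OF pw(2,1)] pw(2)])
    qed
    also have "\<dots> = tension q \<beta> v 1 M J + \<beta> * (?V / real M ^ ?n)" by (simp add: tension_def add_divide_distrib)
    also have "\<dots> \<le> tension q \<beta> v 1 M J + \<beta> * (tilt_constant TYPE('d) * \<theta> + B / real M)"
      using V b by (intro add_left_mono mult_left_mono)
    finally show ?thesis .
  qed
  moreover interpret prob_space "coupling_space \<mu> :: ('d edge \<Rightarrow> real) measure" by (rule coupling_prob_space)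
  have i: "integrable (coupling_space \<mu>) (tension q \<beta> u 1 N)" "integrable (coupling_space \<mu>) (tension q \<beta> v 1 M)"
    using f b NM M0 by (auto intro: tension_integrable)
  ultimately have "mean_tension \<beta> u 1 N \<le> (\<integral>J. tension q \<beta> v 1 M J + \<beta> * (tilt_constant TYPE('d) * \<theta> + B / real M) \<partial>coupling_space \<mu>)"
    unfolding mean_tension_def by (intro integral_mono) auto
  also have "\<dots> = mean_tension \<beta> v 1 M + \<beta> * (tilt_constant TYPE('d) * \<theta> + B / real M)"
    using i by (simp add: mean_tension_def prob_space)
  finally show ?thesis .
qed

lemma tau_quenched_tilted:
  fixes u v :: "nat \<Rightarrow> real ^ 'd::finite"
  assumes dim: "2 \<le> CARD('d)" and f: "frame u" "frame v" and b: "0 \<le> \<beta>"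
    and close: "\<And>k. k \<in> {1..CARD('d)} \<Longrightarrow> norm (u k - v k) \<le> \<theta>" and th: "0 \<le> \<theta>" "8 * real CARD('d) * \<theta> \<le> 1"
  shows "tau_quenched \<mu> q \<beta> (u CARD('d)) \<le> tau_quenched \<mu> q \<beta> (v CARD('d)) + \<beta> * (tilt_constant TYPE('d) * \<theta>)"
proof -
  obtain m where d: "CARD('d) = Suc (Suc m)" using dim le_Suc_ex[of 2 "CARD('d)"] by auto
  define B where "B = 3 ^ CARD('d) * (real (Suc m) * 2 ^ m * ((5 + 8 * real CARD('d)) * (4 + 2 * real CARD('d))))"
  let ?N = "\<lambda>M. nat \<lceil>real M + 4 * \<theta> * real CARD('d) * real M + 2\<rceil>"
  have "M \<le> ?N M" for M
  proof -
    have "real M \<le> real M + 4 * \<theta> * real CARD('d) * real M + 2" using th(1) by simp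
    then show ?thesis by linarith
  qed
  then have "filterlim ?N at_top sequentially"
    by (intro filterlim_at_top_mono[OF filterlim_ident]) auto
  then have l1: "(\<lambda>M. mean_tension \<beta> u 1 (?N M)) \<longlonglongrightarrow> tau_quenched \<mu> q \<beta> (u CARD('d))"
    using filterlim_compose[OF tau_quenched_limit[OF dim b f(1) zero_less_one]] by blast
  have "(\<lambda>M. B / real M) \<longlonglongrightarrow> 0" by real_asymp
  then have l2: "(\<lambda>M. mean_tension \<beta> v 1 M + \<beta> * (tilt_constant TYPE('d) * \<theta> + B / real M))
      \<longlonglongrightarrow> tau_quenched \<mu> q \<beta> (v CARD('d)) + \<beta> * (tilt_constant TYPE('d) * \<theta> + 0)"
    by (intro tendsto_intros tau_quenched_limit[OF dim b f(2) zero_less_one])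
  have "\<forall>\<^sub>F M in sequentially. 8 * real CARD('d) + 8 \<le> real M" by real_asymp
  then have "\<forall>\<^sub>F M in sequentially. mean_tension \<beta> u 1 (?N M) \<le> mean_tension \<beta> v 1 M + \<beta> * (tilt_constant TYPE('d) * \<theta> + B / real M)"
    by eventually_elim (rule mean_tension_tilted[OF d f b close th _ refl B_def])
  from tendsto_le[OF sequentially_bot l2 l1 this] show ?thesis by simp
qed

end

text \<open>
  The rotation that takes the normal \<open>u\<^sub>d\<close> to \<open>n\<close> and fixes the vectors orthogonal to both.
\<close>

lemma rotated_frame:
  fixes u :: "nat \<Rightarrow> real ^ 'd::finite"
  assumes u: "frame u" and n: "norm n = 1" "norm (u CARD('d) - n) \<le> 1"
  obtains v where "frame v" "v CARD('d) = n" "\<And>k. k \<in> {1..CARD('d)} \<Longrightarrow> norm (u k - v k) \<le> 2 * norm (u CARD('d) - n)"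
proof -
  interpret frame_loc u by unfold_locales (rule u)
  let ?I = "{1..CARD('d)}" and ?u = "u CARD('d)"
  have I: "CARD('d) \<in> ?I" using card_pos[where 'd='d] by auto
  define s where "s = ?u \<bullet> n"
  have nn: "n \<bullet> n = 1" "?u \<bullet> ?u = 1" using n(1) norm_u[OF I] by (simp_all add: dot_square_norm)
  have s: "1 \<le> 1 + s"
  proof -
    have "(norm (?u - n))\<^sup>2 \<le> 1\<^sup>2" using n(2) by (intro power_mono) auto
    then have "(?u - n) \<bullet> (?u - n) \<le> 1" by (simp add: power2_norm_eq_inner)
    then show ?thesis using nn by (simp add: inner_diff_left inner_diff_right s_def inner_commute)
  qed
  define c where "c k = (n \<bullet> u k) / (1 + s)" for k
  define v where "v k = (if k = CARD('d) then n else u k - c k *\<^sub>R (?u + n))" for k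
  have c: "n \<bullet> u k = c k * (1 + s)" for k using s by (simp add: c_def)
  have uk: "u k \<bullet> ?u = 0" "?u \<bullet> u k = 0" if "k \<in> ?I" "k \<noteq> CARD('d)" for k
    using that ortho[OF that(1) I] by (simp_all add: inner_commute)
  have o: "v i \<bullet> v j = (if i = j then 1 else 0)" if ij: "i \<in> ?I" "j \<in> ?I" for i j
  proof -
    have 1: "v i \<bullet> n = 0" "n \<bullet> v i = 0" if "i \<in> ?I" "i \<noteq> CARD('d)" for i
    proof -
      show "n \<bullet> v i = 0" unfolding v_def using that nn c[of i]
        by (simp add: inner_diff_right inner_add_right s_def[symmetric] inner_commute[of n ?u] algebra_simps)
      then show "v i \<bullet> n = 0" by (simp add: inner_commute)
    qed
    consider "i = CARD('d)" | "j = CARD('d)" | "i \<noteq> CARD('d)" "j \<noteq> CARD('d)" by blast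
    then show ?thesis
    proof cases
      case 3
      have "v i \<bullet> v j = u i \<bullet> u j - c j * (u i \<bullet> ?u + u i \<bullet> n) - c i * (?u \<bullet> u j + n \<bullet> u j) + c i * c j * (?u \<bullet> ?u + ?u \<bullet> n + n \<bullet> ?u + n \<bullet> n)"
        using 3 by (simp add: v_def inner_diff_left inner_diff_right inner_add_left inner_add_right algebra_simps)
      also have "\<dots> = u i \<bullet> u j"
        using uk 3 ij nn c[of i] c[of j] by (simp add: inner_commute[of "u i" n] inner_commute[of n ?u] s_def[symmetric] algebra_simps)
      finally show ?thesis using ortho[OF ij] by simp
    qed (use 1[of i] 1[of j] ij nn v_def in auto)
  qed
  have inj: "inj_on v ?I"
  proof (rule inj_onI)
    fix i j assume ij: "i \<in> ?I" "j \<in> ?I" "v i = v j"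
    show "i = j" using o[OF ij(1,2)] o[OF ij(1,1)] ij(3) by (auto split: if_splits)
  qed
  have "independent (v ` ?I)"
  proof (rule pairwise_orthogonal_independent)
    show "pairwise orthogonal (v ` ?I)" using o by (auto simp: pairwise_def orthogonal_def)
    show "0 \<notin> v ` ?I" using o by (metis imageE inner_zero_left zero_neq_one)
  qed
  then have "span (v ` ?I) = UNIV"
    using card_ge_dim_independent[of "v ` ?I" UNIV] inj by (simp add: card_image dim_UNIV) (metis UNIV_eq_I subsetD UNIV_I)
  then have "frame v" unfolding frame_def using o by blast
  moreover have "v CARD('d) = n" by (simp add: v_def)
  moreover have "norm (u k - v k) \<le> 2 * norm (?u - n)" if k: "k \<in> ?I" for k
  proof (cases "k = CARD('d)")
    case False
    have "n \<bullet> u k = (n - ?u) \<bullet> u k" using uk(2)[OF k False] by (simp add: inner_diff_left)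
    then have "\<bar>n \<bullet> u k\<bar> \<le> norm (?u - n)" using inner_le[OF k, of "n - ?u"] by (simp add: norm_minus_commute)
    moreover have "\<bar>c k\<bar> \<le> \<bar>n \<bullet> u k\<bar>"
    proof -
      have "\<bar>c k\<bar> * 1 \<le> \<bar>c k\<bar> * (1 + s)" using s by (intro mult_left_mono) auto
      also have "\<dots> = \<bar>n \<bullet> u k\<bar>" using s unfolding c[of k] abs_mult by simp
      finally show ?thesis by simp
    qed
    moreover have "norm (?u + n) \<le> 2" using norm_triangle_ineq[of ?u n] n(1) norm_u[OF I] by simp
    moreover have "norm (u k - v k) = \<bar>c k\<bar> * norm (?u + n)" using False by (simp add: v_def)
    moreover have "\<bar>c k\<bar> * norm (?u + n) \<le> norm (?u - n) * 2"
      using calculation(1-3) by (intro mult_mono) auto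
    ultimately show ?thesis by linarith
  qed (simp add: v_def)
  ultimately show ?thesis using that by blast
qed

section \<open>The exceptional inverse temperatures\<close>

context media
begin

lemma tau_quenched_lipschitz:
  fixes n n' :: "real ^ 'd::finite"
  assumes dim: "2 \<le> CARD('d)" and n: "norm n = 1" "norm n' = 1" and b: "0 \<le> \<beta>"
    and close: "16 * real CARD('d) * norm (n - n') \<le> 1"
  shows "tau_quenched \<mu> q \<beta> n \<le> tau_quenched \<mu> q \<beta> n' + \<beta> * (2 * tilt_constant TYPE('d) * norm (n - n'))"
proof -
  obtain u where u: "frame u" "u CARD('d) = n" using unit_cubes_nonempty[OF n(1)] .
  have "norm (n - n') * 1 \<le> norm (n - n') * (16 * real CARD('d))" using dim by (intro mult_left_mono) auto
  then have "norm (u CARD('d) - n') \<le> 1" using close u(2) by (simp add: mult_ac)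
  then obtain v where v: "frame v" "v CARD('d) = n'" "\<And>k. k \<in> {1..CARD('d)} \<Longrightarrow> norm (u k - v k) \<le> 2 * norm (n - n')"
    using rotated_frame[OF u(1) n(2)] u(2) by metis
  have "tau_quenched \<mu> q \<beta> (u CARD('d)) \<le> tau_quenched \<mu> q \<beta> (v CARD('d)) + \<beta> * (tilt_constant TYPE('d) * (2 * norm (n - n')))"
    by (rule tau_quenched_tilted[OF dim u(1) v(1) b v(3)]) (use close in auto)
  then show ?thesis using u(2) v(2) by (simp add: mult_ac)
qed

lemma not_left_continuous_jump:
  fixes n :: "real ^ 'd::finite"
  assumes dim: "2 \<le> CARD('d)" and n: "norm n = 1" and b: "0 \<le> \<beta>"
    and c: "\<not> continuous (at \<beta> within {0..\<beta>}) (\<lambda>\<beta>'. tau_quenched \<mu> q \<beta>' n)"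
  obtains j where "0 < \<beta>" "0 < j" "\<And>\<beta>'. 0 \<le> \<beta>' \<Longrightarrow> \<beta>' < \<beta> \<Longrightarrow> tau_quenched \<mu> q \<beta>' n + j \<le> tau_quenched \<mu> q \<beta> n"
proof -
  let ?f = "\<lambda>\<beta>'. tau_quenched \<mu> q \<beta>' n"
  obtain j where j: "0 < j" "\<And>d. 0 < d \<Longrightarrow> \<exists>x\<in>{0..\<beta>}. dist x \<beta> < d \<and> \<not> dist (?f x) (?f \<beta>) < j"
    using c unfolding continuous_within_eps_delta by blast
  have "?f \<beta>' + j \<le> ?f \<beta>" if b': "0 \<le> \<beta>'" "\<beta>' < \<beta>" for \<beta>'
  proof -
    obtain x where x: "0 \<le> x" "x \<le> \<beta>" "dist x \<beta> < \<beta> - \<beta>'" "\<not> dist (?f x) (?f \<beta>) < j"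
      using j(2)[of "\<beta> - \<beta>'"] b' by auto
    have "\<beta>' \<le> x" using x by (simp add: dist_real_def)
    then have "?f \<beta>' \<le> ?f x" using b' by (intro tau_quenched_mono dim n)
    moreover have "?f x \<le> ?f \<beta>" using x by (intro tau_quenched_mono dim n)
    ultimately show ?thesis using x(4) by (simp add: dist_real_def)
  qed
  moreover have "0 < \<beta>"
  proof (rule ccontr)
    assume "\<not> 0 < \<beta>"
    then have "{0..\<beta>} \<subseteq> {\<beta>}" using b by auto
    then show False using j(1) j(2)[of 1] by auto
  qed
  ultimately show ?thesis using that j(1) by blast
qed

text \<open>
  At an exceptional \<open>\<beta>\<close> the tension in some direction \<open>n\<close> has a left jump of size \<open>j\<close>. A direction \<open>m\<close> of the dense
  set is chosen so close to \<open>n\<close> that the tensions differ by at most \<open>j / 4\<close> for all inverse temperatures up to \<open>\<beta>\<close>; then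
  a jump of size \<open>j / 2\<close> remains in direction \<open>m\<close>.
\<close>

theorem countable_rate_zero:
  assumes dim: "2 \<le> CARD('d::finite)"
  shows "countable {\<beta>. 0 \<le> \<beta> \<and> (\<exists>(n::real ^ 'd)\<in>sphere 0 1. \<exists>r>0. rate \<mu> q \<beta> n (tau_quenched \<mu> q \<beta> n - r) = 0)}"
    (is "countable ?N")
proof -
  obtain T where T: "countable T" "T \<subseteq> sphere 0 1" "sphere 0 (1::real) \<subseteq> closure (T :: (real ^ 'd) set)"
    using separable[of "sphere 0 1"] by blast
  let ?f = "\<lambda>n \<beta>. tau_quenched \<mu> q \<beta> n" and ?K = "tilt_constant TYPE('d)"
  let ?X = "\<Union>m\<in>T. {\<beta>\<in>{0..}. \<not> continuous (at \<beta> within {0..}) (?f m)}"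
  have K: "0 \<le> ?K" by (simp add: tilt_constant_def)
  have "countable {\<beta>\<in>{0..}. \<not> continuous (at \<beta> within {0..}) (?f m)}" if "m \<in> T" for m
  proof (rule mono_on_ctble_discont)
    have "norm m = 1" using that T(2) by auto
    then show "mono_on {0..} (?f m)" by (intro mono_onI tau_quenched_mono dim) auto
  qed
  then have X: "countable ?X" using T(1) by blast
  have "?N \<subseteq> ?X"
  proof
    fix \<beta> assume "\<beta> \<in> ?N"
    then obtain n :: "real ^ 'd" and r where b: "0 \<le> \<beta>" and n: "norm n = 1" and r: "0 < r" "rate \<mu> q \<beta> n (?f n \<beta> - r) = 0"
      by auto
    have c: "\<not> continuous (at \<beta> within {0..\<beta>}) (?f n)"
      using rate_pos_of_left_continuous[OF dim n b _ r(1)] r(2) by auto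
    then obtain j where b0: "0 < \<beta>" and j: "0 < j" "\<And>\<beta>'. 0 \<le> \<beta>' \<Longrightarrow> \<beta>' < \<beta> \<Longrightarrow> ?f n \<beta>' + j \<le> ?f n \<beta>"
      using not_left_continuous_jump[OF dim n b] by metis
    define \<epsilon> where "\<epsilon> = min (1 / (16 * real CARD('d))) (j / (8 * (\<beta> * ?K + 1)))"
    have bK: "0 < \<beta> * ?K + 1" using b K by (simp add: add_nonneg_pos)
    have "0 < \<epsilon>" using j(1) bK by (simp add: \<epsilon>_def)
    then obtain m where m: "m \<in> T" "dist m n < \<epsilon>" using T(3) n closure_approachable[of n T] by auto
    have m1: "norm m = 1" using m(1) T(2) by auto
    have mn: "norm (n - m) \<le> \<epsilon>" "norm (m - n) \<le> \<epsilon>" using m(2) by (simp_all add: dist_norm norm_minus_commute)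
    have cl: "16 * real CARD('d) * norm (n - m) \<le> 1"
    proof -
      have "16 * real CARD('d) * norm (n - m) \<le> 16 * real CARD('d) * (1 / (16 * real CARD('d)))"
        using mn by (intro mult_left_mono) (auto simp: \<epsilon>_def)
      then show ?thesis by simp
    qed
    have err: "x * (2 * ?K * norm (n - m)) \<le> j / 4" if "0 \<le> x" "x \<le> \<beta>" for x
    proof -
      have "x * (2 * ?K * norm (n - m)) \<le> \<beta> * (2 * ?K * (j / (8 * (\<beta> * ?K + 1))))"
        using that mn K by (intro mult_mono) (auto simp: \<epsilon>_def)
      also have "\<dots> = (\<beta> * ?K) * (j / (\<beta> * ?K + 1)) / 4"
      proof -
        have "a * (2 * k * (y / (8 * z))) = (a * k) * (y / z) / 4" for a k y z :: real by simp
        then show ?thesis .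
      qed
      also have "\<dots> \<le> (\<beta> * ?K + 1) * (j / (\<beta> * ?K + 1)) / 4"
        using j(1) bK by (intro divide_right_mono mult_right_mono) auto
      also have "\<dots> = j / 4" using bK by simp
      finally show ?thesis .
    qed
    have up: "?f m x \<le> ?f n x + j / 4" and lo: "?f n x \<le> ?f m x + j / 4" if "0 \<le> x" "x \<le> \<beta>" for x
      using tau_quenched_lipschitz[OF dim n m1 that(1) cl] tau_quenched_lipschitz[OF dim m1 n that(1)] cl err[OF that]
      by (simp_all add: norm_minus_commute)
    have "\<not> continuous (at \<beta> within {0..}) (?f m)"
    proof
      assume "continuous (at \<beta> within {0..}) (?f m)"
      then obtain x where x: "0 < x" "x < \<beta>" "\<bar>?f m x - ?f m \<beta>\<bar> < j / 2"
        using left_approach[of \<beta> "{0..}" "?f m" "j / 2"] b0 j(1) by auto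
      then show False using up[of x] lo[of \<beta>] j(2)[of x] b by linarith
    qed
    then show "\<beta> \<in> ?X" using m(1) b by auto
  qed
  then show ?thesis using X by (rule countable_subset)
qed

end

theorem corollary1p9:
  fixes \<mu> :: "real measure" and q :: real
  assumes dim: "CARD('d::finite) \<ge> 2"
    and q: "q \<ge> 1"
    and law: "prob_space \<mu>" "sets \<mu> = sets borel" "measure \<mu> {0..1} = 1"
  shows "(\<forall>(n::real ^ 'd) \<beta>. n \<in> sphere 0 1 \<longrightarrow> \<beta> \<ge> 0 \<longrightarrow>
            continuous (at \<beta> within {0..\<beta>}) (\<lambda>\<beta>'. tau_quenched \<mu> q \<beta>' n) \<longrightarrow>
            (\<forall>r>0. rate \<mu> q \<beta> n (tau_quenched \<mu> q \<beta> n - r) > 0))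
       \<and> countable {\<beta>. \<beta> \<ge> 0 \<and> (\<exists>(n::real ^ 'd)\<in>sphere 0 1. \<exists>r>0.
            rate \<mu> q \<beta> n (tau_quenched \<mu> q \<beta> n - r) = 0)}"
proof -
  interpret media \<mu> q by (rule media.intro[OF law q])
  show ?thesis
  proof (intro conjI allI impI countable_rate_zero dim)
    fix n :: "real ^ 'd" and \<beta> r :: real
    assume "n \<in> sphere 0 1" "\<beta> \<ge> 0" "0 < r"
      "continuous (at \<beta> within {0..\<beta>}) (\<lambda>\<beta>'. tau_quenched \<mu> q \<beta>' n)"
    then show "0 < rate \<mu> q \<beta> n (tau_quenched \<mu> q \<beta> n - r)"
      by (intro rate_pos_of_left_continuous dim) auto
  qed
qed

end
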